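(* Let $f:(\mathbb{R}^2,0)\to(\mathbb{R},0)$ be a smooth function germ with a generic $A_1^-$-singularity, normalised so that its Taylor expansion is $xy+a_{22}y^2+\sum_{i\ge 3}\sum_{j=0}^{i}a_{ij}x^{i-j}y^j$. Here generic means that the numbers $\eta_1,\eta_2,\eta_3,\eta_4$ defined in the context are all non-zero. Then any 1-parameter $\mathcal{R}_e$-versal deformation of $f$ is FRS-equivalent to $F:(\mathbb{R}^3,0)\to(\mathbb{R},0)$, $F(x,y,t)=f(x,y)+t$. The possible geometric configurations of $F$ are the following (in the notation of the context): (1) $vivi - vv \leftrightarrow viv - vvi$, if $\eta_3\eta_4<0$; (2) $vi - vi \leftrightarrow viviv - vvv$, if $\eta_3\eta_4>0$ and $\eta_1\eta_2\eta_3>0$; (3) $ivi - v \leftrightarrow vviv - vviv$, if $\eta_3\eta_4>0$ and $\eta_1\eta_2\eta_3<0$.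
   Context: For a smooth germ $g$, $C_g=\{g=0\}$. At a regular point of $C_g$ let $\kappa$ be the curvature of the curve and $'$ the derivative along it. The point is an inflection if $\kappa=0$ and a vertex if $\kappa'=0$. It is an inflection of order $n$ if $\kappa=\dots=\kappa^{(n-1)}=0\neq\kappa^{(n)}$, and a vertex of order $n$ if $\kappa'=\dots=\kappa^{(n)}=0\ne\kappa^{(n+1)}$. $f$ has an $A_1^-$-singularity at $0$ if $df(0)=0$ and its quadratic part is a nondegenerate indefinite quadratic form. By isometries and homotheties of the plane, $f$ can be normalised to the form in the claim. Put $\eta_1=a_{30}$, $\eta_2=a_{22}^3a_{30}-a_{22}^2a_{31}+a_{22}a_{32}-a_{33}$, $\eta_3=a_{22}a_{30}^2-a_{30}a_{31}+a_{40}$, $\bar\eta_4=\eta_2(3a_{22}^2a_{30}-2a_{22}a_{31}+a_{32})+a_{22}^4a_{40}-a_{22}^3a_{41}+a_{22}^2a_{42}-a_{22}a_{43}+a_{44}$, $\eta_4=(1+a_{22}^2)\bar\eta_4-2a_{22}\eta_2^2$. An $m$-parameter deformation of $f$ is a smooth germ $F:(\mathbb{R}^2\times\mathbb{R}^m,0)\to(\mathbb{R},0)$ with $F(x,y,0)=f(x,y)$; write $F_s(x,y)=F(x,y,s)$. It is $\mathcal{R}_e$-versal if $\partial F/\partial s_1|_{s=0},\dots,\partial F/\partial s_m|_{s=0}$ together with the ideal $\langle f_x,f_y\rangle$ span the ring of smooth function germs at $0$ over $\mathbb{R}$. FRS-equivalence: let $F_s,\tilde F_u$ be $m$-parameter deformations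 of $f$. Suppose there are stratification germs $(S_1,0)$ and $(S_2,0)$ of $\mathbb{R}^m$ such that, for any two parameters in the same stratum (of $S_1$ for $F$, of $S_2$ for $\tilde F$), the corresponding curves (i) are diffeomorphic; (ii) have the same numbers of inflections and vertices; (iii) have the same relative position of their singularities, self-intersection points, inflections and vertices. $F$ and $\tilde F$ are FRS-equivalent if, for such stratifications, there is a stratified homeomorphism germ $k:(\mathbb{R}^m,(S_1,0))\to(\mathbb{R}^m,(S_2,0))$ such that all pairs of curves $F_s=0$ and $\tilde F_{k(s)}=0$ satisfy (i), (ii), (iii). All curves are considered in a small neighbourhood of the origin and for small parameters. Notation for configurations: each side of the arrow $\leftrightarrow$ represents one sign of the parameter $t$. The two strings separated by a hyphen represent the two connected parts of the curve $F_t=0$ near the origin. The letters $i$ and $v$ stand for inflections and vertices, and their order is the order in which these points occur along the connected part. *)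

theory Defs
  imports "HOL-Analysis.Analysis"
begin

section \<open>Smooth functions and germs\<close>

text \<open>Germs at the origin are represented by functions on the whole space. All notions below
  depend only on the values of such a function near the origin.\<close>

primrec Ck_on :: "nat \<Rightarrow> 'a::euclidean_space set \<Rightarrow> ('a \<Rightarrow> 'b::real_normed_vector) \<Rightarrow> bool" where
  "Ck_on 0 S f \<longleftrightarrow> continuous_on S f"
| "Ck_on (Suc k) S f \<longleftrightarrow>
     (\<forall>x\<in>S. f differentiable (at x)) \<and>
     (\<forall>b\<in>Basis. Ck_on k S (\<lambda>x. frechet_derivative f (at x) b))"

text \<open>Both notions are meant for open \<open>S\<close> only.\<close>

definition smooth_on :: "'a::euclidean_space set \<Rightarrow> ('a \<Rightarrow> 'b::real_normed_vector) \<Rightarrow> bool" where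
  "smooth_on S f \<longleftrightarrow> (\<forall>k. Ck_on k S f)"

definition smooth_germ :: "('a::euclidean_space \<Rightarrow> real) \<Rightarrow> bool" where
  "smooth_germ f \<longleftrightarrow> (\<exists>U. open U \<and> 0 \<in> U \<and> smooth_on U f)"

text \<open>Smoothness on an arbitrary subset of a Euclidean space, and diffeomorphism of subsets,
  are understood through local smooth extensions to the ambient space.\<close>

definition smooth_on_subset ::
    "'a::euclidean_space set \<Rightarrow> ('a \<Rightarrow> 'b::euclidean_space) \<Rightarrow> bool" where
  "smooth_on_subset A h \<longleftrightarrow>
     (\<forall>p\<in>A. \<exists>U H. open U \<and> p \<in> U \<and> smooth_on U H \<and> (\<forall>q\<in>A \<inter> U. H q = h q))"

definition diffeomorphic ::
    "'a::euclidean_space set \<Rightarrow> 'b::euclidean_space set \<Rightarrow> bool" where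
  "diffeomorphic A B \<longleftrightarrow>
     (\<exists>h k. smooth_on_subset A h \<and> smooth_on_subset B k \<and> h ` A = B \<and> k ` B = A \<and>
            (\<forall>p\<in>A. k (h p) = p) \<and> (\<forall>q\<in>B. h (k q) = q))"

section \<open>Taylor coefficients and the \<open>A\<^sub>1\<^sup>-\<close>-singularity\<close>

definition pdx :: "(real \<times> real \<Rightarrow> real) \<Rightarrow> real \<times> real \<Rightarrow> real" where
  "pdx f p = frechet_derivative f (at p) (1, 0)"

definition pdy :: "(real \<times> real \<Rightarrow> real) \<Rightarrow> real \<times> real \<Rightarrow> real" where
  "pdy f p = frechet_derivative f (at p) (0, 1)"

text \<open>\<open>taylor_coeff f i j\<close> (for \<open>j \<le> i\<close>) is the coefficient \<open>a\<^sub>i\<^sub>j\<close> of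
  \<open>x\<^bsup>i-j\<^esup>y\<^bsup>j\<^esup>\<close>.\<close>

definition taylor_coeff :: "(real \<times> real \<Rightarrow> real) \<Rightarrow> nat \<Rightarrow> nat \<Rightarrow> real" where
  "taylor_coeff f i j =
     ((pdx ^^ (i - j)) ((pdy ^^ j) f)) (0, 0) / (fact (i - j) * fact j)"

definition quadratic_part :: "(real \<times> real \<Rightarrow> real) \<Rightarrow> real \<times> real \<Rightarrow> real" where
  "quadratic_part f p = (\<Sum>j\<le>2. taylor_coeff f 2 j * fst p ^ (2 - j) * snd p ^ j)"

definition nondegenerate_form :: "(real \<times> real \<Rightarrow> real) \<Rightarrow> bool" where
  "nondegenerate_form Q \<longleftrightarrow> (\<forall>p. (\<forall>q. Q (p + q) - Q p - Q q = 0) \<longrightarrow> p = 0)"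

definition indefinite_form :: "(real \<times> real \<Rightarrow> real) \<Rightarrow> bool" where
  "indefinite_form Q \<longleftrightarrow> (\<exists>p. Q p > 0) \<and> (\<exists>q. Q q < 0)"

definition A1_minus :: "(real \<times> real \<Rightarrow> real) \<Rightarrow> bool" where
  "A1_minus f \<longleftrightarrow> pdx f (0, 0) = 0 \<and> pdy f (0, 0) = 0 \<and>
     nondegenerate_form (quadratic_part f) \<and> indefinite_form (quadratic_part f)"

definition eta1 :: "(real \<times> real \<Rightarrow> real) \<Rightarrow> real" where
  "eta1 f = (let a = taylor_coeff f in a 3 0)"

definition eta2 :: "(real \<times> real \<Rightarrow> real) \<Rightarrow> real" where
  "eta2 f = (let a = taylor_coeff f in
     (a 2 2)^3 * a 3 0 - (a 2 2)^2 * a 3 1 + a 2 2 * a 3 2 - a 3 3)"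

definition eta3 :: "(real \<times> real \<Rightarrow> real) \<Rightarrow> real" where
  "eta3 f = (let a = taylor_coeff f in
     a 2 2 * (a 3 0)^2 - a 3 0 * a 3 1 + a 4 0)"

definition eta4_bar :: "(real \<times> real \<Rightarrow> real) \<Rightarrow> real" where
  "eta4_bar f = (let a = taylor_coeff f in
     eta2 f * (3 * (a 2 2)^2 * a 3 0 - 2 * a 2 2 * a 3 1 + a 3 2)
     + (a 2 2)^4 * a 4 0 - (a 2 2)^3 * a 4 1 + (a 2 2)^2 * a 4 2 - a 2 2 * a 4 3 + a 4 4)"

definition eta4 :: "(real \<times> real \<Rightarrow> real) \<Rightarrow> real" where
  "eta4 f = (let a = taylor_coeff f in
     (1 + (a 2 2)^2) * eta4_bar f - 2 * a 2 2 * (eta2 f)^2)"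

section \<open>Deformations\<close>

definition deformation ::
    "(real \<times> real \<Rightarrow> real) \<Rightarrow> (real \<times> real \<Rightarrow> 'p::euclidean_space \<Rightarrow> real) \<Rightarrow> bool" where
  "deformation f F \<longleftrightarrow>
     smooth_germ (\<lambda>(p, s). F p s) \<and> F 0 0 = 0 \<and> (\<forall>\<^sub>F p in nhds 0. F p 0 = f p)"

definition Re_versal ::
    "(real \<times> real \<Rightarrow> real) \<Rightarrow> (real \<times> real \<Rightarrow> 'p::euclidean_space \<Rightarrow> real) \<Rightarrow> bool" where
  "Re_versal f F \<longleftrightarrow>
     (\<forall>g. smooth_germ g \<longrightarrow>
       (\<exists>(c :: 'p \<Rightarrow> real) \<alpha> \<beta>. smooth_germ \<alpha> \<and> smooth_germ \<beta> \<and>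
         (\<forall>\<^sub>F p in nhds 0.
            g p = (\<Sum>b\<in>Basis. c b * frechet_derivative (F p) (at 0) b)
                  + \<alpha> p * pdx f p + \<beta> p * pdy f p)))"

section \<open>The geometry of the curve \<open>g = 0\<close>\<close>

definition curve :: "real \<Rightarrow> (real \<times> real \<Rightarrow> real) \<Rightarrow> (real \<times> real) set" where
  "curve \<epsilon> g = {p \<in> ball 0 \<epsilon>. g p = 0}"

definition regular_point :: "(real \<times> real \<Rightarrow> real) \<Rightarrow> real \<times> real \<Rightarrow> bool" where
  "regular_point g p \<longleftrightarrow> g p = 0 \<and> (pdx g p, pdy g p) \<noteq> (0, 0)"

definition singular_point :: "(real \<times> real \<Rightarrow> real) \<Rightarrow> real \<times> real \<Rightarrow> bool" where
  "singular_point g p \<longleftrightarrow> g p = 0 \<and> (pdx g p, pdy g p) = (0, 0)"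

text \<open>At a regular point such a parametrisation exists and its germ is unique up to the
  orientation, which affects at most the signs of the curvature and of its derivatives.\<close>

definition arclength_param ::
    "(real \<times> real \<Rightarrow> real) \<Rightarrow> real \<times> real \<Rightarrow> (real \<Rightarrow> real \<times> real) \<Rightarrow> bool" where
  "arclength_param g p \<gamma> \<longleftrightarrow> \<gamma> 0 = p \<and>
     (\<exists>r>0. smooth_on {-r<..<r} \<gamma> \<and>
        (\<forall>s\<in>{-r<..<r}. g (\<gamma> s) = 0 \<and> norm (vector_derivative \<gamma> (at s)) = 1))"

text \<open>Signed curvature \<open>det(\<gamma>', \<gamma>'')\<close> of a unit speed curve.\<close>

definition curvature :: "(real \<Rightarrow> real \<times> real) \<Rightarrow> real \<Rightarrow> real" where
  "curvature \<gamma> s =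
     (let v = (\<lambda>u. vector_derivative \<gamma> (at u)); w = vector_derivative v (at s)
      in fst (v s) * snd w - snd (v s) * fst w)"

definition inflection :: "(real \<times> real \<Rightarrow> real) \<Rightarrow> real \<times> real \<Rightarrow> bool" where
  "inflection g p \<longleftrightarrow> regular_point g p \<and>
     (\<exists>\<gamma>. arclength_param g p \<gamma> \<and> curvature \<gamma> 0 = 0)"

definition vertex :: "(real \<times> real \<Rightarrow> real) \<Rightarrow> real \<times> real \<Rightarrow> bool" where
  "vertex g p \<longleftrightarrow> regular_point g p \<and>
     (\<exists>\<gamma>. arclength_param g p \<gamma> \<and> deriv (curvature \<gamma>) 0 = 0)"

text \<open>A self-intersection point of \<open>C\<close> is one through which at least two branches pass: two
  arcs in \<open>C\<close> with \<open>p\<close> in their interior which meet only at \<open>p\<close>.\<close>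

definition self_intersection :: "(real \<times> real) set \<Rightarrow> real \<times> real \<Rightarrow> bool" where
  "self_intersection C p \<longleftrightarrow>
     (\<exists>\<gamma>\<^sub>1 \<gamma>\<^sub>2. (\<forall>\<gamma>\<in>{\<gamma>\<^sub>1, \<gamma>\<^sub>2}. continuous_on {-1..1::real} \<gamma> \<and> inj_on \<gamma> {-1..1} \<and>
                          \<gamma> 0 = p \<and> \<gamma> ` {-1..1} \<subseteq> C) \<and>
             \<gamma>\<^sub>1 ` {-1..1} \<inter> \<gamma>\<^sub>2 ` {-1..1} = {p})"

section \<open>FRS-equivalence\<close>

definition submanifold :: "'a::euclidean_space set \<Rightarrow> nat \<Rightarrow> bool" where
  "submanifold M d \<longleftrightarrow>
     (\<forall>p\<in>M. \<exists>W (L :: 'a set) W'. openin (top_of_set M) W \<and> p \<in> W \<and> subspace L \<and> dim L = d \<and>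
        openin (top_of_set L) W' \<and> diffeomorphic W W')"

text \<open>A finite partition of \<open>V\<close> into connected smooth submanifolds satisfying the frontier
  condition. A stratification germ is represented by a stratification of a neighbourhood.\<close>

definition stratification :: "'a::euclidean_space set \<Rightarrow> 'a set set \<Rightarrow> bool" where
  "stratification V S \<longleftrightarrow> finite S \<and> \<Union>S = V \<and> disjoint S \<and>
     (\<forall>X\<in>S. X \<noteq> {} \<and> connected X \<and> (\<exists>d. submanifold X d)) \<and>
     (\<forall>X\<in>S. \<forall>Y\<in>S. Y \<inter> closure X \<noteq> {} \<longrightarrow> V \<inter> closure X \<supseteq> Y)"

text \<open>Two curves have the same relative position of their distinguished points if a
  homeomorphism between the curves matches the points of each of the four kinds.\<close>

definition same_relative_position ::
    "real \<Rightarrow> (real \<times> real \<Rightarrow> real) \<Rightarrow> (real \<times> real \<Rightarrow> real) \<Rightarrow> bool" where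
  "same_relative_position \<epsilon> g h \<longleftrightarrow>
     (\<exists>\<phi> \<psi>. homeomorphism (curve \<epsilon> g) (curve \<epsilon> h) \<phi> \<psi> \<and>
        (\<forall>p\<in>curve \<epsilon> g.
           (singular_point g p \<longleftrightarrow> singular_point h (\<phi> p)) \<and>
           (self_intersection (curve \<epsilon> g) p \<longleftrightarrow> self_intersection (curve \<epsilon> h) (\<phi> p)) \<and>
           (inflection g p \<longleftrightarrow> inflection h (\<phi> p)) \<and>
           (vertex g p \<longleftrightarrow> vertex h (\<phi> p))))"

definition FRS_same ::
    "real \<Rightarrow> (real \<times> real \<Rightarrow> real) \<Rightarrow> (real \<times> real \<Rightarrow> real) \<Rightarrow> bool" where
  "FRS_same \<epsilon> g h \<longleftrightarrow>
     diffeomorphic (curve \<epsilon> g) (curve \<epsilon> h) \<and>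
     {p \<in> curve \<epsilon> g. inflection g p} \<approx> {p \<in> curve \<epsilon> h. inflection h p} \<and>
     {p \<in> curve \<epsilon> g. vertex g p} \<approx> {p \<in> curve \<epsilon> h. vertex h p} \<and>
     same_relative_position \<epsilon> g h"

text \<open>The curves are compared in every sufficiently small ball, for parameters that are small
  depending on the ball. The stratifications and the homeomorphism do not depend on the ball.\<close>

definition FRS_equivalent ::
    "(real \<times> real \<Rightarrow> 'p::euclidean_space \<Rightarrow> real) \<Rightarrow> (real \<times> real \<Rightarrow> 'p \<Rightarrow> real) \<Rightarrow> bool" where
  "FRS_equivalent F G \<longleftrightarrow>
     (\<exists>V\<^sub>1 S\<^sub>1 V\<^sub>2 S\<^sub>2 k k'.
        open V\<^sub>1 \<and> 0 \<in> V\<^sub>1 \<and> stratification V\<^sub>1 S\<^sub>1 \<and>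
        open V\<^sub>2 \<and> 0 \<in> V\<^sub>2 \<and> stratification V\<^sub>2 S\<^sub>2 \<and>
        homeomorphism V\<^sub>1 V\<^sub>2 k k' \<and> k 0 = 0 \<and> (\<lambda>X. k ` X) ` S\<^sub>1 = S\<^sub>2 \<and>
        (\<exists>\<epsilon>\<^sub>0>0. \<forall>\<epsilon>. 0 < \<epsilon> \<and> \<epsilon> < \<epsilon>\<^sub>0 \<longrightarrow> (\<exists>\<delta>>0.
           (\<forall>X\<in>S\<^sub>1. \<forall>s\<in>X \<inter> ball 0 \<delta>. \<forall>s'\<in>X \<inter> ball 0 \<delta>.
              FRS_same \<epsilon> (\<lambda>p. F p s) (\<lambda>p. F p s')) \<and>
           (\<forall>X\<in>S\<^sub>2. \<forall>u\<in>X \<inter> ball 0 \<delta>. \<forall>u'\<in>X \<inter> ball 0 \<delta>.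
              FRS_same \<epsilon> (\<lambda>p. G p u) (\<lambda>p. G p u')) \<and>
           (\<forall>s\<in>V\<^sub>1 \<inter> ball 0 \<delta>. FRS_same \<epsilon> (\<lambda>p. F p s) (\<lambda>p. G p (k s))))))"

section \<open>Configurations\<close>

datatype letter = I | V

text \<open>\<open>has_word g K w\<close>: the part \<open>K\<close> of the curve is a regular open arc, and the inflections and
  vertices met along it spell \<open>w\<close>. No orientation is prescribed, so \<open>w\<close> is determined only up
  to reversal. No point is both an inflection and a vertex.\<close>

definition has_word ::
    "(real \<times> real \<Rightarrow> real) \<Rightarrow> (real \<times> real) set \<Rightarrow> letter list \<Rightarrow> bool" where
  "has_word g K w \<longleftrightarrow>
     (\<forall>p\<in>K. regular_point g p) \<and>
     (\<exists>\<gamma> \<gamma>' \<tau>. homeomorphism {0<..<1::real} K \<gamma> \<gamma>' \<and>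
        sorted_wrt (<) \<tau> \<and> length \<tau> = length w \<and>
        set \<tau> = {u \<in> {0<..<1}. inflection g (\<gamma> u) \<or> vertex g (\<gamma> u)} \<and>
        (\<forall>j<length w. (w ! j = I \<longleftrightarrow> inflection g (\<gamma> (\<tau> ! j))) \<and>
                      (w ! j = V \<longleftrightarrow> vertex g (\<gamma> (\<tau> ! j)))))"

definition has_strings ::
    "real \<Rightarrow> (real \<times> real \<Rightarrow> real) \<Rightarrow> letter list \<times> letter list \<Rightarrow> bool" where
  "has_strings \<epsilon> g ws \<longleftrightarrow>
     (\<exists>K\<^sub>1 K\<^sub>2. K\<^sub>1 \<noteq> K\<^sub>2 \<and> components (curve \<epsilon> g) = {K\<^sub>1, K\<^sub>2} \<and>
        has_word g K\<^sub>1 (fst ws) \<and> has_word g K\<^sub>2 (snd ws))"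

text \<open>The configuration \<open>l \<leftrightarrow> r\<close>: one sign \<open>\<sigma>\<close> of the parameter gives \<open>l\<close>, the other one
  gives \<open>r\<close>.\<close>

definition has_configuration ::
    "(real \<times> real \<Rightarrow> real \<Rightarrow> real) \<Rightarrow> letter list \<times> letter list \<Rightarrow> letter list \<times> letter list
      \<Rightarrow> bool" where
  "has_configuration F l r \<longleftrightarrow>
     (\<exists>\<sigma>\<in>{1, -1}. \<exists>\<epsilon>\<^sub>0>0. \<forall>\<epsilon>. 0 < \<epsilon> \<and> \<epsilon> < \<epsilon>\<^sub>0 \<longrightarrow> (\<exists>\<delta>>0. \<forall>t. 0 < t \<and> t < \<delta> \<longrightarrow>
        has_strings \<epsilon> (\<lambda>p. F p (\<sigma> * t)) l \<and> has_strings \<epsilon> (\<lambda>p. F p (- \<sigma> * t)) r))"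

end

theory Submission
  imports Defs
begin

text \<open>Write \<open>\<theta>\<close> for the derivative along the Hamiltonian field of \<open>f\<close>, which is tangent to every
  level curve. The inflections of a level curve are the zeros on it of a form \<open>I\<close> of the partial
  derivatives of \<open>f\<close>, and the vertices are the zeros of \<open>W = 2 N \<theta>(I) - 3 I \<theta>(N)\<close>, where \<open>N\<close> is the
  squared norm of the gradient. In skew coordinates in which the tangent lines of the node are the
  axes, \<open>f = x y + \<dots>\<close>, and a level curve \<open>f = t\<close> consists of two arcs, one in each of two opposite
  quadrants. Away from the axes \<open>I\<close> and \<open>\<theta>(W)\<close> are dominated by their leading terms, so that there
  is no inflection and exactly one vertex. Near an axis, every zero of \<open>I\<close>, and every zero of \<open>W\<close>,
  is a crossing in a direction fixed by the jets of the branch of \<open>f = 0\<close> tangent to that axis, so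
  that each occurs at most once, while the values of \<open>I\<close> and \<open>W\<close> on the branch
  (multiples of \<open>\<eta>\<^sub>1\<close> and \<open>\<eta>\<^sub>3\<close>, or of \<open>\<eta>\<^sub>2\<close> and \<open>\<eta>\<^sub>4\<close>) decide whether it occurs. A vertex close to
  an inflection lies farther out, because \<open>W \<noteq> 0\<close> has a fixed sign wherever \<open>I = 0\<close>.

  A versal deformation has \<open>\<partial>G/\<partial>s \<noteq> 0\<close> at the origin, so \<open>G(p, s) = 0\<close> can be solved for \<open>s\<close>. By
  Hadamard's lemma the solution is a unit times \<open>f\<close>; hence, up to a constant factor, it has the same
  jets along the branches and the first argument applies to it as well.\<close>



section \<open>Calculus of smooth functions\<close>

text \<open>On the level \<open>f = t\<close>, at abscissa x near a branch, the height w above the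
  branch is about t / x. There I is about -2 p2 x^3 - 2 x w and W is about v1 x^6 - 12 A x^3 w,
  which puts an inflection at x ~ t^(1/3), a vertex at x ~ t^(1/4) and the middle vertex at x ~
  t^(1/2). The proof does not locate these points along the arc: on each piece it suffices to know
  the signs at the two ends and the sign of the derivative at a zero, so that counting becomes a
  statement about crossings in one variable. The cubic jet of a branch is enough, because W
  restricted to it starts with x^6 and a coefficient depending on p2 and p3 alone. Versal
  deformations are usually compared through changes of coordinates, but these destroy inflections
  and vertices. Multiplication by a unit moves no curve, and it is the reduction used here. The four
  quadrants and both branches share one argument, since a linear change of coordinates multiplies I,
  W and their derivatives along the field by explicit powers of its determinant.\<close>

lemma Ck_on_cong:
  assumes "open S" "\<And>x. x \<in> S \<Longrightarrow> f x = g x"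
  shows "Ck_on k S f \<longleftrightarrow> Ck_on k S g"
  using assms
proof (induction k arbitrary: f g)
  case 0
  then show ?case by (simp cong: continuous_on_cong)
next
  case (Suc k)
  have tr: "(g has_derivative D) (at x) \<longleftrightarrow> (f has_derivative D) (at x)" if "x \<in> S" for x D
    using has_derivative_transform_within_open[of f D x UNIV S g]
      has_derivative_transform_within_open[of g D x UNIV S f] Suc.prems that by auto
  have 1: "f differentiable at x \<longleftrightarrow> g differentiable at x" if "x \<in> S" for x
    unfolding differentiable_def using tr[OF that] by simp
  have 2: "frechet_derivative f (at x) = frechet_derivative g (at x)" if "x \<in> S" for x
    unfolding frechet_derivative_def using tr[OF that] by simp
  have 3: "Ck_on k S (\<lambda>x. frechet_derivative f (at x) b) \<longleftrightarrow> Ck_on k S (\<lambda>x. frechet_derivative g (at x) b)" for b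
    by (rule Suc.IH[OF Suc.prems(1)]) (simp add: 2)
  show ?case
    unfolding Ck_on.simps using 1 3 by blast
qed

text \<open>The definition of \<open>Ck_on\<close> refers to \<open>frechet_derivative\<close>, a
  choice. On an open set the derivative is unique, so an explicit formula may be used in its
  place.\<close>

lemma Ck_on_has_derivativeI:
  assumes "open S" "\<And>x. x \<in> S \<Longrightarrow> (f has_derivative f' x) (at x)"
    and "\<And>b. b \<in> Basis \<Longrightarrow> Ck_on k S (\<lambda>x. f' x b)"
  shows "Ck_on (Suc k) S f"
proof -
  have eq: "frechet_derivative f (at x) = f' x" if "x \<in> S" for x
    using frechet_derivative_at[OF assms(2)[OF that]] by simp
  have "Ck_on k S (\<lambda>x. frechet_derivative f (at x) b)" if "b \<in> Basis" for b
    using Ck_on_cong[OF assms(1), of "\<lambda>x. frechet_derivative f (at x) b" "\<lambda>x. f' x b"] eq assms(3)[OF that]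
    by simp
  then show ?thesis using assms(2) by (auto simp: differentiable_def)
qed

lemma Ck_on_SucD: "Ck_on (Suc k) S f \<Longrightarrow> Ck_on k S f"
proof (induction k arbitrary: f)
  case 0
  then show ?case
    by (auto intro!: continuous_at_imp_continuous_on differentiable_imp_continuous_within)
next
  case (Suc k)
  then show ?case by (simp only: Ck_on.simps) blast
qed

lemma Ck_on_mono_set: "Ck_on k S f \<Longrightarrow> T \<subseteq> S \<Longrightarrow> Ck_on k T f"
  by (induction k arbitrary: f) (auto intro: continuous_on_subset)

lemma Ck_on_Suc_frechet:
  assumes "Ck_on (Suc k) S f" "x \<in> S"
  shows "(f has_derivative frechet_derivative f (at x)) (at x)"
  using assms by (auto simp: frechet_derivative_works)

lemma Ck_on_const: "open S \<Longrightarrow> Ck_on k S (\<lambda>x. c)"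
proof (induction k arbitrary: c)
  case (Suc k)
  show ?case
    by (rule Ck_on_has_derivativeI[where f' = "\<lambda>x v. 0"]) (use Suc in auto)
qed auto

lemma Ck_on_linear:
  assumes "open S" "bounded_linear f" shows "Ck_on k S f"
proof (cases k)
  case (Suc k)
  then show ?thesis
    using Ck_on_has_derivativeI[OF assms(1), of f "\<lambda>x. f"] Ck_on_const[OF assms(1)]
      bounded_linear_imp_has_derivative[OF assms(2)] by blast
qed (use assms in \<open>auto intro: linear_continuous_on\<close>)

lemma Ck_on_linear_compose:
  assumes "open S" "bounded_linear L" shows "Ck_on k S g \<Longrightarrow> Ck_on k S (\<lambda>x. L (g x))"
proof (induction k arbitrary: g)
  case 0
  then show ?case using bounded_linear.continuous_on[OF assms(2)] by auto
next
  case (Suc k)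
  show ?case
  proof (rule Ck_on_has_derivativeI[OF assms(1)])
    show "((\<lambda>x. L (g x)) has_derivative (\<lambda>v. L (frechet_derivative g (at x) v))) (at x)" if "x \<in> S" for x
      by (rule bounded_linear.has_derivative[OF assms(2) Ck_on_Suc_frechet[OF Suc.prems that]])
    show "Ck_on k S (\<lambda>x. L (frechet_derivative g (at x) b))" if "b \<in> Basis" for b
      by (rule Suc.IH) (use Suc.prems that in auto)
  qed
qed

lemma Ck_on_add:
  "open S \<Longrightarrow> Ck_on k S f \<Longrightarrow> Ck_on k S g \<Longrightarrow> Ck_on k S (\<lambda>x. f x + g x)"
proof (induction k arbitrary: f g)
  case (Suc k)
  show ?case
  proof (rule Ck_on_has_derivativeI[OF Suc.prems(1)])
    show "((\<lambda>x. f x + g x) has_derivative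
        (\<lambda>v. frechet_derivative f (at x) v + frechet_derivative g (at x) v)) (at x)" if "x \<in> S" for x
      by (intro has_derivative_add Ck_on_Suc_frechet[OF Suc.prems(2) that] Ck_on_Suc_frechet[OF Suc.prems(3) that])
    show "Ck_on k S (\<lambda>x. frechet_derivative f (at x) b + frechet_derivative g (at x) b)" if "b \<in> Basis" for b
      by (rule Suc.IH) (use Suc.prems that in auto)
  qed
qed (auto intro: continuous_intros)

lemma Ck_on_sum:
  "open S \<Longrightarrow> (\<And>i. i \<in> A \<Longrightarrow> Ck_on k S (f i)) \<Longrightarrow> Ck_on k S (\<lambda>x. \<Sum>i\<in>A. f i x)"
  by (induction A rule: infinite_finite_induct) (auto simp: Ck_on_const intro!: Ck_on_add)

lemma Ck_on_bilinear:
  assumes "open S" "bounded_bilinear B"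
  shows "Ck_on k S f \<Longrightarrow> Ck_on k S g \<Longrightarrow> Ck_on k S (\<lambda>x. B (f x) (g x))"
proof (induction k arbitrary: f g)
  case 0
  then show ?case using bounded_bilinear.continuous_on[OF assms(2)] by auto
next
  case (Suc k)
  show ?case
  proof (rule Ck_on_has_derivativeI[OF assms(1)])
    show "((\<lambda>x. B (f x) (g x)) has_derivative
        (\<lambda>v. B (f x) (frechet_derivative g (at x) v) + B (frechet_derivative f (at x) v) (g x))) (at x)"
      if "x \<in> S" for x
      by (rule bounded_bilinear.FDERIV[OF assms(2) Ck_on_Suc_frechet[OF Suc.prems(1) that] Ck_on_Suc_frechet[OF Suc.prems(2) that]])
    show "Ck_on k S (\<lambda>x. B (f x) (frechet_derivative g (at x) b) + B (frechet_derivative f (at x) b) (g x))"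
      if "b \<in> Basis" for b
      by (intro Ck_on_add assms(1) Suc.IH Ck_on_SucD[OF Suc.prems(1)] Ck_on_SucD[OF Suc.prems(2)])
        (use Suc.prems that in auto)
  qed
qed

text \<open>The chain rule evaluates the derivative of the outer function in a direction that varies
  with the point, whereas \<open>Ck_on\<close> speaks of basis directions only. This expansion
  connects the two.\<close>

lemma frechet_compose_sum:
  fixes g :: "'a::euclidean_space \<Rightarrow> 'b::euclidean_space"
  assumes "bounded_linear D"
  shows "D w = (\<Sum>i\<in>Basis. (w \<bullet> i) *\<^sub>R D i)"
proof -
  interpret bounded_linear D by fact
  have "D w = D (\<Sum>i\<in>Basis. (w \<bullet> i) *\<^sub>R i)" by (simp add: euclidean_representation)
  then show ?thesis by (simp add: sum scaleR)
qed

text \<open>The induction generalises the outer function alone: its partial derivatives are composed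
  with the same \<open>g\<close>, which is then used with one order of differentiability
  less.\<close>

lemma Ck_on_compose:
  fixes g :: "'a::euclidean_space \<Rightarrow> 'b::euclidean_space"
  assumes "open S" "open T"
  shows "Ck_on k T f \<Longrightarrow> Ck_on k S g \<Longrightarrow> g ` S \<subseteq> T \<Longrightarrow> Ck_on k S (\<lambda>x. f (g x))"
proof (induction k arbitrary: f)
  case 0
  then show ?case using continuous_on_compose2[of T f S g] by auto
next
  case (Suc k)
  have g: "(g has_derivative frechet_derivative g (at x)) (at x)" if "x \<in> S" for x
    by (rule Ck_on_Suc_frechet[OF Suc.prems(2) that])
  have f: "(f has_derivative frechet_derivative f (at (g x))) (at (g x))" if "x \<in> S" for x
    using Ck_on_Suc_frechet[OF Suc.prems(1)] that Suc.prems(3) by auto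
  show ?case
  proof (rule Ck_on_has_derivativeI[OF assms(1)])
    fix x assume x: "x \<in> S"
    show "((\<lambda>x. f (g x)) has_derivative (\<lambda>v. \<Sum>i\<in>Basis.
         (frechet_derivative g (at x) v \<bullet> i) *\<^sub>R frechet_derivative f (at (g x)) i)) (at x)"
      by (rule has_derivative_eq_rhs[OF diff_chain_at[OF g[OF x] f[OF x], unfolded o_def]], rule ext)
        (rule frechet_compose_sum[OF has_derivative_bounded_linear[OF f[OF x]]])
  next
    fix b :: 'a assume b: "b \<in> Basis"
    have "Ck_on k S (\<lambda>x. frechet_derivative f (at (g x)) i)" if "i \<in> Basis" for i
      by (rule Suc.IH[of "\<lambda>y. frechet_derivative f (at y) i"])
        (use Suc.prems(1,3) Ck_on_SucD[OF Suc.prems(2)] that in auto)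
    moreover have "Ck_on k S (\<lambda>x. frechet_derivative g (at x) b \<bullet> i)" for i
      using Suc.prems(2) b by (intro Ck_on_linear_compose[OF assms(1) bounded_linear_inner_left]) auto
    ultimately show "Ck_on k S (\<lambda>x. \<Sum>i\<in>Basis. (frechet_derivative g (at x) b \<bullet> i) *\<^sub>R frechet_derivative f (at (g x)) i)"
      by (intro Ck_on_sum Ck_on_bilinear[OF assms(1) bounded_bilinear_scaleR]) (use assms in auto)
  qed
qed

lemma Ck_on_Pair:
  assumes "open S" shows "Ck_on k S f \<Longrightarrow> Ck_on k S g \<Longrightarrow> Ck_on k S (\<lambda>x. (f x, g x))"
proof (induction k arbitrary: f g)
  case (Suc k)
  show ?case
  proof (rule Ck_on_has_derivativeI[OF assms])
    show "((\<lambda>x. (f x, g x)) has_derivative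
        (\<lambda>v. (frechet_derivative f (at x) v, frechet_derivative g (at x) v))) (at x)" if "x \<in> S" for x
      by (intro has_derivative_Pair Ck_on_Suc_frechet[OF Suc.prems(1) that] Ck_on_Suc_frechet[OF Suc.prems(2) that])
    show "Ck_on k S (\<lambda>x. (frechet_derivative f (at x) b, frechet_derivative g (at x) b))" if "b \<in> Basis" for b
      by (rule Suc.IH) (use Suc.prems that in auto)
  qed
qed (auto intro: continuous_intros)

text \<open>The derivative of 1 / f is a product of factors 1 / f and a derivative of f, so the
  regularity of the inverse bootstraps itself. The square root below works in the same way.\<close>

lemma Ck_on_inverse:
  fixes f :: "'a::euclidean_space \<Rightarrow> real"
  assumes "open S" "\<And>x. x \<in> S \<Longrightarrow> f x \<noteq> 0"
  shows "Ck_on k S f \<Longrightarrow> Ck_on k S (\<lambda>x. inverse (f x))"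
proof (induction k)
  case 0
  then show ?case using assms by (auto intro!: continuous_intros)
next
  case (Suc k)
  show ?case
  proof (rule Ck_on_has_derivativeI[OF assms(1)])
    show "((\<lambda>x. inverse (f x)) has_derivative
        (\<lambda>v. - (inverse (f x) * frechet_derivative f (at x) v * inverse (f x)))) (at x)" if "x \<in> S" for x
      by (rule Deriv.has_derivative_inverse[OF assms(2)[OF that] Ck_on_Suc_frechet[OF Suc.prems that]])
    show "Ck_on k S (\<lambda>x. - (inverse (f x) * frechet_derivative f (at x) b * inverse (f x)))" if "b \<in> Basis" for b
      by (intro Ck_on_linear_compose[OF assms(1) bounded_linear_minus[OF bounded_linear_ident]]
          Ck_on_bilinear[OF assms(1) bounded_bilinear_mult] Suc.IH Ck_on_SucD[OF Suc.prems])
        (use that Suc.prems in auto)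
  qed
qed

lemma Ck_on_sqrt:
  fixes f :: "'a::euclidean_space \<Rightarrow> real"
  assumes "open S" "\<And>x. x \<in> S \<Longrightarrow> f x > 0"
  shows "Ck_on k S f \<Longrightarrow> Ck_on k S (\<lambda>x. sqrt (f x))"
proof (induction k)
  case 0
  then show ?case by (auto intro!: continuous_intros)
next
  case (Suc k)
  show ?case
  proof (rule Ck_on_has_derivativeI[OF assms(1)])
    show "((\<lambda>x. sqrt (f x)) has_derivative
        (\<lambda>v. frechet_derivative f (at x) v * (inverse (sqrt (f x)) / 2))) (at x)" if "x \<in> S" for x
      using has_derivative_real_sqrt[OF assms(2)[OF that] Ck_on_Suc_frechet[OF Suc.prems that]]
      by (auto simp: field_simps)
    show "Ck_on k S (\<lambda>x. frechet_derivative f (at x) b * (inverse (sqrt (f x)) / 2))" if "b \<in> Basis" for b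
      unfolding divide_inverse
      by (intro Ck_on_bilinear[OF assms(1) bounded_bilinear_mult] Ck_on_inverse Ck_on_const
          assms(1) Suc.IH Ck_on_SucD[OF Suc.prems])
        (use that Suc.prems assms(2) assms(2)[THEN less_imp_neq, symmetric] in auto)
  qed
qed

section \<open>Smoothness of infinite order\<close>

lemma smooth_on_cong:
  "open S \<Longrightarrow> (\<And>x. x \<in> S \<Longrightarrow> f x = g x) \<Longrightarrow> smooth_on S f \<longleftrightarrow> smooth_on S g"
  unfolding smooth_on_def using Ck_on_cong by blast

lemma smooth_on_mono_set: "smooth_on S f \<Longrightarrow> T \<subseteq> S \<Longrightarrow> smooth_on T f"
  unfolding smooth_on_def using Ck_on_mono_set by blast

lemma smooth_on_frechet:
  assumes "smooth_on S f" "x \<in> S"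
  shows "(f has_derivative frechet_derivative f (at x)) (at x)"
  using assms Ck_on_Suc_frechet unfolding smooth_on_def by blast

lemma smooth_on_continuous: "smooth_on S f \<Longrightarrow> continuous_on S f"
  unfolding smooth_on_def using Ck_on.simps(1) by blast

lemma smooth_on_has_derivativeI:
  assumes "open S" "\<And>x. x \<in> S \<Longrightarrow> (f has_derivative f' x) (at x)"
    and "\<And>b. b \<in> Basis \<Longrightarrow> smooth_on S (\<lambda>x. f' x b)"
  shows "smooth_on S f"
  unfolding smooth_on_def
proof
  fix k show "Ck_on k S f"
    by (rule Ck_on_SucD, rule Ck_on_has_derivativeI[OF assms(1,2)])
      (use assms(3) in \<open>auto simp: smooth_on_def\<close>)
qed

named_theorems smooth_intros

lemma smooth_on_const [smooth_intros]: "open S \<Longrightarrow> smooth_on S (\<lambda>x. c)"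
  by (simp add: smooth_on_def Ck_on_const)

lemma smooth_on_linear: "open S \<Longrightarrow> bounded_linear f \<Longrightarrow> smooth_on S f"
  by (simp add: smooth_on_def Ck_on_linear)

lemma smooth_on_id [smooth_intros]: "open S \<Longrightarrow> smooth_on S (\<lambda>x. x)"
  by (simp add: smooth_on_linear)

lemma smooth_on_linear_compose:
  "bounded_linear L \<Longrightarrow> open S \<Longrightarrow> smooth_on S g \<Longrightarrow> smooth_on S (\<lambda>x. L (g x))"
  by (simp add: smooth_on_def Ck_on_linear_compose)

lemmas smooth_on_fst [smooth_intros] = smooth_on_linear_compose[OF bounded_linear_fst]
lemmas smooth_on_snd [smooth_intros] = smooth_on_linear_compose[OF bounded_linear_snd]
lemmas smooth_on_minus [smooth_intros] = smooth_on_linear_compose[OF bounded_linear_minus[OF bounded_linear_ident]]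

lemma smooth_on_add [smooth_intros]:
  "open S \<Longrightarrow> smooth_on S f \<Longrightarrow> smooth_on S g \<Longrightarrow> smooth_on S (\<lambda>x. f x + g x)"
  by (simp add: smooth_on_def Ck_on_add)

lemma smooth_on_diff [smooth_intros]:
  assumes "open S" "smooth_on S f" "smooth_on S g" shows "smooth_on S (\<lambda>x. f x - g x)"
  using smooth_on_add[OF assms(1,2) smooth_on_minus[OF assms(1,3)]] by simp

lemma smooth_on_sum [smooth_intros]:
  "open S \<Longrightarrow> (\<And>i. i \<in> A \<Longrightarrow> smooth_on S (f i)) \<Longrightarrow> smooth_on S (\<lambda>x. \<Sum>i\<in>A. f i x)"
  by (simp add: smooth_on_def Ck_on_sum)

lemma smooth_on_bilinear:
  "bounded_bilinear B \<Longrightarrow> open S \<Longrightarrow> smooth_on S f \<Longrightarrow> smooth_on S g \<Longrightarrow> smooth_on S (\<lambda>x. B (f x) (g x))"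
  by (simp add: smooth_on_def Ck_on_bilinear)

lemmas smooth_on_scaleR [smooth_intros] = smooth_on_bilinear[OF bounded_bilinear_scaleR]

lemma smooth_on_mult [smooth_intros]:
  fixes f g :: "'a::euclidean_space \<Rightarrow> real"
  shows "open S \<Longrightarrow> smooth_on S f \<Longrightarrow> smooth_on S g \<Longrightarrow> smooth_on S (\<lambda>x. f x * g x)"
  by (rule smooth_on_bilinear[OF bounded_bilinear_mult])

lemma smooth_on_power [smooth_intros]:
  fixes f :: "'a::euclidean_space \<Rightarrow> real"
  shows "open S \<Longrightarrow> smooth_on S f \<Longrightarrow> smooth_on S (\<lambda>x. f x ^ n)"
  by (induction n) (auto intro!: smooth_intros)

lemma smooth_on_Pair [smooth_intros]:
  "open S \<Longrightarrow> smooth_on S f \<Longrightarrow> smooth_on S g \<Longrightarrow> smooth_on S (\<lambda>x. (f x, g x))"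
  by (simp add: smooth_on_def Ck_on_Pair)

lemma smooth_on_inverse [smooth_intros]:
  fixes f :: "'a::euclidean_space \<Rightarrow> real"
  shows "open S \<Longrightarrow> smooth_on S f \<Longrightarrow> (\<And>x. x \<in> S \<Longrightarrow> f x \<noteq> 0) \<Longrightarrow> smooth_on S (\<lambda>x. inverse (f x))"
  by (simp add: smooth_on_def Ck_on_inverse)

lemma smooth_on_divide [smooth_intros]:
  fixes f g :: "'a::euclidean_space \<Rightarrow> real"
  shows "open S \<Longrightarrow> smooth_on S f \<Longrightarrow> smooth_on S g \<Longrightarrow> (\<And>x. x \<in> S \<Longrightarrow> g x \<noteq> 0) \<Longrightarrow> smooth_on S (\<lambda>x. f x / g x)"
  unfolding divide_inverse by (intro smooth_intros) auto

lemma smooth_on_sqrt [smooth_intros]: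
  fixes f :: "'a::euclidean_space \<Rightarrow> real"
  shows "open S \<Longrightarrow> smooth_on S f \<Longrightarrow> (\<And>x. x \<in> S \<Longrightarrow> f x > 0) \<Longrightarrow> smooth_on S (\<lambda>x. sqrt (f x))"
  by (simp add: smooth_on_def Ck_on_sqrt)

lemma smooth_on_compose:
  fixes g :: "'a::euclidean_space \<Rightarrow> 'b::euclidean_space"
  shows "smooth_on T f \<Longrightarrow> open S \<Longrightarrow> open T \<Longrightarrow> smooth_on S g \<Longrightarrow> g ` S \<subseteq> T \<Longrightarrow> smooth_on S (\<lambda>x. f (g x))"
  unfolding smooth_on_def using Ck_on_compose by blast

lemma smooth_on_frechet_Basis:
  assumes "smooth_on S f" "b \<in> Basis"
  shows "smooth_on S (\<lambda>x. frechet_derivative f (at x) b)"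
  using assms unfolding smooth_on_def by (metis Ck_on.simps(2))

lemma smooth_on_frechet_apply:
  assumes "open S" "smooth_on S f"
  shows "smooth_on S (\<lambda>x. frechet_derivative f (at x) w)"
proof -
  have "frechet_derivative f (at x) w = (\<Sum>b\<in>Basis. (w \<bullet> b) *\<^sub>R frechet_derivative f (at x) b)" if "x \<in> S" for x
    by (rule frechet_compose_sum[OF has_derivative_bounded_linear[OF smooth_on_frechet[OF assms(2) that]]])
  then show ?thesis
    by (subst smooth_on_cong[OF assms(1)]) (auto intro!: smooth_intros assms(1) smooth_on_frechet_Basis[OF assms(2)])
qed


section \<open>Implicit functions\<close>

lemma smooth_vertical_derivative:
  fixes g :: "'a::euclidean_space \<times> real \<Rightarrow> real"
  assumes "smooth_on W g" "(x, y) \<in> W"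
  shows "((\<lambda>s. g (x, s)) has_real_derivative frechet_derivative g (at (x, y)) (0, 1)) (at y)"
proof -
  let ?D = "frechet_derivative g (at (x, y))"
  have D: "(g has_derivative ?D) (at (x, y))" by (rule smooth_on_frechet[OF assms])
  interpret D: bounded_linear ?D by (rule has_derivative_bounded_linear[OF D])
  have "((\<lambda>s. (x, s)) has_derivative (\<lambda>s. (0, s))) (at y)"
    by (auto intro!: derivative_eq_intros)
  from diff_chain_at[OF this D] have 1: "((\<lambda>s. g (x, s)) has_derivative (\<lambda>s. ?D (0, s))) (at y)"
    by (simp add: o_def)
  have 2: "s * ?D (0, 1) = ?D (0, s)" for s
    using D.scaleR[of s "(0, 1)"] by simp
  show ?thesis by (rule has_derivative_imp_has_field_derivative[OF 1 2])
qed

text \<open>A positive vertical derivative on a vertically convex set makes \<open>g\<close>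
  strictly increasing on every fibre. The zero is therefore unique on the whole fibre and the
  solution is defined over all of \<open>A\<close> rather than as a germ; this global form is what
  later presents an entire level arc as a graph.\<close>

lemma implicit_function:
  fixes g :: "'a::euclidean_space \<times> real \<Rightarrow> real"
  assumes W: "open W" "smooth_on W g"
    and pos: "\<And>z. z \<in> W \<Longrightarrow> frechet_derivative g (at z) (0, 1) > 0"
    and conv: "\<And>x y1 y2 y. (x, y1) \<in> W \<Longrightarrow> (x, y2) \<in> W \<Longrightarrow> y1 \<le> y \<Longrightarrow> y \<le> y2 \<Longrightarrow> (x, y) \<in> W"
    and A: "open A" and ex: "\<And>x. x \<in> A \<Longrightarrow> \<exists>y. (x, y) \<in> W \<and> g (x, y) = 0"
  obtains Y where "smooth_on A Y" "\<And>x. x \<in> A \<Longrightarrow> (x, Y x) \<in> W" "\<And>x. x \<in> A \<Longrightarrow> g (x, Y x) = 0"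
    "\<And>x y. x \<in> A \<Longrightarrow> (x, y) \<in> W \<Longrightarrow> g (x, y) = 0 \<Longrightarrow> y = Y x"
proof -
  have mono: "g (x, y1) < g (x, y2)" if "(x, y1) \<in> W" "(x, y2) \<in> W" "y1 < y2" for x y1 y2
  proof (rule DERIV_pos_imp_increasing[OF that(3)])
    fix y assume "y1 \<le> y" "y \<le> y2"
    then have "(x, y) \<in> W" using conv that by blast
    then show "\<exists>d. ((\<lambda>y. g (x, y)) has_real_derivative d) (at y) \<and> 0 < d"
      using smooth_vertical_derivative[OF W(2)] pos by blast
  qed
  obtain Y where Y: "\<And>x. x \<in> A \<Longrightarrow> (x, Y x) \<in> W \<and> g (x, Y x) = 0"
    using ex by metis
  have uniq: "y = Y x" if "x \<in> A" "(x, y) \<in> W" "g (x, y) = 0" for x y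
    using mono[of x y "Y x"] mono[of x "Y x" y] Y[OF that(1)] that by (cases y "Y x" rule: linorder_cases) auto
  have gcont: "isCont g z" if "z \<in> W" for z
    using smooth_on_continuous[OF W(2)] W(1) that by (simp add: continuous_on_eq_continuous_at)
  have contY: "isCont Y x" if x: "x \<in> A" for x
    unfolding isCont_def
  proof (rule tendstoI)
    fix e :: real assume "e > 0"
    obtain r where r: "r > 0" "ball (x, Y x) r \<subseteq> W"
      using Y[OF x] W(1) open_contains_ball by blast
    \<comment> \<open>The signs of \<open>g\<close> at heights \<open>Y x + d\<close> and
      \<open>Y x - d\<close> persist over nearby base points, which traps the zero between these
      heights.\<close>
    define d where "d = min e r / 2"
    have d: "d > 0" "d < e" "d < r" using \<open>e > 0\<close> r by (auto simp: d_def)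
    have in1: "(x, Y x + d) \<in> W" "(x, Y x - d) \<in> W"
      using r(2) d by (auto simp: subset_iff dist_Pair_Pair dist_real_def)
    have g1: "g (x, Y x + d) > 0" "g (x, Y x - d) < 0"
      using mono[of x "Y x" "Y x + d"] mono[of x "Y x - d" "Y x"] in1 Y[OF x] d(1) by auto
    have tend: "((\<lambda>z. (z, Y x + c)) \<longlongrightarrow> (x, Y x + c)) (at x)" for c
      by (intro tendsto_intros)
    have ev1: "\<forall>\<^sub>F z in at x. (z, Y x + d) \<in> W" "\<forall>\<^sub>F z in at x. (z, Y x - d) \<in> W"
      using topological_tendstoD[OF tend[of d] W(1)] topological_tendstoD[OF tend[of "-d"] W(1)] in1 by auto
    have ev2: "\<forall>\<^sub>F z in at x. g (z, Y x + d) > 0"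
      using order_tendstoD(1)[OF isCont_tendsto_compose[OF gcont[OF in1(1)] tend[of d]] g1(1)] .
    have ev3: "\<forall>\<^sub>F z in at x. g (z, Y x - d) < 0"
      using order_tendstoD(2)[OF isCont_tendsto_compose[OF gcont[OF in1(2)], of "\<lambda>z. (z, Y x - d)" "at x"] g1(2)] tend[of "-d"]
      by simp
    have "\<forall>\<^sub>F z in at x. z \<in> A" using A x by (simp add: eventually_at_in_open')
    with ev1 ev2 ev3 show "\<forall>\<^sub>F z in at x. dist (Y z) (Y x) < e"
    proof eventually_elim
      case (elim z)
      have inW: "(z, y) \<in> W" if "Y x - d \<le> y" "y \<le> Y x + d" for y
        using conv elim that by blast
      have "\<exists>y. Y x - d \<le> y \<and> y \<le> Y x + d \<and> g (z, y) = 0"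
      proof (rule IVT')
        show "continuous_on {Y x - d..Y x + d} (\<lambda>y. g (z, y))"
        proof (intro continuous_at_imp_continuous_on ballI)
          fix y assume "y \<in> {Y x - d..Y x + d}"
          then show "isCont (\<lambda>y. g (z, y)) y"
            using DERIV_isCont[OF smooth_vertical_derivative[OF W(2) inW]] by auto
        qed
      qed (use elim d in auto)
      then obtain y where y: "Y x - d \<le> y" "y \<le> Y x + d" "g (z, y) = 0" by blast
      then have "y = Y z" using uniq inW elim by blast
      then show ?case using y d by (auto simp: dist_real_def)
    qed
  qed
  let ?D = "\<lambda>x. frechet_derivative g (at (x, Y x))"
  let ?Y' = "\<lambda>x v. - (?D x (v, 0)) * inverse (?D x (0, 1))"
  have derY: "(Y has_derivative ?Y' x) (at x)" if x: "x \<in> A" for x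
  proof -
    define D where "D = ?D x"
    define a where "a = D (0, 1)"
    have a: "a > 0" unfolding a_def D_def using pos Y[OF x] by blast
    have Dd: "(g has_derivative D) (at (x, Y x))"
      unfolding D_def using smooth_on_frechet[OF W(2)] Y[OF x] by blast
    interpret D: bounded_linear D by (rule has_derivative_bounded_linear[OF Dd])
    obtain K where K: "K > 0" "\<And>w. norm (D w) \<le> norm w * K" using D.pos_bounded by blast
    \<comment> \<open>An a priori Lipschitz bound for \<open>Y\<close> at \<open>x\<close>. As
      \<open>e'\<close> is at most a / 2, the error term in \<Delta> can be absorbed, leaving
      |\<Delta>| a / 2 \<le> (K + a) |v|. The second bound in \<open>e'\<close> then makes the total
      error e' (1 + L) |v| at most e a |v|.\<close>
    define L where "L = 2 * (K / a + 1)"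
    have L: "L > 0" using K a by (auto simp: L_def intro!: add_pos_pos)
    have bl: "bounded_linear (\<lambda>v. D (v, 0))"
      by (rule bounded_linear_compose[OF D.bounded_linear_axioms]) 
         (intro bounded_linear_Pair bounded_linear_ident bounded_linear_zero)
    have "(Y has_derivative (\<lambda>v. - D (v, 0) * inverse a)) (at x)"
      unfolding has_derivative_at_alt
    proof (intro conjI allI impI)
      show "bounded_linear (\<lambda>v. - D (v, 0) * inverse a)"
        by (intro bounded_linear_mult_left[THEN bounded_linear_compose] bounded_linear_minus bl)
      fix e :: real assume e: "e > 0"
      define e' where "e' = min (a / 2) (e * a / (1 + L))"
      have e': "e' > 0" "e' \<le> a / 2" using e a L by (simp add: e'_def) (unfold e'_def, rule min.cobounded1)
      have "e' * (1 + L) \<le> e * a / (1 + L) * (1 + L)"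
        using L by (intro mult_right_mono) (auto simp: e'_def)
      with L have e'L: "e' * (1 + L) \<le> e * a" by simp
      obtain d where d: "d > 0" "\<And>w. norm (w - (x, Y x)) < d \<Longrightarrow>
          norm (g w - g (x, Y x) - D (w - (x, Y x))) \<le> e' * norm (w - (x, Y x))"
        using Dd e'(1) unfolding has_derivative_at_alt by blast
      have "((\<lambda>z. (z, Y z)) \<longlongrightarrow> (x, Y x)) (at x)"
        using contY[OF x] by (intro tendsto_intros) (simp add: isCont_def)
      then have "\<forall>\<^sub>F z in at x. dist (z, Y z) (x, Y x) < d" using d(1) tendstoD by blast
      moreover have "\<forall>\<^sub>F z in at x. z \<in> A" using A x by (simp add: eventually_at_in_open')
      ultimately have "\<forall>\<^sub>F z in at x. dist (z, Y z) (x, Y x) < d \<and> z \<in> A" by eventually_elim auto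
      then obtain s where s: "s > 0" "\<And>z. z \<noteq> x \<Longrightarrow> dist z x < s \<Longrightarrow> dist (z, Y z) (x, Y x) < d \<and> z \<in> A"
        unfolding eventually_at by auto
      show "\<exists>s>0. \<forall>z. norm (z - x) < s \<longrightarrow> norm (Y z - Y x - - D (z - x, 0) * inverse a) \<le> e * norm (z - x)"
      proof (intro exI[of _ s] conjI allI impI s(1))
        fix z assume z: "norm (z - x) < s"
        show "norm (Y z - Y x - - D (z - x, 0) * inverse a) \<le> e * norm (z - x)"
        proof (cases "z = x")
          case True then show ?thesis using D.zero by (simp flip: zero_prod_def)
        next
          case False
          define v where "v = z - x"
          define \<Delta> where "\<Delta> = Y z - Y x"
          have zA: "z \<in> A" and dd: "dist (z, Y z) (x, Y x) < d"
            using s(2)[OF False] z by (auto simp: dist_norm)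
          have "norm (D (v, \<Delta>)) \<le> e' * norm (v, \<Delta>)"
            using d(2)[of "(z, Y z)"] dd Y[OF zA] Y[OF x] by (auto simp: v_def \<Delta>_def dist_norm)
          moreover have "D (v, \<Delta>) = D (v, 0) + \<Delta> * a"
            using D.add[of "(v, 0)" "(0, \<Delta>)"] D.scaleR[of \<Delta> "(0, 1)"] by (simp add: a_def)
          moreover have nle: "norm (v, \<Delta>) \<le> norm v + \<bar>\<Delta>\<bar>"
            by (metis norm_Pair_le real_norm_def)
          ultimately have 1: "\<bar>D (v, 0) + \<Delta> * a\<bar> \<le> e' * (norm v + \<bar>\<Delta>\<bar>)"
            using e'(1) by (smt (verit) mult_left_mono real_norm_def)
          have 2: "\<bar>D (v, 0)\<bar> \<le> K * norm v"
            using K(2)[of "(v, 0)"] by (simp add: norm_Pair mult.commute)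
          have "\<bar>\<Delta>\<bar> * a = \<bar>\<Delta> * a\<bar>" using a by (simp add: abs_mult)
          also have "\<dots> \<le> K * norm v + e' * norm v + e' * \<bar>\<Delta>\<bar>"
            using 1 2 by (simp add: distrib_left)
          also have "\<dots> \<le> K * norm v + a * norm v + a / 2 * \<bar>\<Delta>\<bar>"
            using e'(2) a by (intro add_mono mult_right_mono order_refl) auto
          finally have "\<bar>\<Delta>\<bar> * a \<le> 2 * (K + a) * norm v" by (simp add: field_simps)
          then have 3: "\<bar>\<Delta>\<bar> \<le> L * norm v" using a by (simp add: L_def field_simps)
          have "\<bar>\<Delta> + D (v, 0) * inverse a\<bar> * a = \<bar>D (v, 0) + \<Delta> * a\<bar>"
          proof -
            have "(\<Delta> + D (v, 0) * inverse a) * a = D (v, 0) + \<Delta> * a" using a by (simp add: field_simps)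
            then show ?thesis using a by (metis abs_mult abs_of_pos)
          qed
          also have "\<dots> \<le> e' * (norm v + L * norm v)"
            using 1 3 e'(1) by (smt (verit) mult_left_mono)
          also have "\<dots> = e' * (1 + L) * norm v" by (simp add: algebra_simps)
          also have "\<dots> \<le> e * a * norm v" using e'L by (intro mult_right_mono) auto
          finally have "\<bar>\<Delta> + D (v, 0) * inverse a\<bar> \<le> e * norm v" using a by (simp add: mult.commute mult.left_commute)
          then show ?thesis by (simp add: v_def \<Delta>_def)
        qed
      qed
    qed
    then show ?thesis by (simp add: D_def a_def)
  qed
  \<comment> \<open>The formula for the derivative contains \<open>Y\<close> but no derivative of
    \<open>Y\<close>, so each order of differentiability yields the next.\<close>
  have "Ck_on k A Y" for k
  proof (induction k)
    case 0
    then show ?case using contY by (auto intro: continuous_at_imp_continuous_on)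
  next
    case (Suc k)
    have c: "Ck_on k A (\<lambda>x. ?D x w)" for w
      by (rule Ck_on_compose[OF A W(1), of k "\<lambda>z. frechet_derivative g (at z) w" "\<lambda>x. (x, Y x)"])
        (use smooth_on_frechet_apply[OF W, of w] Y Suc Ck_on_linear[OF A bounded_linear_ident]
          in \<open>auto simp: smooth_on_def intro!: Ck_on_Pair A\<close>)
    show ?case
    proof (rule Ck_on_has_derivativeI[OF A derY])
      fix b :: 'a
      have "?D x (0, 1) \<noteq> 0" if "x \<in> A" for x using pos Y that by (metis less_irrefl)
      then show "Ck_on k A (\<lambda>x. ?Y' x b)"
        by (intro Ck_on_bilinear[OF A bounded_bilinear_mult] Ck_on_inverse A c
            Ck_on_linear_compose[OF A bounded_linear_minus[OF bounded_linear_ident]])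
    qed
  qed
  then have "smooth_on A Y" by (simp add: smooth_on_def)
  then show thesis using that Y uniq by blast
qed

text \<open>Differentiation under the integral sign gives an integral of the same shape, so the
  induction on the order runs over all integrands at once. The lemma supplies the smoothness of the
  Hadamard quotient.\<close>

lemma smooth_on_integral:
  fixes \<psi> :: "'a::euclidean_space \<times> real \<Rightarrow> real"
  assumes W: "open W" and A: "open A" "\<And>x t. x \<in> A \<Longrightarrow> t \<in> cbox 0 1 \<Longrightarrow> (x, t) \<in> W"
    and \<psi>: "smooth_on W \<psi>"
  shows "smooth_on A (\<lambda>x. integral (cbox 0 1) (\<lambda>t. \<psi> (x, t)))"
proof -
  have "Ck_on k A (\<lambda>x. integral (cbox 0 1) (\<lambda>t. \<psi> (x, t)))" if "smooth_on W \<psi>"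
    for k and \<psi> :: "'a \<times> real \<Rightarrow> real"
    using that
  proof (induction k arbitrary: \<psi>)
    case 0
    have "continuous_on (A \<times> cbox 0 1) \<psi>"
      by (rule continuous_on_subset[OF smooth_on_continuous[OF 0]]) (use A(2) in auto)
    then show ?case
      using integral_continuous_on_param[of A 0 1 "\<lambda>x t. \<psi> (x, t)"] by simp
  next
    case (Suc k)
    have AW: "A \<times> cbox 0 1 \<subseteq> W" using A(2) by auto
    define d where "d = (\<lambda>x t v. frechet_derivative \<psi> (at (x, t)) (v, 0))"
    have dbl: "bounded_linear (d x t)" if "(x, t) \<in> W" for x t
      unfolding d_def
      by (rule bounded_linear_compose[OF has_derivative_bounded_linear[OF smooth_on_frechet[OF Suc.prems that]]])
        (intro bounded_linear_Pair bounded_linear_ident bounded_linear_zero)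
    have sm: "smooth_on W (\<lambda>z. frechet_derivative \<psi> (at z) (v, 0))" for v
      by (rule smooth_on_frechet_apply[OF W Suc.prems])
    have der: "((\<lambda>x. \<psi> (x, t)) has_derivative d x t) (at x)" if "(x, t) \<in> W" for x t
    proof -
      have "((\<lambda>x. (x, t)) has_derivative (\<lambda>v. (v, 0))) (at x)"
        by (auto intro!: derivative_eq_intros)
      from diff_chain_at[OF this smooth_on_frechet[OF Suc.prems that]] show ?thesis
        by (simp add: o_def d_def)
    qed
    have cont_v: "continuous_on (A \<times> cbox 0 1) (\<lambda>(x, t). d x t v)" for v
      using continuous_on_subset[OF smooth_on_continuous[OF sm[of v]] AW]
      by (simp add: d_def split_beta)
    \<comment> \<open>\<open>leibniz_rule\<close> asks for a derivative that is continuous in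
      operator norm; in finite dimension this follows from continuity in every basis
      direction.\<close>
    define \<Psi> where "\<Psi> = (\<lambda>x t. Blinfun (d x t))"
    have \<Psi>: "blinfun_apply (\<Psi> x t) = d x t" if "(x, t) \<in> W" for x t
      unfolding \<Psi>_def by (rule bounded_linear_Blinfun_apply[OF dbl[OF that]])
    have cont: "continuous_on (A \<times> cbox 0 1) (\<lambda>(x, t). \<Psi> x t)"
    proof (rule continuous_on_blinfun_componentwise)
      fix i :: 'a
      show "continuous_on (A \<times> cbox 0 1) (\<lambda>z. blinfun_apply (case z of (x, t) \<Rightarrow> \<Psi> x t) i)"
        using cont_v[of i] by (rule continuous_on_eq) (use \<Psi> A(2) in auto)
    qed
    show ?case
    proof (rule Ck_on_has_derivativeI[OF A(1)])
      fix x assume x: "x \<in> A"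
      obtain r where r: "r > 0" "ball x r \<subseteq> A" using A(1) x open_contains_ball by blast
      have intg: "(\<lambda>t. \<psi> (y, t)) integrable_on cbox 0 1" if "y \<in> A" for y
        by (rule integrable_continuous)
          (intro continuous_on_compose2[OF smooth_on_continuous[OF Suc.prems], of _ "\<lambda>t. (y, t)"] continuous_intros,
            use A(2) that in auto)
      have hd: "((\<lambda>x. integral (cbox 0 1) (\<lambda>t. \<psi> (x, t))) has_derivative integral (cbox 0 1) (\<Psi> x)) (at x within ball x r)"
      proof (rule leibniz_rule)
        show "((\<lambda>x. \<psi> (x, t)) has_derivative blinfun_apply (\<Psi> y t)) (at y within ball x r)"
          if "y \<in> ball x r" "t \<in> cbox 0 1" for y t
        proof -
          have "(y, t) \<in> W" using A(2) r(2) that by blast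
          with der[of y t] \<Psi>[of y t] show ?thesis by (simp add: has_derivative_at_withinI)
        qed
        show "continuous_on (ball x r \<times> cbox 0 1) (\<lambda>(x, t). \<Psi> x t)"
          by (rule continuous_on_subset[OF cont]) (use r in auto)
      qed (use r intg in auto)
      have at: "at x within ball x r = at x"
        by (rule at_within_open) (use r in auto)
      have ap: "blinfun_apply (integral (cbox 0 1) (\<Psi> x)) v = integral (cbox 0 1) (\<lambda>t. d x t v)" for v
      proof -
        have "continuous_on (cbox 0 1) (\<Psi> x)"
        proof -
          have "continuous_on (cbox 0 1) (\<lambda>t. (x, t))" by (intro continuous_intros)
          from continuous_on_compose2[OF cont this] x show ?thesis by auto
        qed
        then have "\<Psi> x integrable_on cbox 0 1" by (rule integrable_continuous)
        from blinfun_apply_integral[OF this, of v]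
        show ?thesis by (simp, intro integral_cong) (use \<Psi> A(2) x in auto)
      qed
      show "((\<lambda>x. integral (cbox 0 1) (\<lambda>t. \<psi> (x, t))) has_derivative
          (\<lambda>v. integral (cbox 0 1) (\<lambda>t. d x t v))) (at x)"
        by (rule has_derivative_eq_rhs[OF hd[unfolded at] ext[OF ap]])
    next
      fix b :: 'a
      show "Ck_on k A (\<lambda>x. integral (cbox 0 1) (\<lambda>t. d x t b))"
        unfolding d_def using Suc.IH[OF sm[of b]] by simp
    qed
  qed
  then show ?thesis using \<psi> by (simp add: smooth_on_def)
qed


section \<open>Partial derivatives and vanishing orders in the plane\<close>

lemma pdx_eqI: "(f has_derivative D) (at p) \<Longrightarrow> pdx f p = D (1, 0)"
  unfolding pdx_def using frechet_derivative_at by metis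

lemma pdy_eqI: "(f has_derivative D) (at p) \<Longrightarrow> pdy f p = D (0, 1)"
  unfolding pdy_def using frechet_derivative_at by metis

lemma smooth_on_pdx [smooth_intros]: "open U \<Longrightarrow> smooth_on U f \<Longrightarrow> smooth_on U (pdx f)"
  using smooth_on_frechet_apply[of U f "(1, 0)"] by (simp add: pdx_def[abs_def])

lemma smooth_on_pdy [smooth_intros]: "open U \<Longrightarrow> smooth_on U f \<Longrightarrow> smooth_on U (pdy f)"
  using smooth_on_frechet_apply[of U f "(0, 1)"] by (simp add: pdy_def[abs_def])

lemma smooth_on_has_derivative_pd:
  assumes "smooth_on U f" "p \<in> U"
  shows "(f has_derivative (\<lambda>v. fst v * pdx f p + snd v * pdy f p)) (at p)"
proof -
  let ?D = "frechet_derivative f (at p)"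
  have D: "(f has_derivative ?D) (at p)" by (rule smooth_on_frechet[OF assms])
  interpret D: bounded_linear ?D by (rule has_derivative_bounded_linear[OF D])
  have "?D v = fst v * pdx f p + snd v * pdy f p" for v
    using D.add[of "fst v *\<^sub>R (1, 0)" "snd v *\<^sub>R (0, 1)"] D.scaleR[of "fst v" "(1, 0)"]
      D.scaleR[of "snd v" "(0, 1)"] by (simp add: pdx_def pdy_def)
  then have "?D = (\<lambda>v. fst v * pdx f p + snd v * pdy f p)" by (rule ext)
  with D show ?thesis by simp
qed

lemma pd_cong:
  assumes "open U" "p \<in> U" "\<And>q. q \<in> U \<Longrightarrow> f q = g q"
  shows "pdx f p = pdx g p" "pdy f p = pdy g p"
proof -
  have "(g has_derivative D) (at p) \<longleftrightarrow> (f has_derivative D) (at p)" for D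
    using has_derivative_transform_within_open[of f D p UNIV U g]
      has_derivative_transform_within_open[of g D p UNIV U f] assms by auto
  then show "pdx f p = pdx g p" "pdy f p = pdy g p"
    by (simp_all add: pdx_def pdy_def frechet_derivative_def)
qed

lemma pd_const [simp]: "pdx (\<lambda>q. c) p = 0" "pdy (\<lambda>q. c) p = 0"
  by (simp_all add: pdx_def pdy_def)

lemma pd_fst [simp]: "pdx fst p = 1" "pdy fst p = 0"
  using pdx_eqI[OF bounded_linear_imp_has_derivative[OF bounded_linear_fst]]
    pdy_eqI[OF bounded_linear_imp_has_derivative[OF bounded_linear_fst]] by auto

lemma pd_snd [simp]: "pdx snd p = 0" "pdy snd p = 1"
  using pdx_eqI[OF bounded_linear_imp_has_derivative[OF bounded_linear_snd]]
    pdy_eqI[OF bounded_linear_imp_has_derivative[OF bounded_linear_snd]] by auto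

lemma smooth_on_fst' [smooth_intros]: "open U \<Longrightarrow> smooth_on U fst"
  and smooth_on_snd' [smooth_intros]: "open U \<Longrightarrow> smooth_on U snd"
  by (auto intro: smooth_on_linear bounded_linear_fst bounded_linear_snd)

context
  fixes U :: "(real \<times> real) set" and f g :: "real \<times> real \<Rightarrow> real" and p
  assumes f: "smooth_on U f" and g: "smooth_on U g" and p: "p \<in> U"
begin

lemma pd_add: "pdx (\<lambda>q. f q + g q) p = pdx f p + pdx g p" "pdy (\<lambda>q. f q + g q) p = pdy f p + pdy g p"
  using pdx_eqI[OF has_derivative_add[OF smooth_on_has_derivative_pd[OF f p] smooth_on_has_derivative_pd[OF g p]]]
    pdy_eqI[OF has_derivative_add[OF smooth_on_has_derivative_pd[OF f p] smooth_on_has_derivative_pd[OF g p]]] by auto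

lemma pd_diff: "pdx (\<lambda>q. f q - g q) p = pdx f p - pdx g p" "pdy (\<lambda>q. f q - g q) p = pdy f p - pdy g p"
  using pdx_eqI[OF has_derivative_diff[OF smooth_on_has_derivative_pd[OF f p] smooth_on_has_derivative_pd[OF g p]]]
    pdy_eqI[OF has_derivative_diff[OF smooth_on_has_derivative_pd[OF f p] smooth_on_has_derivative_pd[OF g p]]] by auto

lemma pd_mult: "pdx (\<lambda>q. f q * g q) p = f p * pdx g p + pdx f p * g p"
  "pdy (\<lambda>q. f q * g q) p = f p * pdy g p + pdy f p * g p"
  using pdx_eqI[OF has_derivative_mult[OF smooth_on_has_derivative_pd[OF f p] smooth_on_has_derivative_pd[OF g p]]]
    pdy_eqI[OF has_derivative_mult[OF smooth_on_has_derivative_pd[OF f p] smooth_on_has_derivative_pd[OF g p]]] by auto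

end

lemma pd_minus:
  assumes "smooth_on U f" "p \<in> U"
  shows "pdx (\<lambda>q. - f q) p = - pdx f p" "pdy (\<lambda>q. - f q) p = - pdy f p"
  using pdx_eqI[OF has_derivative_minus[OF smooth_on_has_derivative_pd[OF assms]]]
    pdy_eqI[OF has_derivative_minus[OF smooth_on_has_derivative_pd[OF assms]]] by auto

lemma pd_cmult:
  assumes "smooth_on U f" "p \<in> U"
  shows "pdx (\<lambda>q. c * f q) p = c * pdx f p" "pdy (\<lambda>q. c * f q) p = c * pdy f p"
  using pdx_eqI[OF has_derivative_mult_right[OF smooth_on_has_derivative_pd[OF assms]]]
    pdy_eqI[OF has_derivative_mult_right[OF smooth_on_has_derivative_pd[OF assms]]] by auto

lemma pd_power:
  assumes "smooth_on U f" "p \<in> U"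
  shows "pdx (\<lambda>q. f q ^ n) p = of_nat n * (pdx f p * f p ^ (n - 1))"
    "pdy (\<lambda>q. f q ^ n) p = of_nat n * (pdy f p * f p ^ (n - 1))"
  using pdx_eqI[OF has_derivative_power[OF smooth_on_has_derivative_pd[OF assms]]]
    pdy_eqI[OF has_derivative_power[OF smooth_on_has_derivative_pd[OF assms]]] by auto

lemma pd_compose:
  assumes f: "smooth_on U f" and u: "smooth_on S u" "smooth_on S v" and q: "q \<in> S" "(u q, v q) \<in> U"
  shows "pdx (\<lambda>q. f (u q, v q)) q = pdx f (u q, v q) * pdx u q + pdy f (u q, v q) * pdx v q"
    "pdy (\<lambda>q. f (u q, v q)) q = pdx f (u q, v q) * pdy u q + pdy f (u q, v q) * pdy v q"
proof -
  have "((\<lambda>q. (u q, v q)) has_derivative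
      (\<lambda>w. (fst w * pdx u q + snd w * pdy u q, fst w * pdx v q + snd w * pdy v q))) (at q)"
    by (intro has_derivative_Pair smooth_on_has_derivative_pd[OF u(1) q(1)] smooth_on_has_derivative_pd[OF u(2) q(1)])
  from diff_chain_at[OF this smooth_on_has_derivative_pd[OF f q(2)]]
  have "((\<lambda>q. f (u q, v q)) has_derivative (\<lambda>w. (fst w * pdx u q + snd w * pdy u q) * pdx f (u q, v q)
      + (fst w * pdx v q + snd w * pdy v q) * pdy f (u q, v q))) (at q)" by (simp add: o_def)
  from pdx_eqI[OF this] pdy_eqI[OF this]
  show "pdx (\<lambda>q. f (u q, v q)) q = pdx f (u q, v q) * pdx u q + pdy f (u q, v q) * pdx v q"
    "pdy (\<lambda>q. f (u q, v q)) q = pdx f (u q, v q) * pdy u q + pdy f (u q, v q) * pdy v q"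
    by (simp_all add: mult.commute)
qed

lemma pd_real_derivative:
  assumes "smooth_on U f" "(x, y) \<in> U"
  shows "((\<lambda>s. f (s, y)) has_real_derivative pdx f (x, y)) (at x)"
    "((\<lambda>s. f (x, s)) has_real_derivative pdy f (x, y)) (at y)"
proof -
  note D = smooth_on_has_derivative_pd[OF assms]
  have "((\<lambda>s. (s, y)) has_derivative (\<lambda>s. (s, 0))) (at x)" "((\<lambda>s. (x, s)) has_derivative (\<lambda>s. (0, s))) (at y)"
    by (auto intro!: derivative_eq_intros)
  from diff_chain_at[OF this(1) D] diff_chain_at[OF this(2) D]
  have "((\<lambda>s. f (s, y)) has_derivative (\<lambda>s. s * pdx f (x, y))) (at x)"
    "((\<lambda>s. f (x, s)) has_derivative (\<lambda>s. s * pdy f (x, y))) (at y)" by (simp_all add: o_def)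
  then show "((\<lambda>s. f (s, y)) has_real_derivative pdx f (x, y)) (at x)"
    "((\<lambda>s. f (x, s)) has_real_derivative pdy f (x, y)) (at y)"
    by (auto intro: has_derivative_imp_has_field_derivative)
qed

lemma pd_curve_derivative:
  assumes "smooth_on U f" "(u s, v s) \<in> U"
    "(u has_real_derivative u') (at s)" "(v has_real_derivative v') (at s)"
  shows "((\<lambda>s. f (u s, v s)) has_real_derivative u' * pdx f (u s, v s) + v' * pdy f (u s, v s)) (at s)"
proof -
  have "((\<lambda>s. (u s, v s)) has_derivative (\<lambda>h. (u' * h, v' * h))) (at s)"
    using assms(3,4) by (intro has_derivative_Pair) (auto simp: has_field_derivative_def)
  from diff_chain_at[OF this smooth_on_has_derivative_pd[OF assms(1,2)]]
  have "((\<lambda>s. f (u s, v s)) has_derivative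
     (\<lambda>h. u' * h * pdx f (u s, v s) + v' * h * pdy f (u s, v s))) (at s)" by (simp add: o_def)
  then show ?thesis
    by (rule has_derivative_imp_has_field_derivative) (simp add: algebra_simps)
qed

text \<open>The mean value theorem is applied in x to the difference of two horizontal sections and
  then in y. The radius 2 h is chosen so that the ball contains the square of side h.\<close>

lemma double_difference:
  assumes "smooth_on U f" "open U" "cball (a, b) (2 * h) \<subseteq> U" "h > 0"
  obtains q where "q \<in> cball (a, b) (2 * h)"
    "f (a + h, b + h) - f (a + h, b) - f (a, b + h) + f (a, b) = h\<^sup>2 * pdy (pdx f) q"
proof -
  have sq: "(x, y) \<in> cball (a, b) (2 * h)" if "a \<le> x" "x \<le> a + h" "b \<le> y" "y \<le> b + h" for x y
  proof -
    have "dist (a, b) (x, y) \<le> \<bar>a - x\<bar> + \<bar>b - y\<bar>"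
      by (simp add: dist_Pair_Pair dist_real_def sqrt_sum_squares_le_sum_abs)
    also have "\<dots> \<le> 2 * h" using that by auto
    finally show ?thesis by simp
  qed
  have "\<exists>x>a. x < a + h \<and> (f (a + h, b + h) - f (a + h, b)) - (f (a, b + h) - f (a, b))
      = (a + h - a) * (pdx f (x, b + h) - pdx f (x, b))"
  proof (rule MVT2)
    fix x assume "a \<le> x" "x \<le> a + h"
    then show "((\<lambda>x. f (x, b + h) - f (x, b)) has_real_derivative pdx f (x, b + h) - pdx f (x, b)) (at x)"
      using sq assms by (intro DERIV_diff pd_real_derivative(1)[OF assms(1)]) (auto simp: subset_iff)
  qed (use assms in auto)
  then obtain x where x: "a < x" "x < a + h"
    "(f (a + h, b + h) - f (a + h, b)) - (f (a, b + h) - f (a, b)) = h * (pdx f (x, b + h) - pdx f (x, b))" by auto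
  have "\<exists>y>b. y < b + h \<and> pdx f (x, b + h) - pdx f (x, b) = (b + h - b) * pdy (pdx f) (x, y)"
  proof (rule MVT2)
    fix y assume "b \<le> y" "y \<le> b + h"
    then show "((\<lambda>y. pdx f (x, y)) has_real_derivative pdy (pdx f) (x, y)) (at y)"
      using sq assms x by (intro pd_real_derivative(2)[OF smooth_on_pdx[OF assms(2,1)]]) (auto simp: subset_iff)
  qed (use assms in auto)
  then obtain y where y: "b < y" "y < b + h" "pdx f (x, b + h) - pdx f (x, b) = h * pdy (pdx f) (x, y)" by auto
  show thesis
    by (rule that[of "(x, y)"]) (use sq x y in \<open>auto simp: power2_eq_square algebra_simps\<close>)
qed

text \<open>The second difference over a square is symmetric in the two coordinates. Evaluated for
  \<open>f\<close> and for \<open>f\<close> with exchanged arguments, it equals a nearby value of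
  each mixed derivative, and continuity rules out that these differ at the point by 2 d > 0.\<close>

lemma pd_commute:
  assumes U: "open U" "smooth_on U f" and p: "p \<in> U"
  shows "pdx (pdy f) p = pdy (pdx f) p"
proof (rule ccontr)
  obtain a b where ab: "p = (a, b)" by (cases p)
  assume ne: "pdx (pdy f) p \<noteq> pdy (pdx f) p"
  define d where "d = \<bar>pdx (pdy f) p - pdy (pdx f) p\<bar> / 2"
  have d: "d > 0" using ne by (simp add: d_def)
  let ?sw = "\<lambda>q :: real \<times> real. (snd q, fst q)"
  define W where "W = ?sw -` U"
  have W: "open W" unfolding W_def using U(1) by (intro continuous_open_vimage continuous_intros)
  define g where "g = (\<lambda>q. f (snd q, fst q))"
  have g: "smooth_on W g" unfolding g_def
    by (rule smooth_on_compose[OF U(2) W U(1)]) (intro smooth_intros W, auto simp: W_def)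
  have gx: "pdx g q = pdy f (snd q, fst q)" if "q \<in> W" for q
    using pd_compose(1)[OF U(2), of W snd fst q] W that unfolding g_def W_def by (auto intro: smooth_intros)
  have gyx: "pdy (pdx g) q = pdx (pdy f) (snd q, fst q)" if "q \<in> W" for q
    using pd_cong(2)[OF W that gx] pd_compose(2)[OF smooth_on_pdy[OF U], of W snd fst q] W that
    unfolding W_def by (auto intro: smooth_intros)
  have cx: "isCont (pdx (pdy f)) p" "isCont (pdy (pdx f)) p"
    using p smooth_on_continuous[OF smooth_on_pdx[OF U(1) smooth_on_pdy[OF U]]]
      smooth_on_continuous[OF smooth_on_pdy[OF U(1) smooth_on_pdx[OF U]]]
    by (simp_all add: continuous_on_eq_continuous_at[OF U(1)])
  have "\<forall>\<^sub>F q in nhds p. dist (pdx (pdy f) q) (pdx (pdy f) p) < d \<and> dist (pdy (pdx f) q) (pdy (pdx f) p) < d \<and> q \<in> U"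
    using cx d U(1) p by (intro eventually_conj eventually_nhds_in_open tendstoD)
      (auto simp: isCont_def tendsto_at_iff_tendsto_nhds)
  then obtain r where r: "r > 0" "\<And>q. dist q p < r \<Longrightarrow> dist (pdx (pdy f) q) (pdx (pdy f) p) < d \<and>
      dist (pdy (pdx f) q) (pdy (pdx f) p) < d \<and> q \<in> U"
    unfolding eventually_nhds_metric by blast
  define h where "h = r / 3"
  have h: "h > 0" "2 * h < r" using r by (auto simp: h_def)
  have sub: "cball (a, b) (2 * h) \<subseteq> U" using r h ab by (force simp: dist_commute)
  have sub': "cball (b, a) (2 * h) \<subseteq> W"
  proof
    fix q assume "q \<in> cball (b, a) (2 * h)"
    then have "(snd q, fst q) \<in> cball (a, b) (2 * h)" by (cases q) (auto simp: dist_Pair_Pair add.commute)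
    then show "q \<in> W" using sub by (auto simp: W_def)
  qed
  obtain q1 where q1: "q1 \<in> cball (a, b) (2 * h)"
    "f (a + h, b + h) - f (a + h, b) - f (a, b + h) + f (a, b) = h\<^sup>2 * pdy (pdx f) q1"
    by (rule double_difference[OF U(2,1) sub h(1)])
  obtain q2 where q2: "q2 \<in> cball (b, a) (2 * h)"
    "g (b + h, a + h) - g (b + h, a) - g (b, a + h) + g (b, a) = h\<^sup>2 * pdy (pdx g) q2"
    by (rule double_difference[OF g W sub' h(1)])
  have q2': "(snd q2, fst q2) \<in> cball (a, b) (2 * h)" using q2(1) by (cases q2) (auto simp: dist_Pair_Pair add.commute)
  have gf: "g (x, y) = f (y, x)" for x y by (simp add: g_def)
  have "h\<^sup>2 * pdy (pdx f) q1 = h\<^sup>2 * pdy (pdx g) q2" using q1(2) q2(2) unfolding gf by linarith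
  then have "pdy (pdx f) q1 = pdx (pdy f) (snd q2, fst q2)"
    using gyx[of q2] sub' q2(1) h(1) by auto
  then show False
    using r(2)[of q1] r(2)[of "(snd q2, fst q2)"] q1(1) q2' h(2) ab
    by (auto simp: d_def dist_real_def dist_commute abs_if split: if_splits)
qed

text \<open>\<open>vord k U g\<close>: \<open>g\<close> lies in the \<open>k\<close>-th power of the maximal ideal at the origin.\<close>

primrec vord :: "nat \<Rightarrow> (real \<times> real) set \<Rightarrow> (real \<times> real \<Rightarrow> real) \<Rightarrow> bool" where
  "vord 0 U g \<longleftrightarrow> smooth_on U g"
| "vord (Suc k) U g \<longleftrightarrow> smooth_on U g \<and> g 0 = 0 \<and> vord k U (pdx g) \<and> vord k U (pdy g)"

section \<open>Arithmetic, substitution and growth for functions of given vanishing order\<close>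

lemma vord_smooth: "vord k U g \<Longrightarrow> smooth_on U g"
  by (cases k) auto

lemma vord_cong:
  assumes "open U" "0 \<in> U" "\<And>p. p \<in> U \<Longrightarrow> f p = g p"
  shows "vord k U f \<longleftrightarrow> vord k U g"
  using assms(3)
proof (induction k arbitrary: f g)
  case 0
  then show ?case using smooth_on_cong[OF assms(1), of f g] by simp
next
  case (Suc k)
  have "vord k U (pdx f) \<longleftrightarrow> vord k U (pdx g)" "vord k U (pdy f) \<longleftrightarrow> vord k U (pdy g)"
    using pd_cong[OF assms(1) _ Suc.prems] by (auto intro!: Suc.IH)
  then show ?case using Suc.prems[OF assms(2)] smooth_on_cong[OF assms(1) Suc.prems] by simp
qed

lemma vord_SucD: "vord (Suc k) U g \<Longrightarrow> vord k U g"
proof (induction k arbitrary: g)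
  case (Suc k)
  have "vord (Suc k) U (pdx g)" "vord (Suc k) U (pdy g)" "smooth_on U g" "g 0 = 0"
    using Suc.prems by simp_all
  then show ?case using Suc.IH[of "pdx g"] Suc.IH[of "pdy g"] by (simp del: vord.simps add: vord.simps(2)[of k U g])
qed simp

lemma vord_mono: "vord k U g \<Longrightarrow> j \<le> k \<Longrightarrow> vord j U g"
proof (induction k)
  case (Suc k)
  then show ?case using vord_SucD[OF Suc.prems(1)] by (metis le_Suc_eq)
qed simp

lemma vord_pd: 
  assumes "open U" "vord k U g" shows "vord (k - 1) U (pdx g)" "vord (k - 1) U (pdy g)"
  using assms by (cases k; auto intro: smooth_intros)+

lemma vord_add:
  assumes "open U" "0 \<in> U" shows "vord k U f \<Longrightarrow> vord k U g \<Longrightarrow> vord k U (\<lambda>p. f p + g p)"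
proof (induction k arbitrary: f g)
  case 0
  then show ?case using assms by (auto intro: smooth_intros)
next
  case (Suc k)
  have s: "smooth_on U f" "smooth_on U g" using Suc.prems by auto
  have "vord k U (pdx (\<lambda>p. f p + g p))"
    by (subst vord_cong[OF assms pd_add(1)[OF s]]) (use Suc in auto)
  moreover have "vord k U (pdy (\<lambda>p. f p + g p))"
    by (subst vord_cong[OF assms pd_add(2)[OF s]]) (use Suc in auto)
  ultimately show ?case using Suc.prems assms by (auto intro: smooth_intros)
qed

text \<open>By the product rule, a derivative lowers one of the two orders by one. The target order
  \<open>k\<close> is kept separate from i + j because truncated subtraction leaves an order 0
  unchanged, which the inequality tolerates.\<close>

lemma vord_mult:
  assumes U: "open U" "0 \<in> U" shows "vord i U f \<Longrightarrow> vord j U g \<Longrightarrow> k \<le> i + j \<Longrightarrow> vord k U (\<lambda>p. f p * g p)"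
proof (induction k arbitrary: i j f g)
  case 0
  then show ?case using assms vord_smooth by (auto intro!: smooth_intros)
next
  case (Suc k)
  have s: "smooth_on U f" "smooth_on U g" using Suc.prems vord_smooth by auto
  have d: "vord (i - 1) U (pdx f)" "vord (i - 1) U (pdy f)" "vord (j - 1) U (pdx g)" "vord (j - 1) U (pdy g)"
    using vord_pd[OF U(1)] Suc.prems by blast+
  have k: "k \<le> i + (j - 1)" "k \<le> i - 1 + j" using Suc.prems(3) by auto
  have "vord k U (pdx (\<lambda>p. f p * g p))"
    by (subst vord_cong[OF U pd_mult(1)[OF s]])
      (auto intro!: vord_add[OF U] Suc.IH[OF Suc.prems(1) d(3) k(1)] Suc.IH[OF d(1) Suc.prems(2) k(2)])
  moreover have "vord k U (pdy (\<lambda>p. f p * g p))"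
    by (subst vord_cong[OF U pd_mult(2)[OF s]])
      (auto intro!: vord_add[OF U] Suc.IH[OF Suc.prems(1) d(4) k(1)] Suc.IH[OF d(2) Suc.prems(2) k(2)])
  moreover have "f 0 * g 0 = 0" using Suc.prems by (cases i; cases j) auto
  ultimately show ?case using s U by (auto intro: smooth_intros)
qed

lemma vord_cmult:
  assumes U: "open U" "0 \<in> U" and "vord k U f" shows "vord k U (\<lambda>p. c * f p)"
  by (rule vord_mult[OF U, of 0 _ k]) (use assms in \<open>auto intro: smooth_intros\<close>)

lemma vord_minus:
  assumes U: "open U" "0 \<in> U" and "vord k U f" shows "vord k U (\<lambda>p. - f p)"
  using vord_cmult[OF assms, of "-1"] by simp

lemma vord_diff:
  assumes U: "open U" "0 \<in> U" and "vord k U f" "vord k U g" shows "vord k U (\<lambda>p. f p - g p)"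
  using vord_add[OF U assms(3) vord_minus[OF U assms(4)]] by simp

lemma vord_power:
  assumes U: "open U" "0 \<in> U" and "vord j U f" "k \<le> n * j" shows "vord k U (\<lambda>p. f p ^ n)"
  using assms(4)
proof (induction n arbitrary: k)
  case 0
  then show ?case using U by (auto intro: smooth_intros)
next
  case (Suc n)
  show ?case unfolding power_Suc
    by (rule vord_mult[OF U assms(3) Suc.IH[OF order_refl]]) (use Suc.prems in auto)
qed

lemma vord_fst: "open U \<Longrightarrow> k \<le> 1 \<Longrightarrow> vord k U fst"
  and vord_snd: "open U \<Longrightarrow> k \<le> 1 \<Longrightarrow> vord k U snd"
  by (cases k; auto intro!: smooth_intros simp: fun_eq_iff[symmetric]; fail)+

text \<open>By the chain rule the partial derivatives of the composite are sums of composites with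
  \<open>pdx g\<close> or \<open>pdy g\<close>, each times a smooth factor. Restriction to a branch
  and linear changes of coordinates are both instances.\<close>

lemma vord_compose:
  assumes U: "open U" "0 \<in> U" and S: "open S" "0 \<in> S"
    and u: "vord 1 S u" "vord 1 S v" and sub: "\<And>q. q \<in> S \<Longrightarrow> (u q, v q) \<in> U"
  shows "vord k U g \<Longrightarrow> vord k S (\<lambda>q. g (u q, v q))"
proof (induction k arbitrary: g)
  have s: "smooth_on S u" "smooth_on S v" using u by auto
  have sm: "smooth_on S (\<lambda>q. g (u q, v q))" if "smooth_on U g" for g :: "real \<times> real \<Rightarrow> real"
    by (rule smooth_on_compose[OF that S(1) U(1)]) (use s S sub in \<open>auto intro: smooth_intros\<close>)
  {
    case 0
    then show ?case using sm by simp
  next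
    case (Suc k)
    have g: "smooth_on U g" using Suc.prems by simp
    have d: "vord 0 S (pdx u)" "vord 0 S (pdx v)" "vord 0 S (pdy u)" "vord 0 S (pdy v)"
      using s S by (auto intro: smooth_intros)
    have gd: "vord k S (\<lambda>q. pdx g (u q, v q))" "vord k S (\<lambda>q. pdy g (u q, v q))"
      using Suc by auto
    have "vord k S (pdx (\<lambda>q. g (u q, v q)))"
      by (subst vord_cong[OF S pd_compose(1)[OF g s]])
        (use sub in \<open>auto intro!: vord_add[OF S] vord_mult[OF S gd(1) d(1)] vord_mult[OF S gd(2) d(2)]\<close>)
    moreover have "vord k S (pdy (\<lambda>q. g (u q, v q)))"
      by (subst vord_cong[OF S pd_compose(2)[OF g s]])
        (use sub in \<open>auto intro!: vord_add[OF S] vord_mult[OF S gd(1) d(3)] vord_mult[OF S gd(2) d(4)]\<close>)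
    moreover have "g (u 0, v 0) = 0" using u Suc.prems by (simp flip: zero_prod_def)
    ultimately show ?case using sm[OF g] by simp
  }
qed

text \<open>The mean value theorem on the segment from the origin gains one power of the norm over
  the bounds for the two partial derivatives.\<close>

lemma vord_bound:
  assumes U: "open U" "0 \<in> U"
  shows "vord k U g \<Longrightarrow> \<exists>C\<ge>0. \<forall>\<^sub>F p in nhds 0. \<bar>g p\<bar> \<le> C * norm p ^ k"
proof (induction k arbitrary: g)
  case 0
  then have "isCont g 0"
    using U(2) smooth_on_continuous[of U g] continuous_on_eq_continuous_at[OF U(1), of g] by simp
  then have "(g \<longlongrightarrow> g 0) (nhds 0)" by (simp add: isCont_def tendsto_at_iff_tendsto_nhds)
  then have "\<forall>\<^sub>F p in nhds 0. dist (g p) (g 0) < 1" by (rule tendstoD) simp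
  then have "\<forall>\<^sub>F p in nhds 0. \<bar>g p\<bar> \<le> (\<bar>g 0\<bar> + 1) * norm p ^ 0"
    by eventually_elim (auto simp: dist_real_def)
  then show ?case by (intro exI[of _ "\<bar>g 0\<bar> + 1"]) auto
next
  case (Suc k)
  then obtain C1 C2 where C: "C1 \<ge> 0" "C2 \<ge> 0" "\<forall>\<^sub>F p in nhds 0. \<bar>pdx g p\<bar> \<le> C1 * norm p ^ k"
    "\<forall>\<^sub>F p in nhds 0. \<bar>pdy g p\<bar> \<le> C2 * norm p ^ k"
    by (auto dest!: Suc.IH)
  have "\<forall>\<^sub>F p in nhds 0. p \<in> U \<and> \<bar>pdx g p\<bar> \<le> C1 * norm p ^ k \<and> \<bar>pdy g p\<bar> \<le> C2 * norm p ^ k"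
    using C U by (intro eventually_conj eventually_nhds_in_open)
  then obtain r where r: "r > 0" "\<And>p. norm p < r \<Longrightarrow> p \<in> U \<and> \<bar>pdx g p\<bar> \<le> C1 * norm p ^ k \<and> \<bar>pdy g p\<bar> \<le> C2 * norm p ^ k"
    unfolding eventually_nhds_metric by (auto simp: dist_norm)
  have "\<bar>g p\<bar> \<le> (C1 + C2) * norm p ^ Suc k" if p: "norm p < r" for p
  proof -
    obtain x y where xy: "p = (x, y)" by (cases p)
    have inU: "norm (s *\<^sub>R p) < r" if "0 \<le> s" "s \<le> 1" for s
    proof -
      have "norm (s *\<^sub>R p) \<le> norm p" using that by (simp add: mult_left_le_one_le)
      with p show ?thesis by simp
    qed
    have "\<exists>s>0. s < 1 \<and> g (1 * x, 1 * y) - g (0 * x, 0 * y) = (1 - 0) * (x * pdx g (s * x, s * y) + y * pdy g (s * x, s * y))"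
    proof (rule MVT2[of 0 1 "\<lambda>s. g (s * x, s * y)"])
      fix s :: real assume "0 \<le> s" "s \<le> 1"
      then have "(s * x, s * y) \<in> U" using inU r(2)[of "s *\<^sub>R p"] by (simp add: xy)
      then show "((\<lambda>s. g (s * x, s * y)) has_real_derivative
          x * pdx g (s * x, s * y) + y * pdy g (s * x, s * y)) (at s)"
        using Suc.prems by (intro pd_curve_derivative) (auto intro!: derivative_eq_intros)
    qed auto
    then obtain s where s: "0 < s" "s < 1" "g p = x * pdx g (s *\<^sub>R p) + y * pdy g (s *\<^sub>R p)"
      using Suc.prems by (auto simp: xy simp flip: zero_prod_def)
    have n: "norm (s *\<^sub>R p) ^ k \<le> norm p ^ k"
      using s by (intro power_mono) (auto simp: mult_left_le_one_le)
    have x: "\<bar>x\<bar> \<le> norm p" "\<bar>y\<bar> \<le> norm p" using norm_fst_le[of x y] norm_snd_le[of y x] by (auto simp: xy)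
    have 1: "\<bar>pdx g (s *\<^sub>R p)\<bar> \<le> C1 * norm p ^ k" "\<bar>pdy g (s *\<^sub>R p)\<bar> \<le> C2 * norm p ^ k"
      using r(2)[OF inU[of s]] s n C(1,2) by (smt (verit) mult_left_mono)+
    have "\<bar>g p\<bar> \<le> \<bar>x\<bar> * \<bar>pdx g (s *\<^sub>R p)\<bar> + \<bar>y\<bar> * \<bar>pdy g (s *\<^sub>R p)\<bar>"
      using s(3) by (metis abs_mult abs_triangle_ineq)
    also have "\<dots> \<le> norm p * (C1 * norm p ^ k) + norm p * (C2 * norm p ^ k)"
      using x 1 by (intro add_mono mult_mono) auto
    finally show ?thesis by (simp add: algebra_simps)
  qed
  then have "\<forall>\<^sub>F p in nhds 0. \<bar>g p\<bar> \<le> (C1 + C2) * norm p ^ Suc k"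
    unfolding eventually_nhds_metric using r(1) by (auto simp: dist_norm)
  then show ?case using C(1,2) by (intro exI[of _ "C1 + C2"]) auto
qed

text \<open>In this form resolution itself computes an order for a product or a power as an
  arithmetic term; the comparison with the order wanted is left to \<open>vord_mono\<close>. The
  order counts below all run in this way.\<close>

lemma vord_mult_add: "open U \<Longrightarrow> 0 \<in> U \<Longrightarrow> vord i U f \<Longrightarrow> vord j U g \<Longrightarrow> vord (i + j) U (\<lambda>p. f p * g p)"
  by (rule vord_mult) auto

lemma vord_power_mult: "open U \<Longrightarrow> 0 \<in> U \<Longrightarrow> vord j U f \<Longrightarrow> vord (n * j) U (\<lambda>p. f p ^ n)"
  by (rule vord_power) auto

lemma vord_const: "open U \<Longrightarrow> vord 0 U (\<lambda>p. c)"
  by (auto intro: smooth_intros)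

lemmas pd_simps = pd_add[OF _ _ UNIV_I] pd_diff[OF _ _ UNIV_I] pd_mult[OF _ _ UNIV_I]
  pd_power[OF _ UNIV_I] pd_minus[OF _ UNIV_I]


section \<open>Inflections and vertices of level curves\<close>

text \<open>\<open>tder f\<close> is the derivative along the Hamiltonian field of \<open>f\<close>, which is tangent to all
  level curves. In a quadratic metric with coefficients \<open>A, B, C\<close>, a level curve has curvature
  proportional to \<open>infl f / qn A B C f powr (3/2)\<close>; hence \<open>vert A B C f\<close> vanishes exactly at the
  vertices.\<close>

definition tder :: "(real \<times> real \<Rightarrow> real) \<Rightarrow> (real \<times> real \<Rightarrow> real) \<Rightarrow> real \<times> real \<Rightarrow> real" where
  "tder f g p = pdx f p * pdy g p - pdy f p * pdx g p"

definition infl :: "(real \<times> real \<Rightarrow> real) \<Rightarrow> real \<times> real \<Rightarrow> real" where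
  "infl f p = pdx (pdx f) p * (pdy f p)\<^sup>2 - 2 * pdy (pdx f) p * (pdx f p * pdy f p)
     + pdy (pdy f) p * (pdx f p)\<^sup>2"

definition qn :: "real \<Rightarrow> real \<Rightarrow> real \<Rightarrow> (real \<times> real \<Rightarrow> real) \<Rightarrow> real \<times> real \<Rightarrow> real" where
  "qn A B C f p = A * (pdy f p)\<^sup>2 - 2 * B * (pdx f p * pdy f p) + C * (pdx f p)\<^sup>2"

definition vert :: "real \<Rightarrow> real \<Rightarrow> real \<Rightarrow> (real \<times> real \<Rightarrow> real) \<Rightarrow> real \<times> real \<Rightarrow> real" where
  "vert A B C f p = 2 * (qn A B C f p * tder f (infl f) p) - 3 * (infl f p * tder f (qn A B C f) p)"

lemma smooth_on_tder [smooth_intros]: "open U \<Longrightarrow> smooth_on U f \<Longrightarrow> smooth_on U g \<Longrightarrow> smooth_on U (tder f g)"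
  unfolding tder_def[abs_def] by (intro smooth_intros)

lemma smooth_on_infl [smooth_intros]: "open U \<Longrightarrow> smooth_on U f \<Longrightarrow> smooth_on U (infl f)"
  unfolding infl_def[abs_def] by (intro smooth_intros)

lemma smooth_on_qn [smooth_intros]: "open U \<Longrightarrow> smooth_on U f \<Longrightarrow> smooth_on U (qn A B C f)"
  unfolding qn_def[abs_def] by (intro smooth_intros)

lemma smooth_on_vert [smooth_intros]: "open U \<Longrightarrow> smooth_on U f \<Longrightarrow> smooth_on U (vert A B C f)"
  unfolding vert_def[abs_def] by (intro smooth_intros)

section \<open>Leading terms at a node\<close>

text \<open>The axes are the tangent lines of the node; \<open>A, B, C\<close> are the coefficients of the Euclidean
  metric in these coordinates, and \<open>y = p2 x\<^sup>2 + p3 x\<^sup>3\<close> approximates the branch tangent to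
  the \<open>x\<close>-axis.\<close>

locale node =
  fixes U :: "(real \<times> real) set" and f :: "real \<times> real \<Rightarrow> real" and A B C p2 p3 :: real
  assumes U: "open U" "0 \<in> U" and f: "smooth_on U f"
    and quad: "vord 3 U (\<lambda>p. f p - fst p * snd p)"
    and pos: "A > 0" "C > 0"
    and branch: "vord 5 ((\<lambda>p. (fst p, p2 * fst p ^ 2 + p3 * fst p ^ 3)) -` U)
                   (\<lambda>p. f (fst p, p2 * fst p ^ 2 + p3 * fst p ^ 3))"
begin

abbreviation "Nf \<equiv> qn A B C f"
abbreviation "Vf \<equiv> vert A B C f"
abbreviation "Sf \<equiv> tder f Vf"

lemmas vadd = vord_add[OF U] and vdiff = vord_diff[OF U] and vcong = vord_cong[OF U]
  and vpdx = vord_pd(1)[OF U(1)] and vpdy = vord_pd(2)[OF U(1)] and vconst = vord_const[OF U(1)]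
  and vsyn = vord_mult_add[OF U] vord_power_mult[OF U]

lemma dpd:
  assumes "vord j U g" "j = Suc k" shows "vord k U (pdx g)" "vord k U (pdy g)"
  using vpdx[OF assms(1)] vpdy[OF assms(1)] assms(2) by simp_all

lemma smooths: "smooth_on U (pdx f)" "smooth_on U (pdy f)" "smooth_on U (infl f)" "smooth_on U Nf"
  "smooth_on U Vf" "smooth_on U Sf" "smooth_on U (tder f (infl f))"
  by (auto intro!: smooth_intros U f)

lemma smooth_xy: "smooth_on U (\<lambda>p. fst p * snd p)"
  by (intro smooth_intros U)

lemma vx: "vord 1 U fst" "vord 1 U snd"
  using vord_fst[OF U(1), of 1] vord_snd[OF U(1), of 1] by auto

lemma e1: "vord 2 U (\<lambda>p. pdx f p - snd p)" and e2: "vord 2 U (\<lambda>p. pdy f p - fst p)"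
proof -
  have "pdx (\<lambda>p. f p - fst p * snd p) p = pdx f p - snd p" "pdy (\<lambda>p. f p - fst p * snd p) p = pdy f p - fst p"
    if "p \<in> U" for p
    using pd_diff[OF f smooth_xy that] by (simp_all add: pd_simps smooth_intros)
  then show "vord 2 U (\<lambda>p. pdx f p - snd p)" "vord 2 U (\<lambda>p. pdy f p - fst p)"
    using dpd[OF quad, of 2] by (simp_all cong: vcong)
qed

lemma fx: "vord 1 U (pdx f)" and fy: "vord 1 U (pdy f)"
  using vadd[OF vord_mono[OF e1, of 1] vx(2)] vadd[OF vord_mono[OF e2, of 1] vx(1)] by simp_all

lemma e3: "vord 1 U (pdx (pdx f))" and e4: "vord 1 U (\<lambda>p. pdy (pdx f) p - 1)" and e5: "vord 1 U (pdy (pdy f))"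
proof -
  have "pdx (\<lambda>p. pdx f p - snd p) p = pdx (pdx f) p" "pdy (\<lambda>p. pdx f p - snd p) p = pdy (pdx f) p - 1"
    "pdy (\<lambda>p. pdy f p - fst p) p = pdy (pdy f) p"
    if "p \<in> U" for p
    using pd_diff[OF smooths(1) smooth_on_snd'[OF U(1)] that] pd_diff[OF smooths(2) smooth_on_fst'[OF U(1)] that] by simp_all
  then show "vord 1 U (pdx (pdx f))" "vord 1 U (\<lambda>p. pdy (pdx f) p - 1)" "vord 1 U (pdy (pdy f))"
    using dpd[OF e1, of 1] dpd[OF e2, of 1] by (simp_all cong: vcong)
qed

text \<open>To first order the Hamiltonian field of \<open>f\<close> is that of xy, namely y d/dy -
  x d/dx; the remaining part of the field vanishes to second order.\<close>

lemma vord_tder_lead: 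
  assumes "vord k U g"
  shows "vord (Suc k) U (\<lambda>p. tder f g p - (snd p * pdy g p - fst p * pdx g p))"
proof -
  have "vord (Suc k) U (\<lambda>p. (pdx f p - snd p) * pdy g p - (pdy f p - fst p) * pdx g p)"
    by (intro vdiff; rule vord_mono, (rule vsyn e1 e2 vpdx[OF assms] vpdy[OF assms])+, simp)
  then show ?thesis by (simp add: tder_def algebra_simps)
qed

text \<open>The field vanishes at the origin, which makes up for the order lost by
  differentiation.\<close>

lemma vord_tder:
  assumes "vord k U g"
  shows "vord k U (tder f g)"
proof -
  have "vord k U (\<lambda>p. pdx f p * pdy g p - pdy f p * pdx g p)"
    by (intro vdiff; rule vord_mono, (rule vsyn fx fy vpdx[OF assms] vpdy[OF assms])+, simp)
  then show ?thesis by (simp add: tder_def[abs_def])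
qed

lemma vord_tder_diff:
  assumes "vord k U (\<lambda>p. g p - h p)" "smooth_on U g" "smooth_on U h"
  shows "vord k U (\<lambda>p. tder f g p - tder f h p)"
proof -
  have "tder f (\<lambda>p. g p - h p) p = tder f g p - tder f h p" if "p \<in> U" for p
    unfolding tder_def pd_diff[OF assms(2,3) that] by (simp add: algebra_simps)
  then show ?thesis using vord_tder[OF assms(1)] by (simp cong: vcong)
qed

lemma infl_lead: "vord 3 U (\<lambda>p. infl f p - - 2 * (fst p * snd p))"
proof -
  \<comment> \<open>Only the mixed term of \<open>infl\<close> has order 2. Replacing its factors
    f_xy, f_x, f_y by 1, y, x one at a time leaves differences of order at least 3.\<close>
  have "vord 3 U (\<lambda>p. pdx (pdx f) p * (pdy f p)\<^sup>2 - 2 * ((pdy (pdx f) p - 1) * (pdx f p * pdy f p))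
      + pdy (pdy f) p * (pdx f p)\<^sup>2 - 2 * ((pdx f p - snd p) * pdy f p) - 2 * (snd p * (pdy f p - fst p)))"
    by (intro vdiff vadd; rule vord_mono, (rule vsyn e1 e2 e3 e4 e5 fx fy vx vconst)+, simp)
  then show ?thesis by (simp add: infl_def algebra_simps)
qed

lemma vord_infl: "vord 2 U (infl f)"
proof -
  have "vord 2 U (\<lambda>p. (infl f p - - 2 * (fst p * snd p)) + - 2 * (fst p * snd p))"
    by (intro vadd; rule vord_mono, (rule vsyn infl_lead vx vconst)+, simp)
  then show ?thesis by simp
qed

text \<open>One order better than \<open>vord_tder\<close> would give, because xy is a first
  integral of the linear part of the field. For this reason the leading term of \<open>Vf\<close>
  comes from -3 I \<theta>(N) alone.\<close>

lemma vord_tinfl: "vord 3 U (tder f (infl f))"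
proof -
  have s: "smooth_on U (\<lambda>p. - 2 * (fst p * snd p))" by (intro smooth_intros U)
  have "vord 3 U (\<lambda>p. (tder f (infl f) p - tder f (\<lambda>p. - 2 * (fst p * snd p)) p)
     + (- 2 * (fst p * (pdx f p - snd p)) + 2 * (snd p * (pdy f p - fst p))))"
    by (intro vadd vord_tder_diff[OF infl_lead smooths(3) s]; rule vord_mono, (rule vsyn e1 e2 vx vconst)+, simp)
  then show ?thesis by (simp add: tder_def[abs_def] pd_simps smooth_intros algebra_simps)
qed

lemma qn_lead: "vord 3 U (\<lambda>p. Nf p - (A * fst p ^ 2 - 2 * B * (fst p * snd p) + C * snd p ^ 2))"
proof -
  have "vord 3 U (\<lambda>p. A * ((pdy f p - fst p) * (pdy f p + fst p)) - 2 * B * ((pdx f p - snd p) * pdy f p)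
     - 2 * B * (snd p * (pdy f p - fst p)) + C * ((pdx f p - snd p) * (pdx f p + snd p)))"
    by (intro vdiff vadd; rule vord_mono, (rule vsyn e1 e2 vadd[OF fy vx(1)] vadd[OF fx vx(2)] fy vx vconst)+, simp)
  then show ?thesis by (simp add: qn_def algebra_simps power2_eq_square)
qed

lemma vord_qn: "vord 2 U Nf"
proof -
  have "vord 2 U (\<lambda>p. (Nf p - (A * fst p ^ 2 - 2 * B * (fst p * snd p) + C * snd p ^ 2))
      + (A * fst p ^ 2 - 2 * B * (fst p * snd p) + C * snd p ^ 2))"
    by (rule vadd[OF vord_mono[OF qn_lead]], simp, intro vadd vdiff; rule vord_mono, (rule vsyn vx vconst)+, simp)
  then show ?thesis by simp
qed

lemma tqn_lead: "vord 3 U (\<lambda>p. tder f Nf p - (2 * C * snd p ^ 2 - 2 * A * fst p ^ 2))"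
proof -
  let ?q = "\<lambda>p. A * fst p ^ 2 - 2 * B * (fst p * snd p) + C * snd p ^ 2"
  have s: "smooth_on U ?q" by (intro smooth_intros U)
  have q: "vord 2 U ?q"
    by (intro vadd vdiff; rule vord_mono, (rule vsyn vx vconst)+, simp)
  have "vord 3 U (\<lambda>p. (tder f Nf p - tder f ?q p) + (tder f ?q p - (snd p * pdy ?q p - fst p * pdx ?q p)))"
    by (intro vadd vord_tder_diff[OF qn_lead smooths(4) s]) (use vord_tder_lead[OF q] in simp)
  then show ?thesis by (simp add: pd_simps smooth_intros algebra_simps power2_eq_square)
qed

lemma vert_lead: "vord 5 U (\<lambda>p. Vf p - 12 * (fst p * snd p) * (C * snd p ^ 2 - A * fst p ^ 2))"
proof -
  have "vord 5 U (\<lambda>p. 2 * (Nf p * tder f (infl f) p) - 3 * ((infl f p - - 2 * (fst p * snd p)) * tder f Nf p)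
    + 6 * ((fst p * snd p) * (tder f Nf p - (2 * C * snd p ^ 2 - 2 * A * fst p ^ 2))))"
    by (intro vadd vdiff; rule vord_mono,
        (rule vsyn vord_qn vord_tinfl infl_lead tqn_lead vord_tder[OF vord_qn] vx vconst)+, simp)
  then show ?thesis by (simp add: vert_def algebra_simps power2_eq_square)
qed

text \<open>The linear part of the field multiplies x^i y^j by j - i. This turns the difference in
  the leading form of \<open>Vf\<close> into a sum, which has the sign of xy.\<close>

lemma tvert_lead: "vord 5 U (\<lambda>p. Sf p - 24 * (fst p * snd p) * (C * snd p ^ 2 + A * fst p ^ 2))"
proof -
  let ?q = "\<lambda>p. 12 * (fst p * snd p) * (C * snd p ^ 2 - A * fst p ^ 2)"
  have s: "smooth_on U ?q" by (intro smooth_intros U)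
  have q0: "vord 2 U (\<lambda>p. C * snd p ^ 2 - A * fst p ^ 2)"
    by (intro vdiff; rule vord_mono, (rule vsyn vx vconst)+, simp)
  have q: "vord 4 U ?q" by (rule vord_mono, (rule vsyn q0 vx vconst)+, simp)
  have "vord 5 U (\<lambda>p. (Sf p - tder f ?q p) + (tder f ?q p - (snd p * pdy ?q p - fst p * pdx ?q p)))"
    by (intro vadd vord_tder_diff[OF vert_lead smooths(5) s]) (use vord_tder_lead[OF q] in simp)
  then show ?thesis by (simp add: pd_simps smooth_intros algebra_simps power2_eq_square)
qed

lemma infl_lead_y: "vord 2 U (\<lambda>p. pdy (infl f) p - - 2 * fst p)"
proof -
  let ?q = "\<lambda>p. - 2 * (fst p * snd p)"
  have s: "smooth_on U ?q" by (intro smooth_intros U)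
  have q: "pdy ?q p = - 2 * fst p" for p by (simp add: pd_simps smooth_intros)
  have "pdy (\<lambda>p. infl f p - ?q p) p = pdy (infl f) p - - 2 * fst p" if "p \<in> U" for p
    unfolding pd_diff(2)[OF smooths(3) s that] q ..
  then show ?thesis using dpd(2)[OF infl_lead, of 2] by (simp cong: vcong)
qed

lemma tinfl_lead_y: "vord 2 U (pdy (tder f (infl f)))"
  using dpd(2)[OF vord_tinfl, of 2] by simp

lemma vert_lead_y: "vord 4 U (\<lambda>p. pdy Vf p - 12 * fst p * (3 * C * snd p ^ 2 - A * fst p ^ 2))"
proof -
  let ?q = "\<lambda>p. 12 * (fst p * snd p) * (C * snd p ^ 2 - A * fst p ^ 2)"
  have s: "smooth_on U ?q" by (intro smooth_intros U)
  have q: "pdy ?q p = 12 * fst p * (3 * C * snd p ^ 2 - A * fst p ^ 2)" for p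
    by (simp add: pd_simps smooth_intros algebra_simps power2_eq_square)
  have "pdy (\<lambda>p. Vf p - ?q p) p = pdy Vf p - 12 * fst p * (3 * C * snd p ^ 2 - A * fst p ^ 2)" if "p \<in> U" for p
    unfolding pd_diff(2)[OF smooths(5) s that] q ..
  then show ?thesis using dpd(2)[OF vert_lead, of 4] by (simp cong: vcong)
qed

text \<open>The factor 2 is chosen to cancel the x^3 terms of the two derivatives. The rest is small
  where y is small compared with x, whereas \<open>pdy Sf\<close> alone is of size x^3
  there.\<close>

lemma tvert_lead_y: "vord 4 U (\<lambda>p. (pdy Sf p + 2 * pdy Vf p) - 144 * C * fst p * snd p ^ 2)"
proof -
  let ?q = "\<lambda>p. 24 * (fst p * snd p) * (C * snd p ^ 2 + A * fst p ^ 2)"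
  have s: "smooth_on U ?q" by (intro smooth_intros U)
  have q: "pdy ?q p = 24 * fst p * (3 * C * snd p ^ 2 + A * fst p ^ 2)" for p
    by (simp add: pd_simps smooth_intros algebra_simps power2_eq_square)
  have "pdy (\<lambda>p. Sf p - ?q p) p = pdy Sf p - 24 * fst p * (3 * C * snd p ^ 2 + A * fst p ^ 2)" if "p \<in> U" for p
    unfolding pd_diff(2)[OF smooths(6) s that] q ..
  then have "vord 4 U (\<lambda>p. pdy Sf p - 24 * fst p * (3 * C * snd p ^ 2 + A * fst p ^ 2))"
    using dpd(2)[OF tvert_lead, of 4] by (simp cong: vcong)
  from vadd[OF this vadd[OF vert_lead_y vert_lead_y]] show ?thesis by (simp add: algebra_simps)
qed

end


lemma vord_eqI:
  assumes "open U" "0 \<in> U" "vord k U f" "\<And>p. p \<in> U \<Longrightarrow> f p = g p"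
  shows "vord k U g"
  using vord_cong[OF assms(1,2), of f g k] assms(3,4) by blast

section \<open>Restriction of the forms to an approximate branch\<close>

context node begin

text \<open>Functions of one variable are kept as functions of \<open>fst p\<close> on the plane, so
  that the calculus of \<open>vord\<close> serves for them too. \<open>R\<close> restricts to the
  approximate branch; \<open>\<rho>1\<close> is the derivative of \<open>R f\<close> and measures
  how far the field is from being tangent; \<open>n0\<close> is the squared length of the tangent
  vector (1, b'); \<open>v1\<close> will be the coefficient of x^6 in \<open>R Vf\<close>.\<close>

abbreviation (input) "cub x \<equiv> p2 * x ^ 2 + p3 * x ^ 3"
abbreviation "b0 \<equiv> (\<lambda>p :: real \<times> real. cub (fst p))"
abbreviation "b1 \<equiv> (\<lambda>p :: real \<times> real. 2 * p2 * fst p + 3 * p3 * fst p ^ 2)"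
abbreviation "b2 \<equiv> (\<lambda>p :: real \<times> real. 2 * p2 + 6 * p3 * fst p)"
abbreviation "U1 \<equiv> (\<lambda>p. (fst p, cub (fst p))) -` U"
abbreviation "R g \<equiv> (\<lambda>p :: real \<times> real. g (fst p, cub (fst p)) :: real)"
abbreviation "\<phi> \<equiv> R (pdy f)"
abbreviation "\<rho>1 \<equiv> (\<lambda>p. R (pdx f) p + b1 p * \<phi> p)"
abbreviation "n0 \<equiv> (\<lambda>p. A + 2 * B * b1 p + C * b1 p ^ 2)"
abbreviation "v1 \<equiv> 12 * A * p3 - 24 * B * p2\<^sup>2"

lemma U1: "open U1" "0 \<in> U1"
  using U(2) by (auto intro!: continuous_open_vimage U(1) continuous_intros simp: zero_prod_def)

lemmas vsyn1 = vord_mult_add[OF U1] vord_power_mult[OF U1] and vadd1 = vord_add[OF U1]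
  and vdiff1 = vord_diff[OF U1] and vcong1 = vord_cong[OF U1] and vconst1 = vord_const[OF U1(1)]

lemma dpd1:
  assumes "vord j U1 g" "j = Suc k" shows "vord k U1 (pdx g)" "vord k U1 (pdy g)"
  using vord_pd[OF U1(1) assms(1)] assms(2) by simp_all

lemma vx1: "vord 1 U1 fst" using vord_fst[OF U1(1), of 1] by simp

lemma vb: "vord 1 U1 b1" "vord 2 U1 b0" "vord 0 U1 b2" "vord 0 U1 n0"
proof -
  show "vord 1 U1 b1" by (intro vadd1; rule vord_mono, (rule vsyn1 vconst1 vx1)+, simp)
  show "vord 2 U1 b0" by (intro vadd1; rule vord_mono, (rule vsyn1 vconst1 vx1)+, simp)
  show "vord 0 U1 b2" "vord 0 U1 n0" unfolding vord.simps(1) by (intro smooth_intros U1(1))+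
qed

lemma vR: "vord k U g \<Longrightarrow> vord k U1 (R g)"
  by (rule vord_compose[OF U U1 vx1 vord_mono[OF vb(2)]]) auto

lemma sR: "smooth_on U g \<Longrightarrow> smooth_on U1 (R g)"
  using vR[of 0] by simp

lemma pdx_b: "pdx b0 p = b1 p" "pdx b1 p = b2 p" "pdx b2 p = 6 * p3"
  by (simp_all add: pd_simps smooth_intros)

lemma pdx_R:
  assumes "smooth_on U g" "p \<in> U1"
  shows "pdx (R g) p = R (pdx g) p + b1 p * R (pdy g) p"
proof -
  have "(fst p, cub (fst p)) \<in> U" using assms(2) by simp
  from pd_compose(1)[OF assms(1) vord_smooth[OF vx1] vord_smooth[OF vb(2)] assms(2) this]
  show ?thesis by (simp add: pdx_b)
qed

lemma vrho: "vord 5 U1 (R f)"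
  using branch by simp

lemma vrho1: "vord 4 U1 \<rho>1"
  by (rule vord_eqI[OF U1 dpd1(1)[OF vrho]]) (simp, rule pdx_R[OF f])

lemma vphi: "vord 1 U1 \<phi>" "vord 2 U1 (\<lambda>p. \<phi> p - fst p)"
  using vR[OF fy] vR[OF e2] by simp_all

lemma sphi: "smooth_on U1 \<phi>" "smooth_on U1 (pdx \<phi>)" "smooth_on U1 n0"
  using vord_smooth[OF vphi(1)] vord_smooth[OF vb(4)] by (auto intro: smooth_intros U1)

text \<open>This is the second derivative of \<open>R f\<close>. Its high order stands in for the
  identity obtained by differentiating f(x, b(x)) = 0 twice along an exact branch.\<close>

lemma vrho2: "vord 3 U1 (\<lambda>p. R (pdx (pdx f)) p + 2 * b1 p * R (pdy (pdx f)) p + b1 p ^ 2 * R (pdy (pdy f)) p + b2 p * \<phi> p)"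
proof -
  have s: "smooth_on U1 (R (pdx f))" "smooth_on U1 b1" "smooth_on U1 (\<lambda>p. b1 p * \<phi> p)"
    using sR smooths vb(1) vord_smooth sphi by (auto intro!: smooth_intros U1)
  have "pdx \<rho>1 p = R (pdx (pdx f)) p + 2 * b1 p * R (pdy (pdx f)) p + b1 p ^ 2 * R (pdy (pdy f)) p + b2 p * \<phi> p"
    if "p \<in> U1" for p
    unfolding pd_add(1)[OF s(1,3) that] pd_mult(1)[OF s(2) sphi(1) that] pdx_b pdx_R[OF smooths(1) that]
      pdx_R[OF smooths(2) that] using pd_commute[OF U(1) f, of "(fst p, cub (fst p))"] that
    by (simp add: algebra_simps power2_eq_square)
  then show ?thesis by (rule vord_eqI[OF U1 dpd1(1)[OF vrho1], rotated]) simp_all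
qed

text \<open>On an exact branch f_x = - b' f_y, and one more differentiation expresses the second
  derivatives through b'' f_y, so that I becomes - b'' f_y^3. On the approximate branch the errors
  are multiples of \<open>\<rho>1\<close> and of the second derivative of
  \<open>R f\<close>.\<close>

lemma R_infl: "vord 5 U1 (\<lambda>p. R (infl f) p - - (b2 p * \<phi> p ^ 3))"
proof -
  let ?r2 = "\<lambda>p. R (pdx (pdx f)) p + 2 * b1 p * R (pdy (pdx f)) p + b1 p ^ 2 * R (pdy (pdy f)) p + b2 p * \<phi> p"
  have s: "vord 0 U1 (R (pdy (pdx f)))" "vord 0 U1 (R (pdy (pdy f)))"
    by (rule vR, simp, intro smooth_intros U f)+
  have "vord 5 U1 (\<lambda>p. \<phi> p ^ 2 * ?r2 p - 2 * (R (pdy (pdx f)) p * (\<rho>1 p * \<phi> p)) + R (pdy (pdy f)) p * (\<rho>1 p * \<rho>1 p)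
     - 2 * (R (pdy (pdy f)) p * (b1 p * (\<rho>1 p * \<phi> p))))"
    by (rule vdiff1[OF vadd1[OF vdiff1]]; rule vord_mono, (rule vsyn1 vrho1 vrho2 vphi vb s vconst1)+, simp)
  then show ?thesis by (simp add: infl_def algebra_simps power2_eq_square power3_eq_cube)
qed

lemma R_qn: "vord 5 U1 (\<lambda>p. R Nf p - \<phi> p ^ 2 * n0 p)"
proof -
  have "vord 5 U1 (\<lambda>p. C * (\<rho>1 p * \<rho>1 p) - 2 * B * (\<rho>1 p * \<phi> p) - 2 * C * (\<rho>1 p * (b1 p * \<phi> p)))"
    by (rule vdiff1[OF vdiff1]; rule vord_mono, (rule vsyn1 vrho1 vphi vb vconst1)+, simp)
  then show ?thesis by (simp add: qn_def algebra_simps power2_eq_square)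
qed

text \<open>Along the branch the field is - \<phi> d/dx, up to a transversal part proportional to
  \<open>\<rho>1\<close>.\<close>

lemma R_tder:
  assumes "smooth_on U g" "p \<in> U1"
  shows "R (tder f g) p = \<rho>1 p * R (pdy g) p - \<phi> p * pdx (R g) p"
  unfolding pdx_R[OF assms] by (simp add: tder_def algebra_simps)

lemma R_tder_lead:
  assumes "vord 2 U g" "vord 5 U1 (\<lambda>p. R g p - h p)" "smooth_on U1 h"
  shows "vord 5 U1 (\<lambda>p. R (tder f g) p - - (\<phi> p * pdx h p))"
proof -
  have s: "smooth_on U g" by (rule vord_smooth[OF assms(1)])
  have 1: "vord 4 U1 (pdx (\<lambda>p. R g p - h p))" using dpd1[OF assms(2), of 4] by simp
  have 2: "vord 1 U1 (R (pdy g))" using vR[OF dpd(2)[OF assms(1), of 1]] by simp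
  have "vord 5 U1 (\<lambda>p. \<rho>1 p * R (pdy g) p - \<phi> p * pdx (\<lambda>p. R g p - h p) p)"
    by (rule vdiff1; rule vord_mono, (rule vsyn1 vrho1 1 2 vphi)+, simp)
  moreover have "\<rho>1 p * R (pdy g) p - \<phi> p * pdx (\<lambda>p. R g p - h p) p = R (tder f g) p - - (\<phi> p * pdx h p)"
    if "p \<in> U1" for p
    unfolding R_tder[OF s that] pd_diff(1)[OF sR[OF s] assms(3) that] by (simp add: algebra_simps)
  ultimately show ?thesis by (rule vord_eqI[OF U1])
qed

text \<open>After substituting the restrictions of I and N, the terms with the derivative of \<phi>
  cancel: \<phi> only measures the speed of the field, on which the curvature of the branch does not
  depend.\<close>

lemma R_vert0: "vord 7 U1 (\<lambda>p. R Vf p - \<phi> p ^ 6 * (12 * p3 * n0 p - 3 * (b2 p * (2 * B * b2 p + 2 * C * (b1 p * b2 p)))))"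
proof -
  let ?i = "\<lambda>p. - (b2 p * \<phi> p ^ 3)" and ?n = "\<lambda>p. \<phi> p ^ 2 * n0 p"
  have sb: "smooth_on U1 b1" "smooth_on U1 b2" using vb vord_smooth by blast+
  have sp: "smooth_on U1 (\<lambda>p. \<phi> p ^ 3)" "smooth_on U1 (\<lambda>p. \<phi> p ^ 2)" "smooth_on U1 (\<lambda>p. b2 p * \<phi> p ^ 3)"
    by (intro smooth_intros U1 sphi sb)+
  have s: "smooth_on U1 ?i" "smooth_on U1 ?n" by (intro smooth_intros U1 sphi sb sp)+
  have di: "pdx ?i p = - (6 * p3 * \<phi> p ^ 3 + 3 * b2 p * \<phi> p ^ 2 * pdx \<phi> p)" if "p \<in> U1" for p
    unfolding pd_minus(1)[OF sp(3) that] pd_mult(1)[OF sb(2) sp(1) that] pd_power(1)[OF sphi(1) that] pdx_b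
    by (simp add: algebra_simps)
  have dn0: "pdx n0 p = 2 * B * b2 p + 2 * C * (b1 p * b2 p)" if "p \<in> U1" for p
  proof -
    have "smooth_on U1 (\<lambda>p. 2 * B * b1 p)" "smooth_on U1 (\<lambda>p. C * b1 p ^ 2)" "smooth_on U1 (\<lambda>p. b1 p ^ 2)"
      "smooth_on U1 (\<lambda>p. A + 2 * B * b1 p)" "smooth_on U1 (\<lambda>p :: real \<times> real. A)"
      by (intro smooth_intros U1 sb)+
    note q = this
    show ?thesis
      unfolding pd_add(1)[OF q(4,2) that] pd_add(1)[OF q(5,1) that] pd_cmult(1)[OF sb(1) that] pd_cmult(1)[OF q(3) that]
        pd_power(1)[OF sb(1) that] pdx_b by simp
  qed
  have dn: "pdx ?n p = 2 * \<phi> p * pdx \<phi> p * n0 p + \<phi> p ^ 2 * (2 * B * b2 p + 2 * C * (b1 p * b2 p))" if "p \<in> U1" for p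
    unfolding pd_mult(1)[OF sp(2) sphi(3) that] pd_power(1)[OF sphi(1) that] dn0[OF that] by simp
  note ti = R_tder_lead[OF vord_infl R_infl s(1)]
  note tn = R_tder_lead[OF vord_qn R_qn s(2)]
  have vi: "vord 3 U1 ?i" by (rule vord_minus[OF U1], rule vord_mono, (rule vsyn1 vphi vb)+, simp)
  have RI: "vord 2 U1 (R (infl f))" "vord 3 U1 (R (tder f (infl f)))" "vord 2 U1 (R (tder f Nf))"
    using vR[OF vord_infl] vR[OF vord_tinfl] vR[OF vord_tder[OF vord_qn]] by auto
  have "vord 7 U1 (\<lambda>p. 2 * ((R Nf p - ?n p) * R (tder f (infl f)) p) + 2 * (?n p * (R (tder f (infl f)) p - - (\<phi> p * pdx ?i p)))
    - 3 * ((R (infl f) p - ?i p) * R (tder f Nf) p) - 3 * (?i p * (R (tder f Nf) p - - (\<phi> p * pdx ?n p))))"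
    by (rule vdiff1[OF vdiff1[OF vadd1]]; rule vord_mono, (rule R_qn R_infl ti tn vi RI vsyn1 vphi vb vconst1)+, simp)
  moreover have "2 * ((R Nf p - ?n p) * R (tder f (infl f)) p) + 2 * (?n p * (R (tder f (infl f)) p - - (\<phi> p * pdx ?i p)))
    - 3 * ((R (infl f) p - ?i p) * R (tder f Nf) p) - 3 * (?i p * (R (tder f Nf) p - - (\<phi> p * pdx ?n p)))
    = R Vf p - \<phi> p ^ 6 * (12 * p3 * n0 p - 3 * (b2 p * (2 * B * b2 p + 2 * C * (b1 p * b2 p))))" if "p \<in> U1" for p
    unfolding di[OF that] dn[OF that] vert_def by algebra
  ultimately show ?thesis by (rule vord_eqI[OF U1])
qed

lemma R_vert: "vord 7 U1 (\<lambda>p. R Vf p - v1 * fst p ^ 6)"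
proof -
  let ?w = "\<lambda>p. 12 * p3 * n0 p - 3 * (b2 p * (2 * B * b2 p + 2 * C * (b1 p * b2 p)))"
  have b4: "vord 0 U1 (\<lambda>p. b2 p + 2 * p2)" by (intro smooth_intros U1(1) iffD2[OF vord.simps(1)])
  have "vord 1 U1 (\<lambda>p. 12 * p3 * (2 * B * b1 p) + 12 * p3 * (C * b1 p ^ 2) - 6 * B * ((6 * p3 * fst p) * (b2 p + 2 * p2))
     - 6 * C * (b1 p * b2 p ^ 2))"
    by (rule vdiff1[OF vdiff1[OF vadd1]]; rule vord_mono, (rule b4 vsyn1 vb vx1 vconst1)+, simp)
  then have w: "vord 1 U1 (\<lambda>p. ?w p - v1)" by (simp add: algebra_simps power2_eq_square)
  \<comment> \<open>The cofactor of \<phi> - x in \<phi>^6 - x^6; with the difference itself of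
    order 2, replacing \<phi>^6 by x^6 costs order 7.\<close>
  have "vord 5 U1 (\<lambda>p. \<phi> p ^ 5 + \<phi> p ^ 4 * fst p + \<phi> p ^ 3 * fst p ^ 2 + \<phi> p ^ 2 * fst p ^ 3 + \<phi> p * fst p ^ 4 + fst p ^ 5)"
    by (intro vadd1; rule vord_mono, (rule vsyn1 vphi vx1)+, simp)
  note g5 = this
  have "vord 7 U1 (\<lambda>p. (R Vf p - \<phi> p ^ 6 * ?w p) + \<phi> p ^ 6 * (?w p - v1) + v1 * ((\<phi> p - fst p) *
      (\<phi> p ^ 5 + \<phi> p ^ 4 * fst p + \<phi> p ^ 3 * fst p ^ 2 + \<phi> p ^ 2 * fst p ^ 3 + \<phi> p * fst p ^ 4 + fst p ^ 5)))"
    by (rule vadd1[OF vadd1[OF R_vert0]]; rule vord_mono, (rule w g5 vphi(2) vsyn1 vphi(1) vx1 vconst1)+, simp)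
  moreover have "(R Vf p - \<phi> p ^ 6 * ?w p) + \<phi> p ^ 6 * (?w p - v1) + v1 * ((\<phi> p - fst p) *
      (\<phi> p ^ 5 + \<phi> p ^ 4 * fst p + \<phi> p ^ 3 * fst p ^ 2 + \<phi> p ^ 2 * fst p ^ 3 + \<phi> p * fst p ^ 4 + fst p ^ 5))
      = R Vf p - v1 * fst p ^ 6" for p
    by algebra
  ultimately show ?thesis by simp
qed

lemma vord_vert: "vord 4 U Vf"
proof -
  have q0: "vord 2 U (\<lambda>p. C * snd p ^ 2 - A * fst p ^ 2)"
    by (intro vdiff; rule vord_mono, (rule vsyn vx vconst)+, simp)
  have q: "vord 4 U (\<lambda>p. 12 * (fst p * snd p) * (C * snd p ^ 2 - A * fst p ^ 2))"
    by (rule vord_mono, (rule vsyn q0 vx vconst)+, simp)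
  show ?thesis using vadd[OF vord_mono[OF vert_lead, of 4] q] by simp
qed

text \<open>To leading order the field along the branch is -x d/dx, which multiplies x^6 by
  -6.\<close>

lemma R_tvert: "vord 7 U1 (\<lambda>p. R Sf p + 6 * v1 * fst p ^ 6)"
proof -
  have s: "smooth_on U1 (\<lambda>p. v1 * fst p ^ 6)" by (intro smooth_intros U1(1))
  have q: "pdx (\<lambda>p. v1 * fst p ^ 6) p = 6 * v1 * fst p ^ 5" for p by (simp add: pd_simps smooth_intros)
  have "pdx (\<lambda>p. R Vf p - v1 * fst p ^ 6) p = pdx (R Vf) p - 6 * v1 * fst p ^ 5" if "p \<in> U1" for p
    unfolding pd_diff(1)[OF sR[OF smooths(5)] s that] q ..
  then have 1: "vord 6 U1 (\<lambda>p. pdx (R Vf) p - 6 * v1 * fst p ^ 5)"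
    by (rule vord_eqI[OF U1 dpd1(1)[OF R_vert], rotated]) simp_all
  have 2: "vord 3 U1 (R (pdy Vf))" using vR[OF dpd(2)[OF vord_vert, of 3]] by simp
  have "vord 7 U1 (\<lambda>p. \<rho>1 p * R (pdy Vf) p - \<phi> p * (pdx (R Vf) p - 6 * v1 * fst p ^ 5) - 6 * v1 * (fst p ^ 5 * (\<phi> p - fst p)))"
    by (rule vdiff1[OF vdiff1]; rule vord_mono, (rule 1 2 vphi(2) vsyn1 vphi(1) vrho1 vx1 vconst1)+, simp)
  moreover have "\<rho>1 p * R (pdy Vf) p - \<phi> p * (pdx (R Vf) p - 6 * v1 * fst p ^ 5) - 6 * v1 * (fst p ^ 5 * (\<phi> p - fst p))
     = R Sf p + 6 * v1 * fst p ^ 6" if "p \<in> U1" for p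
    unfolding R_tder[OF smooths(5) that] by algebra
  ultimately show ?thesis by (rule vord_eqI[OF U1])
qed

lemma R_infl4: "vord 4 U1 (\<lambda>p. R (infl f) p + 2 * p2 * fst p ^ 3)"
proof -
  have "vord 2 U1 (\<lambda>p. \<phi> p ^ 2 + \<phi> p * fst p + fst p ^ 2)"
    by (intro vadd1; rule vord_mono, (rule vsyn1 vphi vx1)+, simp)
  note h = this
  have r: "vord 4 U1 (\<lambda>p. R (infl f) p - - (b2 p * \<phi> p ^ 3))" by (rule vord_mono[OF R_infl]) simp
  have "vord 4 U1 (\<lambda>p. (R (infl f) p - - (b2 p * \<phi> p ^ 3)) - 6 * p3 * (fst p * \<phi> p ^ 3)
      - 2 * p2 * ((\<phi> p - fst p) * (\<phi> p ^ 2 + \<phi> p * fst p + fst p ^ 2)))"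
    by (rule vdiff1[OF vdiff1[OF r]]; rule vord_mono, (rule h vphi(2) vsyn1 vphi(1) vx1 vconst1)+, simp)
  moreover have "(R (infl f) p - - (b2 p * \<phi> p ^ 3)) - 6 * p3 * (fst p * \<phi> p ^ 3)
      - 2 * p2 * ((\<phi> p - fst p) * (\<phi> p ^ 2 + \<phi> p * fst p + fst p ^ 2)) = R (infl f) p + 2 * p2 * fst p ^ 3" for p
    by algebra
  ultimately show ?thesis by (rule vord_eqI[OF U1])
qed

lemma R_tinfl4: "vord 4 U1 (\<lambda>p. R (tder f (infl f)) p - 6 * p2 * fst p ^ 3)"
proof -
  have s: "smooth_on U1 (\<lambda>p. 2 * p2 * fst p ^ 3)" by (intro smooth_intros U1(1))
  have q: "pdx (\<lambda>p. 2 * p2 * fst p ^ 3) p = 6 * p2 * fst p ^ 2" for p by (simp add: pd_simps smooth_intros)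
  have "pdx (\<lambda>p. R (infl f) p + 2 * p2 * fst p ^ 3) p = pdx (R (infl f)) p + 6 * p2 * fst p ^ 2" if "p \<in> U1" for p
    unfolding pd_add(1)[OF sR[OF smooths(3)] s that] q ..
  then have 1: "vord 3 U1 (\<lambda>p. pdx (R (infl f)) p + 6 * p2 * fst p ^ 2)"
    by (rule vord_eqI[OF U1 dpd1(1)[OF R_infl4], rotated]) simp_all
  have 2: "vord 1 U1 (R (pdy (infl f)))" using vR[OF dpd(2)[OF vord_infl, of 1]] by simp
  have "vord 4 U1 (\<lambda>p. \<rho>1 p * R (pdy (infl f)) p - \<phi> p * (pdx (R (infl f)) p + 6 * p2 * fst p ^ 2) + 6 * p2 * (fst p ^ 2 * (\<phi> p - fst p)))"
    by (rule vadd1[OF vdiff1]; rule vord_mono, (rule 1 2 vphi(2) vsyn1 vphi(1) vrho1 vx1 vconst1)+, simp)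
  moreover have "\<rho>1 p * R (pdy (infl f)) p - \<phi> p * (pdx (R (infl f)) p + 6 * p2 * fst p ^ 2) + 6 * p2 * (fst p ^ 2 * (\<phi> p - fst p))
     = R (tder f (infl f)) p - 6 * p2 * fst p ^ 3" if "p \<in> U1" for p
    unfolding R_tder[OF smooths(3) that] by algebra
  ultimately show ?thesis by (rule vord_eqI[OF U1])
qed

end


section \<open>Uniform bounds, and the signs of the forms near a branch\<close>

lemma vord_bounds:
  assumes U: "open U" "0 \<in> U"
  shows "list_all (\<lambda>(k, g). vord k U g) gs \<Longrightarrow>
    \<exists>K\<ge>1. \<forall>\<^sub>F p in nhds 0. list_all (\<lambda>(k, g). \<bar>g p\<bar> \<le> K * norm p ^ k) gs"
proof (induction gs)
  case Nil
  then show ?case by (auto intro: exI[of _ 1])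
next
  case (Cons kg gs)
  obtain k g where kg: "kg = (k, g)" by force
  from Cons obtain K1 where K1: "K1 \<ge> 1" "\<forall>\<^sub>F p in nhds 0. list_all (\<lambda>(k, g). \<bar>g p\<bar> \<le> K1 * norm p ^ k) gs" by auto
  obtain K2 where K2: "\<forall>\<^sub>F p in nhds 0. \<bar>g p\<bar> \<le> K2 * norm p ^ k"
    using vord_bound[OF U, of k g] Cons.prems kg by auto
  have m: "\<bar>a\<bar> \<le> K * norm p ^ j \<Longrightarrow> K \<le> max K1 K2 \<Longrightarrow> \<bar>a\<bar> \<le> max K1 K2 * norm p ^ j" for a K j and p :: "real \<times> real"
    by (smt (verit) mult_right_mono norm_ge_zero zero_le_power)
  from K1(2) K2 have "\<forall>\<^sub>F p in nhds 0. list_all (\<lambda>(k, g). \<bar>g p\<bar> \<le> max K1 K2 * norm p ^ k) (kg # gs)"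
  proof eventually_elim
    case (elim p)
    then show ?case using m[where p = p] by (auto simp: kg list_all_iff)
  qed
  then show ?case using K1(1) by (intro exI[of _ "max K1 K2"]) auto
qed

lemma eventually_mult_less:
  fixes M c :: real assumes "c > 0" shows "\<forall>\<^sub>F x in at_right 0. M * x < c"
proof -
  have "((\<lambda>x. M * x) \<longlongrightarrow> M * 0) (at_right 0)" by (intro tendsto_intros)
  then show ?thesis using order_tendstoD(2)[of "\<lambda>x. M * x" 0 "at_right 0" c] assms by simp
qed

lemma sign_of_leading:
  fixes a c M x :: real
  assumes "\<bar>a - c * x ^ n\<bar> \<le> M * x ^ Suc n" "M * x < \<bar>c\<bar>" "x > 0"
  shows "c * a > 0"
proof -
  have "M * x * x ^ n < \<bar>c\<bar> * x ^ n" using assms(2,3) by (intro mult_strict_right_mono) auto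
  then have "\<bar>a - c * x ^ n\<bar> < \<bar>c\<bar> * x ^ n" using assms(1) by (simp add: mult.assoc)
  then have "\<bar>a - c * x ^ n\<bar> < \<bar>c * x ^ n\<bar>" using assms(3) by (simp add: abs_mult)
  then have "(c * x ^ n) * a > 0"
    by (smt (verit) mult_neg_neg mult_pos_pos)
  moreover have "(c * x ^ n) * a = (c * a) * x ^ n" by simp
  ultimately show ?thesis using assms(3) by (simp add: zero_less_mult_iff)
qed

lemma mvt_vertical:
  assumes "smooth_on U g" "\<And>\<xi>. min b y \<le> \<xi> \<Longrightarrow> \<xi> \<le> max b y \<Longrightarrow> (x, \<xi>) \<in> U"
  obtains \<xi> where "min b y \<le> \<xi>" "\<xi> \<le> max b y" "g (x, y) = g (x, b) + (y - b) * pdy g (x, \<xi>)"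
proof (cases "b = y")
  case True then show ?thesis using that[of b] by simp
next
  case False
  have d: "((\<lambda>y. g (x, y)) has_real_derivative pdy g (x, \<xi>)) (at \<xi>)" if "min b y \<le> \<xi>" "\<xi> \<le> max b y" for \<xi>
    using pd_real_derivative(2)[OF assms(1) assms(2)[OF that]] .
  have "\<exists>z>min b y. z < max b y \<and> g (x, max b y) - g (x, min b y) = (max b y - min b y) * pdy g (x, z)"
    by (rule MVT2) (use False d in auto)
  then obtain z where "z > min b y" "z < max b y" "g (x, max b y) - g (x, min b y) = (max b y - min b y) * pdy g (x, z)" by blast
  then show ?thesis by (intro that[of z]) (auto simp: max_def min_def algebra_simps split: if_splits)
qed

context node begin

lemma estimates:
  obtains K r where "K \<ge> 1" "0 < r" "r \<le> 1" "ball 0 r \<subseteq> U"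
    "\<And>p. norm p < r \<Longrightarrow> \<bar>f p - fst p * snd p\<bar> \<le> K * norm p ^ 3"
    "\<And>p. norm p < r \<Longrightarrow> \<bar>pdx f p - snd p\<bar> \<le> K * norm p ^ 2"
    "\<And>p. norm p < r \<Longrightarrow> \<bar>pdy f p - fst p\<bar> \<le> K * norm p ^ 2"
    "\<And>p. norm p < r \<Longrightarrow> \<bar>infl f p - - 2 * (fst p * snd p)\<bar> \<le> K * norm p ^ 3"
    "\<And>p. norm p < r \<Longrightarrow> \<bar>Vf p - 12 * (fst p * snd p) * (C * snd p ^ 2 - A * fst p ^ 2)\<bar> \<le> K * norm p ^ 5"
    "\<And>p. norm p < r \<Longrightarrow> \<bar>Sf p - 24 * (fst p * snd p) * (C * snd p ^ 2 + A * fst p ^ 2)\<bar> \<le> K * norm p ^ 5"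
    "\<And>p. norm p < r \<Longrightarrow> \<bar>pdy (infl f) p - - 2 * fst p\<bar> \<le> K * norm p ^ 2"
    "\<And>p. norm p < r \<Longrightarrow> \<bar>pdy (tder f (infl f)) p\<bar> \<le> K * norm p ^ 2"
    "\<And>p. norm p < r \<Longrightarrow> \<bar>pdy Vf p - 12 * fst p * (3 * C * snd p ^ 2 - A * fst p ^ 2)\<bar> \<le> K * norm p ^ 4"
    "\<And>p. norm p < r \<Longrightarrow> \<bar>(pdy Sf p + 2 * pdy Vf p) - 144 * C * fst p * snd p ^ 2\<bar> \<le> K * norm p ^ 4"
    "\<And>x. \<bar>x\<bar> < r \<Longrightarrow> (x, cub x) \<in> U"
    "\<And>x. \<bar>x\<bar> < r \<Longrightarrow> \<bar>cub x\<bar> \<le> K * \<bar>x\<bar> ^ 2"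
    "\<And>x. \<bar>x\<bar> < r \<Longrightarrow> \<bar>f (x, cub x)\<bar> \<le> K * \<bar>x\<bar> ^ 5"
    "\<And>x. \<bar>x\<bar> < r \<Longrightarrow> \<bar>infl f (x, cub x) + 2 * p2 * x ^ 3\<bar> \<le> K * \<bar>x\<bar> ^ 4"
    "\<And>x. \<bar>x\<bar> < r \<Longrightarrow> \<bar>tder f (infl f) (x, cub x) - 6 * p2 * x ^ 3\<bar> \<le> K * \<bar>x\<bar> ^ 4"
    "\<And>x. \<bar>x\<bar> < r \<Longrightarrow> \<bar>Vf (x, cub x) - v1 * x ^ 6\<bar> \<le> K * \<bar>x\<bar> ^ 7"
    "\<And>x. \<bar>x\<bar> < r \<Longrightarrow> \<bar>Sf (x, cub x) + 6 * v1 * x ^ 6\<bar> \<le> K * \<bar>x\<bar> ^ 7"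
proof -
  \<comment> \<open>Collecting the functions with their orders in a list makes one application of
    \<open>vord_bounds\<close> yield a single constant and a single radius for all of them.\<close>
  define gs where "gs = [(3 :: nat, \<lambda>p. f p - fst p * snd p), (2, \<lambda>p. pdx f p - snd p), (2, \<lambda>p. pdy f p - fst p),
    (3, \<lambda>p. infl f p - - 2 * (fst p * snd p)),
    (5, \<lambda>p. Vf p - 12 * (fst p * snd p) * (C * snd p ^ 2 - A * fst p ^ 2)),
    (5, \<lambda>p. Sf p - 24 * (fst p * snd p) * (C * snd p ^ 2 + A * fst p ^ 2)),
    (2, \<lambda>p. pdy (infl f) p - - 2 * fst p), (2, \<lambda>p. pdy (tder f (infl f)) p),
    (4, \<lambda>p. pdy Vf p - 12 * fst p * (3 * C * snd p ^ 2 - A * fst p ^ 2)),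
    (4, \<lambda>p. (pdy Sf p + 2 * pdy Vf p) - 144 * C * fst p * snd p ^ 2)]"
  have "list_all (\<lambda>(k, g). vord k U g) gs"
    using quad e1 e2 infl_lead vert_lead tvert_lead infl_lead_y tinfl_lead_y vert_lead_y tvert_lead_y
    by (simp only: gs_def list.pred_inject prod.case simp_thms)
  from vord_bounds[OF U this] obtain K1 where K1: "K1 \<ge> 1"
    "\<forall>\<^sub>F p in nhds 0. list_all (\<lambda>(k, g). \<bar>g p\<bar> \<le> K1 * norm p ^ k) gs" by blast
  define hs where "hs = [(2 :: nat, b0), (5, R f), (4, \<lambda>p. R (infl f) p + 2 * p2 * fst p ^ 3),
    (4, \<lambda>p. R (tder f (infl f)) p - 6 * p2 * fst p ^ 3), (7, \<lambda>p. R Vf p - v1 * fst p ^ 6),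
    (7, \<lambda>p. R Sf p + 6 * v1 * fst p ^ 6)]"
  have "list_all (\<lambda>(k, g). vord k U1 g) hs"
    using vb(2) vrho R_infl4 R_tinfl4 R_vert R_tvert
    by (simp only: hs_def list.pred_inject prod.case simp_thms)
  from vord_bounds[OF U1 this] obtain K2 where K2: "K2 \<ge> 1"
    "\<forall>\<^sub>F p in nhds 0. list_all (\<lambda>(k, g). \<bar>g p\<bar> \<le> K2 * norm p ^ k) hs" by blast
  have "\<forall>\<^sub>F p in nhds 0. p \<in> U \<and> p \<in> U1 \<and> list_all (\<lambda>(k, g). \<bar>g p\<bar> \<le> K1 * norm p ^ k) gs \<and>
      list_all (\<lambda>(k, g). \<bar>g p\<bar> \<le> K2 * norm p ^ k) hs"
    using K1(2) K2(2) U U1 by (intro eventually_conj eventually_nhds_in_open)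
  then obtain r0 where r0: "r0 > 0" "\<And>p. norm p < r0 \<Longrightarrow> p \<in> U \<and> p \<in> U1 \<and>
      list_all (\<lambda>(k, g). \<bar>g p\<bar> \<le> K1 * norm p ^ k) gs \<and> list_all (\<lambda>(k, g). \<bar>g p\<bar> \<le> K2 * norm p ^ k) hs"
    unfolding eventually_nhds_metric by (auto simp: dist_norm)
  define K where "K = max K1 K2"
  have m: "\<bar>a\<bar> \<le> K1 * t ^ j \<Longrightarrow> 0 \<le> t \<Longrightarrow> \<bar>a\<bar> \<le> K * t ^ j" "\<bar>a\<bar> \<le> K2 * t ^ j \<Longrightarrow> 0 \<le> t \<Longrightarrow> \<bar>a\<bar> \<le> K * t ^ j" for a t j
    unfolding K_def by (smt (verit) max.cobounded1 max.cobounded2 mult_right_mono zero_le_power)+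
  define r where "r = min r0 1"
  have g: "list_all (\<lambda>(k, g). \<bar>g p\<bar> \<le> K * norm p ^ k) gs" if "norm p < r" for p
    using r0(2)[of p] that m(1)[of _ "norm p"] by (auto simp: r_def list_all_iff)
  have h: "list_all (\<lambda>(k, g). \<bar>g (x, 0)\<bar> \<le> K * \<bar>x\<bar> ^ k) hs" "(x, cub x) \<in> U" if "\<bar>x\<bar> < r" for x
    using r0(2)[of "(x, 0)"] that m(2)[of _ "\<bar>x\<bar>"] by (auto simp: r_def list_all_iff norm_Pair)
  have K: "K \<ge> 1" "0 < r" "r \<le> 1" "ball 0 r \<subseteq> U"
    using K1(1) r0 by (auto simp: K_def r_def subset_iff)
  show thesis
    by (rule that[OF K]) (use g h in \<open>simp_all only: gs_def hs_def list.pred_inject prod.case simp_thms fst_conv snd_conv\<close>)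
qed

text \<open>The point is compared with the approximate branch on the same vertical line. With w the
  height above it, the vertical derivative is about x for \<open>f\<close>, about -2 x for
  \<open>infl f\<close>, and between -15 A x^3 and -3 A x^3 for \<open>Vf\<close>. The condition f
  \<le> \<kappa> x^4 describes the far end of a level arc, which runs so close to the branch that
  the values on the branch decide both signs.\<close>

lemma zone:
  assumes p2: "p2 \<noteq> 0" and v1: "v1 \<noteq> 0"
  obtains \<nu> \<kappa> r where "0 < \<nu>" "\<nu> \<le> 1" "C * \<nu>\<^sup>2 \<le> A / 6" "0 < \<kappa>" "0 < r" "ball 0 r \<subseteq> U"
    "\<And>x y. 0 < x \<Longrightarrow> \<bar>y\<bar> \<le> \<nu> * x \<Longrightarrow> norm (x, y) < r \<Longrightarrow> f (x, y) > 0 \<Longrightarrow> infl f (x, y) = 0 \<Longrightarrow>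
        p2 * tder f (infl f) (x, y) > 0 \<and> Vf (x, y) < 0"
    "\<And>x y. 0 < x \<Longrightarrow> \<bar>y\<bar> \<le> \<nu> * x \<Longrightarrow> norm (x, y) < r \<Longrightarrow> f (x, y) > 0 \<Longrightarrow> Vf (x, y) = 0 \<Longrightarrow>
        v1 * Sf (x, y) < 0"
    "\<And>x y. 0 < x \<Longrightarrow> \<bar>y\<bar> \<le> \<nu> * x \<Longrightarrow> norm (x, y) < r \<Longrightarrow> f (x, y) > 0 \<Longrightarrow> f (x, y) \<le> \<kappa> * x ^ 4 \<Longrightarrow>
        p2 * infl f (x, y) < 0 \<and> v1 * Vf (x, y) > 0"
proof -
  obtain K r0 where K: "K \<ge> 1" and r0: "0 < r0" "r0 \<le> 1" "ball 0 r0 \<subseteq> U"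
    and est: 
    "\<And>p. norm p < r0 \<Longrightarrow> \<bar>pdy f p - fst p\<bar> \<le> K * norm p ^ 2"
    "\<And>p. norm p < r0 \<Longrightarrow> \<bar>pdy (infl f) p - - 2 * fst p\<bar> \<le> K * norm p ^ 2"
    "\<And>p. norm p < r0 \<Longrightarrow> \<bar>pdy (tder f (infl f)) p\<bar> \<le> K * norm p ^ 2"
    "\<And>p. norm p < r0 \<Longrightarrow> \<bar>pdy Vf p - 12 * fst p * (3 * C * snd p ^ 2 - A * fst p ^ 2)\<bar> \<le> K * norm p ^ 4"
    "\<And>p. norm p < r0 \<Longrightarrow> \<bar>(pdy Sf p + 2 * pdy Vf p) - 144 * C * fst p * snd p ^ 2\<bar> \<le> K * norm p ^ 4"
    and br: "\<And>x. \<bar>x\<bar> < r0 \<Longrightarrow> (x, cub x) \<in> U"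
    "\<And>x. \<bar>x\<bar> < r0 \<Longrightarrow> \<bar>cub x\<bar> \<le> K * \<bar>x\<bar> ^ 2"
    "\<And>x. \<bar>x\<bar> < r0 \<Longrightarrow> \<bar>f (x, cub x)\<bar> \<le> K * \<bar>x\<bar> ^ 5"
    "\<And>x. \<bar>x\<bar> < r0 \<Longrightarrow> \<bar>infl f (x, cub x) + 2 * p2 * x ^ 3\<bar> \<le> K * \<bar>x\<bar> ^ 4"
    "\<And>x. \<bar>x\<bar> < r0 \<Longrightarrow> \<bar>tder f (infl f) (x, cub x) - 6 * p2 * x ^ 3\<bar> \<le> K * \<bar>x\<bar> ^ 4"
    "\<And>x. \<bar>x\<bar> < r0 \<Longrightarrow> \<bar>Vf (x, cub x) - v1 * x ^ 6\<bar> \<le> K * \<bar>x\<bar> ^ 7"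
    "\<And>x. \<bar>x\<bar> < r0 \<Longrightarrow> \<bar>Sf (x, cub x) + 6 * v1 * x ^ 6\<bar> \<le> K * \<bar>x\<bar> ^ 7"
    by (rule estimates) blast
  define v where "v = v1"
  \<comment> \<open>Then 3 C y^2 \<le> A x^2 / 2 in the cone, so that \<open>pdy Vf\<close> is at
    most -6 A x^3 before the error and -3 A x^3 with it.\<close>
  define \<nu> where "\<nu> = min 1 (sqrt (A / (6 * C)))"
  have \<nu>: "0 < \<nu>" "\<nu> \<le> 1" using pos by (auto simp: \<nu>_def)
  have "\<nu>\<^sup>2 \<le> (sqrt (A / (6 * C)))\<^sup>2" using \<nu> by (intro power_mono) (auto simp: \<nu>_def)
  then have \<nu>2: "C * \<nu>\<^sup>2 \<le> A / 6" using pos by (simp add: field_simps)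
  \<comment> \<open>On f \<le> \<kappa> x^4 the height is at most about 2 \<kappa> x^3, which
    changes \<open>Vf\<close> by at most 30 A \<kappa> x^6. This has to stay below |v| x^6 / 2, and
    84 = 2 * 42 leaves some room.\<close>
  define \<kappa> where "\<kappa> = min 1 (\<bar>v\<bar> / (84 * A))"
  have \<kappa>: "0 < \<kappa>" "\<kappa> \<le> 1" "42 * A * \<kappa> \<le> \<bar>v\<bar> / 2"
    using v1 pos by (auto simp: \<kappa>_def v_def min_def field_simps)
  \<comment> \<open>L x^3 bounds the height at a zero of \<open>Vf\<close>. \<open>P\<close> and
    \<open>M\<close> are the error constants in the comparisons of \<open>tder f (infl f)\<close>
    with 6 p2 x^3 and of -\<open>Sf\<close> with 4 v x^6.\<close>
  define L where "L = (\<bar>v\<bar> + K) / (3 * A)"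
  define P where "P = K * (1 + 12 * \<bar>p2\<bar>)"
  define M where "M = 3 * K + L * (144 * C * (K + L)\<^sup>2 + 16 * K)"
  have L: "L > 0" using K pos by (auto simp: L_def intro!: divide_pos_pos add_nonneg_pos)
  have "\<forall>\<^sub>F x in at_right 0. 0 < x \<and> K * x < \<nu> \<and> 2 * x < r0 \<and> 8 * K * x < 1 \<and> K * x < \<bar>p2\<bar> \<and> P * x < \<bar>6 * p2\<bar>
      \<and> 6 * K * x < \<bar>p2\<bar> \<and> 16 * K * x < 3 * A \<and> (\<bar>v\<bar> + K) * x < A * \<bar>p2\<bar> \<and> M * x < \<bar>4 * v\<bar>
      \<and> (13 * K + 6) * x < \<bar>2 * p2\<bar> \<and> (K + 42 * A * K) * x < \<bar>v\<bar> / 2"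
    using \<nu> r0 p2 v1 pos
    by (intro eventually_conj eventually_mult_less eventually_at_right_less) (auto simp: v_def)
  then obtain r1 where r1: "r1 > 0" and sm: "\<And>x. 0 < x \<Longrightarrow> x < r1 \<Longrightarrow> K * x < \<nu> \<and> 2 * x < r0 \<and> 8 * K * x < 1 \<and> K * x < \<bar>p2\<bar>
      \<and> P * x < \<bar>6 * p2\<bar>
      \<and> 6 * K * x < \<bar>p2\<bar> \<and> 16 * K * x < 3 * A \<and> (\<bar>v\<bar> + K) * x < A * \<bar>p2\<bar> \<and> M * x < \<bar>4 * v\<bar>
      \<and> (13 * K + 6) * x < \<bar>2 * p2\<bar> \<and> (K + 42 * A * K) * x < \<bar>v\<bar> / 2"
    unfolding eventually_at_right_field by blast
  have main: "(infl f (x, y) = 0 \<longrightarrow> p2 * tder f (infl f) (x, y) > 0 \<and> Vf (x, y) < 0) \<and>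
      (Vf (x, y) = 0 \<longrightarrow> v1 * Sf (x, y) < 0) \<and>
      (f (x, y) \<le> \<kappa> * x ^ 4 \<longrightarrow> p2 * infl f (x, y) < 0 \<and> v1 * Vf (x, y) > 0)"
    if x: "0 < x" and y: "\<bar>y\<bar> \<le> \<nu> * x" and n: "norm (x, y) < min r0 r1" and fpos: "f (x, y) > 0" for x y
  proof -
    have "\<bar>x\<bar> \<le> norm (x, y)" using norm_fst_le[of x y] by simp
    then have xr: "x < r1" using n x by auto
    note s = sm[OF x xr]
    have x1: "x < 1" using s r0 by auto
    define b where "b = cub x"
    define w where "w = y - b"
    have ax: "\<bar>x\<bar> = x" "\<bar>x\<bar> < r0" using x s by auto
    note br' = br[OF ax(2), unfolded ax(1) b_def[symmetric] v_def[symmetric]]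
    have "K * x * x \<le> \<nu> * x" using s x by (intro mult_right_mono) auto
    then have b\<nu>: "\<bar>b\<bar> \<le> \<nu> * x" using br'(2) by (simp add: power2_eq_square mult.assoc)
    have bet: "\<bar>\<xi>\<bar> \<le> \<nu> * x \<and> norm (x, \<xi>) \<le> 2 * x \<and> norm (x, \<xi>) < r0 \<and> (x, \<xi>) \<in> U"
      if "min b y \<le> \<xi>" "\<xi> \<le> max b y" for \<xi>
    proof -
      have 1: "\<bar>\<xi>\<bar> \<le> \<nu> * x" using that b\<nu> y by (auto simp: min_def max_def abs_le_iff split: if_splits)
      moreover have "\<nu> * x \<le> x" using \<nu> x by simp
      ultimately have "norm (x, \<xi>) \<le> 2 * x" using norm_Pair_le[of x \<xi>] x unfolding real_norm_def by linarith
      then show ?thesis using 1 s r0(3) by (auto simp: subset_iff)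
    qed
    have pw: "K * norm (x, \<xi>) ^ 2 \<le> 4 * K * x ^ 2" "K * norm (x, \<xi>) ^ 4 \<le> 16 * K * x ^ 4"
      if "norm (x, \<xi>) \<le> 2 * x" for \<xi>
      using power_mono[OF that, of 2] power_mono[OF that, of 4] K by (simp_all add: power_mult_distrib)
    have Kx2: "8 * K * x ^ 2 \<le> x" using s x by (simp add: power2_eq_square) 
    have Kx4: "16 * K * x ^ 4 \<le> 3 * A * x ^ 3"
    proof -
      have "16 * K * x * x ^ 3 \<le> 3 * A * x ^ 3" using s x by (intro mult_right_mono) auto
      then show ?thesis by (simp add: power_numeral_reduce mult_ac)
    qed
    obtain \<xi>0 where m0: "min b y \<le> \<xi>0" "\<xi>0 \<le> max b y" "f (x, y) = f (x, b) + (y - b) * pdy (f) (x, \<xi>0)"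
      by (rule mvt_vertical[OF f, of b y x]) (use bet in blast)
    have \<xi>0: "f (x, y) = f (x, b) + w * pdy f (x, \<xi>0)" "\<bar>pdy f (x, \<xi>0) - x\<bar> \<le> 4 * K * x ^ 2"
      using m0(3) bet[OF m0(1,2)] est(1)[of "(x, \<xi>0)"] pw[of \<xi>0] unfolding w_def fst_conv snd_conv by linarith+
    obtain \<xi>1 where m1: "min b y \<le> \<xi>1" "\<xi>1 \<le> max b y" "infl f (x, y) = infl f (x, b) + (y - b) * pdy (infl f) (x, \<xi>1)"
      by (rule mvt_vertical[OF smooths(3), of b y x]) (use bet in blast)
    have \<xi>1: "infl f (x, y) = infl f (x, b) + w * pdy (infl f) (x, \<xi>1)"
      "\<bar>pdy (infl f) (x, \<xi>1) - - 2 * x\<bar> \<le> 4 * K * x ^ 2"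
      using m1(3) bet[OF m1(1,2)] est(2)[of "(x, \<xi>1)"] pw[of \<xi>1] unfolding w_def fst_conv snd_conv by linarith+
    obtain \<xi>2 where m2: "min b y \<le> \<xi>2" "\<xi>2 \<le> max b y" "tder f (infl f) (x, y) = tder f (infl f) (x, b) + (y - b) * pdy (tder f (infl f)) (x, \<xi>2)"
      by (rule mvt_vertical[OF smooths(7), of b y x]) (use bet in blast)
    have \<xi>2: "tder f (infl f) (x, y) = tder f (infl f) (x, b) + w * pdy (tder f (infl f)) (x, \<xi>2)"
      "\<bar>pdy (tder f (infl f)) (x, \<xi>2)\<bar> \<le> 4 * K * x ^ 2"
      using m2(3) bet[OF m2(1,2)] est(3)[of "(x, \<xi>2)"] pw[of \<xi>2] unfolding w_def fst_conv snd_conv by linarith+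
    obtain \<xi>3 where m3: "min b y \<le> \<xi>3" "\<xi>3 \<le> max b y" "Vf (x, y) = Vf (x, b) + (y - b) * pdy (Vf) (x, \<xi>3)"
      by (rule mvt_vertical[OF smooths(5), of b y x]) (use bet in blast)
    have \<xi>3: "Vf (x, y) = Vf (x, b) + w * pdy Vf (x, \<xi>3)" "\<bar>\<xi>3\<bar> \<le> \<nu> * x"
      "\<bar>pdy Vf (x, \<xi>3) - 12 * x * (3 * C * \<xi>3 ^ 2 - A * x ^ 2)\<bar> \<le> 16 * K * x ^ 4"
      using m3(3) bet[OF m3(1,2)] est(4)[of "(x, \<xi>3)"] pw[of \<xi>3] unfolding w_def fst_conv snd_conv by linarith+
    \<comment> \<open>\<open>Sf + 2 Vf\<close> agrees with \<open>Sf\<close> at the zeros of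
      \<open>Vf\<close>, and by \<open>tvert_lead_y\<close> it hardly varies in vertical direction
      close to the branch.\<close>
    have smc: "smooth_on U (\<lambda>p. Sf p + 2 * Vf p)" by (intro smooth_intros U smooths)
    have pdc: "pdy (\<lambda>p. Sf p + 2 * Vf p) p = pdy Sf p + 2 * pdy Vf p" if "p \<in> U" for p
    proof -
      have "smooth_on U (\<lambda>p. 2 * Vf p)" by (intro smooth_intros U smooths)
      from pd_add(2)[OF smooths(6) this that] show ?thesis using pd_cmult(2)[OF smooths(5) that] by simp
    qed
    obtain \<xi>4 where m4: "min b y \<le> \<xi>4" "\<xi>4 \<le> max b y"
      "Sf (x, y) + 2 * Vf (x, y) = Sf (x, b) + 2 * Vf (x, b) + (y - b) * pdy (\<lambda>p. Sf p + 2 * Vf p) (x, \<xi>4)"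
      by (rule mvt_vertical[OF smc, of b y x]) (use bet in blast)
    have \<xi>4: "Sf (x, y) + 2 * Vf (x, y) = Sf (x, b) + 2 * Vf (x, b) + w * (pdy Sf (x, \<xi>4) + 2 * pdy Vf (x, \<xi>4))"
      "min b y \<le> \<xi>4" "\<xi>4 \<le> max b y"
      "\<bar>(pdy Sf (x, \<xi>4) + 2 * pdy Vf (x, \<xi>4)) - 144 * C * x * \<xi>4 ^ 2\<bar> \<le> 16 * K * x ^ 4"
    proof -
      have p4: "norm (x, \<xi>4) < r0" "norm (x, \<xi>4) \<le> 2 * x" "(x, \<xi>4) \<in> U" using bet[OF m4(1,2)] by auto
      show "Sf (x, y) + 2 * Vf (x, y) = Sf (x, b) + 2 * Vf (x, b) + w * (pdy Sf (x, \<xi>4) + 2 * pdy Vf (x, \<xi>4))"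
        using m4(3) unfolding pdc[OF p4(3)] w_def .
      show "\<bar>(pdy Sf (x, \<xi>4) + 2 * pdy Vf (x, \<xi>4)) - 144 * C * x * \<xi>4 ^ 2\<bar> \<le> 16 * K * x ^ 4"
        using est(5)[OF p4(1)] pw(2)[OF p4(2)] unfolding fst_conv snd_conv by linarith
    qed (use m4 in auto)
    have fy: "pdy f (x, \<xi>0) \<ge> x / 2" "pdy f (x, \<xi>0) > 0" using \<xi>0(2) Kx2 x by auto
    have Iy: "x \<le> - pdy (infl f) (x, \<xi>1)" "- pdy (infl f) (x, \<xi>1) \<le> 3 * x" using \<xi>1(2) Kx2 by auto
    have "3 * C * \<xi>3 ^ 2 \<le> 3 * C * (\<nu> * x) ^ 2"
      using \<xi>3(2) pos by (intro mult_left_mono) (auto simp: abs_le_square_iff[symmetric] simp del: power_mult_distrib)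
    also have "\<dots> = 3 * (C * \<nu>\<^sup>2) * x ^ 2" by (simp add: power_mult_distrib)
    also have "\<dots> \<le> 3 * (A / 6) * x ^ 2" using \<nu>2 by (intro mult_right_mono mult_left_mono) auto
    finally have c3: "3 * C * \<xi>3 ^ 2 \<le> A / 2 * x ^ 2" by simp
    have "12 * x * (3 * C * \<xi>3 ^ 2 - A * x ^ 2) \<le> 12 * x * (- (A / 2) * x ^ 2)"
      using c3 x by (intro mult_left_mono) auto
    moreover have "12 * x * (3 * C * \<xi>3 ^ 2 - A * x ^ 2) \<ge> 12 * x * (- A * x ^ 2)"
      using x pos by (intro mult_left_mono) auto
    moreover have "12 * x * (- (A / 2) * x ^ 2) = - 6 * (A * x ^ 3)" "12 * x * (- A * x ^ 2) = - 12 * (A * x ^ 3)"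
      by (simp_all add: power_numeral_reduce)
    ultimately have Vy: "pdy Vf (x, \<xi>3) \<le> - (3 * A * x ^ 3)" "- (15 * A * x ^ 3) \<le> pdy Vf (x, \<xi>3)"
      using \<xi>3(3) Kx4 unfolding mult.assoc by linarith+
    have x34: "x ^ 3 > 0" "x ^ 2 > 0" "x ^ 4 > 0" using x by auto
    \<comment> \<open>Positivity of \<open>f\<close> puts the point above the branch, up to the
      error K x^5 of the approximation divided by the slope x / 2.\<close>
    have wlow: "w \<ge> - (2 * K * x ^ 4)"
    proof (rule ccontr)
      assume "\<not> w \<ge> - (2 * K * x ^ 4)"
      then have "w < - (2 * K * x ^ 4)" by simp
      then have "w * pdy f (x, \<xi>0) < - (2 * K * x ^ 4) * pdy f (x, \<xi>0)" using fy(2) by (rule mult_strict_right_mono)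
      also have "\<dots> \<le> - (2 * K * x ^ 4) * (x / 2)" using fy(1) K x34 by (intro mult_left_mono_neg) auto
      also have "\<dots> = - (K * x ^ 5)" by (simp add: power_numeral_reduce)
      finally show False using br'(3) \<xi>0(1) fpos by linarith
    qed
    have absV: "\<bar>Vf (x, b)\<bar> \<le> (\<bar>v\<bar> + K) * x ^ 6"
    proof -
      have "K * x ^ 7 \<le> K * x ^ 6" using K x x1 by (intro mult_left_mono power_decreasing) auto
      moreover have "\<bar>v * x ^ 6\<bar> = \<bar>v\<bar> * x ^ 6" using x by (simp add: abs_mult)
      ultimately show ?thesis using br'(6) by (simp add: distrib_right)
    qed
    \<comment> \<open>A zero of \<open>infl f\<close> has a height of order x^2, far beyond the
      tolerance in \<open>wlow\<close>, hence lies above the branch. At this height the contribution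
      of w to \<open>Vf\<close>, of order x^5 and negative, outweighs the value of order x^6 on the
      branch.\<close>
    have 1: "p2 * tder f (infl f) (x, y) > 0 \<and> Vf (x, y) < 0" if I0: "infl f (x, y) = 0"
    proof -
      have e: "\<bar>w\<bar> * \<bar>pdy (infl f) (x, \<xi>1)\<bar> = \<bar>infl f (x, b)\<bar>"
        using \<xi>1(1) I0 by (metis abs_minus_cancel abs_mult add_eq_0_iff)
      have k: "K * x * x ^ 3 \<le> \<bar>p2\<bar> * x ^ 3" using s x by (intro mult_right_mono) auto
      have k': "K * x ^ 4 = K * x * x ^ 3" by (simp add: power_numeral_reduce)
      have a3: "\<bar>2 * p2 * x ^ 3\<bar> = 2 * \<bar>p2\<bar> * x ^ 3" using x by (simp add: abs_mult)
      have Ib: "\<bar>p2\<bar> * x ^ 3 \<le> \<bar>infl f (x, b)\<bar>" "\<bar>infl f (x, b)\<bar> \<le> 3 * \<bar>p2\<bar> * x ^ 3"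
        using br'(4) k k' a3 by linarith+
      have "\<bar>w\<bar> * x \<le> \<bar>w\<bar> * \<bar>pdy (infl f) (x, \<xi>1)\<bar>" using Iy x by (intro mult_left_mono) auto
      also have "\<dots> \<le> (3 * \<bar>p2\<bar> * x ^ 2) * x" using e Ib(2) by (simp add: power_numeral_reduce mult_ac)
      finally have w1: "\<bar>w\<bar> \<le> 3 * \<bar>p2\<bar> * x ^ 2" using x by simp
      have "(\<bar>p2\<bar> * x ^ 2) * x \<le> \<bar>w\<bar> * \<bar>pdy (infl f) (x, \<xi>1)\<bar>" using e Ib(1) by (simp add: power_numeral_reduce mult_ac)
      also have "\<dots> \<le> \<bar>w\<bar> * (3 * x)" using Iy x by (intro mult_left_mono) auto
      finally have w2: "\<bar>p2\<bar> * x ^ 2 \<le> 3 * \<bar>w\<bar>" using x by (simp add: mult.assoc[symmetric])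
      have "6 * K * x * x ^ 3 \<le> \<bar>p2\<bar> * x ^ 3" using s x by (intro mult_right_mono) auto
      moreover have "\<bar>p2\<bar> * x ^ 3 < \<bar>p2\<bar> * x ^ 2"
        using x x1 p2 by (intro mult_strict_left_mono power_strict_decreasing) auto
      moreover have "6 * K * x * x ^ 3 = 3 * (2 * K * x ^ 4)" by (simp add: power_numeral_reduce)
      ultimately have w3: "w > 0" "\<bar>p2\<bar> * x ^ 2 \<le> 3 * w" using w2 wlow by linarith+
      have "\<bar>w * pdy (tder f (infl f)) (x, \<xi>2)\<bar> \<le> (3 * \<bar>p2\<bar> * x ^ 2) * (4 * K * x ^ 2)"
        unfolding abs_mult using w1 \<xi>2(2) by (intro mult_mono) auto
      also have "\<dots> = 12 * K * \<bar>p2\<bar> * x ^ 4" by (simp add: power_numeral_reduce)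
      finally have "\<bar>tder f (infl f) (x, y) - 6 * p2 * x ^ 3\<bar> \<le> P * x ^ Suc 3"
        using \<xi>2(1) br'(5) by (simp add: P_def algebra_simps abs_le_iff)
      then have "(6 * p2) * tder f (infl f) (x, y) > 0"
        by (rule sign_of_leading) (use s x in auto)
      moreover have "Vf (x, y) < 0"
      proof -
        have "w * pdy Vf (x, \<xi>3) \<le> w * (- (3 * A * x ^ 3))" using Vy(1) w3 by (intro mult_left_mono) auto
        also have "\<dots> = - (A * x ^ 3) * (3 * w)" by simp
        also have "\<dots> \<le> - (A * x ^ 3) * (\<bar>p2\<bar> * x ^ 2)"
          using w3 x34 pos by (intro mult_left_mono_neg) auto
        also have "\<dots> = - (A * \<bar>p2\<bar> * x ^ 5)" by (simp add: power_numeral_reduce)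
        finally have "Vf (x, y) \<le> (\<bar>v\<bar> + K) * x * x ^ 5 - A * \<bar>p2\<bar> * x ^ 5"
          using absV \<xi>3(1) by (simp add: power_numeral_reduce mult_ac)
        also have "\<dots> < 0" using s x by simp
        finally show ?thesis .
      qed
      ultimately show ?thesis by (simp add: mult.assoc zero_less_mult_iff)
    qed
    \<comment> \<open>At a zero of \<open>Vf\<close> the height is O(x^3), so up to O(x^7) the value
      of \<open>Sf\<close> is that of \<open>Sf + 2 Vf\<close> on the branch, namely (-6 + 2) v1
      x^6.\<close>
    have 2: "v1 * Sf (x, y) < 0" if V0: "Vf (x, y) = 0"
    proof -
      have e: "\<bar>w\<bar> * \<bar>pdy Vf (x, \<xi>3)\<bar> = \<bar>Vf (x, b)\<bar>"
        using \<xi>3(1) V0 by (metis abs_minus_cancel abs_mult add_eq_0_iff)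
      have "\<bar>w\<bar> * (3 * A * x ^ 3) \<le> \<bar>w\<bar> * \<bar>pdy Vf (x, \<xi>3)\<bar>" using Vy(1) x34 pos by (intro mult_left_mono) auto
      also have "\<dots> \<le> ((\<bar>v\<bar> + K) * x ^ 3) * x ^ 3" using e absV by (simp add: power_numeral_reduce mult_ac)
      finally have "\<bar>w\<bar> * (3 * A) * x ^ 3 \<le> ((\<bar>v\<bar> + K) * x ^ 3) * x ^ 3" by (simp add: mult.assoc)
      then have "\<bar>w\<bar> * (3 * A) \<le> (\<bar>v\<bar> + K) * x ^ 3" using x34(1) by (simp only: mult_le_cancel_right_pos)
      then have wL: "\<bar>w\<bar> \<le> L * x ^ 3" using pos by (simp add: L_def field_simps)
      have "\<bar>\<xi>4\<bar> \<le> \<bar>b\<bar> + \<bar>w\<bar>" using \<xi>4(2,3) by (auto simp: w_def min_def max_def split: if_splits)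
      moreover have "L * x ^ 3 \<le> L * x ^ 2" using L x x1 by (intro mult_left_mono power_decreasing) auto
      ultimately have "\<bar>\<xi>4\<bar> \<le> (K + L) * x ^ 2" using wL br'(2) by (simp add: distrib_right)
      then have "\<xi>4 ^ 2 \<le> ((K + L) * x ^ 2) ^ 2" by (metis abs_ge_zero power2_abs power_mono)
      then have "144 * C * x * \<xi>4 ^ 2 \<le> 144 * C * x * ((K + L) * x ^ 2) ^ 2" using pos x by (intro mult_left_mono) auto
      also have "\<dots> = 144 * C * (K + L)\<^sup>2 * x ^ 5" by (simp add: power_mult_distrib power_numeral_reduce)
      also have "\<dots> \<le> 144 * C * (K + L)\<^sup>2 * x ^ 4" using pos x x1 by (intro mult_left_mono power_decreasing) auto
      finally have "\<bar>144 * C * x * \<xi>4 ^ 2\<bar> \<le> 144 * C * (K + L)\<^sup>2 * x ^ 4" using pos x by simp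
      then have "\<bar>pdy Sf (x, \<xi>4) + 2 * pdy Vf (x, \<xi>4)\<bar> \<le> (144 * C * (K + L)\<^sup>2 + 16 * K) * x ^ 4"
        using \<xi>4(4) unfolding distrib_right by linarith
      then have "\<bar>w * (pdy Sf (x, \<xi>4) + 2 * pdy Vf (x, \<xi>4))\<bar> \<le> (L * x ^ 3) * ((144 * C * (K + L)\<^sup>2 + 16 * K) * x ^ 4)"
        unfolding abs_mult using wL by (intro mult_mono) auto
      also have "\<dots> = L * (144 * C * (K + L)\<^sup>2 + 16 * K) * x ^ 7" by (simp add: power_numeral_reduce)
      finally have "\<bar>- Sf (x, y) - 4 * v * x ^ 6\<bar> \<le> M * x ^ Suc 6"
        using \<xi>4(1) br'(6,7) V0 by (simp add: M_def distrib_right abs_le_iff)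
      then have "(4 * v) * - Sf (x, y) > 0"
        by (rule sign_of_leading) (use s x in auto)
      then have "v * Sf (x, y) < 0" by (simp add: mult.assoc)
      then show ?thesis by (simp only: v_def)
    qed
    \<comment> \<open>Dividing by the slope x / 2 turns the bound on \<open>f\<close> into a height
      O(x^3). This shifts \<open>infl f\<close> by O(x^4) against the branch value -2 p2 x^3, and
      \<open>Vf\<close> by less than its branch value.\<close>
    have 3: "p2 * infl f (x, y) < 0 \<and> v1 * Vf (x, y) > 0" if f4: "f (x, y) \<le> \<kappa> * x ^ 4"
    proof -
      have "\<bar>w\<bar> * (x / 2) \<le> \<bar>w\<bar> * \<bar>pdy f (x, \<xi>0)\<bar>" using fy by (intro mult_left_mono) auto
      also have "\<dots> = \<bar>f (x, y) - f (x, b)\<bar>" using \<xi>0(1) by (simp add: abs_mult)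
      also have "\<dots> \<le> \<kappa> * x ^ 4 + K * x ^ 5" using f4 fpos br'(3) by (simp add: abs_le_iff)
      also have "\<dots> = (\<kappa> * x ^ 3 + K * x ^ 4) * x" by (simp add: power_numeral_reduce algebra_simps)
      finally have "\<bar>w\<bar> * x \<le> (2 * \<kappa> * x ^ 3 + 2 * K * x ^ 4) * x" unfolding distrib_right by linarith
      then have w: "\<bar>w\<bar> \<le> 2 * \<kappa> * x ^ 3 + 2 * K * x ^ 4" using x by (simp only: mult_le_cancel_right_pos)
      have "\<bar>w * pdy (infl f) (x, \<xi>1)\<bar> \<le> (2 * \<kappa> * x ^ 3 + 2 * K * x ^ 4) * (3 * x)"
        unfolding abs_mult using w Iy x by (intro mult_mono) auto
      also have "\<dots> = 6 * \<kappa> * x ^ 4 + 6 * K * x ^ 5" by (simp add: power_numeral_reduce algebra_simps)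
      also have "\<dots> \<le> 6 * x ^ 4 + 6 * K * x ^ 4"
        using \<kappa> K x x1 by (intro add_mono mult_left_mono mult_right_mono power_decreasing) auto
      finally have "\<bar>- infl f (x, y) - 2 * p2 * x ^ 3\<bar> \<le> (7 * K + 6) * x ^ Suc 3"
        using \<xi>1(1) br'(4) by (simp add: distrib_right abs_le_iff)
      also have "\<dots> \<le> (13 * K + 6) * x ^ Suc 3" using K x by (intro mult_right_mono) auto
      finally have I: "(2 * p2) * - infl f (x, y) > 0"
        by (rule sign_of_leading) (use s x in auto)
      have "\<bar>w * pdy Vf (x, \<xi>3)\<bar> \<le> (2 * \<kappa> * x ^ 3 + 2 * K * x ^ 4) * (15 * A * x ^ 3)"
        unfolding abs_mult using w Vy x34 pos K \<kappa> by (intro mult_mono) auto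
      also have "\<dots> = 30 * A * \<kappa> * x ^ 6 + 30 * A * K * x ^ 7" by (simp add: power_numeral_reduce algebra_simps)
      finally have "\<bar>Vf (x, y) - v * x ^ 6\<bar> \<le> 30 * A * \<kappa> * x ^ 6 + (K + 30 * A * K) * x ^ 7"
        using \<xi>3(1) br'(6) by (simp add: distrib_right abs_le_iff)
      also have "\<dots> \<le> (\<bar>v\<bar> / 2) * x ^ 6 + (K + 42 * A * K) * x ^ 7"
        using \<kappa> K x pos by (intro add_mono mult_right_mono) auto
      also have "\<dots> = (\<bar>v\<bar> / 2 + (K + 42 * A * K) * x) * x ^ 6" by (simp add: power_numeral_reduce algebra_simps)
      also have "\<dots> < \<bar>v\<bar> * x ^ 6" using s x by (intro mult_strict_right_mono) auto
      also have "\<dots> = \<bar>v * x ^ 6\<bar>" using x by (simp add: abs_mult)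
      finally have "(v * x ^ 6) * Vf (x, y) > 0" by (smt (verit) mult_neg_neg mult_pos_pos)
      then have "v * Vf (x, y) > 0" using x by (simp add: mult.assoc mult.left_commute[of _ "x ^ 6"] zero_less_mult_iff)
      with I show ?thesis by (simp add: v_def mult.assoc)
    qed
    show ?thesis using 1 2 3 by blast
  qed
  show thesis
    by (rule that[of \<nu> \<kappa> "min r0 r1"]) (use \<nu> \<nu>2 \<kappa> r0 r1 main in \<open>auto simp: subset_iff\<close>)
qed

end


section \<open>Linear changes of coordinates\<close>

text \<open>Two instances occur: the exchange of the axes, and the passage from Euclidean
  coordinates to those adapted to the node in a chosen quadrant. The factor \<open>c\<close> adjusts
  the sign of the function.\<close>

locale linear_change =
  fixes U :: "(real \<times> real) set" and f :: "real \<times> real \<Rightarrow> real" and c a1 a2 b1 b2 :: real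
  assumes U: "open U" and f: "smooth_on U f"
begin

definition lin :: "real \<times> real \<Rightarrow> real \<times> real" where
  "lin q = (a1 * fst q + a2 * snd q, b1 * fst q + b2 * snd q)"

definition g :: "real \<times> real \<Rightarrow> real" where "g q = c * f (lin q)"

abbreviation "W \<equiv> lin -` U"
abbreviation "dt \<equiv> a1 * b2 - a2 * b1"

lemma W: "open W"
  unfolding lin_def[abs_def] by (intro continuous_open_vimage U continuous_intros)

lemma smooth_lin: "smooth_on S (\<lambda>q. fst (lin q))" "smooth_on S (\<lambda>q. snd (lin q))" if "open S"
  unfolding lin_def fst_conv snd_conv by (intro smooth_intros that)+

lemma smooth_lin': "open S \<Longrightarrow> smooth_on S lin"
  unfolding lin_def[abs_def] by (intro smooth_intros)

lemma smooth_comp: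
  fixes h :: "real \<times> real \<Rightarrow> real"
  assumes "smooth_on U h" shows "smooth_on W (\<lambda>q. h (lin q))"
  by (rule smooth_on_compose[OF assms W U smooth_lin'[OF W]]) auto

lemma pd_lin:
  assumes "smooth_on U h" "q \<in> W"
  shows "pdx (\<lambda>q. h (lin q)) q = a1 * pdx h (lin q) + b1 * pdy h (lin q)"
    "pdy (\<lambda>q. h (lin q)) q = a2 * pdx h (lin q) + b2 * pdy h (lin q)"
proof -
  have eq: "(\<lambda>q. h (lin q)) = (\<lambda>q. h (fst (lin q), snd (lin q)))" by simp
  have m: "(fst (lin q), snd (lin q)) \<in> U" using assms(2) by simp
  have d: "pdx (\<lambda>q. fst (lin q)) q = a1" "pdx (\<lambda>q. snd (lin q)) q = b1"
    "pdy (\<lambda>q. fst (lin q)) q = a2" "pdy (\<lambda>q. snd (lin q)) q = b2"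
    by (simp_all add: lin_def pd_simps smooth_intros)
  show "pdx (\<lambda>q. h (lin q)) q = a1 * pdx h (lin q) + b1 * pdy h (lin q)"
    "pdy (\<lambda>q. h (lin q)) q = a2 * pdx h (lin q) + b2 * pdy h (lin q)"
    unfolding eq pd_compose[OF assms(1) smooth_lin[OF W] assms(2) m] d by simp_all
qed

lemma pd_clin:
  assumes "smooth_on U h" "q \<in> W"
  shows "pdx (\<lambda>q. k * h (lin q)) q = k * (a1 * pdx h (lin q) + b1 * pdy h (lin q))"
    "pdy (\<lambda>q. k * h (lin q)) q = k * (a2 * pdx h (lin q) + b2 * pdy h (lin q))"
  unfolding pd_cmult[OF smooth_comp[OF assms(1)] assms(2)] pd_lin[OF assms] by simp_all

lemma pd_clin2:
  assumes "smooth_on U h1" "smooth_on U h2" "q \<in> W"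
  shows "pdx (\<lambda>q. k * (i * h1 (lin q) + j * h2 (lin q))) q = k * (i * (a1 * pdx h1 (lin q) + b1 * pdy h1 (lin q))
      + j * (a1 * pdx h2 (lin q) + b1 * pdy h2 (lin q)))"
    "pdy (\<lambda>q. k * (i * h1 (lin q) + j * h2 (lin q))) q = k * (i * (a2 * pdx h1 (lin q) + b2 * pdy h1 (lin q))
      + j * (a2 * pdx h2 (lin q) + b2 * pdy h2 (lin q)))"
proof -
  have s: "smooth_on W (\<lambda>q. i * h1 (lin q))" "smooth_on W (\<lambda>q. j * h2 (lin q))"
    "smooth_on W (\<lambda>q. i * h1 (lin q) + j * h2 (lin q))"
    by (intro smooth_intros W smooth_comp assms)+
  show "pdx (\<lambda>q. k * (i * h1 (lin q) + j * h2 (lin q))) q = k * (i * (a1 * pdx h1 (lin q) + b1 * pdy h1 (lin q))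
      + j * (a1 * pdx h2 (lin q) + b1 * pdy h2 (lin q)))"
    "pdy (\<lambda>q. k * (i * h1 (lin q) + j * h2 (lin q))) q = k * (i * (a2 * pdx h1 (lin q) + b2 * pdy h1 (lin q))
      + j * (a2 * pdx h2 (lin q) + b2 * pdy h2 (lin q)))"
    unfolding pd_cmult[OF s(3) assms(3)] pd_add[OF s(1,2) assms(3)] pd_clin[OF assms(1,3)] pd_clin[OF assms(2,3)] by simp_all
qed

lemma smooth_g: "smooth_on W g"
  unfolding g_def[abs_def] by (intro smooth_intros W smooth_comp f)

lemma pd_g:
  assumes "q \<in> W"
  shows "pdx g q = c * (a1 * pdx f (lin q) + b1 * pdy f (lin q))"
    "pdy g q = c * (a2 * pdx f (lin q) + b2 * pdy f (lin q))"
  using pd_clin[OF f assms] unfolding g_def[abs_def] .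

lemma pd2_g:
  assumes q: "q \<in> W"
  shows "pdx (pdx g) q = c * (a1\<^sup>2 * pdx (pdx f) (lin q) + 2 * a1 * b1 * pdy (pdx f) (lin q) + b1\<^sup>2 * pdy (pdy f) (lin q))"
    "pdy (pdx g) q = c * (a1 * a2 * pdx (pdx f) (lin q) + (a1 * b2 + a2 * b1) * pdy (pdx f) (lin q) + b1 * b2 * pdy (pdy f) (lin q))"
    "pdy (pdy g) q = c * (a2\<^sup>2 * pdx (pdx f) (lin q) + 2 * a2 * b2 * pdy (pdx f) (lin q) + b2\<^sup>2 * pdy (pdy f) (lin q))"
proof -
  note s = smooth_on_pdx[OF U f] smooth_on_pdy[OF U f]
  have e1: "pdx (pdx g) q = pdx (\<lambda>q. c * (a1 * pdx f (lin q) + b1 * pdy f (lin q))) q"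
    and e2: "pdy (pdx g) q = pdy (\<lambda>q. c * (a1 * pdx f (lin q) + b1 * pdy f (lin q))) q"
    and e3: "pdy (pdy g) q = pdy (\<lambda>q. c * (a2 * pdx f (lin q) + b2 * pdy f (lin q))) q"
    by (rule pd_cong[OF W q], rule pd_g, assumption)+
  have e: "pdx (pdy f) (lin q) = pdy (pdx f) (lin q)" using pd_commute[OF U f] q by simp
  show "pdx (pdx g) q = c * (a1\<^sup>2 * pdx (pdx f) (lin q) + 2 * a1 * b1 * pdy (pdx f) (lin q) + b1\<^sup>2 * pdy (pdy f) (lin q))"
    unfolding e1 pd_clin2[OF s q] e by (simp add: algebra_simps power2_eq_square)
  show "pdy (pdx g) q = c * (a1 * a2 * pdx (pdx f) (lin q) + (a1 * b2 + a2 * b1) * pdy (pdx f) (lin q) + b1 * b2 * pdy (pdy f) (lin q))"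
    unfolding e2 pd_clin2[OF s q] e by (simp add: algebra_simps)
  show "pdy (pdy g) q = c * (a2\<^sup>2 * pdx (pdx f) (lin q) + 2 * a2 * b2 * pdy (pdx f) (lin q) + b2\<^sup>2 * pdy (pdy f) (lin q))"
    unfolding e3 pd_clin2[OF s q] e by (simp add: algebra_simps power2_eq_square)
qed

text \<open>The Hamiltonian field picks up the factor c times the determinant. The extra factor
  \<open>k\<close> of the differentiated function lets the rule be iterated, from
  \<open>infl\<close> and \<open>qn\<close> to \<open>vert\<close> and its derivative.\<close>

lemma tder_g:
  assumes "q \<in> W" "smooth_on U h" "\<And>q. q \<in> W \<Longrightarrow> u q = k * h (lin q)"
  shows "tder g u q = (c * dt * k) * tder f h (lin q)"
proof -
  have e: "pdx u q = pdx (\<lambda>q. k * h (lin q)) q" "pdy u q = pdy (\<lambda>q. k * h (lin q)) q"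
    by (rule pd_cong[OF W assms(1)], rule assms(3), assumption)+
  show ?thesis unfolding tder_def e pd_clin[OF assms(2,1)] pd_g[OF assms(1)] by algebra
qed

lemma infl_g: "q \<in> W \<Longrightarrow> infl g q = (c ^ 3 * dt\<^sup>2) * infl f (lin q)"
  unfolding infl_def pd2_g pd_g by algebra

lemma tinfl_g: "q \<in> W \<Longrightarrow> tder g (infl g) q = (c * dt * (c ^ 3 * dt\<^sup>2)) * tder f (infl f) (lin q)"
  by (rule tder_g[OF _ smooth_on_infl[OF U f] infl_g])

context
  fixes A B C A' B' C' :: real
  assumes A': "A' = A * a1\<^sup>2 + 2 * B * a1 * b1 + C * b1\<^sup>2"
    and B': "B' = A * a1 * a2 + B * (a1 * b2 + a2 * b1) + C * b1 * b2"
    and C': "C' = A * a2\<^sup>2 + 2 * B * a2 * b2 + C * b2\<^sup>2"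
begin

text \<open>\<open>qn\<close> is the squared length of the Hamiltonian vector (-f_y, f_x) in the
  metric A dx^2 + 2 B dx dy + C dy^2; accordingly \<open>A'\<close>, \<open>B'\<close>,
  \<open>C'\<close> are the coefficients of the metric pulled back by the linear map.\<close>

lemma qn_g: "q \<in> W \<Longrightarrow> qn A' B' C' g q = (c\<^sup>2 * dt\<^sup>2) * qn A B C f (lin q)"
  unfolding qn_def pd_g A' B' C' by algebra

lemma vert_g: "q \<in> W \<Longrightarrow> vert A' B' C' g q = (c ^ 6 * dt ^ 5) * vert A B C f (lin q)"
proof -
  assume q: "q \<in> W"
  have t: "tder g (qn A' B' C' g) q = (c * dt * (c\<^sup>2 * dt\<^sup>2)) * tder f (qn A B C f) (lin q)"
    by (rule tder_g[OF q smooth_on_qn[OF U f] qn_g])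
  show ?thesis unfolding vert_def qn_g[OF q] infl_g[OF q] tinfl_g[OF q] t by algebra
qed

lemma tvert_g: "q \<in> W \<Longrightarrow> tder g (vert A' B' C' g) q = (c * dt * (c ^ 6 * dt ^ 5)) * tder f (vert A B C f) (lin q)"
  by (rule tder_g[OF _ smooth_on_vert[OF U f] vert_g])

end

end

section \<open>The middle part of a smoothing\<close>

context node begin

text \<open>In this region the value t of \<open>f\<close> is comparable with r^2, so xy \<ge> t /
  2. The leading terms are at least constant multiples of t or t r^2, while the errors, of one
  degree more, are small multiples of them.\<close>

lemma middle:
  assumes M: "M \<ge> 1"
  obtains \<delta> where "\<delta> > 0" "\<And>x y. 0 < f (x, y) \<Longrightarrow> f (x, y) < \<delta> \<Longrightarrow> norm (x, y) ^ 2 \<le> M * f (x, y) \<Longrightarrow>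
     infl f (x, y) < 0 \<and> Sf (x, y) > 0 \<and> (2 * C * y\<^sup>2 \<le> A * x\<^sup>2 \<longrightarrow> Vf (x, y) < 0) \<and> (2 * A * x\<^sup>2 \<le> C * y\<^sup>2 \<longrightarrow> Vf (x, y) > 0)"
proof -
  obtain K r0 where K: "K \<ge> 1" and r0: "0 < r0" "r0 \<le> 1" "ball 0 r0 \<subseteq> U"
    and est: 
    "\<And>p. norm p < r0 \<Longrightarrow> \<bar>f p - fst p * snd p\<bar> \<le> K * norm p ^ 3"
    "\<And>p. norm p < r0 \<Longrightarrow> \<bar>infl f p - - 2 * (fst p * snd p)\<bar> \<le> K * norm p ^ 3"
    "\<And>p. norm p < r0 \<Longrightarrow> \<bar>Vf p - 12 * (fst p * snd p) * (C * snd p ^ 2 - A * fst p ^ 2)\<bar> \<le> K * norm p ^ 5"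
    "\<And>p. norm p < r0 \<Longrightarrow> \<bar>Sf p - 24 * (fst p * snd p) * (C * snd p ^ 2 + A * fst p ^ 2)\<bar> \<le> K * norm p ^ 5"
    by (rule estimates) blast
  define m where "m = min A C"
  have m: "m > 0" "m \<le> A" "m \<le> C" using pos by (auto simp: m_def)
  \<comment> \<open>If one axis dominates as in the conditional claims, then x^2 \<ge> c1 r^2,
    respectively y^2 \<ge> c2 r^2.\<close>
  define c1 where "c1 = 2 * C / (2 * C + A)"
  define c2 where "c2 = 2 * A / (2 * A + C)"
  have c12: "c1 > 0" "c2 > 0" using pos by (auto simp: c1_def c2_def)
  \<comment> \<open>The tolerated ratio of the errors K r^3 and K r^5 to t and t r^2, one bound for
    each of the claims; the radius \<open>e\<close> is then chosen with K M e \<le> d.\<close>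
  define d where "d = min (1/4) (min (6 * m) (min (2 * A * c1) (2 * C * c2)))"
  have d: "d > 0" "d \<le> 1/4" "d \<le> 6 * m" "d \<le> 2 * A * c1" "d \<le> 2 * C * c2"
    using m pos c12 by (auto simp: d_def)
  define e where "e = min r0 (d / (K * M))"
  have KM: "K * M > 0" using K M by auto
  have e: "e > 0" "e \<le> r0" using r0 d KM by (auto simp: e_def)
  have "K * M * e \<le> K * M * (d / (K * M))" using KM by (intro mult_left_mono) (auto simp: e_def)
  moreover have "K * M * (d / (K * M)) = d"
    using KM by (metis less_irrefl nonzero_mult_div_cancel_left times_divide_eq_right)
  ultimately have KMe: "K * M * e \<le> d" by simp
  have main: "infl f (x, y) < 0 \<and> Sf (x, y) > 0 \<and> (2 * C * y\<^sup>2 \<le> A * x\<^sup>2 \<longrightarrow> Vf (x, y) < 0) \<and> (2 * A * x\<^sup>2 \<le> C * y\<^sup>2 \<longrightarrow> Vf (x, y) > 0)"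
    if \<tau>: "0 < f (x, y)" "f (x, y) < e\<^sup>2 / M" "norm (x, y) ^ 2 \<le> M * f (x, y)" for x y
  proof -
    define t where "t = f (x, y)"
    define r where "r = norm (x, y)"
    have r2: "r ^ 2 = x\<^sup>2 + y\<^sup>2" by (simp add: r_def norm_Pair)
    have "r ^ 2 < e ^ 2" using \<tau> M by (simp add: r_def field_simps)
    then have re: "r < e" using e by (simp add: power_less_imp_less_base)
    have rn: "r \<ge> 0" by (simp add: r_def)
    have t: "t > 0" using \<tau> by (simp add: t_def)
    have "K * r ^ 3 = K * r * r ^ 2" by (simp add: power_numeral_reduce)
    also have "\<dots> \<le> K * e * (M * t)" using \<tau> re K rn e M t by (intro mult_mono) (auto simp: r_def t_def)
    also have "\<dots> = K * M * e * t" by simp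
    also have "\<dots> \<le> d * t" using KMe t by (intro mult_right_mono) auto
    finally have k3: "K * r ^ 3 \<le> d * t" .
    have "K * r ^ 5 = K * r ^ 3 * r ^ 2" by (simp add: power_numeral_reduce)
    also have "\<dots> \<le> d * t * r ^ 2" using k3 by (intro mult_right_mono) auto
    finally have k5: "K * r ^ 5 \<le> d * t * r ^ 2" .
    have rr: "norm (x, y) < r0" using re e by (simp add: r_def)
    note E = est[OF rr, folded r_def, unfolded fst_conv snd_conv]
    have "d * t \<le> 1/4 * t" using d t by (intro mult_right_mono) auto
    then have xy: "x * y \<ge> t / 2" "d * t \<le> t / 4" using E(1) k3 by (auto simp: t_def abs_le_iff)
    have "x * y > 0" using xy t by linarith
    then have "x \<noteq> 0" by auto
    then have r2pos: "r ^ 2 > 0" unfolding r2 by (simp add: sum_power2_gt_zero_iff)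
    have 1: "infl f (x, y) < 0" using E(2) k3 xy t unfolding abs_le_iff by linarith
    have tr: "t * r ^ 2 > 0" using t r2pos by simp
    have 2: "Sf (x, y) > 0"
    proof -
      have "m * r ^ 2 \<le> C * y ^ 2 + A * x ^ 2"
        unfolding r2 distrib_left using m by (smt (verit) mult_right_mono zero_le_power2)
      then have "24 * (t / 2) * (m * r ^ 2) \<le> 24 * (x * y) * (C * y ^ 2 + A * x ^ 2)"
        using xy t m r2pos by (intro mult_mono) auto
      moreover have "d * (t * r ^ 2) \<le> 6 * m * (t * r ^ 2)" using d tr by (intro mult_right_mono) auto
      moreover have "6 * m * (t * r ^ 2) > 0" using m tr by simp
      ultimately show ?thesis using E(4) k5 by (simp add: abs_le_iff algebra_simps)
    qed
    have 3: "Vf (x, y) < 0" if "2 * C * y\<^sup>2 \<le> A * x\<^sup>2"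
    proof -
      have "(2 * C + A) * x\<^sup>2 \<ge> 2 * C * r ^ 2" using that by (simp add: r2 algebra_simps)
      then have x2: "x\<^sup>2 \<ge> c1 * r ^ 2" using pos by (simp add: c1_def field_simps)
      have "12 * (x * y) * (C * y ^ 2 - A * x ^ 2) \<le> 12 * (x * y) * (- (A / 2 * (c1 * r ^ 2)))"
      proof (intro mult_left_mono)
        have "A / 2 * (c1 * r ^ 2) \<le> A / 2 * x\<^sup>2" using x2 pos by (intro mult_left_mono) auto
        then show "C * y ^ 2 - A * x ^ 2 \<le> - (A / 2 * (c1 * r ^ 2))" using that by simp
      qed (use xy t in auto)
      also have "\<dots> \<le> 12 * (t / 2) * (- (A / 2 * (c1 * r ^ 2)))"
        using xy pos c12 r2pos by (intro mult_right_mono_neg) auto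
      also have "\<dots> = - (3 * (A * c1) * (t * r ^ 2))" by simp
      finally have "Vf (x, y) \<le> - (3 * (A * c1) * (t * r ^ 2)) + d * (t * r ^ 2)"
        using E(3) k5 by (simp add: abs_le_iff algebra_simps)
      also have "d * (t * r ^ 2) \<le> 2 * A * c1 * (t * r ^ 2)" using d tr by (intro mult_right_mono) auto
      finally have "Vf (x, y) \<le> - (A * c1 * (t * r ^ 2))" by simp
      also have "\<dots> < 0" using pos c12 tr by simp
      finally show ?thesis .
    qed
    have 4: "Vf (x, y) > 0" if "2 * A * x\<^sup>2 \<le> C * y\<^sup>2"
    proof -
      have "(2 * A + C) * y\<^sup>2 \<ge> 2 * A * r ^ 2" using that by (simp add: r2 algebra_simps)
      then have y2: "y\<^sup>2 \<ge> c2 * r ^ 2" using pos by (simp add: c2_def field_simps)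
      have "12 * (t / 2) * (C / 2 * (c2 * r ^ 2)) \<le> 12 * (x * y) * (C / 2 * (c2 * r ^ 2))"
        using xy pos c12 r2pos by (intro mult_right_mono) auto
      also have "\<dots> \<le> 12 * (x * y) * (C * y ^ 2 - A * x ^ 2)"
      proof (intro mult_left_mono)
        have "C / 2 * (c2 * r ^ 2) \<le> C / 2 * y\<^sup>2" using y2 pos by (intro mult_left_mono) auto
        then show "C / 2 * (c2 * r ^ 2) \<le> C * y ^ 2 - A * x ^ 2" using that by simp
      qed (use xy t in auto)
      finally have "3 * (C * c2) * (t * r ^ 2) - d * (t * r ^ 2) \<le> Vf (x, y)"
        using E(3) k5 by (simp add: abs_le_iff algebra_simps)
      moreover have "d * (t * r ^ 2) \<le> 2 * C * c2 * (t * r ^ 2)" using d tr by (intro mult_right_mono) auto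
      moreover have "C * c2 * (t * r ^ 2) > 0" using pos c12 tr by simp
      ultimately show ?thesis by simp
    qed
    show ?thesis using 1 2 3 4 by blast
  qed
  show thesis by (rule that[of "e\<^sup>2 / M"]) (use e M main in auto)
qed

text \<open>Everything follows from f = xy + small error and 4 xy = (x + y)^2 - (x - y)^2. The
  threshold (x - y)^2 = 8 f / \<nu> separates the cones about the axes, where \<open>zone\<close>
  applies, from the part near the diagonal, where \<open>middle\<close> applies with M = 16 / \<nu>
  + 4.\<close>

lemma level_geometry:
  assumes \<nu>: "0 < \<nu>" "\<nu> \<le> 1"
  obtains r where "0 < r" "ball 0 r \<subseteq> U"
    "\<And>x y. norm (x, y) < r \<Longrightarrow> 0 < f (x, y) \<Longrightarrow> x + y \<noteq> 0"
    "\<And>x y. norm (x, y) < r \<Longrightarrow> 0 < f (x, y) \<Longrightarrow> 0 < x + y \<Longrightarrow> pdx f (x, y) + pdy f (x, y) > 0"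
    "\<And>x y. norm (x, y) < r \<Longrightarrow> 0 < f (x, y) \<Longrightarrow> 0 < x + y \<Longrightarrow> x - y \<ge> 0 \<Longrightarrow> 8 / \<nu> * f (x, y) \<le> (x - y)\<^sup>2 \<Longrightarrow>
       0 < x \<and> \<bar>y\<bar> \<le> \<nu> * x"
    "\<And>x y. norm (x, y) < r \<Longrightarrow> 0 < f (x, y) \<Longrightarrow> 0 < x + y \<Longrightarrow> x - y \<le> 0 \<Longrightarrow> 8 / \<nu> * f (x, y) \<le> (x - y)\<^sup>2 \<Longrightarrow>
       0 < y \<and> \<bar>x\<bar> \<le> \<nu> * y"
    "\<And>x y. norm (x, y) < r \<Longrightarrow> 0 < f (x, y) \<Longrightarrow> (x - y)\<^sup>2 \<le> 8 / \<nu> * f (x, y) \<Longrightarrow>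
       norm (x, y) ^ 2 \<le> (16 / \<nu> + 4) * f (x, y)"
    "\<And>x y. norm (x, y) < r \<Longrightarrow> 0 < f (x, y) \<Longrightarrow> (x - y)\<^sup>2 / 4 < (x + y)\<^sup>2"
    "\<And>x y. norm (x, y) < r \<Longrightarrow> \<bar>f (x, y) - x * y\<bar> \<le> (x\<^sup>2 + y\<^sup>2) / 16"
    "\<And>x y. norm (x, y) < r \<Longrightarrow> \<bar>x - y\<bar> / 2 < x + y \<Longrightarrow> pdx f (x, y) + pdy f (x, y) > 0"
proof -
  obtain K r0 where K: "K \<ge> 1" and r0: "0 < r0" "r0 \<le> 1" "ball 0 r0 \<subseteq> U"
    and est: 
    "\<And>p. norm p < r0 \<Longrightarrow> \<bar>f p - fst p * snd p\<bar> \<le> K * norm p ^ 3"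
    "\<And>p. norm p < r0 \<Longrightarrow> \<bar>pdx f p - snd p\<bar> \<le> K * norm p ^ 2"
    "\<And>p. norm p < r0 \<Longrightarrow> \<bar>pdy f p - fst p\<bar> \<le> K * norm p ^ 2"
    by (rule estimates) blast
  define r where "r = min r0 (\<nu> / (16 * K))"
  have r: "0 < r" "r \<le> r0" "K * r \<le> \<nu> / 16"
    using r0 \<nu> K by (auto simp: r_def min_def field_simps)
  have a: "\<bar>f (x, y) - x * y\<bar> \<le> \<nu> / 16 * (x\<^sup>2 + y\<^sup>2)" if "norm (x, y) < r" for x y
  proof -
    have "K * norm (x, y) ^ 3 = (K * norm (x, y)) * (norm (x, y)) ^ 2" by (simp add: power_numeral_reduce)
    also have "\<dots> \<le> (\<nu> / 16) * (norm (x, y)) ^ 2"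
    proof (intro mult_right_mono)
      have "K * norm (x, y) \<le> K * r" using that K by (intro mult_left_mono) auto
      then show "K * norm (x, y) \<le> \<nu> / 16" using r by simp
    qed auto
    finally show ?thesis using est(1)[of "(x, y)"] that r by (simp add: norm_Pair)
  qed
  have a': "\<bar>f (x, y) - x * y\<bar> \<le> (x\<^sup>2 + y\<^sup>2) / 16" if "norm (x, y) < r" for x y
  proof -
    have "\<nu> / 16 * (x\<^sup>2 + y\<^sup>2) \<le> 1 / 16 * (x\<^sup>2 + y\<^sup>2)" using \<nu> by (intro mult_right_mono) auto
    then show ?thesis using a[OF that] by simp
  qed
  have b: "(x - y)\<^sup>2 / 4 < (x + y)\<^sup>2" if "norm (x, y) < r" "0 < f (x, y)" for x y
  proof -
    define S D P m where "S = x\<^sup>2 + y\<^sup>2" and "D = (x - y)\<^sup>2" and "P = (x + y)\<^sup>2" and "m = x * y"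
    have "P = S + 2 * m" "D = S - 2 * m" "S \<ge> 0"
      by (simp_all add: S_def D_def P_def m_def power2_eq_square algebra_simps)
    moreover have "f (x, y) - m \<le> S / 16" using abs_le_D1[OF a'[OF that(1)]] by (simp add: S_def m_def)
    ultimately have "D / 4 < P" using that(2) by linarith
    then show ?thesis by (simp add: D_def P_def)
  qed
  have c: "pdx f (x, y) + pdy f (x, y) > 0" if n: "norm (x, y) < r" and xy: "\<bar>x - y\<bar> / 2 < x + y" for x y
  proof -
    have q: "x + y > 0" by (rule le_less_trans[OF _ xy]) simp
    define S D P where "S = x\<^sup>2 + y\<^sup>2" and "D = (x - y)\<^sup>2" and "P = (x + y)\<^sup>2"
    have "\<bar>x - y\<bar> \<le> \<bar>2 * (x + y)\<bar>" using xy q by simp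
    then have "(x - y)\<^sup>2 \<le> (2 * (x + y))\<^sup>2" by (simp only: abs_le_square_iff)
    moreover have P4: "(2 * (x + y))\<^sup>2 = 4 * P" unfolding P_def power_mult_distrib by simp
    moreover have "2 * S = P + D" by (simp add: S_def D_def P_def power2_eq_square algebra_simps)
    moreover have "P \<ge> 0" unfolding P_def by (rule zero_le_power2)
    ultimately have "S \<le> 4 * P" by (simp add: D_def)
    moreover have "norm (x, y) ^ 2 = S" by (simp add: norm_Pair S_def)
    ultimately have "norm (x, y) ^ 2 \<le> (2 * (x + y))\<^sup>2" unfolding P4 by simp
    then have "norm (x, y) \<le> 2 * (x + y)" by (rule power2_le_imp_le) (use q in simp)
    note nle = this
    have "K * norm (x, y) \<le> K * r" using n K by (intro mult_left_mono) auto
    then have k: "K * norm (x, y) \<le> 1 / 16" using r \<nu> by simp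
    have "(K * norm (x, y)) * norm (x, y) \<le> (1 / 16) * (2 * (x + y))"
      by (rule mult_mono[OF k nle]) simp_all
    then have "K * norm (x, y) ^ 2 \<le> (x + y) / 8" by (simp add: power2_eq_square)
    moreover have "\<bar>pdx f (x, y) - y\<bar> \<le> K * norm (x, y) ^ 2" "\<bar>pdy f (x, y) - x\<bar> \<le> K * norm (x, y) ^ 2"
      using est(2,3)[of "(x, y)"] n r by simp_all
    ultimately have "y - pdx f (x, y) \<le> (x + y) / 8" "x - pdy f (x, y) \<le> (x + y) / 8"
      by (smt (verit))+
    then show ?thesis using q by simp
  qed
  have c': "\<bar>x - y\<bar> / 2 < x + y" if "norm (x, y) < r" "0 < f (x, y)" "0 < x + y" for x y
  proof -
    have "(\<bar>x - y\<bar> / 2)\<^sup>2 < (x + y)\<^sup>2" using b[OF that(1,2)] by (simp add: power_divide)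
    then show ?thesis by (rule power_less_imp_less_base) (use that(3) in simp)
  qed
  have d: "0 < x \<and> \<bar>y\<bar> \<le> \<nu> * x"
    if e: "\<bar>t - x * y\<bar> \<le> \<nu> / 16 * (x\<^sup>2 + y\<^sup>2)" and t: "0 < t" and xy: "0 < x + y" "0 \<le> x - y"
      and big: "8 / \<nu> * t \<le> (x - y)\<^sup>2" for x y t :: real
  proof -
    have x: "x > 0" "\<bar>y\<bar> \<le> x" using xy by auto
    have y2: "y\<^sup>2 \<le> x\<^sup>2" using x by (simp add: abs_le_square_iff[symmetric])
    have "(x - y)\<^sup>2 \<le> (2 * x)\<^sup>2" using xy x by (intro power_mono) auto
    then have "8 / \<nu> * t \<le> 4 * x\<^sup>2" using big by (simp add: power_mult_distrib)
    then have "t \<le> \<nu> / 2 * x\<^sup>2" using \<nu> by (simp add: field_simps)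
    moreover have "\<nu> / 16 * (x\<^sup>2 + y\<^sup>2) \<le> \<nu> / 16 * (2 * x\<^sup>2)" using \<nu> y2 by (intro mult_left_mono) auto
    moreover have "\<nu> * x\<^sup>2 \<ge> 0" using \<nu> by simp
    ultimately have "\<bar>x * y\<bar> \<le> \<nu> * x\<^sup>2" using e t by linarith
    then have "x * \<bar>y\<bar> \<le> x * (\<nu> * x)" using x by (simp add: abs_mult power2_eq_square mult.left_commute)
    then show ?thesis using x by simp
  qed
  have ne: "x + y \<noteq> 0" if "norm (x, y) < r" "0 < f (x, y)" for x y
  proof
    assume "x + y = 0"
    with b[OF that] show False by (simp add: not_less)
  qed
  have d2: "0 < y \<and> \<bar>x\<bar> \<le> \<nu> * y"
    if "norm (x, y) < r" "0 < f (x, y)" "0 < x + y" "x - y \<le> 0" "8 / \<nu> * f (x, y) \<le> (x - y)\<^sup>2" for x y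
    by (rule d[of "f (x, y)" y x])
      (use that a[OF that(1)] in \<open>simp_all add: mult.commute add.commute power2_commute\<close>)
  have n2: "norm (x, y) ^ 2 \<le> (16 / \<nu> + 4) * f (x, y)"
    if n: "norm (x, y) < r" and t: "0 < f (x, y)" and le: "(x - y)\<^sup>2 \<le> 8 / \<nu> * f (x, y)" for x y
  proof -
    define S D m where "S = x\<^sup>2 + y\<^sup>2" and "D = (x - y)\<^sup>2" and "m = x * y"
    define E where "E = 8 / \<nu> * f (x, y)"
    have "S = D + 2 * m" by (simp add: S_def D_def m_def power2_eq_square algebra_simps)
    moreover have "m - f (x, y) \<le> 1 / 16 * S" using abs_le_D2[OF a'[OF n]] by (simp add: S_def m_def)
    moreover have "D \<le> E" using le by (simp add: D_def E_def)
    moreover have "E \<ge> 0" using \<nu> t by (simp add: E_def)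
    ultimately have "S \<le> 2 * E + 4 * f (x, y)" using t by linarith
    moreover have "(16 / \<nu> + 4) * f (x, y) = 2 * E + 4 * f (x, y)" by (simp add: E_def distrib_right)
    moreover have "norm (x, y) ^ 2 = S" by (simp add: norm_Pair S_def)
    ultimately show ?thesis by simp
  qed
  show thesis
  proof (rule that)
    show "0 < r" "ball 0 r \<subseteq> U" using r r0 by auto
    show "\<And>x y. norm (x, y) < r \<Longrightarrow> 0 < f (x, y) \<Longrightarrow> x + y \<noteq> 0" by (rule ne)
    show "\<And>x y. norm (x, y) < r \<Longrightarrow> 0 < f (x, y) \<Longrightarrow> 0 < x + y \<Longrightarrow> pdx f (x, y) + pdy f (x, y) > 0" by (rule c[OF _ c'])
    show "\<And>x y. norm (x, y) < r \<Longrightarrow> 0 < f (x, y) \<Longrightarrow> 0 < x + y \<Longrightarrow> x - y \<ge> 0 \<Longrightarrow> 8 / \<nu> * f (x, y) \<le> (x - y)\<^sup>2 \<Longrightarrow>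
       0 < x \<and> \<bar>y\<bar> \<le> \<nu> * x" by (rule d[OF a])
    show "\<And>x y. norm (x, y) < r \<Longrightarrow> 0 < f (x, y) \<Longrightarrow> 0 < x + y \<Longrightarrow> x - y \<le> 0 \<Longrightarrow> 8 / \<nu> * f (x, y) \<le> (x - y)\<^sup>2 \<Longrightarrow>
       0 < y \<and> \<bar>x\<bar> \<le> \<nu> * y" by (rule d2)
    show "\<And>x y. norm (x, y) < r \<Longrightarrow> 0 < f (x, y) \<Longrightarrow> (x - y)\<^sup>2 \<le> 8 / \<nu> * f (x, y) \<Longrightarrow>
       norm (x, y) ^ 2 \<le> (16 / \<nu> + 4) * f (x, y)" by (rule n2)
    show "\<And>x y. norm (x, y) < r \<Longrightarrow> 0 < f (x, y) \<Longrightarrow> (x - y)\<^sup>2 / 4 < (x + y)\<^sup>2" by (rule b)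
    show "\<And>x y. norm (x, y) < r \<Longrightarrow> \<bar>f (x, y) - x * y\<bar> \<le> (x\<^sup>2 + y\<^sup>2) / 16" by (rule a')
    show "\<And>x y. norm (x, y) < r \<Longrightarrow> \<bar>x - y\<bar> / 2 < x + y \<Longrightarrow> pdx f (x, y) + pdy f (x, y) > 0" by (rule c)
  qed
qed

end


section \<open>Level curves as graphs in the coordinates x - y and x + y\<close>

context node begin

text \<open>With p = x - y and q = x + y, \<open>f\<close> is about (q^2 - p^2) / 4 and increases
  with q for q > |p| / 2. It is below t at q = |p| / 2 and above t at q = 2 r, so the implicit
  function theorem gives the level over the whole interval. Points of the level in the smaller ball
  satisfy q > |p| / 2 and hence lie on this graph.\<close>

lemma level_graph:
  assumes rr: "0 < rr"
  obtains r where "0 < r" "4 * r \<le> rr"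
    "\<And>t. 0 < t \<Longrightarrow> t < r\<^sup>2 / 4 \<Longrightarrow> \<exists>c. smooth_on {-r<..<r} c \<and> (\<forall>p\<in>{-r<..<r}. fst (c p) - snd (c p) = p \<and>
       \<bar>p\<bar> / 2 < fst (c p) + snd (c p) \<and> norm (c p) < 4 * r \<and> f (c p) = t) \<and>
       (\<forall>x y. norm (x, y) < r / 2 \<longrightarrow> 0 < x + y \<longrightarrow> f (x, y) = t \<longrightarrow> x - y \<in> {-r<..<r} \<and> (x, y) = c (x - y))"
    "ball 0 (4 * r) \<subseteq> U" 
proof -
  obtain r0 where r0: "0 < r0" "ball 0 r0 \<subseteq> U"
    and b: "\<And>x y. norm (x, y) < r0 \<Longrightarrow> 0 < f (x, y) \<Longrightarrow> (x - y)\<^sup>2 / 4 < (x + y)\<^sup>2"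
    and a: "\<And>x y. norm (x, y) < r0 \<Longrightarrow> \<bar>f (x, y) - x * y\<bar> \<le> (x\<^sup>2 + y\<^sup>2) / 16"
    and d: "\<And>x y. norm (x, y) < r0 \<Longrightarrow> \<bar>x - y\<bar> / 2 < x + y \<Longrightarrow> pdx f (x, y) + pdy f (x, y) > 0"
    by (rule level_geometry[of 1]) auto
  define r where "r = min r0 rr / 4"
  have r: "r > 0" "4 * r \<le> r0" "4 * r \<le> rr" using r0 rr by (auto simp: r_def)
  have sub4: "ball 0 (4 * r) \<subseteq> U"
    by (rule subset_trans[OF subset_ball r0(2)]) (rule r(2))
  define W where "W = {z :: real \<times> real. \<bar>fst z\<bar> < r \<and> \<bar>fst z\<bar> / 2 < snd z \<and> snd z < 2 * r}"
  have W: "open W" unfolding W_def by (intro open_Collect_conj open_Collect_less continuous_intros) auto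
  define X where "X = (\<lambda>z :: real \<times> real. (snd z + fst z) / 2)"
  define Y where "Y = (\<lambda>z :: real \<times> real. (snd z - fst z) / 2)"
  have nrm: "norm (X (p, q), Y (p, q)) < 4 * r" if "\<bar>p\<bar> < r" "\<bar>p\<bar> / 2 \<le> q" "q \<le> 2 * r" for p q
  proof -
    have q: "\<bar>q\<bar> = q" using that by auto
    have "\<bar>q + p\<bar> \<le> q + \<bar>p\<bar>" "\<bar>q - p\<bar> \<le> q + \<bar>p\<bar>"
      using abs_triangle_ineq[of q p] abs_triangle_ineq4[of q p] q by simp_all
    then have XY: "\<bar>X (p, q)\<bar> \<le> (q + \<bar>p\<bar>) / 2" "\<bar>Y (p, q)\<bar> \<le> (q + \<bar>p\<bar>) / 2" by (simp_all add: X_def Y_def)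
    have "norm (X (p, q), Y (p, q)) \<le> \<bar>X (p, q)\<bar> + \<bar>Y (p, q)\<bar>" using norm_Pair_le[of "X (p, q)" "Y (p, q)"] by simp
    also have "\<dots> \<le> (q + \<bar>p\<bar>) / 2 + (q + \<bar>p\<bar>) / 2" using XY by (rule add_mono)
    also have "\<dots> = q + \<bar>p\<bar>" by simp
    also have "\<dots> < 4 * r" using that r by linarith
    finally show ?thesis .
  qed
  have inU: "(X z, Y z) \<in> U" if "z \<in> W" for z
  proof -
    have "norm (X (fst z, snd z), Y (fst z, snd z)) < 4 * r" using that by (intro nrm) (auto simp: W_def)
    then show ?thesis using sub4 by (auto simp: subset_iff)
  qed
  have sXY: "smooth_on W X" "smooth_on W Y" unfolding X_def Y_def by (intro smooth_intros W; simp)+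
  have sf: "smooth_on W (\<lambda>z. f (X z, Y z))"
    by (rule smooth_on_compose[OF f W U(1)]) (intro smooth_intros W sXY, use inU in auto)
  have XY: "X (x - y, x + y) = x" "Y (x - y, x + y) = y" for x y by (auto simp: X_def Y_def)
  have XYa: "X z + Y z = snd z" "X z - Y z = fst z" for z by (auto simp: X_def Y_def field_simps)
  show thesis
  proof (rule that[of r])
    show "0 < r" "4 * r \<le> rr" by fact+
    show "ball 0 (4 * r) \<subseteq> U" by (rule sub4)
    fix t :: real assume t: "0 < t" "t < r\<^sup>2 / 4"
    define g where "g = (\<lambda>z. f (X z, Y z) - t)"
    have sg: "smooth_on W g" unfolding g_def by (intro smooth_intros W sf)
    have gpos: "frechet_derivative g (at z) (0, 1) > 0" if z: "z \<in> W" for z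
    proof -
      have "frechet_derivative g (at z) (0, 1) = pdy (\<lambda>z. f (X z, Y z)) z"
        using pd_diff(2)[OF sf smooth_on_const[OF W] z] by (simp add: pdy_def g_def)
      also have "\<dots> = pdx f (X z, Y z) * pdy X z + pdy f (X z, Y z) * pdy Y z"
        by (rule pd_compose(2)[OF f sXY z inU[OF z]])
      also have "pdy X z = 1 / 2"
        using pd_cmult(2)[of UNIV "\<lambda>z. snd z + fst z" z "1 / 2"] by (simp add: X_def pd_simps smooth_intros)
      also have "pdy Y z = 1 / 2"
        using pd_cmult(2)[of UNIV "\<lambda>z. snd z - fst z" z "1 / 2"] by (simp add: Y_def pd_simps smooth_intros)
      also have "pdx f (X z, Y z) * (1/2) + pdy f (X z, Y z) * (1/2) = (pdx f (X z, Y z) + pdy f (X z, Y z)) / 2" by simp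
      also have "\<dots> > 0"
      proof -
        have "norm (X (fst z, snd z), Y (fst z, snd z)) < r0" using z nrm[of "fst z" "snd z"] r by (auto simp: W_def)
        then show ?thesis using d[of "X z" "Y z"] z unfolding XYa by (auto simp: W_def)
      qed
      finally show ?thesis .
    qed
    have ex: "\<exists>q. (p, q) \<in> W \<and> g (p, q) = 0" if p: "p \<in> {-r<..<r}" for p
    proof -
      have pr: "\<bar>p\<bar> < r" using p by auto
      have aq: "\<bar>f (X (p, q), Y (p, q)) - (q\<^sup>2 - p\<^sup>2) / 4\<bar> \<le> (q\<^sup>2 + p\<^sup>2) / 32" if "\<bar>p\<bar> / 2 \<le> q" "q \<le> 2 * r" for q
        using a[of "X (p, q)" "Y (p, q)"] nrm[OF pr that] r
        by (simp add: X_def Y_def power2_eq_square field_simps)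
      have p2: "p\<^sup>2 \<le> r\<^sup>2" using pr by (simp add: abs_le_square_iff[symmetric])
      have aq': "32 * f (X (p, q), Y (p, q)) - 8 * (q\<^sup>2 - p\<^sup>2) \<le> q\<^sup>2 + p\<^sup>2"
        "8 * (q\<^sup>2 - p\<^sup>2) - 32 * f (X (p, q), Y (p, q)) \<le> q\<^sup>2 + p\<^sup>2" if "\<bar>p\<bar> / 2 \<le> q" "q \<le> 2 * r" for q
        using abs_le_D1[OF aq[OF that]] abs_le_D2[OF aq[OF that]] by (simp_all add: field_simps)
      \<comment> \<open>At q = |p| / 2 the main part is -3 p^2 / 16 and the error at most 5 p^2 /
        128, so the value is not positive. At q = 2 r the value is at least 19 r^2 / 32, more than
        r^2 / 4.\<close>
      define h where "h = \<bar>p\<bar> / 2"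
      have "4 * h\<^sup>2 = p\<^sup>2" by (simp add: h_def power_divide)
      moreover have "p\<^sup>2 \<ge> 0" by (rule zero_le_power2)
      moreover have "32 * f (X (p, h), Y (p, h)) - 8 * (h\<^sup>2 - p\<^sup>2) \<le> h\<^sup>2 + p\<^sup>2"
        by (rule aq'(1)) (use pr r(1) in \<open>simp_all add: h_def\<close>)
      ultimately have "f (X (p, h), Y (p, h)) < t" using t(1) by (smt (verit))
      then have lo: "f (X (p, \<bar>p\<bar> / 2), Y (p, \<bar>p\<bar> / 2)) < t" by (simp only: h_def)
      have "(2 * r)\<^sup>2 = 4 * r\<^sup>2" "4 * t < r\<^sup>2" using t(2) by (simp_all add: power_mult_distrib)
      moreover have "\<bar>p\<bar> / 2 \<le> 2 * r" using pr r(1) by simp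
      ultimately have hi: "t < f (X (p, 2 * r), Y (p, 2 * r))"
        using aq'(2)[OF _ order_refl] p2 t(1) by (smt (verit))
      have "\<exists>q. \<bar>p\<bar> / 2 \<le> q \<and> q \<le> 2 * r \<and> f (X (p, q), Y (p, q)) = t"
      proof (rule IVT')
        show "continuous_on {\<bar>p\<bar> / 2..2 * r} (\<lambda>q. f (X (p, q), Y (p, q)))"
        proof (rule continuous_on_compose2[OF smooth_on_continuous[OF f]])
          show "continuous_on {\<bar>p\<bar> / 2..2 * r} (\<lambda>q. (X (p, q), Y (p, q)))"
            unfolding X_def Y_def by (intro continuous_intros) auto
          show "(\<lambda>q. (X (p, q), Y (p, q))) ` {\<bar>p\<bar> / 2..2 * r} \<subseteq> U"
            using nrm[OF pr] sub4 by (auto simp: subset_iff)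
        qed
      qed (use lo hi pr in auto)
      then obtain q where q: "\<bar>p\<bar> / 2 \<le> q" "q \<le> 2 * r" "f (X (p, q), Y (p, q)) = t" by blast
      have "q \<noteq> \<bar>p\<bar> / 2" "q \<noteq> 2 * r" using q(3) lo hi by (metis less_irrefl)+
      then show ?thesis using q pr by (intro exI[of _ q]) (auto simp: W_def g_def)
    qed
    obtain Q where Q: "smooth_on {-r<..<r} Q" "\<And>p. p \<in> {-r<..<r} \<Longrightarrow> (p, Q p) \<in> W"
      "\<And>p. p \<in> {-r<..<r} \<Longrightarrow> g (p, Q p) = 0" "\<And>p q. p \<in> {-r<..<r} \<Longrightarrow> (p, q) \<in> W \<Longrightarrow> g (p, q) = 0 \<Longrightarrow> q = Q p"
      by (rule implicit_function[OF W sg gpos _ open_greaterThanLessThan ex]) (auto simp: W_def)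
    define c where "c = (\<lambda>p. (X (p, Q p), Y (p, Q p)))"
    have sc: "smooth_on {-r<..<r} c"
      unfolding c_def X_def Y_def by (intro smooth_intros; (rule Q(1))?; simp)
    show "\<exists>c. smooth_on {-r<..<r} c \<and> (\<forall>p\<in>{-r<..<r}. fst (c p) - snd (c p) = p \<and>
       \<bar>p\<bar> / 2 < fst (c p) + snd (c p) \<and> norm (c p) < 4 * r \<and> f (c p) = t) \<and>
       (\<forall>x y. norm (x, y) < r / 2 \<longrightarrow> 0 < x + y \<longrightarrow> f (x, y) = t \<longrightarrow> x - y \<in> {-r<..<r} \<and> (x, y) = c (x - y))"
    proof (intro exI[of _ c] conjI sc ballI allI impI)
      fix p assume p: "p \<in> {-r<..<r}"
      show "fst (c p) - snd (c p) = p" "\<bar>p\<bar> / 2 < fst (c p) + snd (c p)" "norm (c p) < 4 * r" "f (c p) = t"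
        using Q(2,3)[OF p] nrm[of p "Q p"] unfolding c_def fst_conv snd_conv XYa by (auto simp: W_def g_def)
    next
      fix x y assume n: "norm (x, y) < r / 2" and q: "0 < x + y" and ft: "f (x, y) = t"
      have xy: "\<bar>x\<bar> < r / 2" "\<bar>y\<bar> < r / 2" using n norm_fst_le[of x y] norm_snd_le[of y x] by auto
  have "(\<bar>x - y\<bar> / 2)\<^sup>2 < (x + y)\<^sup>2" using b[of x y] n r r0 ft t by (simp add: power_divide)
      then have "\<bar>x - y\<bar> / 2 < x + y" by (rule power_less_imp_less_base) (use q in simp)
      then have w: "(x - y, x + y) \<in> W" using xy by (auto simp: W_def)
      show p: "x - y \<in> {-r<..<r}" using xy by auto
      have "x + y = Q (x - y)" by (rule Q(4)[OF p w]) (simp add: g_def XY ft)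
      then show "(x, y) = c (x - y)" using XY[of x y] by (simp add: c_def)
    qed
  qed
qed

end


section \<open>Words along an interval\<close>

text \<open>Stating both equivalences for each letter excludes a point that is an inflection and a
  vertex at once. Predicates on arbitrary sets of parameters allow words to be concatenated and
  reversed before any curve is involved.\<close>

definition spells :: "real set \<Rightarrow> (real \<Rightarrow> bool) \<Rightarrow> (real \<Rightarrow> bool) \<Rightarrow> letter list \<Rightarrow> bool" where
  "spells S P Q w \<longleftrightarrow> (\<exists>ts. sorted_wrt (<) ts \<and> set ts = {u \<in> S. P u \<or> Q u} \<and>
     list_all2 (\<lambda>l u. (l = I \<longleftrightarrow> P u) \<and> (l = V \<longleftrightarrow> Q u)) w ts)"

lemma spells_append:
  assumes "spells S P Q v" "spells T P Q w" "\<And>s t. s \<in> S \<Longrightarrow> t \<in> T \<Longrightarrow> s < t"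
  shows "spells (S \<union> T) P Q (v @ w)"
proof -
  obtain ss ts where "sorted_wrt (<) ss" "set ss = {u \<in> S. P u \<or> Q u}"
    "list_all2 (\<lambda>l u. (l = I \<longleftrightarrow> P u) \<and> (l = V \<longleftrightarrow> Q u)) v ss"
    "sorted_wrt (<) ts" "set ts = {u \<in> T. P u \<or> Q u}"
    "list_all2 (\<lambda>l u. (l = I \<longleftrightarrow> P u) \<and> (l = V \<longleftrightarrow> Q u)) w ts"
    using assms(1,2) unfolding spells_def by blast
  then show ?thesis using assms(3) unfolding spells_def
    by (intro exI[of _ "ss @ ts"]) (auto simp: sorted_wrt_append list_all2_appendI)
qed

lemma spells_empty: "(\<And>u. u \<in> S \<Longrightarrow> \<not> P u \<and> \<not> Q u) \<Longrightarrow> spells S P Q []"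
  unfolding spells_def by (intro exI[of _ "[]"]) auto

lemma spells_single:
  assumes "z \<in> S" "\<And>u. u \<in> S \<Longrightarrow> P u \<or> Q u \<longleftrightarrow> u = z" "(l = I \<longleftrightarrow> P z) \<and> (l = V \<longleftrightarrow> Q z)"
  shows "spells S P Q [l]"
  unfolding spells_def by (intro exI[of _ "[z]"]) (use assms in auto)

lemma spells_cong:
  assumes "\<And>u. u \<in> S \<Longrightarrow> P u = P' u" "\<And>u. u \<in> S \<Longrightarrow> Q u = Q' u"
  shows "spells S P Q w \<longleftrightarrow> spells S P' Q' w"
proof -
  have "spells S P Q w \<Longrightarrow> spells S P' Q' w"
    if "\<And>u. u \<in> S \<Longrightarrow> P u = P' u" "\<And>u. u \<in> S \<Longrightarrow> Q u = Q' u" for P P' Q Q'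
  proof -
    assume "spells S P Q w"
    then obtain ts where ts: "sorted_wrt (<) ts" "set ts = {u \<in> S. P u \<or> Q u}"
      "list_all2 (\<lambda>l u. (l = I \<longleftrightarrow> P u) \<and> (l = V \<longleftrightarrow> Q u)) w ts" unfolding spells_def by blast
    have "list_all2 (\<lambda>l u. (l = I \<longleftrightarrow> P' u) \<and> (l = V \<longleftrightarrow> Q' u)) w ts"
      using ts(3) by (rule list.rel_mono_strong) (use ts(2) that in auto)
    then show ?thesis unfolding spells_def using ts that by (intro exI[of _ ts]) auto
  qed
  from this[of P P' Q Q'] this[of P' P Q' Q] assms show ?thesis by auto
qed

lemma sorted_wrt_less_rev_map:
  fixes h :: "real \<Rightarrow> real"
  assumes "sorted_wrt (<) ts" "\<And>s t. s \<in> set ts \<Longrightarrow> t \<in> set ts \<Longrightarrow> s < t \<Longrightarrow> h t < h s"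
  shows "sorted_wrt (<) (rev (map h ts))"
  using assms
proof (induction ts)
  case (Cons a ts)
  then show ?case by (auto simp: sorted_wrt_append)
qed simp

text \<open>Serves to run through the part of an arc along the second branch from the middle
  outwards, and later to reverse the orientation of a whole arc.\<close>

lemma spells_antimono:
  fixes h :: "real \<Rightarrow> real"
  assumes "spells S P Q w" "\<And>s t. s \<in> S \<Longrightarrow> t \<in> S \<Longrightarrow> s < t \<Longrightarrow> h t < h s"
    and "\<And>s. s \<in> S \<Longrightarrow> P' (h s) = P s" "\<And>s. s \<in> S \<Longrightarrow> Q' (h s) = Q s"
  shows "spells (h ` S) P' Q' (rev w)"
proof -
  obtain ts where ts: "sorted_wrt (<) ts" "set ts = {u \<in> S. P u \<or> Q u}"
    "list_all2 (\<lambda>l u. (l = I \<longleftrightarrow> P u) \<and> (l = V \<longleftrightarrow> Q u)) w ts" using assms(1) unfolding spells_def by blast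
  have "sorted_wrt (<) (rev (map h ts))"
    by (rule sorted_wrt_less_rev_map[OF ts(1)]) (use ts(2) assms(2) in auto)
  moreover have "set (rev (map h ts)) = {u \<in> h ` S. P' u \<or> Q' u}" using ts(2) assms(3,4) by auto
  moreover have "list_all2 (\<lambda>l u. (l = I \<longleftrightarrow> P' u) \<and> (l = V \<longleftrightarrow> Q' u)) (rev w) (rev (map h ts))"
    unfolding list_all2_rev list_all2_map2
    using ts(3) by (rule list.rel_mono_strong) (use ts(2) assms(3,4) in auto)
  ultimately show ?thesis unfolding spells_def by blast
qed

section \<open>Functions whose zeros are all crossings in the same direction\<close>

text \<open>Once positive, the function cannot come back: its first later zero would be reached from
  positive values, against the positive derivative there. No monotonicity is available, since the
  derivative is controlled at zeros only.\<close>

lemma upcrossing_sign: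
  fixes g :: "real \<Rightarrow> real"
  assumes "a \<le> b" and d: "\<And>u. a \<le> u \<Longrightarrow> u \<le> b \<Longrightarrow> (g has_real_derivative g' u) (at u)"
    and up: "\<And>u. a \<le> u \<Longrightarrow> u \<le> b \<Longrightarrow> g u = 0 \<Longrightarrow> g' u > 0" and "g a \<ge> 0"
  shows "a < b \<Longrightarrow> g b > 0"
proof (rule ccontr)
  assume ab: "a < b" and "\<not> g b > 0"
  have c: "continuous_on {a..b} g" using d by (auto intro!: continuous_at_imp_continuous_on DERIV_isCont)
  have "\<exists>s. a < s \<and> s \<le> b \<and> g s \<ge> 0 \<and> g s \<noteq> 0"
  proof (cases "g a = 0")
    case True
    obtain e where e: "e > 0" "\<And>h. 0 < h \<Longrightarrow> h < e \<Longrightarrow> g a < g (a + h)"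
      using DERIV_pos_inc_right[OF d up] ab True by (metis less_imp_le order_refl)
    define h where "h = min (e / 2) (b - a)"
    have "0 < h" "h < e" "h \<le> b - a" using e(1) ab by (auto simp: h_def min_less_iff_disj)
    then show ?thesis using e(2)[of h] True by (intro exI[of _ "a + h"]) auto
  next
    case False
    then have "g a > 0" using assms by simp
    moreover have "continuous (at a within {a..b}) g" using c ab by (auto simp: continuous_on_eq_continuous_within)
    then have "(g \<longlongrightarrow> g a) (at_right a)" using ab by (simp add: continuous_within at_within_Icc_at_right)
    ultimately have "\<forall>\<^sub>F u in at_right a. g u > 0" by (rule order_tendstoD(1)[rotated])
    then obtain b' where b': "b' > a" and "\<And>u. a < u \<Longrightarrow> u < b' \<Longrightarrow> g u > 0" unfolding eventually_at_right_field by blast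
    moreover obtain u where "a < u" "u < min b b'"
      using dense[of a "min b b'"] ab b' by auto
    ultimately have "a < u" "u < b'" "u \<le> b" "\<And>u. a < u \<Longrightarrow> u < b' \<Longrightarrow> g u > 0" by auto
    then show ?thesis by (intro exI[of _ u]) (auto simp: less_imp_le less_imp_neq[symmetric])
  qed
  then obtain s where s: "a < s" "s \<le> b" "g s > 0" by force
  \<comment> \<open>The least point of \<open>Z\<close> is a zero by the intermediate value theorem,
    and the positive derivative there produces a smaller point of \<open>Z\<close>.\<close>
  define Z where "Z = {u \<in> {s..b}. g u \<le> 0}"
  have cs: "continuous_on {s..b} g" by (rule continuous_on_subset[OF c]) (use s in auto)
  have "closed Z" unfolding Z_def
    by (intro continuous_on_closed_Collect_le cs continuous_intros closed_atLeastAtMost)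
  moreover have "bounded Z" by (rule bounded_subset[of "{s..b}"]) (auto simp: Z_def)
  ultimately have cz: "compact Z" by (simp add: compact_eq_bounded_closed)
  have "b \<in> Z" using s \<open>\<not> g b > 0\<close> by (auto simp: Z_def)
  then obtain z where z: "z \<in> Z" "\<And>u. u \<in> Z \<Longrightarrow> z \<le> u" using compact_attains_inf[OF cz] by blast
  have zs: "s \<le> z" "z \<le> b" "g z \<le> 0" using z(1) by (auto simp: Z_def)
  have "\<exists>u\<ge>s. u \<le> z \<and> g u = 0"
    using IVT2'[of g z 0 s] zs s continuous_on_subset[OF cs, of "{s..z}"] by auto
  then obtain u where u: "s \<le> u" "u \<le> z" "g u = 0" by blast
  then have "u = z" using z(2)[of u] zs by (auto simp: Z_def)
  then have g0: "g z = 0" and sz: "s < z" using u s by (auto simp: order_less_le)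
  obtain e where e: "e > 0" "\<And>h. 0 < h \<Longrightarrow> h < e \<Longrightarrow> g (z - h) < g z"
    using DERIV_pos_inc_left[OF d up] g0 zs s by (metis less_imp_le order_trans)
  have "g (z - min (e / 2) (z - s)) < 0" using e(2)[of "min (e / 2) (z - s)"] e(1) g0 sz by auto
  then have "z - min (e / 2) (z - s) \<in> Z" using e(1) sz zs by (auto simp: Z_def)
  then show False using z(2)[of "z - min (e / 2) (z - s)"] e(1) sz by auto
qed

lemma upcrossing_zero:
  fixes g :: "real \<Rightarrow> real"
  assumes ab: "a < b" and d: "\<And>u. a \<le> u \<Longrightarrow> u \<le> b \<Longrightarrow> (g has_real_derivative g' u) (at u)"
    and up: "\<And>u. a \<le> u \<Longrightarrow> u \<le> b \<Longrightarrow> g u = 0 \<Longrightarrow> g' u > 0" and sgn: "g a < 0" "g b > 0"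
  obtains z where "a < z" "z < b" "g z = 0" "\<And>u. a \<le> u \<Longrightarrow> u < z \<Longrightarrow> g u < 0" "\<And>u. z < u \<Longrightarrow> u \<le> b \<Longrightarrow> g u > 0"
proof -
  have c: "continuous_on {a..b} g" using d by (auto intro!: continuous_at_imp_continuous_on DERIV_isCont)
  obtain z where z: "a \<le> z" "z \<le> b" "g z = 0" using IVT'[of g a 0 b] sgn ab c by auto
  have az: "a < z" "z < b" using z sgn by (auto simp: order_less_le)
  show thesis
  proof (rule that[OF az z(3)])
    show "g u > 0" if "z < u" "u \<le> b" for u
      by (rule upcrossing_sign[of z u g g']) (use that d up z in auto)
    show "g u < 0" if "a \<le> u" "u < z" for u
    proof (rule ccontr)
      assume "\<not> g u < 0"
      then have "g z > 0" by (intro upcrossing_sign[of u z g g']) (use that d up z in auto)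
      then show False using z by simp
    qed
  qed
qed

text \<open>Reversing the parameter turns downcrossings into upcrossings; a nonnegative value at
  \<open>u\<close> would then force a positive value at \<open>a\<close>.\<close>

lemma downcrossing_none:
  fixes g :: "real \<Rightarrow> real"
  assumes d: "\<And>u. a \<le> u \<Longrightarrow> u \<le> b \<Longrightarrow> (g has_real_derivative g' u) (at u)"
    and down: "\<And>u. a \<le> u \<Longrightarrow> u \<le> b \<Longrightarrow> g u = 0 \<Longrightarrow> g' u < 0" and sgn: "g a < 0" and u: "a \<le> u" "u \<le> b"
  shows "g u < 0"
proof (cases "u = a")
  case False
  have d': "((\<lambda>s. g (- s)) has_real_derivative - g' (- s)) (at s)" if "- u \<le> s" "s \<le> - a" for s
  proof -
    have "((\<lambda>s. g (- s)) has_real_derivative g' (- s) * (- 1)) (at s)"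
      by (rule DERIV_chain2[where g = uminus]) (use that u in \<open>auto intro!: derivative_eq_intros d\<close>)
    then show ?thesis by simp
  qed
  show ?thesis
  proof (rule ccontr)
    assume "\<not> g u < 0"
    then have "g (- (- a)) > 0"
      by (intro upcrossing_sign[of "-u" "-a" "\<lambda>s. g (- s)" "\<lambda>s. - g' (- s)"]) (use False u d' down[of "- s" for s] in auto)
    then show False using sgn by simp
  qed
qed (use sgn in simp)

text \<open>The behaviour along the part of an arc that runs close to a branch of the node; \<open>i\<close> and
  \<open>v\<close> stand for the inflection and the vertex form.\<close>

lemma branch_word:
  fixes i v :: "real \<Rightarrow> real"
  assumes ab: "a < b"
    and di: "\<And>u. a \<le> u \<Longrightarrow> u \<le> b \<Longrightarrow> (i has_real_derivative i' u) (at u)"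
    and dv: "\<And>u. a \<le> u \<Longrightarrow> u \<le> b \<Longrightarrow> (v has_real_derivative v' u) (at u)"
    and sgn: "i a < 0" "v a < 0" "s1 * i b > 0" "s2 * v b > 0"
    and i0: "\<And>u. a \<le> u \<Longrightarrow> u \<le> b \<Longrightarrow> i u = 0 \<Longrightarrow> s1 * i' u > 0 \<and> v u < 0"
    and v0: "\<And>u. a \<le> u \<Longrightarrow> u \<le> b \<Longrightarrow> v u = 0 \<Longrightarrow> s2 * v' u > 0"
  shows "spells {a<..<b} (\<lambda>u. i u = 0) (\<lambda>u. v u = 0)
     ((if s1 > 0 then [I] else []) @ (if s2 > (0::real) then [V] else []))"
proof -
  \<comment> \<open>The end conditions make \<open>s1\<close> and \<open>s2\<close> nonzero. If one
    of them is negative, every zero of the corresponding function is a downcrossing, which a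
    function with negative initial value cannot have.\<close>
  have i_none: "i u < 0" if "\<not> s1 > 0" "a \<le> u" "u \<le> b" for u
    by (rule downcrossing_none[OF di _ sgn(1)]) (use i0 that in \<open>auto simp: zero_less_mult_iff\<close>)
  have v_none: "v u < 0" if "\<not> s2 > 0" "a \<le> u" "u \<le> b" for u
    by (rule downcrossing_none[OF dv _ sgn(2)]) (use v0 that in \<open>auto simp: zero_less_mult_iff\<close>)
  have i_one: "\<exists>z>a. z < b \<and> i z = 0 \<and> (\<forall>u. a \<le> u \<and> u < z \<longrightarrow> i u < 0) \<and> (\<forall>u. z < u \<and> u \<le> b \<longrightarrow> i u > 0)" if "s1 > 0"
  proof -
    have up: "\<And>u. a \<le> u \<Longrightarrow> u \<le> b \<Longrightarrow> i u = 0 \<Longrightarrow> i' u > 0" and b0: "i b > 0"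
      using i0 sgn(3) that by (auto simp: zero_less_mult_iff)
    obtain z where "a < z" "z < b" "i z = 0" "\<And>u. a \<le> u \<Longrightarrow> u < z \<Longrightarrow> i u < 0" "\<And>u. z < u \<Longrightarrow> u \<le> b \<Longrightarrow> i u > 0"
      using upcrossing_zero[OF ab di up sgn(1) b0] by blast
    then show ?thesis by blast
  qed
  have v_one: "\<exists>z>a. z < b \<and> v z = 0 \<and> (\<forall>u. a \<le> u \<and> u < z \<longrightarrow> v u < 0) \<and> (\<forall>u. z < u \<and> u \<le> b \<longrightarrow> v u > 0)" if "s2 > 0"
  proof -
    have up: "\<And>u. a \<le> u \<Longrightarrow> u \<le> b \<Longrightarrow> v u = 0 \<Longrightarrow> v' u > 0" and b0: "v b > 0"
      using v0 sgn(4) that by (auto simp: zero_less_mult_iff)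
    obtain z where "a < z" "z < b" "v z = 0" "\<And>u. a \<le> u \<Longrightarrow> u < z \<Longrightarrow> v u < 0" "\<And>u. z < u \<Longrightarrow> u \<le> b \<Longrightarrow> v u > 0"
      using upcrossing_zero[OF ab dv up sgn(2) b0] by blast
    then show ?thesis by blast
  qed
  consider "\<not> s1 > 0" "\<not> s2 > 0" | "\<not> s1 > 0" "s2 > 0" | "s1 > 0" "\<not> s2 > 0" | "s1 > 0" "s2 > 0" by blast
  then show ?thesis
  proof cases
    case 1
    have "i u \<noteq> 0 \<and> v u \<noteq> 0" if "u \<in> {a<..<b}" for u
      using i_none[OF 1(1), of u] v_none[OF 1(2), of u] that by auto
    then have "spells {a<..<b} (\<lambda>u. i u = 0) (\<lambda>u. v u = 0) []" by (rule spells_empty)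
    then show ?thesis using 1 by simp
  next
    case 2
    then obtain z where z: "a < z" "z < b" "v z = 0" "\<forall>u. a \<le> u \<and> u < z \<longrightarrow> v u < 0" "\<forall>u. z < u \<and> u \<le> b \<longrightarrow> v u > 0"
      using v_one by blast
    have "v u = 0 \<longleftrightarrow> u = z" if "a < u" "u < b" for u
    proof -
      have "u < z \<Longrightarrow> v u < 0" "z < u \<Longrightarrow> v u > 0" using z(4,5) that by auto
      with z(3) show ?thesis by (cases u z rule: linorder_cases) auto
    qed
    moreover have "i u \<noteq> 0" if "a < u" "u < b" for u using i_none[OF 2(1), of u] that by auto
    ultimately have "spells {a<..<b} (\<lambda>u. i u = 0) (\<lambda>u. v u = 0) [V]"
      by (intro spells_single[of z]) (use z in auto)
    then show ?thesis using 2 by simp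
  next
    case 3
    then obtain z where z: "a < z" "z < b" "i z = 0" "\<forall>u. a \<le> u \<and> u < z \<longrightarrow> i u < 0" "\<forall>u. z < u \<and> u \<le> b \<longrightarrow> i u > 0"
      using i_one by blast
    have "i u = 0 \<longleftrightarrow> u = z" if "a < u" "u < b" for u
    proof -
      have "u < z \<Longrightarrow> i u < 0" "z < u \<Longrightarrow> i u > 0" using z(4,5) that by auto
      with z(3) show ?thesis by (cases u z rule: linorder_cases) auto
    qed
    moreover have "v u \<noteq> 0" if "a < u" "u < b" for u using v_none[OF 3(2), of u] that by auto
    ultimately have "spells {a<..<b} (\<lambda>u. i u = 0) (\<lambda>u. v u = 0) [I]"
      by (intro spells_single[of z]) (use z in auto)
    then show ?thesis using 3 by simp
  next
    case 4
    then obtain z where z: "a < z" "z < b" "i z = 0" "\<forall>u. a \<le> u \<and> u < z \<longrightarrow> i u < 0" "\<forall>u. z < u \<and> u \<le> b \<longrightarrow> i u > 0"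
      using i_one by blast
    obtain y where y: "a < y" "y < b" "v y = 0" "\<forall>u. a \<le> u \<and> u < y \<longrightarrow> v u < 0" "\<forall>u. y < u \<and> u \<le> b \<longrightarrow> v u > 0"
      using v_one 4 by blast
    have "v z < 0" using i0[of z] z by auto
    then have zy: "z < y" using y z by (cases z y rule: linorder_cases) force+
    have iz: "i u = 0 \<longleftrightarrow> u = z" if "a < u" "u < b" for u
    proof -
      have "u < z \<Longrightarrow> i u < 0" "z < u \<Longrightarrow> i u > 0" using z(4,5) that by auto
      with z(3) show ?thesis by (cases u z rule: linorder_cases) auto
    qed
    have vy: "v u = 0 \<longleftrightarrow> u = y" if "a < u" "u < b" for u
    proof -
      have "u < y \<Longrightarrow> v u < 0" "y < u \<Longrightarrow> v u > 0" using y(4,5) that by auto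
      with y(3) show ?thesis by (cases u y rule: linorder_cases) auto
    qed
    have "spells {a<..<b} (\<lambda>u. i u = 0) (\<lambda>u. v u = 0) [I, V]"
      unfolding spells_def
    proof (intro exI[of _ "[z, y]"] conjI)
      show "set [z, y] = {u \<in> {a<..<b}. i u = 0 \<or> v u = 0}" using iz vy z y by auto
    qed (use zy iz[of z] iz[of y] vy[of y] vy[of z] z y in auto)
    then show ?thesis using 4 by simp
  qed
qed


section \<open>A complete level arc inside a ball\<close>

lemma smooth_curve_components:
  fixes c :: "real \<Rightarrow> real \<times> real"
  assumes "smooth_on S c" "p \<in> S"
  obtains x' y' where "((\<lambda>p. fst (c p)) has_real_derivative x') (at p)" "((\<lambda>p. snd (c p)) has_real_derivative y') (at p)"
proof -
  have D: "(c has_derivative frechet_derivative c (at p)) (at p)" by (rule smooth_on_frechet[OF assms])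
  interpret D: bounded_linear "frechet_derivative c (at p)" by (rule has_derivative_bounded_linear[OF D])
  have "frechet_derivative c (at p) h = h *\<^sub>R frechet_derivative c (at p) 1" for h
    using D.scaleR[of h 1] by simp
  then have "h * fst (frechet_derivative c (at p) 1) = fst (frechet_derivative c (at p) h)"
    "h * snd (frechet_derivative c (at p) 1) = snd (frechet_derivative c (at p) h)" for h
    by (metis fst_scaleR real_scaleR_def, metis snd_scaleR real_scaleR_def)
  then show thesis
    by (intro that[of "fst (frechet_derivative c (at p) 1)" "snd (frechet_derivative c (at p) 1)"]
        has_derivative_imp_has_field_derivative[OF has_derivative_fst[OF D]]
        has_derivative_imp_has_field_derivative[OF has_derivative_snd[OF D]])
qed

text \<open>The velocity is a multiple of the Hamiltonian vector, and x' - y' = 1 fixes the factor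
  as -1 / (f_x + f_y). As the denominator is positive, derivatives along the arc have the sign
  opposite to \<open>tder f u\<close>.\<close>

lemma level_curve_derivative:
  assumes f: "smooth_on U f" and c: "smooth_on {a<..<b} c"
    and p: "p \<in> {a<..<b}" and U: "\<And>p. p \<in> {a<..<b} \<Longrightarrow> c p \<in> U"
    and diag: "\<And>p. p \<in> {a<..<b} \<Longrightarrow> fst (c p) - snd (c p) = p"
    and lev: "\<And>p. p \<in> {a<..<b} \<Longrightarrow> f (c p) = t"
    and pos: "pdx f (c p) + pdy f (c p) > 0"
    and u: "smooth_on U u"
  shows "((\<lambda>p. u (c p)) has_real_derivative - tder f u (c p) / (pdx f (c p) + pdy f (c p))) (at p)"
proof -
  obtain x' y' where d: "((\<lambda>p. fst (c p)) has_real_derivative x') (at p)" "((\<lambda>p. snd (c p)) has_real_derivative y') (at p)"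
    by (rule smooth_curve_components[OF c p])
  have chain: "((\<lambda>p. g (c p)) has_real_derivative x' * pdx g (c p) + y' * pdy g (c p)) (at p)" if "smooth_on U g" for g :: "real \<times> real \<Rightarrow> real"
    using pd_curve_derivative[OF that _ d] U[OF p] by simp
  have ev: "\<forall>\<^sub>F q in nhds p. q \<in> {a<..<b}" using p by (intro eventually_nhds_in_open) auto
  have "((\<lambda>p. fst (c p) - snd (c p)) has_real_derivative x' - y') (at p)" by (intro DERIV_diff d)
  moreover have "((\<lambda>p. fst (c p) - snd (c p)) has_real_derivative 1) (at p)"
  proof (rule DERIV_cong_ev[THEN iffD2])
    show "\<forall>\<^sub>F q in nhds p. fst (c q) - snd (c q) = q" using ev by eventually_elim (rule diag)
  qed (auto intro: DERIV_ident)
  ultimately have 1: "x' - y' = 1" by (rule DERIV_unique)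
  have "((\<lambda>p. f (c p)) has_real_derivative 0) (at p)"
  proof (rule DERIV_cong_ev[THEN iffD2])
    show "\<forall>\<^sub>F q in nhds p. f (c q) = t" using ev by eventually_elim (rule lev)
  qed auto
  then have 2: "x' * pdx f (c p) + y' * pdy f (c p) = 0" using chain[OF f] DERIV_unique by blast
  have "x' * (pdx f (c p) + pdy f (c p)) = pdy f (c p)" "y' * (pdx f (c p) + pdy f (c p)) = - pdx f (c p)"
    using 1 2 by algebra+
  then have xy: "x' = pdy f (c p) / (pdx f (c p) + pdy f (c p))" "y' = - pdx f (c p) / (pdx f (c p) + pdy f (c p))"
    using pos by (simp_all add: field_simps)
  have "x' * pdx u (c p) + y' * pdy u (c p) = - tder f u (c p) / (pdx f (c p) + pdy f (c p))"
    unfolding xy tder_def by (simp add: diff_divide_distrib algebra_simps)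
  with chain[OF u] show ?thesis by simp
qed

text \<open>The quadratic form is the squared Euclidean distance from the node in skew coordinates.
  The leading part 2 C y^2 - 2 A x^2 of its derivative is negative in the cone, so the distance
  grows along the outer part of an arc, which therefore leaves a ball only once.\<close>

lemma (in node) metric_increasing:
  assumes \<nu>: "0 < \<nu>" "\<nu> \<le> 1" "C * \<nu>\<^sup>2 \<le> A / 6"
  obtains r where "0 < r" "\<And>x y. 0 < x \<Longrightarrow> \<bar>y\<bar> \<le> \<nu> * x \<Longrightarrow> norm (x, y) < r \<Longrightarrow>
     tder f (\<lambda>p. A * fst p ^ 2 + 2 * B * (fst p * snd p) + C * snd p ^ 2) (x, y) < 0"
proof -
  let ?q = "\<lambda>p :: real \<times> real. A * fst p ^ 2 + 2 * B * (fst p * snd p) + C * snd p ^ 2"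
  have q: "vord 2 U ?q"
    by (intro vadd; rule vord_mono, (rule vsyn vx vconst)+, simp)
  have e: "snd p * pdy ?q p - fst p * pdx ?q p = 2 * C * snd p ^ 2 - 2 * A * fst p ^ 2" for p
    by (simp add: pd_simps smooth_intros algebra_simps power2_eq_square)
  have "vord 3 U (\<lambda>p. tder f ?q p - (2 * C * snd p ^ 2 - 2 * A * fst p ^ 2))"
    using vord_tder_lead[OF q] unfolding e by simp
  from vord_bound[OF U this] obtain K where K: "K \<ge> 0"
    "\<forall>\<^sub>F p in nhds 0. \<bar>tder f ?q p - (2 * C * snd p ^ 2 - 2 * A * fst p ^ 2)\<bar> \<le> K * norm p ^ 3" by blast
  then obtain r0 where r0: "r0 > 0" "\<And>p. norm p < r0 \<Longrightarrow> \<bar>tder f ?q p - (2 * C * snd p ^ 2 - 2 * A * fst p ^ 2)\<bar> \<le> K * norm p ^ 3"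
    unfolding eventually_nhds_metric by (auto simp: dist_norm)
  define r where "r = min r0 (A / (8 * K + 1))"
  have r: "r > 0" "r \<le> r0" "8 * K * r \<le> A"
  proof -
    show "r > 0" "r \<le> r0" using r0 pos K by (auto simp: r_def)
    have "8 * K * r \<le> (8 * K + 1) * (A / (8 * K + 1))"
      using \<open>r > 0\<close> K by (intro mult_mono) (auto simp: r_def)
    also have "\<dots> = A" using K by simp
    finally show "8 * K * r \<le> A" .
  qed
  have "tder f ?q (x, y) < 0" if x: "0 < x" and y: "\<bar>y\<bar> \<le> \<nu> * x" and n: "norm (x, y) < r" for x y
  proof -
    have xr: "x < r" using n norm_fst_le[of x y] by simp
    have "\<bar>y\<bar> \<le> x" using y \<nu> x by (smt (verit) mult_left_le_one_le)
    then have "norm (x, y) \<le> 2 * x" using norm_Pair_le[of x y] x unfolding real_norm_def by linarith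
    then have "K * norm (x, y) ^ 3 \<le> K * (2 * x) ^ 3" using K by (intro mult_left_mono power_mono) auto
    also have "\<dots> = (8 * K * x) * x\<^sup>2" by (simp add: power_numeral_reduce)
    also have "\<dots> \<le> A * x\<^sup>2"
    proof (rule mult_right_mono)
      have "8 * K * x \<le> 8 * K * r" using K xr by (intro mult_left_mono) auto
      then show "8 * K * x \<le> A" using r by simp
    qed simp
    finally have k: "K * norm (x, y) ^ 3 \<le> A * x\<^sup>2" .
    have "y\<^sup>2 \<le> (\<nu> * x)\<^sup>2" using y by (metis abs_ge_zero power2_abs power_mono)
    then have "C * y\<^sup>2 \<le> (C * \<nu>\<^sup>2) * x\<^sup>2" using pos by (simp add: power_mult_distrib mult.assoc)
    also have "\<dots> \<le> (A / 6) * x\<^sup>2" using \<nu> by (intro mult_right_mono) auto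
    finally have "C * y\<^sup>2 \<le> A * x\<^sup>2 / 6" by simp
    moreover have "A * x\<^sup>2 > 0" using pos x by simp
    ultimately show ?thesis using abs_le_D1[OF r0(2)[of "(x, y)"]] k n r(2) by simp
  qed
  then show thesis using that r by blast
qed

text \<open>The second branch becomes the first one for the function with exchanged coordinates, for
  which \<open>A\<close> and \<open>C\<close> trade places; all results of \<open>node\<close> are
  thus available for both branches.\<close>

locale node_pair = node U f A B C p2 p3 + sw: node U' f' C B A q2 q3
  for U f A B C p2 p3 U' f' q2 q3 +
  assumes swap: "U' = (\<lambda>q. (snd q, fst q)) -` U" "f' = (\<lambda>q. f (snd q, fst q))"
    and metric: "B\<^sup>2 < A * C"
    and generic: "p2 \<noteq> 0" "q2 \<noteq> 0" "12 * A * p3 - 24 * B * p2\<^sup>2 \<noteq> 0" "12 * C * q3 - 24 * B * q2\<^sup>2 \<noteq> 0"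
begin

abbreviation "v2 \<equiv> 12 * C * q3 - 24 * B * q2\<^sup>2"

sublocale lc: linear_change U f 1 0 1 1 0
  by unfold_locales (rule U(1), rule f)

text \<open>The exchange of coordinates has determinant -1, so each form keeps or changes its sign
  according to the parity of the power of the determinant in its transformation law.\<close>

lemma swapped: assumes "(x, y) \<in> U"
  shows "(y, x) \<in> U'" "infl f' (y, x) = infl f (x, y)" "tder f' (infl f') (y, x) = - tder f (infl f) (x, y)"
    "vert C B A f' (y, x) = - Vf (x, y)" "tder f' (vert C B A f') (y, x) = Sf (x, y)"
proof -
  have l: "lc.lin = (\<lambda>q. (snd q, fst q))" by (simp add: lc.lin_def[abs_def])
  have g: "f' = lc.g" by (simp add: swap lc.g_def[abs_def] l)
  have w: "(y, x) \<in> lc.lin -` U" using assms by (simp add: l)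
  show "(y, x) \<in> U'" using assms by (simp add: swap)
  have m: "C = A * 0\<^sup>2 + 2 * B * 0 * 1 + C * 1\<^sup>2" "B = A * 0 * 1 + B * (0 * 0 + 1 * 1) + C * 1 * 0"
     "A = A * 1\<^sup>2 + 2 * B * 1 * 0 + C * 0\<^sup>2" by simp_all
  show "infl f' (y, x) = infl f (x, y)" "tder f' (infl f') (y, x) = - tder f (infl f) (x, y)"
    "vert C B A f' (y, x) = - Vf (x, y)" "tder f' (vert C B A f') (y, x) = Sf (x, y)"
    using lc.infl_g[OF w] lc.tinfl_g[OF w] lc.vert_g[OF m w] lc.tvert_g[OF m w] by (simp_all add: l g)
qed

definition qd :: "real \<times> real \<Rightarrow> real" where
  "qd p = A * fst p ^ 2 + 2 * B * (fst p * snd p) + C * snd p ^ 2"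

lemma smooth_qd: "open S \<Longrightarrow> smooth_on S qd"
  unfolding qd_def[abs_def] by (intro smooth_intros)

text \<open>Cayley-Hamilton for the Gram matrix G of the metric: trace(G) G - det(G) equals G^2,
  whose quadratic form is a sum of squares.\<close>

lemma qd_lower: "(A * C - B\<^sup>2) * norm p ^ 2 \<le> (A + C) * qd p"
proof -
  have "(A + C) * qd p - (A * C - B\<^sup>2) * (fst p ^ 2 + snd p ^ 2) = (A * fst p + B * snd p)\<^sup>2 + (B * fst p + C * snd p)\<^sup>2"
    by (simp add: qd_def power2_eq_square algebra_simps)
  also have "\<dots> \<ge> 0" by simp
  finally show ?thesis by (simp add: norm_prod_def)
qed

lemma qd_upper: "qd p \<le> (A + C) * norm p ^ 2"
proof -
  have "A * ((A + C) * (fst p ^ 2 + snd p ^ 2) - qd p) = (A * snd p - B * fst p)\<^sup>2 + (A * C - B\<^sup>2) * fst p ^ 2"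
    by (simp add: qd_def power2_eq_square algebra_simps)
  also have "\<dots> \<ge> 0" using metric by simp
  finally show ?thesis using pos by (simp add: norm_prod_def zero_le_mult_iff)
qed

lemma tder_qd_swapped:
  assumes "(x, y) \<in> U"
  shows "tder f' (\<lambda>p. C * fst p ^ 2 + 2 * B * (fst p * snd p) + A * snd p ^ 2) (y, x) = - tder f qd (x, y)"
proof -
  have l: "lc.lin = (\<lambda>q. (snd q, fst q))" by (simp add: lc.lin_def[abs_def])
  have g: "f' = lc.g" by (simp add: swap lc.g_def[abs_def] l)
  have w: "(y, x) \<in> lc.lin -` U" using assms by (simp add: l)
  have "tder lc.g (\<lambda>p. C * fst p ^ 2 + 2 * B * (fst p * snd p) + A * snd p ^ 2) (y, x) = (1 * (0 * 0 - 1 * 1) * 1) * tder f qd (lc.lin (y, x))"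
    by (rule lc.tder_g[OF w smooth_qd[OF U(1)]]) (simp add: l qd_def algebra_simps)
  then show ?thesis by (simp add: g l)
qed

abbreviation "word \<equiv> rev ((if - q2 > 0 then [I] else []) @ (if v2 > 0 then [V] else [])) @ [V] @
   ((if - p2 > 0 then [I] else []) @ (if v1 > 0 then [V] else []))"

text \<open>The arc is parametrised by p = x - y and cut at -P and P. On the outer parts
  \<open>branch_word\<close> applies, on the left one after reflecting the parameter; in between,
  \<open>Sf\<close> > 0 and opposite signs of \<open>Vf\<close> at the ends leave exactly one
  vertex. The ends of the interval are the exits from the Euclidean ball.\<close>

lemma arc:
  obtains e0 where "e0 > 0" "\<And>e. 0 < e \<Longrightarrow> e < e0 \<Longrightarrow> \<exists>\<delta>>0. \<forall>t. 0 < t \<and> t < \<delta> \<longrightarrow>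
    (\<exists>a b c. a < b \<and> smooth_on {a<..<b} c \<and>
      (\<forall>p\<in>{a<..<b}. fst (c p) - snd (c p) = p \<and> (pdx f (c p), pdy f (c p)) \<noteq> (0, 0)) \<and>
      c ` {a<..<b} = {z. fst z + snd z > 0 \<and> qd z < e\<^sup>2 \<and> f z = t} \<and>
      spells {a<..<b} (\<lambda>p. infl f (c p) = 0) (\<lambda>p. Vf (c p) = 0) word) \<and>
    (\<forall>z. qd z < e\<^sup>2 \<longrightarrow> f z = t \<longrightarrow> fst z + snd z \<noteq> 0)" "\<And>z e. 0 < e \<Longrightarrow> e < e0 \<Longrightarrow> qd z < e\<^sup>2 \<Longrightarrow> z \<in> U"
proof -
  obtain \<nu>1 \<kappa>1 r1 where \<nu>1: "0 < \<nu>1" "\<nu>1 \<le> 1" "C * \<nu>1\<^sup>2 \<le> A / 6" and \<kappa>1: "0 < \<kappa>1" and r1: "0 < r1" "ball 0 r1 \<subseteq> U"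
    and z1: "\<And>x y. 0 < x \<Longrightarrow> \<bar>y\<bar> \<le> \<nu>1 * x \<Longrightarrow> norm (x, y) < r1 \<Longrightarrow> f (x, y) > 0 \<Longrightarrow> infl f (x, y) = 0 \<Longrightarrow>
        p2 * tder f (infl f) (x, y) > 0 \<and> Vf (x, y) < 0"
    "\<And>x y. 0 < x \<Longrightarrow> \<bar>y\<bar> \<le> \<nu>1 * x \<Longrightarrow> norm (x, y) < r1 \<Longrightarrow> f (x, y) > 0 \<Longrightarrow> Vf (x, y) = 0 \<Longrightarrow> v1 * Sf (x, y) < 0"
    "\<And>x y. 0 < x \<Longrightarrow> \<bar>y\<bar> \<le> \<nu>1 * x \<Longrightarrow> norm (x, y) < r1 \<Longrightarrow> f (x, y) > 0 \<Longrightarrow> f (x, y) \<le> \<kappa>1 * x ^ 4 \<Longrightarrow>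
        p2 * infl f (x, y) < 0 \<and> v1 * Vf (x, y) > 0"
    by (rule zone[OF generic(1,3)]) blast
  obtain \<nu>2 \<kappa>2 r2 where \<nu>2: "0 < \<nu>2" "\<nu>2 \<le> 1" "A * \<nu>2\<^sup>2 \<le> C / 6" and \<kappa>2: "0 < \<kappa>2" and r2: "0 < r2" "ball 0 r2 \<subseteq> U'"
    and z2: "\<And>x y. 0 < x \<Longrightarrow> \<bar>y\<bar> \<le> \<nu>2 * x \<Longrightarrow> norm (x, y) < r2 \<Longrightarrow> f' (x, y) > 0 \<Longrightarrow> infl f' (x, y) = 0 \<Longrightarrow>
        q2 * tder f' (infl f') (x, y) > 0 \<and> vert C B A f' (x, y) < 0"
    "\<And>x y. 0 < x \<Longrightarrow> \<bar>y\<bar> \<le> \<nu>2 * x \<Longrightarrow> norm (x, y) < r2 \<Longrightarrow> f' (x, y) > 0 \<Longrightarrow> vert C B A f' (x, y) = 0 \<Longrightarrow>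
        v2 * tder f' (vert C B A f') (x, y) < 0"
    "\<And>x y. 0 < x \<Longrightarrow> \<bar>y\<bar> \<le> \<nu>2 * x \<Longrightarrow> norm (x, y) < r2 \<Longrightarrow> f' (x, y) > 0 \<Longrightarrow> f' (x, y) \<le> \<kappa>2 * x ^ 4 \<Longrightarrow>
        q2 * infl f' (x, y) < 0 \<and> v2 * vert C B A f' (x, y) > 0"
    by (rule sw.zone[OF generic(2,4)]) blast
  define \<nu> where "\<nu> = min \<nu>1 \<nu>2"
  have \<nu>: "0 < \<nu>" "\<nu> \<le> 1" "\<nu> \<le> \<nu>1" "\<nu> \<le> \<nu>2" using \<nu>1 \<nu>2 by (auto simp: \<nu>_def)
  have \<nu>sq: "\<nu>\<^sup>2 \<le> \<nu>1\<^sup>2" "\<nu>\<^sup>2 \<le> \<nu>2\<^sup>2" using \<nu> by (auto intro!: power_mono)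
  have \<nu>C: "C * \<nu>\<^sup>2 \<le> A / 6" using mult_left_mono[OF \<nu>sq(1), of C] pos \<nu>1(3) by linarith
  have \<nu>A: "A * \<nu>\<^sup>2 \<le> C / 6" using mult_left_mono[OF \<nu>sq(2), of A] pos \<nu>2(3) by linarith
  obtain r3 where r3: "0 < r3" "ball 0 r3 \<subseteq> U"
    and g1: "\<And>x y. norm (x, y) < r3 \<Longrightarrow> 0 < f (x, y) \<Longrightarrow> x + y \<noteq> 0"
    and g2: "\<And>x y. norm (x, y) < r3 \<Longrightarrow> 0 < f (x, y) \<Longrightarrow> 0 < x + y \<Longrightarrow> pdx f (x, y) + pdy f (x, y) > 0"
    and g3: "\<And>x y. norm (x, y) < r3 \<Longrightarrow> 0 < f (x, y) \<Longrightarrow> 0 < x + y \<Longrightarrow> x - y \<ge> 0 \<Longrightarrow> 8 / \<nu> * f (x, y) \<le> (x - y)\<^sup>2 \<Longrightarrow>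
       0 < x \<and> \<bar>y\<bar> \<le> \<nu> * x"
    and g4: "\<And>x y. norm (x, y) < r3 \<Longrightarrow> 0 < f (x, y) \<Longrightarrow> 0 < x + y \<Longrightarrow> x - y \<le> 0 \<Longrightarrow> 8 / \<nu> * f (x, y) \<le> (x - y)\<^sup>2 \<Longrightarrow>
       0 < y \<and> \<bar>x\<bar> \<le> \<nu> * y"
    and g5: "\<And>x y. norm (x, y) < r3 \<Longrightarrow> 0 < f (x, y) \<Longrightarrow> (x - y)\<^sup>2 \<le> 8 / \<nu> * f (x, y) \<Longrightarrow>
       norm (x, y) ^ 2 \<le> (16 / \<nu> + 4) * f (x, y)"
    by (rule level_geometry[OF \<nu>(1,2)]) blast
  obtain r5 where r5: "0 < r5" and m1: "\<And>x y. 0 < x \<Longrightarrow> \<bar>y\<bar> \<le> \<nu> * x \<Longrightarrow> norm (x, y) < r5 \<Longrightarrow> tder f qd (x, y) < 0"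
    by (rule metric_increasing[OF \<nu>(1,2) \<nu>C]) (unfold qd_def[abs_def], blast)
  obtain r6 where r6: "0 < r6" and m2: "\<And>x y. 0 < x \<Longrightarrow> \<bar>y\<bar> \<le> \<nu> * x \<Longrightarrow> norm (x, y) < r6 \<Longrightarrow>
      tder f' (\<lambda>p. C * fst p ^ 2 + 2 * B * (fst p * snd p) + A * snd p ^ 2) (x, y) < 0"
    by (rule sw.metric_increasing[OF \<nu>(1,2) \<nu>A]) blast
  define M where "M = 16 / \<nu> + 4"
  have M: "M \<ge> 1" using \<nu> by (simp add: M_def)
  obtain \<delta>m where \<delta>m: "\<delta>m > 0" "\<And>x y. 0 < f (x, y) \<Longrightarrow> f (x, y) < \<delta>m \<Longrightarrow> norm (x, y) ^ 2 \<le> M * f (x, y) \<Longrightarrow>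
     infl f (x, y) < 0 \<and> Sf (x, y) > 0 \<and> (2 * C * y\<^sup>2 \<le> A * x\<^sup>2 \<longrightarrow> Vf (x, y) < 0) \<and> (2 * A * x\<^sup>2 \<le> C * y\<^sup>2 \<longrightarrow> Vf (x, y) > 0)"
    by (rule middle[OF M]) blast
  define rr where "rr = min (min r1 r2) (min r3 (min r5 r6))"
  have rr: "rr > 0" "rr \<le> r1" "rr \<le> r2" "rr \<le> r3" "rr \<le> r5" "rr \<le> r6"
    using r1 r2 r3 r5 r6 by (auto simp: rr_def)
  obtain r where r: "0 < r" "4 * r \<le> rr"
    and graph: "\<And>t. 0 < t \<Longrightarrow> t < r\<^sup>2 / 4 \<Longrightarrow> \<exists>c. smooth_on {-r<..<r} c \<and> (\<forall>p\<in>{-r<..<r}. fst (c p) - snd (c p) = p \<and>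
       \<bar>p\<bar> / 2 < fst (c p) + snd (c p) \<and> norm (c p) < 4 * r \<and> f (c p) = t) \<and>
       (\<forall>x y. norm (x, y) < r / 2 \<longrightarrow> 0 < x + y \<longrightarrow> f (x, y) = t \<longrightarrow> x - y \<in> {-r<..<r} \<and> (x, y) = c (x - y))"
    and rU: "ball 0 (4 * r) \<subseteq> U" 
    by (rule level_graph[OF rr(1)]) blast
  \<comment> \<open>Determinant over trace, a lower bound for the smaller eigenvalue of the
    metric.\<close>
  define m where "m = (A * C - B\<^sup>2) / (A + C)"
  have AC: "A + C > 0" using pos by simp
  have m: "m > 0" using metric AC by (simp add: m_def)
  have ml: "m * norm z ^ 2 \<le> qd z" for z
    using qd_lower[of z] AC by (simp add: m_def field_simps)
  \<comment> \<open>With this bound \<open>qd z < e\<^sup>2\<close> forces |z| < r / 2, the range in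
    which \<open>graph\<close> describes all points of the level.\<close>
  define e0 where "e0 = sqrt (m * r\<^sup>2 / 8)"
  have e0: "e0 > 0" using m r by (simp add: e0_def)
  have esq: "e\<^sup>2 < m * r\<^sup>2 / 8" if "0 < e" "e < e0" for e
  proof -
    have "e\<^sup>2 < e0\<^sup>2" using that by (intro power_strict_mono) auto
    also have "e0\<^sup>2 = m * r\<^sup>2 / 8" using m by (simp add: e0_def)
    finally show ?thesis .
  qed
  have small: "norm z < r / 2" if "0 < e" "e < e0" "qd z < e\<^sup>2" for z e
  proof -
    have "m * norm z ^ 2 < m * (r\<^sup>2 / 8)" using ml[of z] esq[OF that(1,2)] that(3) by simp
    then have "norm z ^ 2 < r\<^sup>2 / 8" using m by simp
    also have "\<dots> \<le> (r / 2)\<^sup>2" by (simp add: power_divide)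
    finally show ?thesis by (rule power_less_imp_less_base) (use r in simp)
  qed
  show thesis
  proof (rule that[OF e0])
    fix z :: "real \<times> real" and e :: real assume "0 < e" "e < e0" "qd z < e\<^sup>2"
    from small[OF this] have "norm z < 4 * r" using r by simp
    then show "z \<in> U" using rU by auto
  next
    fix e :: real assume e: "0 < e" "e < e0"
    define \<kappa> where "\<kappa> = min \<kappa>1 \<kappa>2"
    have \<kappa>: "\<kappa> > 0" "\<kappa> \<le> \<kappa>1" "\<kappa> \<le> \<kappa>2" using \<kappa>1 \<kappa>2 by (auto simp: \<kappa>_def)
    \<comment> \<open>In this order the bounds ensure that \<open>middle\<close> applies, that
      \<open>graph\<close> applies, that P < r / 2, that the middle part lies inside the ball, and
      that f \<le> \<kappa> x^4, or its analogue on the other branch, holds at the exits.\<close>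
    define \<delta> where "\<delta> = Min {\<delta>m, r\<^sup>2 / 4, \<nu> / 8 * (r / 2)\<^sup>2, e\<^sup>2 / ((A + C) * M), \<kappa> * (e\<^sup>2 / (4 * (A + C)))\<^sup>2}"
    have ACM: "(A + C) * M > 0" using AC M by simp
    have \<delta>: "\<delta> > 0" using \<delta>m r \<nu> e AC M \<kappa> by (auto simp: \<delta>_def)
    show "\<exists>\<delta>>0. \<forall>t. 0 < t \<and> t < \<delta> \<longrightarrow>
    (\<exists>a b c. a < b \<and> smooth_on {a<..<b} c \<and>
      (\<forall>p\<in>{a<..<b}. fst (c p) - snd (c p) = p \<and> (pdx f (c p), pdy f (c p)) \<noteq> (0, 0)) \<and>
      c ` {a<..<b} = {z. fst z + snd z > 0 \<and> qd z < e\<^sup>2 \<and> f z = t} \<and>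
      spells {a<..<b} (\<lambda>p. infl f (c p) = 0) (\<lambda>p. Vf (c p) = 0) word) \<and>
    (\<forall>z. qd z < e\<^sup>2 \<longrightarrow> f z = t \<longrightarrow> fst z + snd z \<noteq> 0)"
    proof (rule exI[of _ \<delta>], intro conjI \<delta> allI impI)
      fix t z assume "0 < t \<and> t < \<delta>" "qd z < e\<^sup>2" "f z = t"
      then show "fst z + snd z \<noteq> 0" using g1[of "fst z" "snd z"] small[OF e, of z] r rr by simp
    next
      fix t assume "0 < t \<and> t < \<delta>"
      then have t: "0 < t" "t < \<delta>m" "t < r\<^sup>2 / 4" "t < \<nu> / 8 * (r / 2)\<^sup>2" "t < e\<^sup>2 / ((A + C) * M)"
        "t < \<kappa> * (e\<^sup>2 / (4 * (A + C)))\<^sup>2" by (auto simp: \<delta>_def)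
      obtain c where sc: "smooth_on {-r<..<r} c" and c: "\<And>p. p \<in> {-r<..<r} \<Longrightarrow> fst (c p) - snd (c p) = p"
        "\<And>p. p \<in> {-r<..<r} \<Longrightarrow> \<bar>p\<bar> / 2 < fst (c p) + snd (c p)" "\<And>p. p \<in> {-r<..<r} \<Longrightarrow> norm (c p) < 4 * r"
        "\<And>p. p \<in> {-r<..<r} \<Longrightarrow> f (c p) = t"
        and cu: "\<And>x y. norm (x, y) < r / 2 \<Longrightarrow> 0 < x + y \<Longrightarrow> f (x, y) = t \<Longrightarrow> x - y \<in> {-r<..<r} \<and> (x, y) = c (x - y)"
        using graph[OF t(1,3)] by blast
      define x where "x = (\<lambda>p. fst (c p))"
      define y where "y = (\<lambda>p. snd (c p))"
      have cxy: "c p = (x p, y p)" for p by (simp add: x_def y_def)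
      have cx: "x p - y p = p" "0 < x p + y p" "norm (x p, y p) < rr" "f (x p, y p) = t" "(x p, y p) \<in> U"
        if "p \<in> {-r<..<r}" for p
      proof -
        show "x p - y p = p" "f (x p, y p) = t" using c(1,4)[OF that] by (simp_all add: x_def y_def)
        have "0 \<le> \<bar>p\<bar> / 2" by simp
        then show "0 < x p + y p" using c(2)[OF that] unfolding x_def y_def by linarith
        show "norm (x p, y p) < rr" using c(3)[OF that] r by (simp add: x_def y_def)
        show "(x p, y p) \<in> U" using c(3)[OF that] rU by (auto simp: x_def y_def)
      qed
      have cpos: "pdx f (c p) + pdy f (c p) > 0" if "p \<in> {-r<..<r}" for p
        using g2[of "x p" "y p"] cx[OF that] rr t(1) by (simp add: cxy)
      define w where "w = (\<lambda>p. pdx f (c p) + pdy f (c p))"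
      have wpos: "w p > 0" if "p \<in> {-r<..<r}" for p using cpos[OF that] by (simp add: w_def)
      have der: "((\<lambda>p. u (c p)) has_real_derivative - tder f u (c p) / w p) (at p)"
        if "p \<in> {-r<..<r}" "smooth_on U u" for u p
        unfolding w_def
        by (rule level_curve_derivative[OF f sc that(1) _ c(1,4) cpos[OF that(1)] that(2)]) (use cx(5) in \<open>simp_all add: cxy\<close>)
      \<comment> \<open>The parameter at which (x - y)^2 = 8 t / \<nu>, the threshold of
        \<open>level_geometry\<close>.\<close>
      define P where "P = sqrt (8 / \<nu> * t)"
      have P: "P > 0" "P\<^sup>2 = 8 / \<nu> * t" using \<nu> t by (simp_all add: P_def)
      have "P\<^sup>2 < (r / 2)\<^sup>2" using t(4) \<nu> unfolding P(2) by (simp add: field_simps)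
      then have Pr: "P < r / 2" by (rule power_less_imp_less_base) (use r in simp)
      have cone1: "0 < x p \<and> \<bar>y p\<bar> \<le> \<nu> * x p \<and> \<bar>y p\<bar> \<le> \<nu>1 * x p" if "P \<le> p" "p < r" for p
      proof -
        have pr: "p \<in> {-r<..<r}" using that P r by auto
        have "P\<^sup>2 \<le> p\<^sup>2" using that P by (intro power_mono) auto
        then have 1: "0 < x p" "\<bar>y p\<bar> \<le> \<nu> * x p"
          using g3[of "x p" "y p"] cx[OF pr] rr t(1) that P by auto
        have "\<nu> * x p \<le> \<nu>1 * x p" using 1 \<nu> by (intro mult_right_mono) auto
        with 1 show ?thesis by linarith
      qed
      have cone2: "0 < y p \<and> \<bar>x p\<bar> \<le> \<nu> * y p \<and> \<bar>x p\<bar> \<le> \<nu>2 * y p" if "p \<le> - P" "- r < p" for p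
      proof -
        have pr: "p \<in> {-r<..<r}" using that P r by auto
        have "P\<^sup>2 \<le> (- p)\<^sup>2" using that P by (intro power_mono) auto
        then have 1: "0 < y p" "\<bar>x p\<bar> \<le> \<nu> * y p"
          using g4[of "x p" "y p"] cx[OF pr] rr t(1) that P by auto
        have "\<nu> * y p \<le> \<nu>2 * y p" using 1 \<nu> by (intro mult_right_mono) auto
        with 1 show ?thesis by linarith
      qed
      have mid: "norm (x p, y p) ^ 2 \<le> M * t" if "- P \<le> p" "p \<le> P" for p
      proof -
        have pr: "p \<in> {-r<..<r}" using that Pr r by auto
        have "p\<^sup>2 \<le> P\<^sup>2" using that P by (intro abs_le_square_iff[THEN iffD1]) auto
        then show ?thesis using g5[of "x p" "y p"] cx[OF pr] rr t(1) P by (simp add: M_def)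
      qed
      define Q where "Q = (\<lambda>p. qd (c p))"
      have dQ: "(Q has_real_derivative - tder f qd (c p) / w p) (at p)" if "p \<in> {-r<..<r}" for p
        unfolding Q_def by (rule der[OF that smooth_qd[OF U(1)]])
      have Qmid: "Q p < e\<^sup>2" if "- P \<le> p" "p \<le> P" for p
      proof -
        have "Q p \<le> (A + C) * (M * t)" unfolding Q_def cxy
          using order_trans[OF qd_upper mult_left_mono[OF mid[OF that]]] AC by simp
        also have "\<dots> < e\<^sup>2" using t(5) ACM by (simp add: field_simps)
        finally show ?thesis .
      qed
      \<comment> \<open>Here |z|^2 \<ge> p^2 / 2 because x - y = p, so for p^2 \<ge> r^2 / 4 the
        squared distance is at least m r^2 / 8, beyond the ball.\<close>
      have Qfar: "e\<^sup>2 < Q p" if "r\<^sup>2 / 4 \<le> p\<^sup>2" "p \<in> {-r<..<r}" for p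
      proof -
        have "p\<^sup>2 \<le> 2 * norm (x p, y p) ^ 2"
        proof -
          have "2 * norm (x p, y p) ^ 2 - (x p - y p)\<^sup>2 = (x p + y p)\<^sup>2"
            by (simp add: norm_Pair power2_eq_square algebra_simps)
          also have "\<dots> \<ge> 0" by simp
          finally show ?thesis using cx(1)[OF that(2)] by simp
        qed
        then have "m * (r\<^sup>2 / 8) \<le> m * norm (x p, y p) ^ 2" using that m by (intro mult_left_mono) auto
        then show ?thesis using ml[of "c p"] esq[OF e] by (simp add: Q_def cxy)
      qed
      have Qinc: "Q s < Q u" if "P \<le> s" "s < u" "u < r" for s u
      proof (rule DERIV_pos_imp_increasing[OF that(2)])
        fix p assume "s \<le> p" "p \<le> u"
        then have p: "P \<le> p" "p < r" "p \<in> {-r<..<r}" using that P r by auto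
        have "tder f qd (c p) < 0" unfolding cxy using m1[of "x p" "y p"] cone1[OF p(1,2)] cx(3)[OF p(3)] rr by auto
        then show "\<exists>d. (Q has_real_derivative d) (at p) \<and> 0 < d" using dQ[OF p(3)] wpos[OF p(3)] by (auto intro!: divide_neg_pos)
      qed
      have Qdec: "Q u < Q s" if "- r < s" "s < u" "u \<le> - P" for s u
      proof (rule DERIV_neg_imp_decreasing[OF that(2)])
        fix p assume "s \<le> p" "p \<le> u"
        then have p: "p \<le> - P" "- r < p" "p \<in> {-r<..<r}" using that P r by auto
        have "tder f qd (c p) > 0" unfolding cxy
          using m2[of "y p" "x p"] tder_qd_swapped[OF cx(5)[OF p(3)]] cone2[OF p(1,2)] cx(3)[OF p(3)] rr
          by (auto simp: norm_Pair add.commute)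
        then show "\<exists>d. (Q has_real_derivative d) (at p) \<and> d < 0" using dQ[OF p(3)] wpos[OF p(3)] by (auto intro!: divide_pos_pos)
      qed
      have Qc: "continuous_on S Q" if "S \<subseteq> {-r<..<r}" for S
        by (intro continuous_at_imp_continuous_on ballI DERIV_isCont[OF dQ]) (use that in blast)
      have r2: "(r / 2)\<^sup>2 = r\<^sup>2 / 4" "(- (r / 2))\<^sup>2 = r\<^sup>2 / 4" by (simp_all add: power_divide)
      have "Q P < e\<^sup>2" "Q (- P) < e\<^sup>2" using Qmid P by auto
      moreover have "e\<^sup>2 < Q (r / 2)" "e\<^sup>2 < Q (- (r / 2))" using Qfar[of "r / 2"] Qfar[of "- (r / 2)"] r2 r by auto
      ultimately have "\<exists>b. P \<le> b \<and> b \<le> r / 2 \<and> Q b = e\<^sup>2" "\<exists>a. - (r / 2) \<le> a \<and> a \<le> - P \<and> Q a = e\<^sup>2"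
        using Pr P r by (intro IVT' IVT2' Qc; auto)+
      then obtain a b where ab: "P \<le> b" "b \<le> r / 2" "Q b = e\<^sup>2" "- (r / 2) \<le> a" "a \<le> - P" "Q a = e\<^sup>2"
        by blast
      have ab': "P < b" "a < - P" using ab \<open>Q P < e\<^sup>2\<close> \<open>Q (- P) < e\<^sup>2\<close> by (auto simp: order_less_le)
      have abr: "a > - r" "b < r" "a < b" using ab r P by linarith+
      \<comment> \<open>The size bound in the middle and the monotonicity of the distance on the
        outer parts together show that the part of the graph inside the ball is a single
        interval.\<close>
      have J: "Q p < e\<^sup>2 \<longleftrightarrow> p \<in> {a<..<b}" if p: "p \<in> {-r<..<r}" for p
      proof -
        consider "- P \<le> p" "p \<le> P" | "P < p" "p < b" | "p = b" | "b < p" | "p < - P" "a < p" | "p = a" | "p < a" by linarith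
        then show ?thesis
        proof cases
          case 1 then show ?thesis using Qmid ab' by auto
        next
          case 2 then show ?thesis using Qinc[of p b] ab ab' abr P by auto
        next
          case 4 then show ?thesis using Qinc[of b p] ab p by auto
        next
          case 5 then show ?thesis using Qdec[of a p] ab ab' abr P by auto
        next
          case 7 then show ?thesis using Qdec[of p a] ab p by auto
        qed (use ab in auto)
      qed
      have in1: "p \<in> {-r<..<r}" if "a \<le> p" "p \<le> b" for p using that abr by auto
      define i where "i = (\<lambda>p. infl f (c p))"
      define v where "v = (\<lambda>p. Vf (c p))"
      have di: "(i has_real_derivative - tder f (infl f) (c p) / w p) (at p)" if "p \<in> {-r<..<r}" for p
        unfolding i_def by (rule der[OF that smooths(3)])
      have dv: "(v has_real_derivative - Sf (c p) / w p) (at p)" if "p \<in> {-r<..<r}" for p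
        unfolding v_def by (rule der[OF that smooths(5)])
      have midI: "i p < 0" "Sf (c p) > 0" if "- P \<le> p" "p \<le> P" for p
      proof -
        have pr: "p \<in> {-r<..<r}" using that Pr r by auto
        show "i p < 0" "Sf (c p) > 0" using \<delta>m(2)[of "x p" "y p"] mid[OF that] cx(4)[OF pr] t(1,2) by (auto simp: i_def cxy)
      qed
      have Pin: "P \<in> {-r<..<r}" "- P \<in> {-r<..<r}" using P Pr r by auto
      have sq: "b1 * y1\<^sup>2 \<le> a1 * x1\<^sup>2 / 6" if "b1 * \<nu>\<^sup>2 \<le> a1 / 6" "\<bar>y1\<bar> \<le> \<nu> * x1" "b1 > 0" for a1 b1 x1 y1 :: real
      proof -
        have "y1\<^sup>2 \<le> (\<nu> * x1)\<^sup>2" using that(2) by (metis abs_ge_zero power2_abs power_mono)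
        then have "b1 * y1\<^sup>2 \<le> (b1 * \<nu>\<^sup>2) * x1\<^sup>2" using that(3) by (simp add: power_mult_distrib mult.assoc)
        also have "\<dots> \<le> (a1 / 6) * x1\<^sup>2" using that(1) by (intro mult_right_mono) auto
        finally show ?thesis by simp
      qed
      have vP: "v P < 0"
      proof -
        have "C * (y P)\<^sup>2 \<le> A * (x P)\<^sup>2 / 6" using sq[OF \<nu>C] cone1[of P] Pr r pos by auto
        moreover have "A * (x P)\<^sup>2 \<ge> 0" using pos by simp
        ultimately have "2 * C * (y P)\<^sup>2 \<le> A * (x P)\<^sup>2" by simp
        then show ?thesis using \<delta>m(2)[of "x P" "y P"] mid[of P] cx(4)[OF Pin(1)] t(1,2) P by (auto simp: v_def cxy)
      qed
      have vP': "v (- P) > 0"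
      proof -
        have "A * (x (- P))\<^sup>2 \<le> C * (y (- P))\<^sup>2 / 6" using sq[OF \<nu>A] cone2[of "- P"] Pr r pos by auto
        moreover have "C * (y (- P))\<^sup>2 \<ge> 0" using pos by simp
        ultimately have "2 * A * (x (- P))\<^sup>2 \<le> C * (y (- P))\<^sup>2" by simp
        then show ?thesis using \<delta>m(2)[of "x (- P)" "y (- P)"] mid[of "- P"] cx(4)[OF Pin(2)] t(1,2) P by (auto simp: v_def cxy)
      qed
      have w2: "spells {- P..P} (\<lambda>p. i p = 0) (\<lambda>p. v p = 0) [V]"
      proof -
        have pr: "p \<in> {-r<..<r}" if "- P \<le> p" "p \<le> P" for p using that Pr r by auto
        obtain z where z: "- P < z" "z < P" "- v z = 0" "\<And>u. - P \<le> u \<Longrightarrow> u < z \<Longrightarrow> - v u < 0" "\<And>u. z < u \<Longrightarrow> u \<le> P \<Longrightarrow> - v u > 0"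
        proof (rule upcrossing_zero[of "- P" P "\<lambda>p. - v p" "\<lambda>p. - (- Sf (c p) / w p)"])
          show "((\<lambda>p. - v p) has_real_derivative - (- Sf (c p) / w p)) (at p)" if "- P \<le> p" "p \<le> P" for p
            by (rule DERIV_minus[OF dv[OF pr[OF that]]])
          show "- (- Sf (c p) / w p) > 0" if "- P \<le> p" "p \<le> P" for p
            using midI(2)[OF that] wpos[OF pr[OF that]] by simp
        qed (use P vP vP' in auto)
        have "v p = 0 \<longleftrightarrow> p = z" if "p \<in> {- P..P}" for p
          using z(3) z(4)[of p] z(5)[of p] that by (cases p z rule: linorder_cases) auto
        moreover have "i p \<noteq> 0" if "p \<in> {- P..P}" for p using midI(1)[of p] that by auto
        ultimately show ?thesis by (intro spells_single[of z]) (use z in auto)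
      qed
      \<comment> \<open>An exit lies at Euclidean distance e from the node, which bounds its
        dominant coordinate s from below in terms of e; the last bound in \<open>\<delta>\<close>
        was chosen for this.\<close>
      have tend: "t \<le> \<kappa> * s ^ 4" if "Q p = e\<^sup>2" "norm (x p, y p) \<le> 2 * s" "s > 0" for p s
      proof -
        have "norm (x p, y p) ^ 2 \<le> (2 * s) ^ 2" using that by (intro power_mono) auto
        then have "e\<^sup>2 \<le> (A + C) * (4 * s\<^sup>2)"
          using qd_upper[of "c p"] that(1) AC unfolding Q_def cxy by (smt (verit) mult_left_mono power_mult_distrib four_x_squared)
        then have "e\<^sup>2 / (4 * (A + C)) \<le> s\<^sup>2" using AC by (simp add: field_simps)
        then have "(e\<^sup>2 / (4 * (A + C)))\<^sup>2 \<le> (s\<^sup>2)\<^sup>2" using AC by (intro power_mono) auto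
        then have "\<kappa> * (e\<^sup>2 / (4 * (A + C)))\<^sup>2 \<le> \<kappa> * s ^ 4" using \<kappa> by (intro mult_left_mono) auto
        then show ?thesis using t(6) by linarith
      qed
      have nrm: "norm (x1, y1) \<le> 2 * x1" if "0 < x1" "\<bar>y1\<bar> \<le> \<nu> * x1" for x1 y1 :: real
      proof -
        have "\<nu> * x1 \<le> x1" using \<nu> that by simp
        then show ?thesis using norm_Pair_le[of x1 y1] that unfolding real_norm_def by linarith
      qed
      have w3: "spells {P<..<b} (\<lambda>p. i p = 0) (\<lambda>p. v p = 0) ((if - p2 > 0 then [I] else []) @ (if v1 > 0 then [V] else []))"
      proof (rule branch_word[OF ab'(1), where i' = "\<lambda>p. - tder f (infl f) (c p) / w p" and v' = "\<lambda>p. - Sf (c p) / w p"])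
        fix p assume p: "P \<le> p" "p \<le> b"
        then have pr: "p < r" "p \<in> {-r<..<r}" using abr P by auto
        note zz = z1[of "x p" "y p", unfolded cx(4)[OF pr(2)]]
        have co: "0 < x p" "\<bar>y p\<bar> \<le> \<nu>1 * x p" "norm (x p, y p) < r1" using cone1[OF p(1) pr(1)] cx(3)[OF pr(2)] rr by auto
        show "(i has_real_derivative - tder f (infl f) (c p) / w p) (at p)" by (rule di[OF pr(2)])
        show "(v has_real_derivative - Sf (c p) / w p) (at p)" by (rule dv[OF pr(2)])
        show "- p2 * (- tder f (infl f) (c p) / w p) > 0 \<and> v p < 0" if "i p = 0"
          using zz(1)[OF co t(1)] that wpos[OF pr(2)] by (simp add: i_def v_def cxy)
        show "v1 * (- Sf (c p) / w p) > 0" if "v p = 0"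
          using zz(2)[OF co t(1)] that wpos[OF pr(2)] by (simp add: v_def cxy divide_neg_pos)
      next
        show "i P < 0" using midI(1)[of P] P by simp
        show "v P < 0" by (rule vP)
        have bin: "b \<in> {-r<..<r}" using in1 abr by auto
        have co: "0 < x b" "\<bar>y b\<bar> \<le> \<nu>1 * x b" "norm (x b, y b) < r1" "\<bar>y b\<bar> \<le> \<nu> * x b"
          using cone1[OF ab(1) abr(2)] cx(3)[OF bin] rr by auto
        have "t \<le> \<kappa> * x b ^ 4" by (rule tend[OF ab(3) nrm[OF co(1,4)] co(1)])
        also have "\<dots> \<le> \<kappa>1 * x b ^ 4" using \<kappa> by (intro mult_right_mono) auto
        finally have "p2 * i b < 0 \<and> v1 * v b > 0"
          using z1(3)[of "x b" "y b"] co cx(4)[OF bin] t(1) by (simp add: i_def v_def cxy)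
        then show "- p2 * i b > 0" "v1 * v b > 0" by simp_all
      qed
      \<comment> \<open>Reading outwards from the middle means u = -p. The sign in front of
        \<open>v\<close> reflects that \<open>vert\<close> changes sign under the exchange of axes,
        so that the second branch takes the same form as the first.\<close>
      have w1': "spells {P<..<- a} (\<lambda>u. i (- u) = 0) (\<lambda>u. - v (- u) = 0) ((if - q2 > 0 then [I] else []) @ (if v2 > 0 then [V] else []))"
      proof (rule branch_word[where i' = "\<lambda>u. tder f (infl f) (c (- u)) / w (- u)" and v' = "\<lambda>u. - Sf (c (- u)) / w (- u)"])
        show "P < - a" using ab' by simp
        fix u assume u: "P \<le> u" "u \<le> - a"
        then have pr: "- r < - u" "- u \<in> {-r<..<r}" "- u \<le> - P" using abr P by auto
        have f'e: "f' (y (- u), x (- u)) = t" using cx(4)[OF pr(2)] by (simp add: swap)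
        note zz = z2[of "y (- u)" "x (- u)", unfolded f'e swapped[OF cx(5)[OF pr(2)]]]
        have co: "0 < y (- u)" "\<bar>x (- u)\<bar> \<le> \<nu>2 * y (- u)" "norm (y (- u), x (- u)) < r2"
          using cone2[OF pr(3,1)] cx(3)[OF pr(2)] rr by (auto simp: norm_Pair add.commute)
        have mi: "((\<lambda>u. - u) has_real_derivative - 1) (at u)" by (auto intro!: derivative_eq_intros)
        show "((\<lambda>u. i (- u)) has_real_derivative tder f (infl f) (c (- u)) / w (- u)) (at u)"
          using DERIV_chain2[OF di[OF pr(2)] mi] by simp
        show "((\<lambda>u. - v (- u)) has_real_derivative - Sf (c (- u)) / w (- u)) (at u)"
          using DERIV_minus[OF DERIV_chain2[OF dv[OF pr(2)] mi]] by simp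
        show "- q2 * (tder f (infl f) (c (- u)) / w (- u)) > 0 \<and> - v (- u) < 0" if "i (- u) = 0"
          using zz(1)[OF co t(1)] that wpos[OF pr(2)] by (simp add: i_def v_def cxy divide_neg_pos)
        show "v2 * (- Sf (c (- u)) / w (- u)) > 0" if "- v (- u) = 0"
          using zz(2)[OF co t(1)] that wpos[OF pr(2)] by (simp add: v_def cxy divide_neg_pos)
      next
        show "i (- P) < 0" using midI(1)[of "- P"] P by simp
        show "- v (- P) < 0" using vP' by simp
        have bin: "a \<in> {-r<..<r}" using in1 abr by auto
        have co: "0 < y a" "\<bar>x a\<bar> \<le> \<nu>2 * y a" "norm (y a, x a) < r2" "\<bar>x a\<bar> \<le> \<nu> * y a"
          using cone2[OF ab(5) abr(1)] cx(3)[OF bin] rr by (auto simp: norm_Pair add.commute)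
        have f'e: "f' (y a, x a) = t" using cx(4)[OF bin] by (simp add: swap)
        have "norm (x a, y a) \<le> 2 * y a" using nrm[OF co(1,4)] by (simp add: norm_Pair add.commute)
        then have "t \<le> \<kappa> * y a ^ 4" by (rule tend[OF ab(6) _ co(1)])
        also have "\<dots> \<le> \<kappa>2 * y a ^ 4" using \<kappa> by (intro mult_right_mono) auto
        finally have "q2 * i a < 0 \<and> v2 * (- v a) > 0"
          using z2(3)[of "y a" "x a", unfolded f'e swapped[OF cx(5)[OF bin]]] co t(1) by (simp add: i_def v_def cxy)
        then show "- q2 * i (- (- a)) > 0" "v2 * (- v (- (- a))) > 0" by simp_all
      qed
      have im: "uminus ` {P<..<- a} = {a<..<- P}" by simp
      have w1: "spells {a<..<- P} (\<lambda>p. i p = 0) (\<lambda>p. v p = 0) (rev ((if - q2 > 0 then [I] else []) @ (if v2 > 0 then [V] else [])))"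
        using spells_antimono[OF w1', of uminus "\<lambda>p. i p = 0" "\<lambda>p. v p = 0", unfolded im] by simp
      have "{a<..<- P} \<union> ({- P..P} \<union> {P<..<b}) = {a<..<b}" using ab' P by auto
      then have sp: "spells {a<..<b} (\<lambda>p. i p = 0) (\<lambda>p. v p = 0) word"
        using spells_append[OF w1 spells_append[OF w2 w3]] P ab' by fastforce
      have img: "c ` {a<..<b} = {z. fst z + snd z > 0 \<and> qd z < e\<^sup>2 \<and> f z = t}"
      proof (intro equalityI subsetI)
        fix z assume "z \<in> c ` {a<..<b}"
        then obtain p where p: "z = c p" "p \<in> {a<..<b}" by blast
        then have "p \<in> {-r<..<r}" using abr by auto
        then show "z \<in> {z. fst z + snd z > 0 \<and> qd z < e\<^sup>2 \<and> f z = t}"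
          using p J[of p] cx[of p] by (auto simp: Q_def cxy)
      next
        fix z assume "z \<in> {z. fst z + snd z > 0 \<and> qd z < e\<^sup>2 \<and> f z = t}"
        then have z: "fst z + snd z > 0" "qd z < e\<^sup>2" "f z = t" by auto
        have "norm (fst z, snd z) < r / 2" using small[OF e z(2)] by simp
        from cu[OF this z(1)] z(3) have p: "fst z - snd z \<in> {-r<..<r}" "z = c (fst z - snd z)" by simp_all
        then have "fst z - snd z \<in> {a<..<b}" using J[OF p(1)] z(2) by (simp add: Q_def)
        then show "z \<in> c ` {a<..<b}" using p(2) by blast
      qed
      have sub: "{a<..<b} \<subseteq> {-r<..<r}" using abr by auto
      have reg: "fst (c p) - snd (c p) = p \<and> (pdx f (c p), pdy f (c p)) \<noteq> (0, 0)" if "p \<in> {a<..<b}" for p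
        using c(1)[of p] cpos[of p] sub that by auto
      show "\<exists>a b c. a < b \<and> smooth_on {a<..<b} c \<and>
        (\<forall>p\<in>{a<..<b}. fst (c p) - snd (c p) = p \<and> (pdx f (c p), pdy f (c p)) \<noteq> (0, 0)) \<and>
        c ` {a<..<b} = {z. fst z + snd z > 0 \<and> qd z < e\<^sup>2 \<and> f z = t} \<and>
        spells {a<..<b} (\<lambda>p. infl f (c p) = 0) (\<lambda>p. Vf (c p) = 0) word"
        using abr(3) smooth_on_mono_set[OF sc sub] reg img sp unfolding i_def v_def by blast
    qed
  qed
qed

end


section \<open>Arc length parametrisations\<close>

lemma frechet_real:
  fixes c :: "real \<Rightarrow> 'a::real_normed_vector"
  assumes "smooth_on S c" "s \<in> S"
  shows "(c has_vector_derivative frechet_derivative c (at s) 1) (at s)"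
proof -
  have D: "(c has_derivative frechet_derivative c (at s)) (at s)" by (rule smooth_on_frechet[OF assms])
  interpret D: bounded_linear "frechet_derivative c (at s)" by (rule has_derivative_bounded_linear[OF D])
  have "frechet_derivative c (at s) = (\<lambda>h. h *\<^sub>R frechet_derivative c (at s) 1)"
  proof
    show "frechet_derivative c (at s) h = h *\<^sub>R frechet_derivative c (at s) 1" for h
      using D.scaleR[of h 1] by simp
  qed
  with D show ?thesis unfolding has_vector_derivative_def by metis
qed

lemma has_vector_derivative_fst_snd:
  assumes "((c :: real \<Rightarrow> real \<times> real) has_vector_derivative d) (at s)"
  shows "((\<lambda>s. fst (c s)) has_real_derivative fst d) (at s)" "((\<lambda>s. snd (c s)) has_real_derivative snd d) (at s)"
  using has_derivative_fst[OF assms[unfolded has_vector_derivative_def]]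
    has_derivative_snd[OF assms[unfolded has_vector_derivative_def]]
  by (auto intro: has_derivative_imp_has_field_derivative)

text \<open>With \<open>\<mu>\<close> the component of the Hamiltonian field along \<open>\<gamma>\<close>, the curvature satisfies
  \<open>\<kappa> \<mu>\<^sup>3 = infl g\<close> and \<open>2 \<kappa>' \<mu>\<^sup>6 = vert 1 0 1 g\<close> along \<open>\<gamma>\<close>.\<close>

lemma curvature_criterion:
  assumes U: "open U" "smooth_on U g" and p: "p \<in> U" "(pdx g p, pdy g p) \<noteq> (0, 0)"
    and \<gamma>: "arclength_param g p \<gamma>"
  shows "curvature \<gamma> 0 = 0 \<longleftrightarrow> infl g p = 0" "deriv (curvature \<gamma>) 0 = 0 \<longleftrightarrow> vert 1 0 1 g p = 0"
proof -
  obtain r where r: "r > 0" and g0: "\<gamma> 0 = p" and sm: "smooth_on {-r<..<r} \<gamma>"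
    and lev: "\<And>s. s \<in> {-r<..<r} \<Longrightarrow> g (\<gamma> s) = 0"
    and unit: "\<And>s. s \<in> {-r<..<r} \<Longrightarrow> norm (vector_derivative \<gamma> (at s)) = 1"
    using \<gamma> unfolding arclength_param_def by blast
  define T where "T = {-r<..<r}"
  have T: "open T" "0 \<in> T" using r by (auto simp: T_def)
  define d where "d = (\<lambda>s. frechet_derivative \<gamma> (at s) 1)"
  have sd: "smooth_on T d" unfolding d_def T_def by (rule smooth_on_frechet_apply[OF _ sm]) simp
  define d2 where "d2 = (\<lambda>s. frechet_derivative d (at s) 1)"
  have D1: "(\<gamma> has_vector_derivative d s) (at s)" if "s \<in> T" for s
    using frechet_real[OF sm] that by (simp add: d_def T_def)
  have D2: "(d has_vector_derivative d2 s) (at s)" if "s \<in> T" for s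
    using frechet_real[OF sd that] by (simp add: d2_def)
  have vd: "vector_derivative \<gamma> (at s) = d s" if "s \<in> T" for s by (rule vector_derivative_at[OF D1[OF that]])
  have vd2: "vector_derivative (\<lambda>u. vector_derivative \<gamma> (at u)) (at s) = d2 s" if s: "s \<in> T" for s
  proof (rule vector_derivative_at)
    show "((\<lambda>u. vector_derivative \<gamma> (at u)) has_vector_derivative d2 s) (at s)"
      by (rule has_vector_derivative_transform_within_open[OF D2[OF s] T(1) s]) (simp add: vd)
  qed
  define x y a b a2 b2 where "x = (\<lambda>s. fst (\<gamma> s))" and "y = (\<lambda>s. snd (\<gamma> s))" and "a = (\<lambda>s. fst (d s))"
    and "b = (\<lambda>s. snd (d s))" and "a2 = (\<lambda>s. fst (d2 s))" and "b2 = (\<lambda>s. snd (d2 s))"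
  have xy: "\<gamma> s = (x s, y s)" for s by (simp add: x_def y_def)
  have der: "(x has_real_derivative a s) (at s)" "(y has_real_derivative b s) (at s)"
    "(a has_real_derivative a2 s) (at s)" "(b has_real_derivative b2 s) (at s)" if "s \<in> T" for s
    using has_vector_derivative_fst_snd[OF D1[OF that]] has_vector_derivative_fst_snd[OF D2[OF that]]
    by (simp_all add: x_def y_def a_def b_def a2_def b2_def)
  define k where "k = (\<lambda>s. a s * b2 s - b s * a2 s)"
  have curv: "curvature \<gamma> s = k s" if "s \<in> T" for s
    unfolding curvature_def Let_def vd[OF that] vd2[OF that] by (simp add: k_def a_def b_def a2_def b2_def)
  have ab1: "(a s)\<^sup>2 + (b s)\<^sup>2 = 1" if "s \<in> T" for s
    using unit[of s] vd[OF that] that by (simp add: T_def a_def b_def norm_prod_def)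
  have contg: "continuous_on T \<gamma>" using smooth_on_continuous[OF sm] by (simp add: T_def)
  define S where "S = T \<inter> \<gamma> -` U"
  have S: "open S" "0 \<in> S" "S \<subseteq> T"
    using continuous_open_preimage[OF contg T(1) U(1)] T p g0 by (auto simp: S_def)
  have inU: "(x s, y s) \<in> U" if "s \<in> S" for s using that by (simp add: S_def xy)
  have inT: "s \<in> T" if "s \<in> S" for s using that S by auto
  have chain: "((\<lambda>s. h (x s, y s)) has_real_derivative a s * pdx h (x s, y s) + b s * pdy h (x s, y s)) (at s)"
    if "smooth_on U h" "s \<in> S" for h s
    by (rule pd_curve_derivative[OF that(1) inU[OF that(2)] der(1,2)[OF inT[OF that(2)]]])
  have zero: "D = 0" if "s \<in> S" "(h has_real_derivative D) (at s)" "\<And>u. u \<in> S \<Longrightarrow> h u = (c::real)" for h D s c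
  proof (rule DERIV_unique[OF that(2)])
    have "\<forall>\<^sub>F u in nhds s. u \<in> S" using S that by (intro eventually_nhds_in_open)
    then have "\<forall>\<^sub>F u in nhds s. h u = c" by eventually_elim (rule that(3))
    then show "(h has_real_derivative 0) (at s)" by (simp add: DERIV_cong_ev)
  qed
  have e1: "a s * pdx g (x s, y s) + b s * pdy g (x s, y s) = 0" if "s \<in> S" for s
  proof (rule zero[OF that chain[OF U(2) that]])
    show "g (x u, y u) = 0" if "u \<in> S" for u using lev[of u] inT[OF that] by (simp add: xy T_def)
  qed
  note sx = smooth_on_pdx[OF U] and sy = smooth_on_pdy[OF U]
  have e2: "a2 s * pdx g (x s, y s) + a s * (a s * pdx (pdx g) (x s, y s) + b s * pdy (pdx g) (x s, y s))
      + (b2 s * pdy g (x s, y s) + b s * (a s * pdx (pdy g) (x s, y s) + b s * pdy (pdy g) (x s, y s))) = 0"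
    if "s \<in> S" for s
  proof (rule zero[OF that _ e1])
    show "((\<lambda>s. a s * pdx g (x s, y s) + b s * pdy g (x s, y s)) has_real_derivative
      a2 s * pdx g (x s, y s) + a s * (a s * pdx (pdx g) (x s, y s) + b s * pdy (pdx g) (x s, y s))
      + (b2 s * pdy g (x s, y s) + b s * (a s * pdx (pdy g) (x s, y s) + b s * pdy (pdy g) (x s, y s)))) (at s)"
      using DERIV_add[OF DERIV_mult[OF der(3)[OF inT[OF that]] chain[OF sx that]] DERIV_mult[OF der(4)[OF inT[OF that]] chain[OF sy that]]]
      by (simp add: algebra_simps)
  qed
  define \<mu> where "\<mu> = (\<lambda>s. b s * pdx g (x s, y s) - a s * pdy g (x s, y s))"
  have gx: "pdx g (x s, y s) = \<mu> s * b s" "pdy g (x s, y s) = - \<mu> s * a s" if "s \<in> S" for s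
    using e1[OF that] ab1[OF inT[OF that]] unfolding \<mu>_def by algebra+
  have muN: "(\<mu> s)\<^sup>2 = qn 1 0 1 g (x s, y s)" if "s \<in> S" for s
    using gx[OF that] ab1[OF inT[OF that]] unfolding qn_def by algebra
  have kI: "k s * \<mu> s ^ 3 = infl g (x s, y s)" if s: "s \<in> S" for s
  proof -
    have c: "pdx (pdy g) (x s, y s) = pdy (pdx g) (x s, y s)" by (rule pd_commute[OF U inU[OF s]])
    show ?thesis using e2[OF s] unfolding infl_def c gx[OF s] k_def by algebra
  qed
  have mu0: "\<mu> 0 \<noteq> 0"
  proof
    assume "\<mu> 0 = 0"
    then show False using gx[OF S(2)] p(2) g0 xy[of 0] by simp
  qed
  define \<mu>' where "\<mu>' = b2 0 * pdx g p + b 0 * (a 0 * pdx (pdx g) p + b 0 * pdy (pdx g) p)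
      - (a2 0 * pdy g p + a 0 * (a 0 * pdx (pdy g) p + b 0 * pdy (pdy g) p))"
  have xy0: "(x 0, y 0) = p" using xy[of 0] g0 by simp
  have dmu: "(\<mu> has_real_derivative \<mu>') (at 0)"
    using DERIV_diff[OF DERIV_mult[OF der(4)[OF T(2)] chain[OF sx S(2)]] DERIV_mult[OF der(3)[OF T(2)] chain[OF sy S(2)]]]
    unfolding \<mu>_def \<mu>'_def by (simp add: algebra_simps xy0)
  have ev: "\<forall>\<^sub>F s in nhds 0. s \<in> S" using S by (intro eventually_nhds_in_open)
  define I' where "I' = a 0 * pdx (infl g) p + b 0 * pdy (infl g) p"
  define N' where "N' = a 0 * pdx (qn 1 0 1 g) p + b 0 * pdy (qn 1 0 1 g) p"
  have dI: "((\<lambda>s. infl g (x s, y s)) has_real_derivative I') (at 0)"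
    using chain[OF smooth_on_infl[OF U] S(2)] by (simp add: I'_def xy0)
  have dN: "((\<lambda>s. qn 1 0 1 g (x s, y s)) has_real_derivative N') (at 0)"
    using chain[OF smooth_on_qn[OF U] S(2)] by (simp add: N'_def xy0)
  \<comment> \<open>Differentiating \<open>qn\<close> = \<mu>^2 expresses the derivative of
    \<open>qn\<close>, which occurs in \<open>vert\<close>, through the derivative of \<mu>, which
    occurs in that of the curvature.\<close>
  have "((\<lambda>s. (\<mu> s)\<^sup>2) has_real_derivative 2 * \<mu> 0 * \<mu>') (at 0)"
    using DERIV_power[OF dmu, of 2] by (simp add: mult_ac)
  moreover have "((\<lambda>s. (\<mu> s)\<^sup>2) has_real_derivative N') (at 0)"
    by (rule DERIV_cong_ev[THEN iffD2, OF refl _ refl dN]) (use ev in eventually_elim, rule muN)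
  ultimately have NN: "N' = 2 * \<mu> 0 * \<mu>'" using DERIV_unique by blast
  have mu3: "((\<lambda>s. \<mu> s ^ 3) has_real_derivative 3 * (\<mu> 0)\<^sup>2 * \<mu>') (at 0)"
    using DERIV_power[OF dmu, of 3] by (simp add: mult_ac)
  define k' where "k' = (I' * \<mu> 0 ^ 3 - infl g p * (3 * (\<mu> 0)\<^sup>2 * \<mu>')) / (\<mu> 0 ^ 3 * \<mu> 0 ^ 3)"
  have "((\<lambda>s. infl g (x s, y s) / \<mu> s ^ 3) has_real_derivative k') (at 0)"
    using DERIV_divide[OF dI mu3] mu0 by (simp add: k'_def xy0)
  moreover have ev\<mu>: "\<forall>\<^sub>F s in nhds 0. curvature \<gamma> s = infl g (x s, y s) / \<mu> s ^ 3"
  proof -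
    have "isCont \<mu> 0" using dmu DERIV_isCont by blast
    then have "(\<mu> \<longlongrightarrow> \<mu> 0) (nhds 0)" by (simp add: isCont_def tendsto_at_iff_tendsto_nhds)
    then have "\<forall>\<^sub>F s in nhds 0. \<mu> s \<noteq> 0" using mu0 by (rule tendsto_imp_eventually_ne)
    with ev show ?thesis
    proof eventually_elim
      case (elim s)
      then show ?case using kI[of s] curv[OF inT[of s]] by (simp add: field_simps)
    qed
  qed
  ultimately have "(curvature \<gamma> has_real_derivative k') (at 0)"
    by (subst DERIV_cong_ev[OF refl _ refl]) auto
  then have dk: "deriv (curvature \<gamma>) 0 = k'" by (rule DERIV_imp_deriv)
  have kI0: "k 0 * \<mu> 0 ^ 3 = infl g p" using kI[OF S(2)] by (simp add: xy0)
  then show "curvature \<gamma> 0 = 0 \<longleftrightarrow> infl g p = 0" using curv[OF T(2)] mu0 by auto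
  have kk: "k' * \<mu> 0 ^ 3 = I' - 3 * k 0 * (\<mu> 0)\<^sup>2 * \<mu>'"
    unfolding k'_def kI0[symmetric] using mu0 by (simp add: field_simps)
  have TI: "tder g (infl g) p = \<mu> 0 * I'" "tder g (qn 1 0 1 g) p = \<mu> 0 * N'"
    unfolding tder_def I'_def N'_def using gx[OF S(2)] by (simp_all add: xy0 algebra_simps)
  have "vert 1 0 1 g p = 2 * \<mu> 0 ^ 6 * k'"
  proof -
    have q: "qn 1 0 1 g p = (\<mu> 0)\<^sup>2" using muN[OF S(2)] by (simp add: xy0)
    show ?thesis unfolding vert_def TI kI0[symmetric] NN q using kk by algebra
  qed
  then show "deriv (curvature \<gamma>) 0 = 0 \<longleftrightarrow> vert 1 0 1 g p = 0" using dk mu0 by simp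
qed

text \<open>The arc length L is an antiderivative of the speed. Solving L u - s = 0 for u by
  \<open>implicit_function\<close> inverts it, with smoothness of the inverse included.\<close>

lemma arclength_param_exists:
  fixes c :: "real \<Rightarrow> real \<times> real"
  assumes c: "smooth_on {a<..<b} c" and lev: "\<And>u. u \<in> {a<..<b} \<Longrightarrow> g (c u) = 0"
    and reg: "\<And>u. u \<in> {a<..<b} \<Longrightarrow> frechet_derivative c (at u) 1 \<noteq> 0" and u0: "u0 \<in> {a<..<b}"
  shows "\<exists>\<gamma>. arclength_param g (c u0) \<gamma>"
proof -
  define d where "d = (\<lambda>u. frechet_derivative c (at u) 1)"
  have sd: "smooth_on {a<..<b} d" unfolding d_def by (rule smooth_on_frechet_apply[OF _ c]) simp
  have D: "(c has_vector_derivative d u) (at u)" if "u \<in> {a<..<b}" for u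
    using frechet_real[OF c that] by (simp add: d_def)
  define w where "w = (\<lambda>u. norm (d u))"
  have wpos: "w u > 0" if "u \<in> {a<..<b}" for u using reg[OF that] by (simp add: w_def d_def)
  have wsq: "w u = sqrt (fst (d u) ^ 2 + snd (d u) ^ 2)" for u by (simp add: w_def norm_prod_def)
  have sq: "fst (d u) ^ 2 + snd (d u) ^ 2 > 0" if "u \<in> {a<..<b}" for u
    using wpos[OF that] unfolding wsq by simp
  have "smooth_on {a<..<b} (\<lambda>u. fst (d u) ^ 2 + snd (d u) ^ 2)"
    by (intro smooth_on_add smooth_on_power smooth_on_fst smooth_on_snd sd open_greaterThanLessThan)
  then have "smooth_on {a<..<b} (\<lambda>u. sqrt (fst (d u) ^ 2 + snd (d u) ^ 2))"
    by (rule smooth_on_sqrt[OF open_greaterThanLessThan _ sq])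
  moreover have "w = (\<lambda>u. sqrt (fst (d u) ^ 2 + snd (d u) ^ 2))" by (rule ext) (rule wsq)
  ultimately have sw: "smooth_on {a<..<b} w" by (simp only:)
  \<comment> \<open>A compact interval around \<open>u0\<close>, on which the continuous speed has
    an antiderivative.\<close>
  obtain a' b' where ab: "a < a'" "a' < u0" "u0 < b'" "b' < b" using u0 dense[of a u0] dense[of u0 b] by auto
  have "continuous_on {a'..b'} w" by (rule continuous_on_subset[OF smooth_on_continuous[OF sw]]) (use ab in auto)
  from antiderivative_continuous[OF this] obtain G where
    G: "\<And>u. u \<in> {a'..b'} \<Longrightarrow> (G has_vector_derivative w u) (at u within {a'..b'})" by blast
  define L where "L = (\<lambda>u. G u - G u0)"
  have sub: "u \<in> {a<..<b}" if "u \<in> {a'<..<b'}" for u using that ab by auto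
  have dL: "(L has_real_derivative w u) (at u)" if u: "u \<in> {a'<..<b'}" for u
  proof -
    have "(G has_vector_derivative w u) (at u within {a'<..<b'})"
      by (rule has_vector_derivative_within_subset[OF G]) (use u in auto)
    then have "(G has_real_derivative w u) (at u)"
      unfolding has_real_derivative_iff_has_vector_derivative at_within_open[OF u open_greaterThanLessThan] .
    from DERIV_diff[OF this DERIV_const, of "G u0"] show ?thesis unfolding L_def by simp
  qed
  have sL: "smooth_on {a'<..<b'} L"
  proof (rule smooth_on_has_derivativeI)
    show "(L has_derivative (\<lambda>h. w u * h)) (at u)" if "u \<in> {a'<..<b'}" for u
      using dL[OF that] by (simp add: has_field_derivative_def)
    have "smooth_on {a'<..<b'} w" by (rule smooth_on_mono_set[OF sw]) (use sub in auto)
    then show "smooth_on {a'<..<b'} (\<lambda>u. w u * h)" for h by (intro smooth_intros) auto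
  qed simp
  obtain \<alpha> \<beta> where al: "a' < \<alpha>" "\<alpha> < u0" "u0 < \<beta>" "\<beta> < b'" using ab dense[of a' u0] dense[of u0 b'] by auto
  have Linc: "L s < L u" if "a' < s" "s < u" "u < b'" for s u
  proof (rule DERIV_pos_imp_increasing[OF that(2)])
    fix v assume "s \<le> v" "v \<le> u"
    then have "v \<in> {a'<..<b'}" using that by auto
    then show "\<exists>d. (L has_real_derivative d) (at v) \<and> 0 < d" using dL wpos sub by blast
  qed
  have L0: "L u0 = 0" by (simp add: L_def)
  have La: "L \<alpha> < 0" "0 < L \<beta>" using Linc[of \<alpha> u0] Linc[of u0 \<beta>] al ab L0 by auto
  define r where "r = min (- L \<alpha>) (L \<beta>)"
  have r: "r > 0" using La by (simp add: r_def)
  define W where "W = (UNIV :: real set) \<times> {a'<..<b'}"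
  have W: "open W" unfolding W_def by (intro open_Times) auto
  have sg: "smooth_on W (\<lambda>z. L (snd z) - fst z)"
    by (intro smooth_intros W smooth_on_compose[OF sL W, of snd]) (auto simp: W_def)
  have fr: "frechet_derivative (\<lambda>z. L (snd z) - fst z) (at z) (0, 1) = w (snd z)" if z: "z \<in> W" for z
  proof -
    have "((\<lambda>s. (\<lambda>z. L (snd z) - fst z) (fst z, s)) has_real_derivative
        frechet_derivative (\<lambda>z. L (snd z) - fst z) (at (fst z, snd z)) (0, 1)) (at (snd z))"
      by (rule smooth_vertical_derivative[OF sg]) (use z in simp)
    moreover have "((\<lambda>s. L s - fst z) has_real_derivative w (snd z)) (at (snd z))"
      using DERIV_diff[OF dL DERIV_const, of "snd z" "fst z"] z by (auto simp: W_def)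
    ultimately show ?thesis using DERIV_unique by force
  qed
  have ex: "\<exists>u. (s, u) \<in> W \<and> L (snd (s, u)) - fst (s, u) = 0" if s: "s \<in> {-r<..<r}" for s
  proof -
    have "continuous_on {\<alpha>..\<beta>} L"
      by (rule continuous_on_subset[OF smooth_on_continuous[OF sL]]) (use al in auto)
    moreover have "r \<le> - L \<alpha>" "r \<le> L \<beta>" by (simp_all add: r_def)
    then have "L \<alpha> \<le> s" "s \<le> L \<beta>" using s by auto
    ultimately obtain u where "\<alpha> \<le> u" "u \<le> \<beta>" "L u = s"
      using IVT'[of L \<alpha> s \<beta>] al by auto
    then show ?thesis using al by (intro exI[of _ u]) (auto simp: W_def)
  qed
  obtain \<phi> where \<phi>: "smooth_on {-r<..<r} \<phi>" "\<And>s. s \<in> {-r<..<r} \<Longrightarrow> (s, \<phi> s) \<in> W"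
    "\<And>s. s \<in> {-r<..<r} \<Longrightarrow> L (snd (s, \<phi> s)) - fst (s, \<phi> s) = 0"
    "\<And>s u. s \<in> {-r<..<r} \<Longrightarrow> (s, u) \<in> W \<Longrightarrow> L (snd (s, u)) - fst (s, u) = 0 \<Longrightarrow> u = \<phi> s"
    by (rule implicit_function[OF W sg _ _ open_greaterThanLessThan ex]) (auto simp: fr W_def intro!: wpos sub)
  have ph: "\<phi> s \<in> {a'<..<b'}" "L (\<phi> s) = s" if "s \<in> {-r<..<r}" for s
    using \<phi>(2,3)[OF that] by (auto simp: W_def)
  have ph0: "\<phi> 0 = u0" using \<phi>(4)[of 0 u0] r ab L0 by (simp add: W_def)
  define \<gamma> where "\<gamma> = (\<lambda>s. c (\<phi> s))"
  have "arclength_param g (c u0) \<gamma>"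
    unfolding arclength_param_def
  proof (intro conjI exI[of _ r] r ballI)
    show "\<gamma> 0 = c u0" by (simp add: \<gamma>_def ph0)
    show "smooth_on {-r<..<r} \<gamma>" unfolding \<gamma>_def
      by (rule smooth_on_compose[OF c _ _ \<phi>(1)]) (use ph(1) sub in auto)
    fix s assume s: "s \<in> {-r<..<r}"
    show "g (\<gamma> s) = 0" unfolding \<gamma>_def by (rule lev[OF sub[OF ph(1)[OF s]]])
    define \<phi>' where "\<phi>' = frechet_derivative \<phi> (at s) 1"
    have d\<phi>: "(\<phi> has_vector_derivative \<phi>') (at s)" using frechet_real[OF \<phi>(1) s] by (simp add: \<phi>'_def)
    have "((\<lambda>s. L (\<phi> s)) has_real_derivative w (\<phi> s) * \<phi>') (at s)"
      by (rule DERIV_chain2[where f = L and g = \<phi>, OF dL[OF ph(1)[OF s]]]) (use d\<phi> in \<open>simp add: has_real_derivative_iff_has_vector_derivative\<close>)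
    moreover have "((\<lambda>s. L (\<phi> s)) has_real_derivative 1) (at s)"
    proof (rule DERIV_cong_ev[THEN iffD2])
      have "\<forall>\<^sub>F u in nhds s. u \<in> {-r<..<r}" using s by (intro eventually_nhds_in_open) auto
      then show "\<forall>\<^sub>F u in nhds s. L (\<phi> u) = u" by eventually_elim (rule ph(2))
    qed (auto intro: DERIV_ident)
    ultimately have e: "w (\<phi> s) * \<phi>' = 1" using DERIV_unique by blast
    have wp: "w (\<phi> s) > 0" using wpos[OF sub[OF ph(1)[OF s]]] .
    then have "\<phi>' > 0" using e by (metis mult_pos_neg not_less_iff_gr_or_eq mult_zero_right zero_less_one)
    have "(\<gamma> has_vector_derivative \<phi>' *\<^sub>R d (\<phi> s)) (at s)"
      using vector_diff_chain_at[OF d\<phi> D[OF sub[OF ph(1)[OF s]]]] by (simp add: \<gamma>_def o_def)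
    then have "vector_derivative \<gamma> (at s) = \<phi>' *\<^sub>R d (\<phi> s)" by (rule vector_derivative_at)
    then show "norm (vector_derivative \<gamma> (at s)) = 1"
      using e \<open>\<phi>' > 0\<close> by (simp add: w_def mult.commute)
  qed
  then show ?thesis by blast
qed

text \<open>Inflections and vertices are defined by the existence of a suitable arc length
  parametrisation. The criterion holds for each such parametrisation, and the previous lemma
  provides one, which gives the converse direction.\<close>

lemma inflection_vertex_iff:
  fixes c :: "real \<Rightarrow> real \<times> real"
  assumes U: "open U" "smooth_on U g" and c: "smooth_on {a<..<b} c" "\<And>u. u \<in> {a<..<b} \<Longrightarrow> g (c u) = 0"
    "\<And>u. u \<in> {a<..<b} \<Longrightarrow> frechet_derivative c (at u) 1 \<noteq> 0" and u: "u \<in> {a<..<b}"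
    and p: "c u \<in> U" "(pdx g (c u), pdy g (c u)) \<noteq> (0, 0)"
  shows "inflection g (c u) \<longleftrightarrow> infl g (c u) = 0" "vertex g (c u) \<longleftrightarrow> vert 1 0 1 g (c u) = 0"
proof -
  obtain \<gamma> where \<gamma>: "arclength_param g (c u) \<gamma>" using arclength_param_exists[of a b c g u, OF c u] by blast
  have r: "regular_point g (c u)" using c(2)[OF u] p(2) by (simp add: regular_point_def)
  note k = curvature_criterion[OF U p]
  show "inflection g (c u) \<longleftrightarrow> infl g (c u) = 0" "vertex g (c u) \<longleftrightarrow> vert 1 0 1 g (c u) = 0"
    unfolding inflection_def vertex_def using k \<gamma> r by blast+
qed


section \<open>Curves consisting of two smooth arcs\<close>

text \<open>Affine on each gap between consecutive marked points. Working on closed intervals with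
  prescribed end values lets the pieces of the induction agree where they meet.\<close>

lemma interval_matching:
  fixes a b a' b' :: real
  assumes "a < b" "a' < b'" "sorted_wrt (<) ts" "set ts \<subseteq> {a<..<b}" "sorted_wrt (<) ts'" "set ts' \<subseteq> {a'<..<b'}"
    "length ts = length ts'"
  shows "\<exists>\<psi> \<theta>. homeomorphism {a..b} {a'..b'} \<psi> \<theta> \<and> \<psi> a = a' \<and> \<psi> b = b' \<and> map \<psi> ts = ts'"
  using assms
proof (induction ts arbitrary: a a' ts')
  case Nil
  define \<psi> where "\<psi> = (\<lambda>u. a' + (u - a) * ((b' - a') / (b - a)))"
  define \<theta> where "\<theta> = (\<lambda>u. a + (u - a') * ((b - a) / (b' - a')))"
  have k: "(b' - a') / (b - a) > 0" "(b - a) / (b' - a') > 0" using Nil by auto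
  have e: "\<psi> a = a'" "\<psi> b = b'" "\<theta> a' = a" "\<theta> b' = b" using Nil by (auto simp: \<psi>_def \<theta>_def)
  have m: "u \<le> v \<Longrightarrow> \<psi> u \<le> \<psi> v" "u \<le> v \<Longrightarrow> \<theta> u \<le> \<theta> v" for u v
  proof -
    show "u \<le> v \<Longrightarrow> \<psi> u \<le> \<psi> v" unfolding \<psi>_def
      by (rule add_left_mono, rule mult_right_mono, simp, rule less_imp_le[OF k(1)])
    show "u \<le> v \<Longrightarrow> \<theta> u \<le> \<theta> v" unfolding \<theta>_def
      by (rule add_left_mono, rule mult_right_mono, simp, rule less_imp_le[OF k(2)])
  qed
  have "homeomorphism {a..b} {a'..b'} \<psi> \<theta>"
  proof (rule homeomorphismI)
    show "continuous_on {a..b} \<psi>" "continuous_on {a'..b'} \<theta>"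
      unfolding \<psi>_def \<theta>_def by (intro continuous_intros)+
    show "\<psi> ` {a..b} \<subseteq> {a'..b'}" "\<theta> ` {a'..b'} \<subseteq> {a..b}" using m e by (auto, metis+)
    show "\<theta> (\<psi> x) = x" "\<psi> (\<theta> x) = x" for x using Nil by (simp_all add: \<psi>_def \<theta>_def)
  qed
  then have "homeomorphism {a..b} {a'..b'} \<psi> \<theta> \<and> \<psi> a = a' \<and> \<psi> b = b' \<and> map \<psi> [] = ts'" using Nil e by auto
  then show ?case by blast
next
  case (Cons t ts)
  then obtain t' us where ts': "ts' = t' # us" by (cases ts') auto
  have t: "a < t" "t < b" "a' < t'" "t' < b'" using Cons.prems ts' by auto
  obtain \<psi>2 \<theta>2 where h2: "homeomorphism {t..b} {t'..b'} \<psi>2 \<theta>2" "\<psi>2 t = t'" "\<psi>2 b = b'" "map \<psi>2 ts = us"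
    using Cons.IH[of t t' us] Cons.prems t ts' by (auto simp: subset_iff)
  define k where "k = (t' - a') / (t - a)"
  define \<psi>1 where "\<psi>1 = (\<lambda>u. a' + (u - a) * ((t' - a') / (t - a)))"
  define \<theta>1 where "\<theta>1 = (\<lambda>u. a + (u - a') * ((t - a) / (t' - a')))"
  have k: "(t' - a') / (t - a) > 0" "(t - a) / (t' - a') > 0" using t by auto
  have e: "\<psi>1 a = a'" "\<psi>1 t = t'" "\<theta>1 a' = a" "\<theta>1 t' = t" using t by (auto simp: \<psi>1_def \<theta>1_def)
  have m: "u \<le> v \<Longrightarrow> \<psi>1 u \<le> \<psi>1 v" "u \<le> v \<Longrightarrow> \<theta>1 u \<le> \<theta>1 v" for u v
  proof -
    show "u \<le> v \<Longrightarrow> \<psi>1 u \<le> \<psi>1 v" unfolding \<psi>1_def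
      by (rule add_left_mono, rule mult_right_mono, simp, rule less_imp_le[OF k(1)])
    show "u \<le> v \<Longrightarrow> \<theta>1 u \<le> \<theta>1 v" unfolding \<theta>1_def
      by (rule add_left_mono, rule mult_right_mono, simp, rule less_imp_le[OF k(2)])
  qed
  have inv: "\<theta>1 (\<psi>1 x) = x" "\<psi>1 (\<theta>1 x) = x" for x using t by (simp_all add: \<psi>1_def \<theta>1_def)
  have c1: "continuous_on S \<psi>1" "continuous_on S \<theta>1" for S unfolding \<psi>1_def \<theta>1_def by (intro continuous_intros)+
  have c2: "continuous_on {t..b} \<psi>2" "continuous_on {t'..b'} \<theta>2" "\<psi>2 ` {t..b} = {t'..b'}" "\<theta>2 ` {t'..b'} = {t..b}"
    "\<And>x. x \<in> {t..b} \<Longrightarrow> \<theta>2 (\<psi>2 x) = x" "\<And>x. x \<in> {t'..b'} \<Longrightarrow> \<psi>2 (\<theta>2 x) = x"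
    using h2(1) by (auto simp: homeomorphism_def)
  have chi2: "\<theta>2 t' = t" using c2(5)[of t] h2(2) t by simp
  define \<psi> where "\<psi> = (\<lambda>u. if u \<le> t then \<psi>1 u else \<psi>2 u)"
  define \<theta> where "\<theta> = (\<lambda>u. if u \<le> t' then \<theta>1 u else \<theta>2 u)"
  have U: "{a..b} = {a..t} \<union> {t..b}" "{a'..b'} = {a'..t'} \<union> {t'..b'}" using t by auto
  have p2: "\<psi>2 u \<in> {t'..b'}" "u \<noteq> t \<Longrightarrow> \<psi>2 u > t'" if "u \<in> {t..b}" for u
  proof -
    show 1: "\<psi>2 u \<in> {t'..b'}" using c2(3) that by auto
    show "\<psi>2 u > t'" if "u \<noteq> t" using 1 c2(5)[OF \<open>u \<in> {t..b}\<close>] that chi2 by (cases "\<psi>2 u = t'") auto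
  qed
  have q2: "\<theta>2 u \<in> {t..b}" "u \<noteq> t' \<Longrightarrow> \<theta>2 u > t" if "u \<in> {t'..b'}" for u
  proof -
    show 1: "\<theta>2 u \<in> {t..b}" using c2(4) that by auto
    show "\<theta>2 u > t" if "u \<noteq> t'" using 1 c2(6)[OF \<open>u \<in> {t'..b'}\<close>] that h2(2) by (cases "\<theta>2 u = t") auto
  qed
  have p1: "\<psi>1 u \<in> {a'..t'}" if "u \<in> {a..t}" for u using m(1)[of a u] m(1)[of u t] e that by auto
  have q1: "\<theta>1 u \<in> {a..t}" if "u \<in> {a'..t'}" for u using m(2)[of a' u] m(2)[of u t'] e that by auto
  have "homeomorphism {a..b} {a'..b'} \<psi> \<theta>"
  proof (rule homeomorphismI)
    show "continuous_on {a..b} \<psi>" unfolding \<psi>_def U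
      by (rule continuous_on_cases[OF closed_atLeastAtMost closed_atLeastAtMost c1(1) c2(1)]) (use e h2(2) in auto)
    show "continuous_on {a'..b'} \<theta>" unfolding \<theta>_def U
      by (rule continuous_on_cases[OF closed_atLeastAtMost closed_atLeastAtMost c1(2) c2(2)]) (use e chi2 in auto)
    show "\<psi> ` {a..b} \<subseteq> {a'..b'}"
    proof
      fix v assume "v \<in> \<psi> ` {a..b}"
      then obtain u where "v = \<psi> u" "u \<in> {a..b}" by blast
      then show "v \<in> {a'..b'}" using p1[of u] p2(1)[of u] t by (auto simp: \<psi>_def split: if_splits)
    qed
    show "\<theta> ` {a'..b'} \<subseteq> {a..b}"
    proof
      fix v assume "v \<in> \<theta> ` {a'..b'}"
      then obtain u where "v = \<theta> u" "u \<in> {a'..b'}" by blast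
      then show "v \<in> {a..b}" using q1[of u] q2(1)[of u] t by (auto simp: \<theta>_def split: if_splits)
    qed
    show "\<theta> (\<psi> x) = x" if "x \<in> {a..b}" for x
      using that p1[of x] p2[of x] inv(1)[of x] c2(5)[of x] by (auto simp: \<psi>_def \<theta>_def)
    show "\<psi> (\<theta> x) = x" if "x \<in> {a'..b'}" for x
      using that q1[of x] q2[of x] inv(2)[of x] c2(6)[of x] by (auto simp: \<psi>_def \<theta>_def)
  qed
  moreover have "map \<psi> ts = map \<psi>2 ts" using Cons.prems(3) by (auto simp: \<psi>_def)
  ultimately have "homeomorphism {a..b} {a'..b'} \<psi> \<theta> \<and> \<psi> a = a' \<and> \<psi> b = b' \<and> map \<psi> (t # ts) = ts'"
    using t e h2 by (auto simp: \<psi>_def ts')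
  then show ?case by blast
qed

lemma spells_matching:
  fixes a b a' b' :: real
  assumes ab: "a < b" "a' < b'" and s: "spells {a<..<b} P Q w" "spells {a'<..<b'} P' Q' w"
  shows "\<exists>\<psi> \<theta>. homeomorphism {a<..<b} {a'<..<b'} \<psi> \<theta> \<and> (\<forall>u\<in>{a<..<b}. P' (\<psi> u) = P u \<and> Q' (\<psi> u) = Q u)"
proof -
  obtain ts ts' where ts: "sorted_wrt (<) ts" "set ts = {u \<in> {a<..<b}. P u \<or> Q u}"
    "list_all2 (\<lambda>l u. (l = I \<longleftrightarrow> P u) \<and> (l = V \<longleftrightarrow> Q u)) w ts"
    and ts': "sorted_wrt (<) ts'" "set ts' = {u \<in> {a'<..<b'}. P' u \<or> Q' u}"
    "list_all2 (\<lambda>l u. (l = I \<longleftrightarrow> P' u) \<and> (l = V \<longleftrightarrow> Q' u)) w ts'"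
    using s unfolding spells_def by blast
  have len: "length ts = length w" "length ts' = length w" using ts(3) ts'(3) by (auto dest: list_all2_lengthD)
  have s: "set ts \<subseteq> {a<..<b}" "set ts' \<subseteq> {a'<..<b'}" "length ts = length ts'"
    unfolding ts(2) ts'(2) len by (blast, blast, rule refl)
  obtain \<psi> \<theta> where h: "homeomorphism {a..b} {a'..b'} \<psi> \<theta>" "\<psi> a = a'" "\<psi> b = b'" "map \<psi> ts = ts'"
    using interval_matching[OF ab ts(1) s(1) ts'(1) s(2,3)] by (elim exE conjE)
  have inj: "\<psi> x = \<psi> y \<longleftrightarrow> x = y" if "x \<in> {a..b}" "y \<in> {a..b}" for x y
    using h(1) that unfolding homeomorphism_def by metis
  have im: "\<psi> ` {a..b} = {a'..b'}" using h(1) by (simp add: homeomorphism_def)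
  have img: "\<psi> ` {a<..<b} = {a'<..<b'}"
  proof (intro equalityI subsetI)
    fix v assume "v \<in> \<psi> ` {a<..<b}"
    then obtain u where u: "v = \<psi> u" "u \<in> {a<..<b}" by blast
    then have "v \<in> {a'..b'}" "v \<noteq> a'" "v \<noteq> b'" using im inj[of u a] inj[of u b] h(2,3) ab by auto
    then show "v \<in> {a'<..<b'}" by auto
  next
    fix v assume v: "v \<in> {a'<..<b'}"
    then have "v \<in> \<psi> ` {a..b}" unfolding im by auto
    then obtain u where u: "v = \<psi> u" "u \<in> {a..b}" by blast
    then have "u \<noteq> a" "u \<noteq> b" using v h(2,3) by auto
    then show "v \<in> \<psi> ` {a<..<b}" using u by auto
  qed
  have hom: "homeomorphism {a<..<b} {a'<..<b'} \<psi> \<theta>"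
    by (rule homeomorphism_of_subsets[OF h(1) _ _ img]) auto
  have nth: "ts' ! j = \<psi> (ts ! j)" if "j < length w" for j using h(4) len that by (metis nth_map)
  have lt: "(w ! j = I \<longleftrightarrow> P (ts ! j)) \<and> (w ! j = V \<longleftrightarrow> Q (ts ! j))"
    "(w ! j = I \<longleftrightarrow> P' (ts' ! j)) \<and> (w ! j = V \<longleftrightarrow> Q' (ts' ! j))" if "j < length w" for j
    using ts(3) ts'(3) that by (auto simp: list_all2_conv_all_nth)
  have "P' (\<psi> u) = P u \<and> Q' (\<psi> u) = Q u" if u: "u \<in> {a<..<b}" for u
  proof (cases "u \<in> set ts")
    case True
    then obtain j where "j < length w" "u = ts ! j" using len by (metis in_set_conv_nth)
    then show ?thesis using lt[of j] nth[of j] by auto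
  next
    case False
    have "\<psi> u \<notin> set ts'"
    proof
      assume "\<psi> u \<in> set ts'"
      then obtain v where "v \<in> set ts" "\<psi> u = \<psi> v" using h(4) by auto
      then show False using inj[of u v] u ts(2) False by auto
    qed
    moreover have "\<psi> u \<in> {a'<..<b'}" using img u by blast
    ultimately show ?thesis using False ts(2) ts'(2) u by auto
  qed
  then show ?thesis using hom by blast
qed

text \<open>The notion is built from injective continuous arcs and their intersection, all of which
  a homeomorphism carries over in both directions.\<close>

lemma self_intersection_homeomorphism:
  assumes h: "homeomorphism A B \<phi> \<psi>" and p: "p \<in> A"
  shows "self_intersection A p \<longleftrightarrow> self_intersection B (\<phi> p)"
proof -
  have imp: "self_intersection B (\<phi> p)" if h: "homeomorphism A B \<phi> \<psi>" and p: "p \<in> A" and s: "self_intersection A p"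
    for A B :: "(real \<times> real) set" and \<phi> \<psi> p
  proof -
    obtain c1 c2 where c: "\<forall>\<gamma>\<in>{c1, c2}. continuous_on {-1..1::real} \<gamma> \<and> inj_on \<gamma> {-1..1} \<and> \<gamma> 0 = p \<and> \<gamma> ` {-1..1} \<subseteq> A"
      "c1 ` {-1..1} \<inter> c2 ` {-1..1} = {p}" using s unfolding self_intersection_def by blast
    have inj: "inj_on \<phi> A" using h by (metis homeomorphism_def inj_on_inverseI)
    have "\<forall>\<gamma>\<in>{\<phi> \<circ> c1, \<phi> \<circ> c2}. continuous_on {-1..1::real} \<gamma> \<and> inj_on \<gamma> {-1..1} \<and> \<gamma> 0 = \<phi> p \<and> \<gamma> ` {-1..1} \<subseteq> B"
    proof -
      have "continuous_on {-1..1} (\<phi> \<circ> c) \<and> inj_on (\<phi> \<circ> c) {-1..1} \<and> (\<phi> \<circ> c) 0 = \<phi> p \<and> (\<phi> \<circ> c) ` {-1..1} \<subseteq> B"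
        if "continuous_on {-1..1::real} c \<and> inj_on c {-1..1} \<and> c 0 = p \<and> c ` {-1..1} \<subseteq> A" for c
      proof (intro conjI)
        show "continuous_on {-1..1} (\<phi> \<circ> c)"
          by (rule continuous_on_compose, use that in blast, rule continuous_on_subset[of A])
            (use h that in \<open>auto simp: homeomorphism_def\<close>)
        show "inj_on (\<phi> \<circ> c) {-1..1}"
          by (rule comp_inj_on, use that in blast, rule inj_on_subset[OF inj]) (use that in blast)
        show "(\<phi> \<circ> c) 0 = \<phi> p" using that by simp
        show "(\<phi> \<circ> c) ` {-1..1} \<subseteq> B" using that h by (auto simp: homeomorphism_def)
      qed
      then show ?thesis using c(1) by blast
    qed
    moreover have "(\<phi> \<circ> c1) ` {-1..1} \<inter> (\<phi> \<circ> c2) ` {-1..1} = {\<phi> p}"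
    proof -
      have "\<phi> ` (c1 ` {-1..1} \<inter> c2 ` {-1..1}) = \<phi> ` (c1 ` {-1..1}) \<inter> \<phi> ` (c2 ` {-1..1})"
        by (rule inj_on_image_Int[OF inj]) (use c(1) in auto)
      then show ?thesis by (simp only: image_comp c(2) image_insert image_empty)
    qed
    ultimately show ?thesis unfolding self_intersection_def by blast
  qed
  have "\<psi> (\<phi> p) = p" "\<phi> p \<in> B" using h p by (auto simp: homeomorphism_def)
  then show ?thesis using imp[OF h p] imp[OF homeomorphism_symD[OF h], of "\<phi> p"] by auto
qed

text \<open>The linear form \<open>L\<close> is a left inverse of the parametrisation, defined on
  the whole plane. It makes the inverse continuous and smoothly extendable at once; for level arcs
  it is the pullback of x - y.\<close>

definition arc_on :: "(real \<times> real \<Rightarrow> real) \<Rightarrow> (real \<times> real) set \<Rightarrow> letter list \<Rightarrow> bool" where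
  "arc_on g K w \<longleftrightarrow> (\<exists>a b c L. a < b \<and> smooth_on {a<..<b} c \<and> bounded_linear (L :: real \<times> real \<Rightarrow> real) \<and>
     (\<forall>u\<in>{a<..<b}. L (c u) = u) \<and> c ` {a<..<b} = K \<and> (\<forall>p\<in>K. regular_point g p) \<and>
     spells {a<..<b} (\<lambda>u. inflection g (c u)) (\<lambda>u. vertex g (c u)) w)"

text \<open>A linear form without zeros on the curve makes the two parts open and closed in it, so
  maps defined on the parts can be glued without any condition where they meet.\<close>

definition two_arcs :: "real \<Rightarrow> (real \<times> real \<Rightarrow> real) \<Rightarrow> letter list \<Rightarrow> letter list \<Rightarrow> bool" where
  "two_arcs e g v w \<longleftrightarrow> (\<exists>el. bounded_linear (el :: real \<times> real \<Rightarrow> real) \<and> (\<forall>p\<in>curve e g. el p \<noteq> 0) \<and>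
     arc_on g {p \<in> curve e g. el p > 0} v \<and> arc_on g {p \<in> curve e g. el p < 0} w)"

lemma arc_on_rev: "arc_on g K w \<Longrightarrow> arc_on g K (rev w)"
proof -
  assume "arc_on g K w"
  then obtain a b c L where h: "a < b" "smooth_on {a<..<b} c" "bounded_linear (L :: real \<times> real \<Rightarrow> real)"
    "\<forall>u\<in>{a<..<b}. L (c u) = u" "c ` {a<..<b} = K" "\<forall>p\<in>K. regular_point g p"
    "spells {a<..<b} (\<lambda>u. inflection g (c u)) (\<lambda>u. vertex g (c u)) w"
    unfolding arc_on_def by blast
  have im: "uminus ` {a<..<b} = {- b<..<- a}" by simp
  have "smooth_on {- b<..<- a} (\<lambda>u. c (- u))"
    by (rule smooth_on_compose[OF h(2)]) (auto intro!: smooth_intros)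
  moreover have "bounded_linear (\<lambda>p. - L p)" by (rule bounded_linear_minus[OF h(3)])
  moreover have "(\<lambda>u. c (- u)) ` {- b<..<- a} = K"
    unfolding im[symmetric] image_image minus_minus by (rule h(5))
  moreover have "spells {- b<..<- a} (\<lambda>u. inflection g (c (- u))) (\<lambda>u. vertex g (c (- u))) (rev w)"
    unfolding im[symmetric] by (rule spells_antimono[OF h(7)]) auto
  ultimately show ?thesis unfolding arc_on_def using h
    by (intro exI[of _ "- b"] exI[of _ "- a"] exI[of _ "\<lambda>u. c (- u)"] exI[of _ "\<lambda>p. - L p"]) auto
qed

lemma two_arcs_swap: "two_arcs e g v w \<Longrightarrow> two_arcs e g w v"
  unfolding two_arcs_def
proof (elim exE conjE)
  fix el :: "real \<times> real \<Rightarrow> real"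
  assume h: "bounded_linear el" "\<forall>p\<in>curve e g. el p \<noteq> 0" "arc_on g {p \<in> curve e g. el p > 0} v" "arc_on g {p \<in> curve e g. el p < 0} w"
  show "\<exists>el. bounded_linear (el :: real \<times> real \<Rightarrow> real) \<and> (\<forall>p\<in>curve e g. el p \<noteq> 0) \<and>
     arc_on g {p \<in> curve e g. el p > 0} w \<and> arc_on g {p \<in> curve e g. el p < 0} v"
    by (intro exI[of _ "\<lambda>p. - el p"] conjI bounded_linear_minus[OF h(1)]) (use h in auto)
qed

lemma two_arcs_rev:
  assumes "two_arcs e g v w" shows "two_arcs e g (rev v) w" "two_arcs e g v (rev w)" "two_arcs e g (rev v) (rev w)"
  using assms arc_on_rev unfolding two_arcs_def by blast+

lemma arc_on_connected:
  assumes "arc_on g K w" shows "connected K" "K \<noteq> {}"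
proof -
  obtain a b and c :: "real \<Rightarrow> real \<times> real" where h: "a < b" "smooth_on {a<..<b} c" "c ` {a<..<b} = K"
    using assms unfolding arc_on_def by blast
  show "connected K" using connected_continuous_image[OF smooth_on_continuous[OF h(2)]] h(3) by auto
  show "K \<noteq> {}" using h(1,3) by auto
qed

lemma arc_on_has_word:
  assumes "arc_on g K w" shows "has_word g K w"
proof -
  obtain a b c L where h: "a < b" "smooth_on {a<..<b} c" "bounded_linear (L :: real \<times> real \<Rightarrow> real)"
    "\<And>u. u \<in> {a<..<b} \<Longrightarrow> L (c u) = u" "c ` {a<..<b} = K" "\<forall>p\<in>K. regular_point g p"
    "spells {a<..<b} (\<lambda>u. inflection g (c u)) (\<lambda>u. vertex g (c u)) w"
    using assms unfolding arc_on_def by blast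
  define s where "s = (\<lambda>u. a + u * (b - a))"
  define s' where "s' = (\<lambda>u. (u - a) / (b - a))"
  have ss: "s (s' u) = u" "s' (s u) = u" for u using h(1) by (simp_all add: s_def s'_def)
  have sin: "s u \<in> {a<..<b} \<longleftrightarrow> u \<in> {0<..<1}" for u
  proof -
    have "s u < b \<longleftrightarrow> u * (b - a) < 1 * (b - a)" unfolding s_def mult_1_left by linarith
    then have "s u < b \<longleftrightarrow> u < 1" using mult_less_cancel_right_pos[of "b - a" u 1] h(1) by linarith
    moreover have "a < s u \<longleftrightarrow> 0 * (b - a) < u * (b - a)" unfolding s_def mult_zero_left by linarith
    then have "a < s u \<longleftrightarrow> 0 < u" using mult_less_cancel_right_pos[of "b - a" 0 u] h(1) by linarith
    ultimately show ?thesis by (simp only: greaterThanLessThan_iff)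
  qed
  have s'in: "s' u \<in> {0<..<1} \<longleftrightarrow> u \<in> {a<..<b}" for u using sin[of "s' u"] unfolding ss by (rule sym)
  have sim: "s ` {0<..<1} = {a<..<b}"
  proof (intro equalityI subsetI)
    fix u assume u: "u \<in> {a<..<b}"
    show "u \<in> s ` {0<..<1}" by (rule image_eqI[of _ _ "s' u"], rule ss(1)[symmetric], use u s'in[of u] in blast)
  next
    fix u assume "u \<in> s ` {0<..<1}"
    then show "u \<in> {a<..<b}" using sin by blast
  qed
  obtain ts where ts: "sorted_wrt (<) ts" "set ts = {u \<in> {a<..<b}. inflection g (c u) \<or> vertex g (c u)}"
    "list_all2 (\<lambda>l u. (l = I \<longleftrightarrow> inflection g (c u)) \<and> (l = V \<longleftrightarrow> vertex g (c u))) w ts"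
    using h(7) unfolding spells_def by blast
  have hom: "homeomorphism {0<..<1} K (\<lambda>u. c (s u)) (\<lambda>p. s' (L p))"
  proof (rule homeomorphismI)
    show "continuous_on {0<..<1} (\<lambda>u. c (s u))"
    proof (rule continuous_on_compose2[OF smooth_on_continuous[OF h(2)]])
      show "continuous_on {0<..<1} s" unfolding s_def by (intro continuous_intros)
      show "s ` {0<..<1} \<subseteq> {a<..<b}" using sim by simp
    qed
    have K: "\<exists>u. p = c u \<and> u \<in> {a<..<b} \<and> L p = u" if "p \<in> K" for p using that h(4,5) by blast
    have "continuous_on K (\<lambda>p. (L p - a) / (b - a))"
      by (intro continuous_intros linear_continuous_on[OF h(3)]) (use h(1) in simp)
    then show "continuous_on K (\<lambda>p. s' (L p))" by (simp only: s'_def)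
    show "(\<lambda>u. c (s u)) ` {0<..<1} \<subseteq> K"
    proof
      fix p assume "p \<in> (\<lambda>u. c (s u)) ` {0<..<1}"
      then obtain u where "p = c (s u)" "u \<in> {0<..<1}" by blast
      then show "p \<in> K" using sin[of u] h(5) by blast
    qed
    show "(\<lambda>p. s' (L p)) ` K \<subseteq> {0<..<1}"
    proof
      fix v assume "v \<in> (\<lambda>p. s' (L p)) ` K"
      then obtain p where p: "v = s' (L p)" "p \<in> K" by blast
      obtain u where "u \<in> {a<..<b}" "L p = u" using K[OF p(2)] by blast
      then show "v \<in> {0<..<1}" using s'in[of u] p(1) by metis
    qed
    show "s' (L (c (s u))) = u" if "u \<in> {0<..<1}" for u
    proof -
      have "L (c (s u)) = s u" by (rule h(4)) (use that sin[of u] in blast)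
      then show ?thesis by (simp only: ss)
    qed
    show "c (s (s' (L p))) = p" if "p \<in> K" for p
    proof -
      obtain u where "p = c u" "L p = u" using K \<open>p \<in> K\<close> by blast
      then show ?thesis by (simp only: ss)
    qed
  qed
  have len: "length ts = length w" using ts(3) by (auto dest: list_all2_lengthD)
  have mono: "s' u < s' v" if "u < v" for u v using that h(1) by (simp add: s'_def divide_strict_right_mono)
  have "sorted_wrt (<) (map s' ts)" unfolding sorted_wrt_map
    by (rule sorted_wrt_mono_rel[OF _ ts(1)]) (rule mono)
  moreover have "set (map s' ts) = {u \<in> {0<..<1}. inflection g (c (s u)) \<or> vertex g (c (s u))}"
  proof (intro equalityI subsetI)
    fix u assume "u \<in> set (map s' ts)"
    then obtain v where "v \<in> set ts" "u = s' v" by auto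
    then show "u \<in> {u \<in> {0<..<1}. inflection g (c (s u)) \<or> vertex g (c (s u))}" using ts(2) s'in[of v] ss(1)[of v] by simp
  next
    fix u assume "u \<in> {u \<in> {0<..<1}. inflection g (c (s u)) \<or> vertex g (c (s u))}"
    then have "s u \<in> set ts" using ts(2) sin[of u] by simp
    then show "u \<in> set (map s' ts)" using ss(2)[of u] by force
  qed
  moreover have "\<forall>j<length w. (w ! j = I \<longleftrightarrow> inflection g (c (s (map s' ts ! j)))) \<and> (w ! j = V \<longleftrightarrow> vertex g (c (s (map s' ts ! j))))"
    using ts(3) by (simp add: list_all2_conv_all_nth ss(1) len)
  ultimately show ?thesis unfolding has_word_def using h(6)
    by (intro conjI, blast, intro exI[of _ "\<lambda>u. c (s u)"], intro exI[of _ "\<lambda>p. s' (L p)"],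
        intro exI[of _ "map s' ts"] conjI hom) (simp_all only: length_map len)
qed

text \<open>On a connected subset the form \<open>el\<close> cannot take both signs without
  vanishing, so the two connected parts are maximal.\<close>

lemma two_arcs_has_strings:
  assumes "two_arcs e g v w" shows "has_strings e g (v, w)"
proof -
  obtain el where h: "bounded_linear (el :: real \<times> real \<Rightarrow> real)" "\<forall>p\<in>curve e g. el p \<noteq> 0"
    "arc_on g {p \<in> curve e g. el p > 0} v" "arc_on g {p \<in> curve e g. el p < 0} w"
    using assms unfolding two_arcs_def by blast
  let ?S = "curve e g" and ?K = "{p \<in> curve e g. el p > 0}" and ?M = "{p \<in> curve e g. el p < 0}"
  have S: "?S = ?K \<union> ?M" using h(2) by (auto simp: neq_iff)
  have sep: "False" if "connected d" "d \<subseteq> ?S" "p \<in> d" "q \<in> d" "el p > 0" "el q < 0" for d p q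
  proof -
    have "connected (el ` d)" by (intro connected_continuous_image linear_continuous_on[OF h(1)] that)
    then have "0 \<in> el ` d" using connectedD_interval[of "el ` d" "el q" "el p" 0] that by auto
    then show False using h(2) that(2) by auto
  qed
  note cK = arc_on_connected[OF h(3)] and cM = arc_on_connected[OF h(4)]
  have "?K \<in> components ?S" unfolding in_components_maximal
  proof (intro conjI allI impI)
    fix d assume "d \<noteq> {} \<and> ?K \<subseteq> d \<and> d \<subseteq> ?S \<and> connected d"
    then show "d = ?K" using sep[of d] cK S by blast
  qed (use cK in auto)
  moreover have "?M \<in> components ?S" unfolding in_components_maximal
  proof (intro conjI allI impI)
    fix d assume "d \<noteq> {} \<and> ?M \<subseteq> d \<and> d \<subseteq> ?S \<and> connected d"
    then show "d = ?M" using sep[of d] cM S by blast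
  qed (use cM in auto)
  moreover have "D = ?K \<or> D = ?M" if "D \<in> components ?S" for D
  proof -
    have "D \<noteq> {}" "D \<subseteq> ?S" using that by (auto dest: in_components_nonempty in_components_subset)
    then have "D \<inter> ?K \<noteq> {} \<or> D \<inter> ?M \<noteq> {}" using S by blast
    then show ?thesis using components_nonoverlap[OF that] calculation by blast
  qed
  ultimately have "components ?S = {?K, ?M}" by blast
  moreover have "?K \<noteq> ?M" using cK(2) by auto
  ultimately show ?thesis unfolding has_strings_def
    using arc_on_has_word[OF h(3)] arc_on_has_word[OF h(4)] by (intro exI[of _ ?K] exI[of _ ?M]) simp
qed

text \<open>As the linear forms do not vanish, both parts are relatively closed and the pasting
  lemma applies in either direction.\<close>

lemma homeomorphism_pieces:
  fixes A B :: "(real \<times> real) set" and el m :: "real \<times> real \<Rightarrow> real"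
  assumes l: "bounded_linear el" "\<And>p. p \<in> A \<Longrightarrow> el p \<noteq> 0" and m: "bounded_linear m" "\<And>p. p \<in> B \<Longrightarrow> m p \<noteq> 0"
    and h1: "homeomorphism {p \<in> A. el p > 0} {p \<in> B. m p > 0} f1 g1"
    and h2: "homeomorphism {p \<in> A. el p < 0} {p \<in> B. m p < 0} f2 g2"
  shows "homeomorphism A B (\<lambda>p. if el p > 0 then f1 p else f2 p) (\<lambda>p. if m p > 0 then g1 p else g2 p)"
proof -
  have cont: "continuous_on A (\<lambda>p. if el p > 0 then f1 p else f2 p)"
    if l: "bounded_linear el" "\<And>p. p \<in> A \<Longrightarrow> el p \<noteq> 0" and c: "continuous_on {p \<in> A. el p > 0} f1" "continuous_on {p \<in> A. el p < 0} f2"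
    for A and el :: "real \<times> real \<Rightarrow> real" and f1 f2 :: "real \<times> real \<Rightarrow> real \<times> real"
  proof -
    define K M where "K = {p \<in> A. el p > 0}" and "M = {p \<in> A. el p < 0}"
    have A: "A = K \<union> M" using l(2) by (auto simp: neq_iff K_def M_def)
    have cl: "closed {p. el p \<ge> 0}" "closed {p. el p \<le> 0}"
      by (intro closed_Collect_le continuous_on_const linear_continuous_on[OF l(1)])+
    have "K = A \<inter> {p. el p \<ge> 0}" "M = A \<inter> {p. el p \<le> 0}"
      using l(2) by (auto simp: order_less_le K_def M_def)
    then have "closedin (top_of_set A) K" "closedin (top_of_set A) M"
      using cl by (auto intro: closedin_closed_Int)
    then have c1: "closedin (top_of_set (K \<union> M)) K" "closedin (top_of_set (K \<union> M)) M"
      unfolding A[symmetric] by auto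
    have "continuous_on K f1" "continuous_on M f2" using c by (simp_all add: K_def M_def)
    then have "continuous_on (K \<union> M) (\<lambda>p. if el p > 0 then f1 p else f2 p)"
      by (rule continuous_on_cases_local[OF c1]) (auto simp: K_def M_def)
    then show ?thesis using A by simp
  qed
  show ?thesis
  proof (rule homeomorphismI)
    show "continuous_on A (\<lambda>p. if el p > 0 then f1 p else f2 p)"
      using h1 h2 by (intro cont[OF l]) (auto simp: homeomorphism_def)
    show "continuous_on B (\<lambda>p. if m p > 0 then g1 p else g2 p)"
      using h1 h2 by (intro cont[OF m]) (auto simp: homeomorphism_def)
    have n: "el p > 0 \<or> el p < 0" if "p \<in> A" for p using l(2)[OF that] by auto
    have n': "m p > 0 \<or> m p < 0" if "p \<in> B" for p using m(2)[OF that] by auto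
    have tr: "f p \<in> Y \<and> g (f p) = p" if "homeomorphism X Y f g" "p \<in> X" for f g :: "real \<times> real \<Rightarrow> real \<times> real" and X Y p
      using homeomorphism_image1[OF that(1)] homeomorphism_apply1[OF that] that(2) by blast
    have F: "f1 p \<in> B \<and> m (f1 p) > 0 \<and> g1 (f1 p) = p" if "p \<in> A" "el p > 0" for p using tr[OF h1, of p] that by simp
    have F': "f2 p \<in> B \<and> m (f2 p) < 0 \<and> g2 (f2 p) = p" if "p \<in> A" "el p < 0" for p using tr[OF h2, of p] that by simp
    have G: "g1 p \<in> A \<and> el (g1 p) > 0 \<and> f1 (g1 p) = p" if "p \<in> B" "m p > 0" for p
      using tr[OF homeomorphism_symD[OF h1], of p] that by simp
    have G': "g2 p \<in> A \<and> el (g2 p) < 0 \<and> f2 (g2 p) = p" if "p \<in> B" "m p < 0" for p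
      using tr[OF homeomorphism_symD[OF h2], of p] that by simp
    show "(\<lambda>p. if el p > 0 then f1 p else f2 p) ` A \<subseteq> B" using F F' n by force
    show "(\<lambda>p. if m p > 0 then g1 p else g2 p) ` B \<subseteq> A" using G G' n' by force
    show "(if m (if el p > 0 then f1 p else f2 p) > 0 then g1 (if el p > 0 then f1 p else f2 p)
        else g2 (if el p > 0 then f1 p else f2 p)) = p" if "p \<in> A" for p
    proof (cases "el p > 0")
      case True
      then show ?thesis using F[OF that True] by simp
    next
      case False
      then have "el p < 0" using n[OF that] by blast
      then show ?thesis using F'[OF that] False by (simp add: not_less less_imp_le)
    qed
    show "(if el (if m p > 0 then g1 p else g2 p) > 0 then f1 (if m p > 0 then g1 p else g2 p)
        else f2 (if m p > 0 then g1 p else g2 p)) = p" if "p \<in> B" for p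
    proof (cases "m p > 0")
      case True
      then show ?thesis using G[OF that True] by simp
    next
      case False
      then have "m p < 0" using n'[OF that] by blast
      then show ?thesis using G'[OF that] False by (simp add: not_less less_imp_le)
    qed
  qed
qed

lemma arc_on_matching:
  assumes "arc_on g K w" "arc_on h M w"
  obtains \<phi> \<psi> where "homeomorphism K M \<phi> \<psi>"
    "\<And>p. p \<in> K \<Longrightarrow> inflection h (\<phi> p) = inflection g p \<and> vertex h (\<phi> p) = vertex g p"
proof -
  obtain a b c L where k: "a < b" "smooth_on {a<..<b} c" "bounded_linear (L :: real \<times> real \<Rightarrow> real)"
    "\<And>u. u \<in> {a<..<b} \<Longrightarrow> L (c u) = u" "c ` {a<..<b} = K"
    "spells {a<..<b} (\<lambda>u. inflection g (c u)) (\<lambda>u. vertex g (c u)) w"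
    using assms(1) unfolding arc_on_def by blast
  obtain a' b' c' L' where m: "a' < b'" "smooth_on {a'<..<b'} c'" "bounded_linear (L' :: real \<times> real \<Rightarrow> real)"
    "\<And>u. u \<in> {a'<..<b'} \<Longrightarrow> L' (c' u) = u" "c' ` {a'<..<b'} = M"
    "spells {a'<..<b'} (\<lambda>u. inflection h (c' u)) (\<lambda>u. vertex h (c' u)) w"
    using assms(2) unfolding arc_on_def by blast
  have hk: "homeomorphism K {a<..<b} L c"
    by (rule homeomorphismI) (use k smooth_on_continuous linear_continuous_on in auto)
  have hm: "homeomorphism {a'<..<b'} M c' L'"
    by (rule homeomorphismI) (use m smooth_on_continuous linear_continuous_on in auto)
  obtain \<psi> \<theta> where hh: "homeomorphism {a<..<b} {a'<..<b'} \<psi> \<theta>"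
    "\<forall>u\<in>{a<..<b}. inflection h (c' (\<psi> u)) = inflection g (c u) \<and> vertex h (c' (\<psi> u)) = vertex g (c u)"
    using spells_matching[OF k(1) m(1) k(6) m(6)] by blast
  have "homeomorphism K M (c' \<circ> (\<psi> \<circ> L)) ((c \<circ> \<theta>) \<circ> L')"
    by (rule homeomorphism_compose[OF homeomorphism_compose[OF hk hh(1)] hm])
  then show thesis
    by (rule that) (use hh(2) k(4,5) in auto)
qed

text \<open>Marked points need not correspond here, so an affine map of the parameter intervals is
  enough. Composed with the linear form of one arc and the parametrisation of the other, it is
  smooth on an open strip containing the arc.\<close>

lemma arc_on_diffeomorphic:
  assumes "arc_on g K w" "arc_on h M w'"
  obtains X Y \<phi> \<psi> where "open X" "K \<subseteq> X" "smooth_on X \<phi>" "open Y" "M \<subseteq> Y" "smooth_on Y \<psi>"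
    "\<phi> ` K = M" "\<psi> ` M = K" "\<And>p. p \<in> K \<Longrightarrow> \<psi> (\<phi> p) = p" "\<And>p. p \<in> M \<Longrightarrow> \<phi> (\<psi> p) = p"
proof -
  obtain a b c L where k: "a < b" "smooth_on {a<..<b} c" "bounded_linear (L :: real \<times> real \<Rightarrow> real)"
    "\<And>u. u \<in> {a<..<b} \<Longrightarrow> L (c u) = u" "c ` {a<..<b} = K"
    using assms(1) unfolding arc_on_def by blast
  obtain a' b' c' L' where m: "a' < b'" "smooth_on {a'<..<b'} c'" "bounded_linear (L' :: real \<times> real \<Rightarrow> real)"
    "\<And>u. u \<in> {a'<..<b'} \<Longrightarrow> L' (c' u) = u" "c' ` {a'<..<b'} = M"
    using assms(2) unfolding arc_on_def by blast
  define s where "s = (\<lambda>u. a' + (u - a) * ((b' - a') / (b - a)))"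
  define s' where "s' = (\<lambda>u. a + (u - a') * ((b - a) / (b' - a')))"
  have ss: "s' (s u) = u" "s (s' u) = u" for u using k(1) m(1) by (simp_all add: s_def s'_def)
  have q: "(b' - a') / (b - a) > 0" "(b - a) / (b' - a') > 0" using k(1) m(1) by auto
  have e: "s a = a'" "s b = b'" "s' a' = a" "s' b' = b" using k(1) m(1) by (auto simp: s_def s'_def)
  have mono: "u < v \<Longrightarrow> s u < s v" "u < v \<Longrightarrow> s' u < s' v" for u v
  proof -
    show "u < v \<Longrightarrow> s u < s v" unfolding s_def
      by (rule add_strict_left_mono, rule mult_strict_right_mono, simp, rule q(1))
    show "u < v \<Longrightarrow> s' u < s' v" unfolding s'_def
      by (rule add_strict_left_mono, rule mult_strict_right_mono, simp, rule q(2))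
  qed
  have sin: "s u \<in> {a'<..<b'}" if "u \<in> {a<..<b}" for u using mono(1)[of a u] mono(1)[of u b] e that by auto
  have s'in: "s' u \<in> {a<..<b}" if "u \<in> {a'<..<b'}" for u using mono(2)[of a' u] mono(2)[of u b'] e that by auto
  have sm: "smooth_on T s" "smooth_on T s'" if "open T" for T :: "real set"
    unfolding s_def s'_def by (intro smooth_intros that)+
  define X where "X = L -` {a<..<b}"
  define Y where "Y = L' -` {a'<..<b'}"
  have X: "open X" unfolding X_def by (intro continuous_open_vimage linear_continuous_at[OF k(3)]) auto
  have Y: "open Y" unfolding Y_def by (intro continuous_open_vimage linear_continuous_at[OF m(3)]) auto
  have "smooth_on X (\<lambda>p. s (L p))"
    by (rule smooth_on_compose[OF sm(1)[of UNIV]]) (auto intro: X smooth_on_linear k(3))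
  then have p: "smooth_on X (\<lambda>p. c' (s (L p)))"
    by (rule smooth_on_compose[OF m(2) X open_greaterThanLessThan]) (use sin in \<open>auto simp: X_def\<close>)
  have "smooth_on Y (\<lambda>p. s' (L' p))"
    by (rule smooth_on_compose[OF sm(2)[of UNIV]]) (auto intro: Y smooth_on_linear m(3))
  then have p': "smooth_on Y (\<lambda>p. c (s' (L' p)))"
    by (rule smooth_on_compose[OF k(2) Y open_greaterThanLessThan]) (use s'in in \<open>auto simp: Y_def\<close>)
  have i1: "c (s' (L' (c' (s (L p))))) = p \<and> c' (s (L p)) \<in> M" if pK: "p \<in> K" for p
  proof -
    obtain u where u: "p = c u" "u \<in> {a<..<b}" using pK k(5) by blast
    then have "L p = u" "L' (c' (s u)) = s u" "c' (s u) \<in> M" using k(4) m(4,5) sin[of u] by auto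
    then show ?thesis using u ss by simp
  qed
  have i2: "c' (s (L (c (s' (L' p))))) = p \<and> c (s' (L' p)) \<in> K" if pM: "p \<in> M" for p
  proof -
    obtain u where u: "p = c' u" "u \<in> {a'<..<b'}" using pM m(5) by blast
    then have "L' p = u" "L (c (s' u)) = s' u" "c (s' u) \<in> K" using m(4) k(4,5) s'in[of u] by auto
    then show ?thesis using u ss by simp
  qed
  have KX: "K \<subseteq> X" "M \<subseteq> Y" using k(4,5) m(4,5) by (auto simp: X_def Y_def)
  have im: "(\<lambda>p. c' (s (L p))) ` K = M" "(\<lambda>p. c (s' (L' p))) ` M = K"
    using i1 i2 by (auto simp: image_iff) metis+
  show thesis by (rule that[OF X KX(1) p Y KX(2) p' im]) (use i1 i2 in auto)
qed

text \<open>The homeomorphism that matches inflections and vertices is only piecewise affine in the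
  parameters. The diffeomorphism demanded by \<open>FRS_same\<close> is a separate map, built
  without regard to these points.\<close>

lemma two_arcs_FRS_same:
  assumes g: "two_arcs e g v w" and h: "two_arcs e h v w" shows "FRS_same e g h"
proof -
  obtain el where l: "bounded_linear (el :: real \<times> real \<Rightarrow> real)" "\<And>p. p \<in> curve e g \<Longrightarrow> el p \<noteq> 0"
    "arc_on g {p \<in> curve e g. el p > 0} v" "arc_on g {p \<in> curve e g. el p < 0} w"
    using g unfolding two_arcs_def by blast
  obtain m where m: "bounded_linear (m :: real \<times> real \<Rightarrow> real)" "\<And>p. p \<in> curve e h \<Longrightarrow> m p \<noteq> 0"
    "arc_on h {p \<in> curve e h. m p > 0} v" "arc_on h {p \<in> curve e h. m p < 0} w"
    using h unfolding two_arcs_def by blast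
  let ?A = "curve e g" and ?B = "curve e h"
  obtain f1 g1 where 1: "homeomorphism {p \<in> ?A. el p > 0} {p \<in> ?B. m p > 0} f1 g1"
    "\<And>p. p \<in> {p \<in> ?A. el p > 0} \<Longrightarrow> inflection h (f1 p) = inflection g p \<and> vertex h (f1 p) = vertex g p"
    by (rule arc_on_matching[OF l(3) m(3)]) blast
  obtain f2 g2 where 2: "homeomorphism {p \<in> ?A. el p < 0} {p \<in> ?B. m p < 0} f2 g2"
    "\<And>p. p \<in> {p \<in> ?A. el p < 0} \<Longrightarrow> inflection h (f2 p) = inflection g p \<and> vertex h (f2 p) = vertex g p"
    by (rule arc_on_matching[OF l(4) m(4)]) blast
  define \<phi> where "\<phi> = (\<lambda>p. if el p > 0 then f1 p else f2 p)"
  define \<psi> where "\<psi> = (\<lambda>p. if m p > 0 then g1 p else g2 p)"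
  have hom: "homeomorphism ?A ?B \<phi> \<psi>" unfolding \<phi>_def \<psi>_def
    by (rule homeomorphism_pieces[OF l(1,2) m(1,2) 1(1) 2(1)])
  have iv: "inflection h (\<phi> p) = inflection g p" "vertex h (\<phi> p) = vertex g p" if "p \<in> ?A" for p
    using 1(2)[of p] 2(2)[of p] l(2)[OF that] that by (auto simp: \<phi>_def)
  have regg: "regular_point g p" if "p \<in> ?A" for p
  proof -
    have "\<forall>p\<in>{p \<in> ?A. el p > 0}. regular_point g p" "\<forall>p\<in>{p \<in> ?A. el p < 0}. regular_point g p"
      using l(3,4) unfolding arc_on_def by blast+
    moreover have "el p > 0 \<or> el p < 0" using l(2)[OF that] by (auto simp: neq_iff)
    ultimately show ?thesis using that by blast
  qed
  have regh: "regular_point h p" if "p \<in> ?B" for p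
  proof -
    have "\<forall>p\<in>{p \<in> ?B. m p > 0}. regular_point h p" "\<forall>p\<in>{p \<in> ?B. m p < 0}. regular_point h p"
      using m(3,4) unfolding arc_on_def by blast+
    moreover have "m p > 0 \<or> m p < 0" using m(2)[OF that] by (auto simp: neq_iff)
    ultimately show ?thesis using that by blast
  qed
  have phB: "\<phi> p \<in> ?B" if "p \<in> ?A" for p using hom that by (auto simp: homeomorphism_def)
  have "same_relative_position e g h" unfolding same_relative_position_def
  proof (rule exI[of _ \<phi>], rule exI[of _ \<psi>], intro conjI hom ballI)
    fix p assume p: "p \<in> ?A"
    show "singular_point g p \<longleftrightarrow> singular_point h (\<phi> p)"
      using regg[OF p] regh[OF phB[OF p]] by (auto simp: regular_point_def singular_point_def)
    show "self_intersection ?A p \<longleftrightarrow> self_intersection ?B (\<phi> p)" by (rule self_intersection_homeomorphism[OF hom p])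
    show "inflection g p \<longleftrightarrow> inflection h (\<phi> p)" "vertex g p \<longleftrightarrow> vertex h (\<phi> p)" using iv[OF p] by auto
  qed
  moreover have bij: "bij_betw \<phi> {p \<in> ?A. P p} {p \<in> ?B. P' p}" if "\<And>p. p \<in> ?A \<Longrightarrow> P' (\<phi> p) = P p" for P P'
  proof (rule bij_betw_byWitness[where f' = \<psi>])
    have "\<And>q. q \<in> ?B \<Longrightarrow> \<psi> q \<in> ?A \<and> \<phi> (\<psi> q) = q" "\<And>p. p \<in> ?A \<Longrightarrow> \<psi> (\<phi> p) = p"
      using hom by (auto simp: homeomorphism_def)
    then show "\<forall>a\<in>{p \<in> ?A. P p}. \<psi> (\<phi> a) = a" "\<forall>a'\<in>{p \<in> ?B. P' p}. \<phi> (\<psi> a') = a'"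
      "\<phi> ` {p \<in> ?A. P p} \<subseteq> {p \<in> ?B. P' p}" "\<psi> ` {p \<in> ?B. P' p} \<subseteq> {p \<in> ?A. P p}"
      using that phB by (auto, metis)
  qed
  moreover have "diffeomorphic ?A ?B"
  proof -
    obtain X1 Y1 p1 q1 where d1: "open X1" "{p \<in> ?A. el p > 0} \<subseteq> X1" "smooth_on X1 p1" "open Y1" "{p \<in> ?B. m p > 0} \<subseteq> Y1" "smooth_on Y1 q1"
      "p1 ` {p \<in> ?A. el p > 0} = {p \<in> ?B. m p > 0}" "q1 ` {p \<in> ?B. m p > 0} = {p \<in> ?A. el p > 0}"
      "\<And>p. p \<in> {p \<in> ?A. el p > 0} \<Longrightarrow> q1 (p1 p) = p" "\<And>p. p \<in> {p \<in> ?B. m p > 0} \<Longrightarrow> p1 (q1 p) = p"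
      by (rule arc_on_diffeomorphic[OF l(3) m(3)]) blast
    obtain X2 Y2 p2 q2 where d2: "open X2" "{p \<in> ?A. el p < 0} \<subseteq> X2" "smooth_on X2 p2" "open Y2" "{p \<in> ?B. m p < 0} \<subseteq> Y2" "smooth_on Y2 q2"
      "p2 ` {p \<in> ?A. el p < 0} = {p \<in> ?B. m p < 0}" "q2 ` {p \<in> ?B. m p < 0} = {p \<in> ?A. el p < 0}"
      "\<And>p. p \<in> {p \<in> ?A. el p < 0} \<Longrightarrow> q2 (p2 p) = p" "\<And>p. p \<in> {p \<in> ?B. m p < 0} \<Longrightarrow> p2 (q2 p) = p"
      by (rule arc_on_diffeomorphic[OF l(4) m(4)]) blast
    have sub: "smooth_on_subset A (\<lambda>p. if k p > 0 then u p else u' p)"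
      if k: "bounded_linear k" "\<And>p. p \<in> A \<Longrightarrow> k p \<noteq> 0" and X: "open X" "{p \<in> A. k p > 0} \<subseteq> X" "smooth_on X u"
        and X': "open X'" "{p \<in> A. k p < 0} \<subseteq> X'" "smooth_on X' u'"
      for A X X' and k :: "real \<times> real \<Rightarrow> real" and u u' :: "real \<times> real \<Rightarrow> real \<times> real"
      unfolding smooth_on_subset_def
    proof
      fix p assume p: "p \<in> A"
      have o: "open {p. k p > 0}" "open {p. k p < 0}"
        by (intro open_Collect_less continuous_on_const linear_continuous_on[OF k(1)])+
      show "\<exists>U H. open U \<and> p \<in> U \<and> smooth_on U H \<and> (\<forall>q\<in>A \<inter> U. H q = (if k q > 0 then u q else u' q))"
      proof (cases "k p > 0")
        case True
        show ?thesis by (intro exI[of _ "X \<inter> {p. k p > 0}"] exI[of _ u])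
            (use True p X o smooth_on_mono_set[OF X(3)] in auto)
      next
        case False
        then have "k p < 0" using k(2)[OF p] by simp
        then show ?thesis by (intro exI[of _ "X' \<inter> {p. k p < 0}"] exI[of _ u'])
            (use p X' o smooth_on_mono_set[OF X'(3)] in auto)
      qed
    qed
    define F where "F = (\<lambda>p. if el p > 0 then p1 p else p2 p)"
    define G where "G = (\<lambda>p. if m p > 0 then q1 p else q2 p)"
    have s: "smooth_on_subset ?A F" "smooth_on_subset ?B G"
      unfolding F_def G_def by (rule sub[OF l(1,2) d1(1-3) d2(1-3)], simp, rule sub[OF m(1,2) d1(4-6) d2(4-6)], simp)
    have FA: "F p \<in> ?B \<and> G (F p) = p" if "p \<in> ?A" for p
    proof (cases "el p > 0")
      case True
      then have "p1 p \<in> {p \<in> ?B. m p > 0}" using d1(7) that by blast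
      then show ?thesis using True d1(9)[of p] that by (simp add: F_def G_def)
    next
      case False
      then have n: "el p < 0" using l(2)[OF that] by simp
      then have "p2 p \<in> {p \<in> ?B. m p < 0}" using d2(7) that by blast
      then show ?thesis using n d2(9)[of p] that by (simp add: F_def G_def)
    qed
    have GB: "G p \<in> ?A \<and> F (G p) = p" if "p \<in> ?B" for p
    proof (cases "m p > 0")
      case True
      then have "q1 p \<in> {p \<in> ?A. el p > 0}" using d1(8) that by blast
      then show ?thesis using True d1(10)[of p] that by (simp add: F_def G_def)
    next
      case False
      then have n: "m p < 0" using m(2)[OF that] by simp
      then have "q2 p \<in> {p \<in> ?A. el p < 0}" using d2(8) that by blast
      then show ?thesis using n d2(10)[of p] that by (simp add: F_def G_def)
    qed
    have "F ` ?A = ?B" "G ` ?B = ?A" using FA GB by (auto simp: image_iff) metis+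
    then show ?thesis unfolding diffeomorphic_def using s FA GB by blast
  qed
  ultimately show ?thesis unfolding FRS_same_def eqpoll_def using iv by blast
qed


section \<open>Taylor expansion and the branches of a node\<close>

lemma pd_sum:
  assumes "\<And>i. i \<in> A \<Longrightarrow> smooth_on U (g i)" "p \<in> U"
  shows "pdx (\<lambda>q. \<Sum>i\<in>A. g i q) p = (\<Sum>i\<in>A. pdx (g i) p)" "pdy (\<lambda>q. \<Sum>i\<in>A. g i q) p = (\<Sum>i\<in>A. pdy (g i) p)"
proof -
  have "((\<lambda>q. \<Sum>i\<in>A. g i q) has_derivative (\<lambda>v. \<Sum>i\<in>A. pdx (g i) p * fst v + pdy (g i) p * snd v)) (at p)"
    by (rule has_derivative_sum, rule has_derivative_eq_rhs[OF smooth_on_has_derivative_pd[OF assms(1,2)]])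
      (auto simp: fun_eq_iff)
  from pdx_eqI[OF this] pdy_eqI[OF this]
  show "pdx (\<lambda>q. \<Sum>i\<in>A. g i q) p = (\<Sum>i\<in>A. pdx (g i) p)" "pdy (\<lambda>q. \<Sum>i\<in>A. g i q) p = (\<Sum>i\<in>A. pdy (g i) p)"
    by simp_all
qed

lemma pd_monomial:
  "pdx (\<lambda>p. c * (fst p ^ m * snd p ^ n)) p = c * (of_nat m * fst p ^ (m - 1) * snd p ^ n)"
  "pdy (\<lambda>p. c * (fst p ^ m * snd p ^ n)) p = c * (fst p ^ m * (of_nat n * snd p ^ (n - 1)))"
  by (simp_all add: pd_simps smooth_intros)

lemma smooth_on_pd_iter: "open U \<Longrightarrow> smooth_on U f \<Longrightarrow> smooth_on U ((pdy ^^ n) f)"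
  by (induction n) (auto intro: smooth_intros)

lemma pdx_iter_cong:
  assumes "open U" "\<And>p. p \<in> U \<Longrightarrow> f p = g p" "p \<in> U" shows "(pdx ^^ m) f p = (pdx ^^ m) g p"
  using assms(3)
proof (induction m arbitrary: p)
  case (Suc m)
  show ?case unfolding funpow.simps o_apply by (rule pd_cong[OF assms(1) Suc.prems], rule Suc.IH, assumption)
qed (use assms(2) in simp)

lemma pdy_iter_pdx:
  assumes "open U" "smooth_on U f" "p \<in> U" shows "(pdy ^^ n) (pdx f) p = pdx ((pdy ^^ n) f) p"
  using assms(3)
proof (induction n arbitrary: p)
  case (Suc n)
  have "pdy ((pdy ^^ n) (pdx f)) p = pdy (pdx ((pdy ^^ n) f)) p"
    by (rule pd_cong[OF assms(1) Suc.prems], rule Suc.IH, assumption)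
  also have "\<dots> = pdx (pdy ((pdy ^^ n) f)) p"
    by (rule pd_commute[symmetric, OF assms(1) smooth_on_pd_iter[OF assms(1,2)] Suc.prems])
  finally show ?case by simp
qed simp

text \<open>Since partial derivatives commute, differentiation merely shifts an index. Writing the
  degree as \<open>m + n\<close> keeps the truncated subtraction in \<open>taylor_coeff\<close>
  exact.\<close>

lemma taylor_coeff_pd:
  assumes U: "open U" "0 \<in> U" "smooth_on U f"
  shows "taylor_coeff (pdx f) (m + n) n = real (Suc m) * taylor_coeff f (Suc m + n) n"
    "taylor_coeff (pdy f) (m + n) n = real (Suc n) * taylor_coeff f (m + Suc n) (Suc n)"
proof -
  have "(0, 0) \<in> U" using U(2) by (simp add: zero_prod_def)
  then have "(pdx ^^ m) ((pdy ^^ n) (pdx f)) (0, 0) = (pdx ^^ m) (pdx ((pdy ^^ n) f)) (0, 0)"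
    by (intro pdx_iter_cong[OF U(1)] pdy_iter_pdx[OF U(1,3)])
  then show "taylor_coeff (pdx f) (m + n) n = real (Suc m) * taylor_coeff f (Suc m + n) n"
    unfolding taylor_coeff_def by (simp add: funpow_swap1 field_simps del: of_nat_Suc)
  show "taylor_coeff (pdy f) (m + n) n = real (Suc n) * taylor_coeff f (m + Suc n) (Suc n)"
    unfolding taylor_coeff_def by (simp add: funpow_swap1 field_simps del: of_nat_Suc)
qed

text \<open>The degree stays below \<open>k\<close>. Summation over the exponents of x and y, rather
  than over the degree, makes each partial derivative a shift of one summation index.\<close>

definition taylor_poly :: "nat \<Rightarrow> (real \<times> real \<Rightarrow> real) \<Rightarrow> real \<times> real \<Rightarrow> real" where
  "taylor_poly k f p = (\<Sum>m<k. \<Sum>n<k - m. taylor_coeff f (m + n) n * (fst p ^ m * snd p ^ n))"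

lemma smooth_on_monomial: "open U \<Longrightarrow> smooth_on U (\<lambda>p :: real \<times> real. c * (fst p ^ m * snd p ^ n))"
  by (intro smooth_intros)

lemma smooth_on_taylor_poly: "open U \<Longrightarrow> smooth_on U (taylor_poly k f)"
  unfolding taylor_poly_def[abs_def] by (intro smooth_on_sum smooth_on_monomial)

lemma pd_taylor_poly:
  assumes U: "open U" "0 \<in> U" "smooth_on U f"
  shows "pdx (taylor_poly (Suc k) f) p = taylor_poly k (pdx f) p"
    "pdy (taylor_poly (Suc k) f) p = taylor_poly k (pdy f) p"
proof -
  have s: "smooth_on UNIV (\<lambda>p. \<Sum>n<Suc k - m. taylor_coeff f (m + n) n * (fst p ^ m * snd p ^ n))" for m
    by (intro smooth_on_sum smooth_on_monomial) auto
  note s' = smooth_on_monomial[OF open_UNIV]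
  have "pdx (taylor_poly (Suc k) f) p = (\<Sum>m<Suc k. \<Sum>n<Suc k - m. taylor_coeff f (m + n) n * (of_nat m * fst p ^ (m - 1) * snd p ^ n))"
    unfolding taylor_poly_def[abs_def] pd_sum(1)[OF s UNIV_I] pd_sum(1)[OF s' UNIV_I] pd_monomial ..
  also have "\<dots> = (\<Sum>m<k. \<Sum>n<k - m. taylor_coeff f (Suc m + n) n * (of_nat (Suc m) * fst p ^ m * snd p ^ n))"
    unfolding sum.lessThan_Suc_shift by (simp del: of_nat_Suc)
  also have "\<dots> = taylor_poly k (pdx f) p"
    unfolding taylor_poly_def taylor_coeff_pd(1)[OF U] by (intro sum.cong refl) (simp only: mult_ac)
  finally show "pdx (taylor_poly (Suc k) f) p = taylor_poly k (pdx f) p" .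
  have "pdy (taylor_poly (Suc k) f) p = (\<Sum>m<Suc k. \<Sum>n<Suc k - m. taylor_coeff f (m + n) n * (fst p ^ m * (of_nat n * snd p ^ (n - 1))))"
    unfolding taylor_poly_def[abs_def] pd_sum(2)[OF s UNIV_I] pd_sum(2)[OF s' UNIV_I] pd_monomial ..
  also have "\<dots> = (\<Sum>m<Suc k. \<Sum>n<k - m. taylor_coeff f (m + Suc n) (Suc n) * (fst p ^ m * (of_nat (Suc n) * snd p ^ n)))"
  proof (rule sum.cong[OF refl])
    fix m assume "m \<in> {..<Suc k}"
    then have e: "Suc k - m = Suc (k - m)" by auto
    show "(\<Sum>n<Suc k - m. taylor_coeff f (m + n) n * (fst p ^ m * (of_nat n * snd p ^ (n - 1)))) =
        (\<Sum>n<k - m. taylor_coeff f (m + Suc n) (Suc n) * (fst p ^ m * (of_nat (Suc n) * snd p ^ n)))"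
      unfolding e sum.lessThan_Suc_shift by (simp del: of_nat_Suc)
  qed
  also have "\<dots> = (\<Sum>m<k. \<Sum>n<k - m. taylor_coeff f (m + Suc n) (Suc n) * (fst p ^ m * (of_nat (Suc n) * snd p ^ n)))"
    by (simp del: of_nat_Suc)
  also have "\<dots> = taylor_poly k (pdy f) p"
    unfolding taylor_poly_def taylor_coeff_pd(2)[OF U] by (intro sum.cong refl) (simp only: mult_ac)
  finally show "pdy (taylor_poly (Suc k) f) p = taylor_poly k (pdy f) p" .
qed

text \<open>The partial derivatives of a Taylor polynomial are the Taylor polynomials of the partial
  derivatives, so the induction on the order dispenses with a remainder formula.\<close>

lemma vord_taylor:
  assumes U: "open U" "0 \<in> U" shows "smooth_on U f \<Longrightarrow> vord k U (\<lambda>p. f p - taylor_poly k f p)"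
proof (induction k arbitrary: f)
  case 0
  then show ?case by (auto intro!: smooth_intros smooth_on_taylor_poly U)
next
  case (Suc k)
  note s = smooth_on_pdx[OF U(1) Suc.prems] smooth_on_pdy[OF U(1) Suc.prems]
  note t = smooth_on_taylor_poly[OF U(1), of "Suc k" f]
  have e: "pdx (\<lambda>p. f p - taylor_poly (Suc k) f p) p = pdx f p - taylor_poly k (pdx f) p"
    "pdy (\<lambda>p. f p - taylor_poly (Suc k) f p) p = pdy f p - taylor_poly k (pdy f) p" if "p \<in> U" for p
    unfolding pd_diff[OF Suc.prems t that] pd_taylor_poly[OF U Suc.prems] by simp_all
  have "vord k U (pdx (\<lambda>p. f p - taylor_poly (Suc k) f p))"
    by (rule vord_eqI[OF U Suc.IH[OF s(1)]], rule e(1)[symmetric], assumption)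
  moreover have "vord k U (pdy (\<lambda>p. f p - taylor_poly (Suc k) f p))"
    by (rule vord_eqI[OF U Suc.IH[OF s(2)]], rule e(2)[symmetric], assumption)
  moreover have "taylor_poly (Suc k) f 0 = f 0"
    unfolding taylor_poly_def sum.lessThan_Suc_shift
    by (simp add: taylor_coeff_def sum.lessThan_Suc_shift zero_prod_def)
  moreover have "smooth_on U (\<lambda>p. f p - taylor_poly (Suc k) f p)" by (intro smooth_intros U Suc.prems t)
  ultimately show ?case by simp
qed

section \<open>Jets of the two branches\<close>

definition quartic :: "(nat \<Rightarrow> nat \<Rightarrow> real) \<Rightarrow> real \<Rightarrow> real \<Rightarrow> real" where
  "quartic c x y = x * y + c 2 2 * y ^ 2 + (c 3 0 * x ^ 3 + c 3 1 * (x ^ 2 * y) + c 3 2 * (x * y ^ 2) + c 3 3 * y ^ 3)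
    + (c 4 0 * x ^ 4 + c 4 1 * (x ^ 3 * y) + c 4 2 * (x ^ 2 * y ^ 2) + c 4 3 * (x * y ^ 3) + c 4 4 * y ^ 4)"

lemma taylor_poly_quartic:
  assumes "f (0, 0) = 0" "A1_minus f" "taylor_coeff f 2 0 = 0" "taylor_coeff f 2 1 = 1"
  shows "taylor_poly 5 f p = quartic (taylor_coeff f) (fst p) (snd p)"
proof -
  have l: "taylor_coeff f 0 0 = 0" "taylor_coeff f 1 0 = 0" "taylor_coeff f 1 1 = 0"
    "taylor_coeff f (Suc 0) 0 = 0" "taylor_coeff f (Suc 0) (Suc 0) = 0"
    using assms(1,2) by (simp_all add: A1_minus_def taylor_coeff_def)
  have n: "{..<5::nat} = {0,1,2,3,4}" "{..<4::nat} = {0,1,2,3}" "{..<3::nat} = {0,1,2}" "{..<2::nat} = {0,1}" "{..<Suc 0} = {0}"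
    by auto
  have a2: "taylor_coeff f 2 (Suc 0) = 1" using assms(4) by simp
  show ?thesis unfolding taylor_poly_def quartic_def n
    by (simp add: n l assms(3) a2 algebra_simps numeral_2_eq_2[symmetric])
qed

text \<open>The ansatz y = X^2 w, x = X - a y follows the branch tangent to y = 0, and
  \<open>w\<close> and \<open>k\<close> are determined by the vanishing of the coefficients of X^3
  and X^4. The bracket is the cofactor of X^5, written out so that its smoothness is
  evident.\<close>

lemma quartic_first_branch:
  fixes X k :: real and c :: "nat \<Rightarrow> nat \<Rightarrow> real"
  defines "a \<equiv> c 2 2" and "w \<equiv> - c 3 0 - k * X"
  assumes k: "k = c 4 0 - c 3 0 * c 3 1 + 3 * a * (c 3 0)\<^sup>2"
  shows "quartic c (X - a * (X\<^sup>2 * w)) (X\<^sup>2 * w) = X ^ 5 * (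
     (3 * a * c 3 0 - c 3 1) * k + (c 3 0 * (3 * a ^ 2 * w ^ 2 - a ^ 3 * X * w ^ 3) + c 3 1 * (w * (a ^ 2 * X * w ^ 2 - 2 * a * w))
     + c 3 2 * ((1 - a * X * w) * w ^ 2) + c 3 3 * (X * w ^ 3)
     + c 4 0 * (6 * a ^ 2 * X * w ^ 2 - 4 * a * w - 4 * a ^ 3 * X ^ 2 * w ^ 3 + a ^ 4 * X ^ 3 * w ^ 4)
     + c 4 1 * ((1 - a * X * w) ^ 3 * w) + c 4 2 * ((1 - a * X * w) ^ 2 * X * w ^ 2)
     + c 4 3 * ((1 - a * X * w) * X ^ 2 * w ^ 3) + c 4 4 * (X ^ 3 * w ^ 4)))" (is "_ = X ^ 5 * (?s + ?r)")
proof -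
  have p: "c 3 0 * (X - a * (X\<^sup>2 * w)) ^ 3 = X ^ 3 * c 3 0 - 3 * a * c 3 0 * X ^ 4 * w + X ^ 5 * (c 3 0 * (3 * a ^ 2 * w ^ 2 - a ^ 3 * X * w ^ 3))"
    "c 3 1 * ((X - a * (X\<^sup>2 * w)) ^ 2 * (X\<^sup>2 * w)) = X ^ 4 * c 3 1 * w + X ^ 5 * (c 3 1 * (w * (a ^ 2 * X * w ^ 2 - 2 * a * w)))"
    "c 3 2 * ((X - a * (X\<^sup>2 * w)) * (X\<^sup>2 * w) ^ 2) = X ^ 5 * (c 3 2 * ((1 - a * X * w) * w ^ 2))"
    "c 3 3 * (X\<^sup>2 * w) ^ 3 = X ^ 5 * (c 3 3 * (X * w ^ 3))"
    "c 4 0 * (X - a * (X\<^sup>2 * w)) ^ 4 = X ^ 4 * c 4 0 + X ^ 5 * (c 4 0 * (6 * a ^ 2 * X * w ^ 2 - 4 * a * w - 4 * a ^ 3 * X ^ 2 * w ^ 3 + a ^ 4 * X ^ 3 * w ^ 4))"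
    "c 4 1 * ((X - a * (X\<^sup>2 * w)) ^ 3 * (X\<^sup>2 * w)) = X ^ 5 * (c 4 1 * ((1 - a * X * w) ^ 3 * w))"
    "c 4 2 * ((X - a * (X\<^sup>2 * w)) ^ 2 * (X\<^sup>2 * w) ^ 2) = X ^ 5 * (c 4 2 * ((1 - a * X * w) ^ 2 * X * w ^ 2))"
    "c 4 3 * ((X - a * (X\<^sup>2 * w)) * (X\<^sup>2 * w) ^ 3) = X ^ 5 * (c 4 3 * ((1 - a * X * w) * X ^ 2 * w ^ 3))"
    "c 4 4 * (X\<^sup>2 * w) ^ 4 = X ^ 5 * (c 4 4 * (X ^ 3 * w ^ 4))"
    "(X - a * (X\<^sup>2 * w)) * (X\<^sup>2 * w) + a * (X\<^sup>2 * w) ^ 2 = X ^ 3 * w" by algebra+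
  have "X ^ 3 * w + X ^ 3 * c 3 0 - 3 * a * c 3 0 * X ^ 4 * w + X ^ 4 * c 3 1 * w + X ^ 4 * c 4 0 = X ^ 5 * ?s"
    unfolding w_def k by algebra
  then show ?thesis unfolding quartic_def a_def[symmetric] p distrib_left[of "X ^ 5"] by linarith
qed

text \<open>The same for the branch tangent to x + a y = 0, with the ansatz x = Y^2 w - a Y.
  Cancelling the coefficients of Y^3 and Y^4 is the origin of the formulas for \<open>eta2\<close>
  and \<open>eta4_bar\<close>.\<close>

lemma quartic_second_branch:
  fixes Y k e :: real and c :: "nat \<Rightarrow> nat \<Rightarrow> real"
  defines "a \<equiv> c 2 2" and "w \<equiv> e - k * Y"
  assumes e: "e = a ^ 3 * c 3 0 - a ^ 2 * c 3 1 + a * c 3 2 - c 3 3"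
    and k: "k = e * (3 * a ^ 2 * c 3 0 - 2 * a * c 3 1 + c 3 2) + a ^ 4 * c 4 0 - a ^ 3 * c 4 1 + a ^ 2 * c 4 2 - a * c 4 3 + c 4 4"
  shows "quartic c (Y\<^sup>2 * w - a * Y) Y = Y ^ 5 * (
     - (k * (3 * a ^ 2 * c 3 0 - 2 * a * c 3 1 + c 3 2)) + (c 3 0 * (Y * w ^ 3 - 3 * a * w ^ 2) + c 3 1 * w ^ 2
     + c 4 0 * (6 * a ^ 2 * Y * w ^ 2 - 4 * a ^ 3 * w - 4 * a * Y ^ 2 * w ^ 3 + Y ^ 3 * w ^ 4)
     + c 4 1 * (3 * a ^ 2 * w - 3 * a * Y * w ^ 2 + Y ^ 2 * w ^ 3) + c 4 2 * (Y * w ^ 2 - 2 * a * w) + c 4 3 * w))"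
    (is "_ = Y ^ 5 * (?s + ?r)")
proof -
  let ?x = "Y\<^sup>2 * w - a * Y"
  have p: "c 3 0 * ?x ^ 3 = Y ^ 3 * (- (a ^ 3 * c 3 0)) + Y ^ 4 * w * (3 * a ^ 2 * c 3 0) + Y ^ 5 * (c 3 0 * (Y * w ^ 3 - 3 * a * w ^ 2))"
    "c 3 1 * (?x ^ 2 * Y) = Y ^ 3 * (a ^ 2 * c 3 1) + Y ^ 4 * w * (- (2 * a * c 3 1)) + Y ^ 5 * (c 3 1 * w ^ 2)"
    "c 3 2 * (?x * Y ^ 2) = Y ^ 3 * (- (a * c 3 2)) + Y ^ 4 * w * c 3 2"
    "c 4 0 * ?x ^ 4 = Y ^ 4 * (a ^ 4 * c 4 0) + Y ^ 5 * (c 4 0 * (6 * a ^ 2 * Y * w ^ 2 - 4 * a ^ 3 * w - 4 * a * Y ^ 2 * w ^ 3 + Y ^ 3 * w ^ 4))"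
    "c 4 1 * (?x ^ 3 * Y) = Y ^ 4 * (- (a ^ 3 * c 4 1)) + Y ^ 5 * (c 4 1 * (3 * a ^ 2 * w - 3 * a * Y * w ^ 2 + Y ^ 2 * w ^ 3))"
    "c 4 2 * (?x ^ 2 * Y ^ 2) = Y ^ 4 * (a ^ 2 * c 4 2) + Y ^ 5 * (c 4 2 * (Y * w ^ 2 - 2 * a * w))"
    "c 4 3 * (?x * Y ^ 3) = Y ^ 4 * (- (a * c 4 3)) + Y ^ 5 * (c 4 3 * w)"
    "?x * Y + a * Y ^ 2 = Y ^ 3 * w" by algebra+
  have "Y ^ 3 * w + Y ^ 3 * (- (a ^ 3 * c 3 0)) + Y ^ 4 * w * (3 * a ^ 2 * c 3 0) + Y ^ 3 * (a ^ 2 * c 3 1)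
      + Y ^ 4 * w * (- (2 * a * c 3 1)) + Y ^ 3 * (- (a * c 3 2)) + Y ^ 4 * w * c 3 2 + c 3 3 * Y ^ 3 + Y ^ 4 * (a ^ 4 * c 4 0)
      + Y ^ 4 * (- (a ^ 3 * c 4 1)) + Y ^ 4 * (a ^ 2 * c 4 2) + Y ^ 4 * (- (a * c 4 3)) + c 4 4 * Y ^ 4 = Y ^ 5 * ?s"
    unfolding w_def k e by algebra
  then show ?thesis unfolding quartic_def a_def[symmetric] p distrib_left[of "Y ^ 5"] by linarith
qed

text \<open>The tangent lines of the node are \<open>y = 0\<close> and \<open>x + a y = 0\<close>. In the coordinates
  \<open>X = x + a y\<close> and \<open>y\<close> its branches are \<open>y = - e1 X\<^sup>2 - k1 X\<^sup>3 + \<dots>\<close> and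
  \<open>X = e2 y\<^sup>2 - k2 y\<^sup>3 + \<dots>\<close>.\<close>

locale jets =
  fixes U :: "(real \<times> real) set" and h :: "real \<times> real \<Rightarrow> real" and a e1 k1 e2 k2 :: real
  assumes U: "open U" "0 \<in> U" and h: "smooth_on U h"
    and quad: "vord 3 U (\<lambda>p. h p - (fst p * snd p + a * snd p ^ 2))"
    and first: "vord 5 ((\<lambda>p. (fst p - a * (fst p ^ 2 * (- e1 - k1 * fst p)), fst p ^ 2 * (- e1 - k1 * fst p))) -` U)
        (\<lambda>p. h (fst p - a * (fst p ^ 2 * (- e1 - k1 * fst p)), fst p ^ 2 * (- e1 - k1 * fst p)))"
    and second: "vord 5 ((\<lambda>p. (fst p ^ 2 * (e2 - k2 * fst p) - a * fst p, fst p)) -` U)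
        (\<lambda>p. h (fst p ^ 2 * (e2 - k2 * fst p) - a * fst p, fst p))"

lemma vord_oneI: "open S \<Longrightarrow> smooth_on S u \<Longrightarrow> u 0 = 0 \<Longrightarrow> vord 1 S u"
  by (auto intro: smooth_intros)

text \<open>The difference between \<open>f\<close> and the polynomial keeps its order k under
  substitution, and the polynomial itself becomes a multiple of the k-th power of the
  parameter.\<close>

lemma vord_split_compose:
  assumes U: "open U" "0 \<in> U" and v: "vord k U (\<lambda>p. f p - P (fst p) (snd p))"
    and u: "smooth_on UNIV (u :: real \<times> real \<Rightarrow> real)" "u 0 = 0" "smooth_on UNIV v" "v 0 = 0"
    and P: "\<And>p. P (u p) (v p) = fst p ^ k * r p" and r: "smooth_on UNIV r"
  shows "vord k ((\<lambda>p. (u p, v p)) -` U) (\<lambda>p. f (u p, v p))"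
proof -
  let ?S = "(\<lambda>p. (u p, v p)) -` U"
  have S: "open ?S" "0 \<in> ?S"
  proof -
    have "continuous_on UNIV (\<lambda>p. (u p, v p))" using u smooth_on_continuous by (intro continuous_on_Pair) auto
    then show "open ?S" using U(1) by (simp add: continuous_on_open_vimage)
    show "0 \<in> ?S" using u U(2) by (simp add: zero_prod_def)
  qed
  have 1: "vord k ?S (\<lambda>p. f (u p, v p) - P (u p) (v p))"
    using vord_compose[OF U S vord_oneI[OF S(1) smooth_on_mono_set[OF u(1)] u(2)]
      vord_oneI[OF S(1) smooth_on_mono_set[OF u(3)] u(4)] _ v] by simp
  have "vord k ?S (\<lambda>p. fst p ^ k)" by (rule vord_power[OF S vord_fst[OF S(1), of 1]]) auto
  moreover have "vord 0 ?S r" using smooth_on_mono_set[OF r] by simp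
  ultimately have "vord k ?S (\<lambda>p. fst p ^ k * r p)" by (rule vord_mult[OF S]) simp
  from vord_add[OF S 1 this] show ?thesis by (rule vord_eqI[OF S]) (simp add: P)
qed

text \<open>The cubic coefficient of the first branch differs from \<open>eta3\<close> by 2 a e1^2.
  This term is removed again by the skewness B of the adapted coordinates, through the summand -24 B
  p2^2 of \<open>v1\<close>.\<close>

lemma jets_taylor:
  assumes U: "open U" "0 \<in> U" "smooth_on U f" and f: "f (0, 0) = 0" "A1_minus f" "taylor_coeff f 2 0 = 0" "taylor_coeff f 2 1 = 1"
  shows "jets U f (taylor_coeff f 2 2) (eta1 f) (eta3 f + 2 * taylor_coeff f 2 2 * (eta1 f)\<^sup>2) (eta2 f) (eta4_bar f)"
proof
  let ?c = "taylor_coeff f"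
  show "open U" "0 \<in> U" "smooth_on U f" by fact+
  have t: "vord 5 U (\<lambda>p. f p - quartic ?c (fst p) (snd p))"
    using vord_taylor[OF U(1-3), of 5] unfolding taylor_poly_quartic[OF f] .
  have m: "vord 3 U (\<lambda>p. d * (fst p ^ i * snd p ^ j))" if "3 \<le> i + j" for d i j
  proof (rule vord_cmult[OF U(1,2)], rule vord_mult[OF U(1,2), of i _ j])
    show "vord i U (\<lambda>p. fst p ^ i)" by (rule vord_power[OF U(1,2) vord_fst[OF U(1), of 1]]) auto
    show "vord j U (\<lambda>p. snd p ^ j)" by (rule vord_power[OF U(1,2) vord_snd[OF U(1), of 1]]) auto
  qed (rule that)
  have "vord 3 U (\<lambda>p. (f p - quartic ?c (fst p) (snd p)) +
    ((?c 3 0 * (fst p ^ 3 * snd p ^ 0) + ?c 3 1 * (fst p ^ 2 * snd p ^ 1) + ?c 3 2 * (fst p ^ 1 * snd p ^ 2) + ?c 3 3 * (fst p ^ 0 * snd p ^ 3))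
    + (?c 4 0 * (fst p ^ 4 * snd p ^ 0) + ?c 4 1 * (fst p ^ 3 * snd p ^ 1) + ?c 4 2 * (fst p ^ 2 * snd p ^ 2) + ?c 4 3 * (fst p ^ 1 * snd p ^ 3)
       + ?c 4 4 * (fst p ^ 0 * snd p ^ 4))))"
    by (intro vord_add[OF U(1,2)] m vord_mono[OF t]) auto
  then show "vord 3 U (\<lambda>p. f p - (fst p * snd p + ?c 2 2 * snd p ^ 2))"
    by (rule vord_eqI[OF U(1,2)]) (simp add: quartic_def)
  have k1: "eta3 f + 2 * ?c 2 2 * (eta1 f)\<^sup>2 = ?c 4 0 - ?c 3 0 * ?c 3 1 + 3 * ?c 2 2 * (?c 3 0)\<^sup>2"
    by (simp add: eta3_def eta1_def Let_def)
  have e1: "eta1 f = ?c 3 0" by (simp add: eta1_def)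
  have e2: "eta2 f = ?c 2 2 ^ 3 * ?c 3 0 - ?c 2 2 ^ 2 * ?c 3 1 + ?c 2 2 * ?c 3 2 - ?c 3 3" by (simp add: eta2_def Let_def)
  have k2: "eta4_bar f = eta2 f * (3 * ?c 2 2 ^ 2 * ?c 3 0 - 2 * ?c 2 2 * ?c 3 1 + ?c 3 2) + ?c 2 2 ^ 4 * ?c 4 0
      - ?c 2 2 ^ 3 * ?c 4 1 + ?c 2 2 ^ 2 * ?c 4 2 - ?c 2 2 * ?c 4 3 + ?c 4 4" by (simp add: eta4_bar_def Let_def)
  show "vord 5 ((\<lambda>p. (fst p - ?c 2 2 * (fst p ^ 2 * (- eta1 f - (eta3 f + 2 * ?c 2 2 * (eta1 f)\<^sup>2) * fst p)),
          fst p ^ 2 * (- eta1 f - (eta3 f + 2 * ?c 2 2 * (eta1 f)\<^sup>2) * fst p))) -` U)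
        (\<lambda>p. f (fst p - ?c 2 2 * (fst p ^ 2 * (- eta1 f - (eta3 f + 2 * ?c 2 2 * (eta1 f)\<^sup>2) * fst p)),
          fst p ^ 2 * (- eta1 f - (eta3 f + 2 * ?c 2 2 * (eta1 f)\<^sup>2) * fst p)))"
    unfolding e1
    by (rule vord_split_compose[OF U(1,2) t _ _ _ _ quartic_first_branch[OF k1[unfolded e1]]]; (intro smooth_intros)?) auto
  show "vord 5 ((\<lambda>p. (fst p ^ 2 * (eta2 f - eta4_bar f * fst p) - ?c 2 2 * fst p, fst p)) -` U)
        (\<lambda>p. f (fst p ^ 2 * (eta2 f - eta4_bar f * fst p) - ?c 2 2 * fst p, fst p))"
    by (rule vord_split_compose[OF U(1,2) t _ _ _ _ quartic_second_branch[OF e2 k2]]; (intro smooth_intros)?) auto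
qed


section \<open>The two arcs of a smoothing\<close>

text \<open>d1 and d2 are the signs of x + a y and of y in the quadrant. The four conditions are
  those in the word of \<open>node_pair\<close> after passing to adapted coordinates, with positive
  factors dropped.\<close>

definition quadrant_word :: "real \<Rightarrow> real \<Rightarrow> real \<Rightarrow> real \<Rightarrow> real \<Rightarrow> real \<Rightarrow> letter list" where
  "quadrant_word e1 e2 e3 e4 d1 d2 =
     rev ((if d1 * e2 < 0 then [I] else []) @ (if d1 * d2 * e4 < 0 then [V] else [])) @ [V] @
     ((if d2 * e1 > 0 then [I] else []) @ (if d1 * d2 * e3 < 0 then [V] else []))"

lemma vord_reparam:
  assumes T: "open T" "0 \<in> T" and S: "open S" "0 \<in> S" and H: "vord k T H"
    and sub: "\<And>q. q \<in> S \<Longrightarrow> (d * fst q, snd q) \<in> T" and G: "\<And>q. q \<in> S \<Longrightarrow> G q = s * H (d * fst q, snd q)"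
  shows "vord k S G"
proof -
  have v: "vord 1 S (\<lambda>q. d * fst q)" "vord 1 S snd"
    by (rule vord_oneI[OF S(1)]; (intro smooth_intros S)?; simp)+
  have "vord k S (\<lambda>q. s * H (d * fst q, snd q))"
    by (rule vord_cmult[OF S vord_compose[OF T S v sub H]])
  then show ?thesis by (rule vord_eqI[OF S]) (simp add: G)
qed

text \<open>The forms see a function only through its partial derivatives, so passing from
  \<open>h\<close> to \<open>h\<close> minus a level constant does not affect them.\<close>

lemma vert_cong:
  assumes U: "open U" "p \<in> U" and e: "\<And>q. q \<in> U \<Longrightarrow> pdx f q = pdx g q" "\<And>q. q \<in> U \<Longrightarrow> pdy f q = pdy g q"
  shows "infl f p = infl g p" "vert A B C f p = vert A B C g p"
proof -
  have e2: "pdx (pdx f) q = pdx (pdx g) q" "pdy (pdx f) q = pdy (pdx g) q" "pdy (pdy f) q = pdy (pdy g) q" if "q \<in> U" for q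
    by (rule pd_cong[OF U(1) that], rule e, assumption)+
  have i: "infl f q = infl g q" if "q \<in> U" for q using that by (simp add: infl_def e e2)
  have n: "qn A B C f q = qn A B C g q" if "q \<in> U" for q using that by (simp add: qn_def e)
  have d: "pdx (infl f) p = pdx (infl g) p" "pdy (infl f) p = pdy (infl g) p"
    "pdx (qn A B C f) p = pdx (qn A B C g) p" "pdy (qn A B C f) p = pdy (qn A B C g) p"
    by (rule pd_cong[OF U] , rule i n, assumption)+
  show "infl f p = infl g p" "vert A B C f p = vert A B C g p"
    using U(2) by (simp_all add: i vert_def tder_def n e d)
qed

context jets begin

abbreviation "e3 \<equiv> k1 - 2 * a * e1\<^sup>2"
abbreviation "e4 \<equiv> (1 + a\<^sup>2) * k2 - 2 * a * e2\<^sup>2"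

text \<open>Coordinates with x + a y = d1 q1 and y = d2 q2 carry the quadrant to the positive one,
  and the factor s = d1 d2 turns h into a function q1 q2 + ... with positive level t. In them the
  Euclidean metric has the coefficients 1, -a s, 1 + a^2.\<close>

lemma quadrant:
  assumes d: "d1 = 1 \<or> d1 = -1" "d2 = 1 \<or> d2 = -1" and s: "s = d1 * d2" and nz: "e1 \<noteq> 0" "e2 \<noteq> 0" "e3 \<noteq> 0" "e4 \<noteq> 0"
  shows "\<exists>e0>0. \<forall>e. 0 < e \<longrightarrow> e < e0 \<longrightarrow> (\<exists>\<delta>>0. \<forall>t. 0 < t \<and> t < \<delta> \<longrightarrow>
    arc_on (\<lambda>p. h p - s * t) {p \<in> curve e (\<lambda>p. h p - s * t). d1 * (fst p + a * snd p) + d2 * snd p > 0}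
      (quadrant_word e1 e2 e3 e4 d1 d2) \<and>
    (\<forall>p\<in>curve e (\<lambda>p. h p - s * t). d1 * (fst p + a * snd p) + d2 * snd p \<noteq> 0))"
proof -
  interpret lc: linear_change U h s d1 "- (a * d2)" 0 d2 by unfold_locales (fact U h)+
  have dd: "d1 * d1 = 1" "d2 * d2 = 1" "s * s = 1" "d1 * (d1 * x) = x" "d2 * (d2 * x) = x" "s * (s * x) = x" "d1 * s = d2" "d2 * s = d1" for x
    using d s by auto
  have sq: "d1\<^sup>2 = 1" "d2\<^sup>2 = 1" "s\<^sup>2 = 1" using dd by (simp_all add: power2_eq_square)
  define L where "L = lc.lin"
  have L: "L q = (d1 * fst q - a * d2 * snd q, d2 * snd q)" for q by (simp add: L_def lc.lin_def)
  define W where "W = L -` U"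
  define W' where "W' = (\<lambda>q. (snd q, fst q)) -` W"
  define g where "g = lc.g"
  have g: "g q = s * h (L q)" for q by (simp add: g_def lc.g_def L_def)
  have W: "open W" "0 \<in> W" using lc.W U(2) by (simp_all add: W_def L_def[symmetric]) (simp add: L zero_prod_def)
  have W': "open W'" "0 \<in> W'" unfolding W'_def
    using W by (auto intro!: continuous_open_vimage continuous_intros) (simp add: zero_prod_def)
  have sg: "smooth_on W g" using lc.smooth_g by (simp add: W_def L_def g_def)
  have sL: "smooth_on S L" if "open S" for S unfolding L_def by (rule lc.smooth_lin'[OF that])
  have quad': "vord 3 W (\<lambda>q. g q - fst q * snd q)"
  proof -
    have v: "vord 1 W (\<lambda>q. d1 * fst q - a * d2 * snd q)" "vord 1 W (\<lambda>q. d2 * snd q)"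
      by (rule vord_oneI[OF W(1)]; (intro smooth_intros W)?; simp)+
    have "(d1 * fst q - a * d2 * snd q, d2 * snd q) \<in> U" if "q \<in> W" for q using that by (simp add: W_def L)
    from vord_cmult[OF W vord_compose[OF U W v this quad], of s]
    show ?thesis
    proof (rule vord_eqI[OF W])
      fix q
      have "s * ((d1 * fst q - a * d2 * snd q) * (d2 * snd q) + a * (d2 * snd q)\<^sup>2) = s * (d1 * d2) * (fst q * snd q)"
        by (simp add: algebra_simps power2_eq_square)
      also have "\<dots> = fst q * snd q" using dd(3) s by simp
      finally show "s * (h (d1 * fst q - a * d2 * snd q, d2 * snd q) - (fst (d1 * fst q - a * d2 * snd q, d2 * snd q) * snd (d1 * fst q - a * d2 * snd q, d2 * snd q) +
          a * snd (d1 * fst q - a * d2 * snd q, d2 * snd q) ^ 2)) = g q - fst q * snd q"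
        by (simp only: g L fst_conv snd_conv right_diff_distrib)
    qed
  qed
  let ?T1 = "(\<lambda>p. (fst p - a * (fst p ^ 2 * (- e1 - k1 * fst p)), fst p ^ 2 * (- e1 - k1 * fst p))) -` U"
  let ?T2 = "(\<lambda>p. (fst p ^ 2 * (e2 - k2 * fst p) - a * fst p, fst p)) -` U"
  let ?S1 = "(\<lambda>q. (fst q, - (d2 * e1) * fst q ^ 2 + - (s * k1) * fst q ^ 3)) -` W"
  let ?S2 = "(\<lambda>q. (fst q, d1 * e2 * fst q ^ 2 + - (s * k2) * fst q ^ 3)) -` W'"
  have T: "open ?T1" "open ?T2" "open ?S1" "open ?S2"
  proof -
    show "open ?T1" "open ?T2" by (rule open_vimage[OF U(1)], intro continuous_intros)+
    show "open ?S1" by (rule open_vimage[OF W(1)], intro continuous_intros)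
    show "open ?S2" by (rule open_vimage[OF W'(1)], intro continuous_intros)
  qed
  have z: "0 \<in> ?T1" "0 \<in> ?T2" "0 \<in> ?S1" "0 \<in> ?S2" using U(2) W(2) W'(2) by (simp_all add: zero_prod_def)
  have L1: "L (x, - (d2 * e1) * x ^ 2 + - (s * k1) * x ^ 3) =
      ((d1 * x) - a * ((d1 * x) ^ 2 * (- e1 - k1 * (d1 * x))), (d1 * x) ^ 2 * (- e1 - k1 * (d1 * x)))" for x
    using d unfolding L s by (auto simp: algebra_simps power2_eq_square power3_eq_cube)
  have L2: "L (d1 * e2 * x ^ 2 + - (s * k2) * x ^ 3, x) = ((d2 * x) ^ 2 * (e2 - k2 * (d2 * x)) - a * (d2 * x), d2 * x)" for x
    using d unfolding L s by (auto simp: algebra_simps power2_eq_square power3_eq_cube)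
  have b1: "vord 5 ?S1 (\<lambda>q. g (fst q, - (d2 * e1) * fst q ^ 2 + - (s * k1) * fst q ^ 3))"
  proof (rule vord_reparam[OF T(1) z(1) T(3) z(3) first, of d1 _ s])
    fix q assume "q \<in> ?S1"
    then have "L (fst q, - (d2 * e1) * fst q ^ 2 + - (s * k1) * fst q ^ 3) \<in> U" by (simp only: W_def vimage_eq)
    then show "(d1 * fst q, snd q) \<in> ?T1" unfolding L1 by (simp only: vimage_eq fst_conv)
  qed (simp only: g L1 fst_conv)
  have b2: "vord 5 ?S2 (\<lambda>q. g (d1 * e2 * fst q ^ 2 + - (s * k2) * fst q ^ 3, fst q))"
  proof (rule vord_reparam[OF T(2) z(2) T(4) z(4) second, of d2 _ s])
    fix q assume "q \<in> ?S2"
    then have "L (d1 * e2 * fst q ^ 2 + - (s * k2) * fst q ^ 3, fst q) \<in> U" by (simp only: W_def W'_def vimage_eq fst_conv snd_conv)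
    then show "(d2 * fst q, snd q) \<in> ?T2" unfolding L2 by (simp only: vimage_eq fst_conv)
  qed (simp only: g L2 fst_conv)
  \<comment> \<open>The constants \<open>v1\<close> and \<open>v2\<close> of the two branches. Both
    the cubic coefficients and the skewness are proportional to s, so s factors out and leaves
    multiples of \<open>e3\<close> and \<open>e4\<close>.\<close>
  have e34: "12 * 1 * - (s * k1) - 24 * - (a * s) * (- (d2 * e1))\<^sup>2 = - (12 * (s * e3))"
    "12 * (1 + a\<^sup>2) * - (s * k2) - 24 * - (a * s) * (d1 * e2)\<^sup>2 = - (12 * (s * e4))"
    by (simp_all add: power_mult_distrib sq algebra_simps)
  have s0: "s \<noteq> 0" "d1 \<noteq> 0" "d2 \<noteq> 0" using d s by auto
  interpret np: node_pair W g 1 "- (a * s)" "1 + a\<^sup>2" "- (d2 * e1)" "- (s * k1)" W' "\<lambda>q. g (snd q, fst q)" "d1 * e2" "- (s * k2)"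
  proof (intro node_pair.intro node.intro node_pair_axioms.intro)
    show "vord 5 ?S1 (\<lambda>q. g (fst q, - (d2 * e1) * fst q ^ 2 + - (s * k1) * fst q ^ 3))" by (rule b1)
    show "vord 5 ?S2 (\<lambda>q. g (snd (fst q, d1 * e2 * fst q ^ 2 + - (s * k2) * fst q ^ 3), fst (fst q, d1 * e2 * fst q ^ 2 + - (s * k2) * fst q ^ 3)))"
      using b2 by simp
    show "0 < 1 + a\<^sup>2" "0 < 1 + a\<^sup>2" "0 < (1 :: real)" "0 < (1 :: real)" by (simp_all add: add_pos_nonneg)
    show "(- (a * s))\<^sup>2 < 1 * (1 + a\<^sup>2)" by (simp add: power_mult_distrib sq)
    show "12 * 1 * - (s * k1) - 24 * - (a * s) * (- (d2 * e1))\<^sup>2 \<noteq> 0"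
      "12 * (1 + a\<^sup>2) * - (s * k2) - 24 * - (a * s) * (d1 * e2)\<^sup>2 \<noteq> 0"
      unfolding e34 using nz s0 by simp_all
    show "- (d2 * e1) \<noteq> 0" "d1 * e2 \<noteq> 0" using nz s0 by simp_all
    have v: "vord 1 W' snd" "vord 1 W' fst" by (rule vord_snd[OF W'(1)] vord_fst[OF W'(1)]; simp)+
    have "vord 3 W' (\<lambda>q. g (snd q, fst q) - fst (snd q, fst q) * snd (snd q, fst q))"
      by (rule vord_compose[OF W W' v _ quad']) (simp add: W'_def)
    then show "vord 3 W' (\<lambda>p. g (snd p, fst p) - fst p * snd p)" by (simp add: mult.commute)
    show "smooth_on W' (\<lambda>q. g (snd q, fst q))"
      by (rule smooth_on_compose[OF sg W'(1) W(1)]) (auto simp: W'_def intro!: smooth_intros W'(1)[unfolded W'_def])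
  qed (use W W' sg quad' in \<open>simp_all add: W'_def\<close>)
  have word: "np.word = quadrant_word e1 e2 e3 e4 d1 d2"
    unfolding quadrant_word_def e34 s[symmetric] by simp
  have qd: "np.qd z = (fst (L z))\<^sup>2 + (snd (L z))\<^sup>2" for z
  proof -
    have "(fst (L z))\<^sup>2 + (snd (L z))\<^sup>2 = d1\<^sup>2 * (fst z)\<^sup>2 - 2 * (d1 * d2) * a * (fst z * snd z) + (1 + a\<^sup>2) * (d2\<^sup>2 * (snd z)\<^sup>2)"
      unfolding L fst_conv snd_conv by algebra
    then show ?thesis unfolding sq s[symmetric] np.qd_def by (simp add: algebra_simps power2_eq_square)
  qed
  have ball: "np.qd z < e\<^sup>2 \<longleftrightarrow> L z \<in> ball 0 e" if "0 < e" for z e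
    unfolding qd using that by (simp add: norm_lt_square[of "L z" e] inner_prod_def power2_eq_square)
  define M where "M = (\<lambda>p. (d1 * (fst p + a * snd p), d2 * snd p))"
  have LM: "L (M p) = p" "M (L p) = p" for p
    unfolding L M_def by (simp_all add: dd prod_eq_iff algebra_simps)
  define P where "P = (\<lambda>p :: real \<times> real. d1 * (fst p + a * snd p) - d2 * snd p)"
  have bP: "bounded_linear P" unfolding P_def
    by (intro bounded_linear_sub bounded_linear_const_mult bounded_linear_add bounded_linear_fst bounded_linear_snd)
  have PL: "P (L z) = fst z - snd z" "d1 * (fst (L z) + a * snd (L z)) + d2 * snd (L z) = fst z + snd z" for z
    unfolding P_def L by (simp_all add: dd algebra_simps)
  obtain e0 where e0: "e0 > 0" and arc: "\<And>e. 0 < e \<Longrightarrow> e < e0 \<Longrightarrow> \<exists>\<delta>>0. \<forall>t. 0 < t \<and> t < \<delta> \<longrightarrow>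
    (\<exists>x y c. x < y \<and> smooth_on {x<..<y} c \<and>
      (\<forall>p\<in>{x<..<y}. fst (c p) - snd (c p) = p \<and> (pdx g (c p), pdy g (c p)) \<noteq> (0, 0)) \<and>
      c ` {x<..<y} = {z. fst z + snd z > 0 \<and> np.qd z < e\<^sup>2 \<and> g z = t} \<and>
      spells {x<..<y} (\<lambda>p. infl g (c p) = 0) (\<lambda>p. vert 1 (- (a * s)) (1 + a\<^sup>2) g (c p) = 0) np.word) \<and>
    (\<forall>z. np.qd z < e\<^sup>2 \<longrightarrow> g z = t \<longrightarrow> fst z + snd z \<noteq> 0)"
    and inU: "\<And>z e. 0 < e \<Longrightarrow> e < e0 \<Longrightarrow> np.qd z < e\<^sup>2 \<Longrightarrow> z \<in> W"
    by (rule np.arc) blast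
  have gh: "g z = t \<longleftrightarrow> h (L z) - s * t = 0" for z t
  proof
    show "g z = t \<Longrightarrow> h (L z) - s * t = 0" using dd(6) by (auto simp: g)
    show "h (L z) - s * t = 0 \<Longrightarrow> g z = t" using dd(6) by (auto simp: g)
  qed
  have main: "arc_on (\<lambda>p. h p - s * t) {p \<in> curve e (\<lambda>p. h p - s * t). d1 * (fst p + a * snd p) + d2 * snd p > 0}
      (quadrant_word e1 e2 e3 e4 d1 d2)"
    if e: "0 < e" "e < e0" and c: "x < y" "smooth_on {x<..<y} c"
      "\<forall>p\<in>{x<..<y}. fst (c p) - snd (c p) = p \<and> (pdx g (c p), pdy g (c p)) \<noteq> (0, 0)"
      "c ` {x<..<y} = {z. fst z + snd z > 0 \<and> np.qd z < e\<^sup>2 \<and> g z = t}"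
      "spells {x<..<y} (\<lambda>p. infl g (c p) = 0) (\<lambda>p. vert 1 (- (a * s)) (1 + a\<^sup>2) g (c p) = 0) np.word"
    for e t x y and c :: "real \<Rightarrow> real \<times> real"
  proof -
    define C where "C = (\<lambda>u. L (c u))"
    let ?g = "\<lambda>p. h p - s * t"
    have sC: "smooth_on {x<..<y} C" unfolding C_def
      by (rule smooth_on_compose[OF sL[OF open_UNIV] _ _ c(2)]) auto
    have sg': "smooth_on U ?g" by (intro smooth_intros U h)
    have pg: "pdx ?g p = pdx h p" "pdy ?g p = pdy h p" if "p \<in> U" for p
      using pd_diff[OF h smooth_on_const[OF U(1)] that] by simp_all
    have z: "c u \<in> {z. fst z + snd z > 0 \<and> np.qd z < e\<^sup>2 \<and> g z = t}" if "u \<in> {x<..<y}" for u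
      using c(4) that by blast
    have CU: "c u \<in> W" "C u \<in> U" if "u \<in> {x<..<y}" for u
    proof -
      show "c u \<in> W" using inU[OF e, of "c u"] z[OF that] by blast
      then show "C u \<in> U" by (simp add: C_def W_def)
    qed
    have gC: "?g (C u) = 0" if "u \<in> {x<..<y}" for u using z[OF that] gh[of "c u" t] by (simp add: C_def)
    have PC: "P (C u) = u" if "u \<in> {x<..<y}" for u using c(3) that by (simp add: C_def PL)
    have dC: "frechet_derivative C (at u) 1 \<noteq> 0" if "u \<in> {x<..<y}" for u
    proof
      assume 0: "frechet_derivative C (at u) 1 = 0"
      have "((\<lambda>v. P (C v)) has_derivative (\<lambda>v. P (frechet_derivative C (at u) v))) (at u)"
        by (rule bounded_linear.has_derivative[OF bP smooth_on_frechet[OF sC that]])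
      moreover have "((\<lambda>v. P (C v)) has_derivative (\<lambda>v. v)) (at u)"
        by (rule has_derivative_transform_within_open[OF has_derivative_ident open_greaterThanLessThan that]) (simp add: PC)
      ultimately have "(\<lambda>v. P (frechet_derivative C (at u) v)) = (\<lambda>v. v)" by (rule has_derivative_unique)
      then have "P (frechet_derivative C (at u) 1) = 1" by (rule fun_cong)
      then show False using 0 linear_0[OF bounded_linear.linear[OF bP]] by simp
    qed
    have cW: "c u \<in> lc.lin -` U" if "u \<in> {x<..<y}" for u using CU(1)[OF that] by (simp add: W_def L_def)
    have grad: "(pdx ?g (C u), pdy ?g (C u)) \<noteq> (0, 0)" if "u \<in> {x<..<y}" for u
    proof
      assume "(pdx ?g (C u), pdy ?g (C u)) = (0, 0)"
      then have "pdx h (lc.lin (c u)) = 0" "pdy h (lc.lin (c u)) = 0"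
        using pg[OF CU(2)[OF that]] by (simp_all add: C_def L_def)
      then have "pdx g (c u) = 0" "pdy g (c u) = 0" using lc.pd_g[OF cW[OF that]] by (simp_all add: g_def)
      then show False using c(3) that by blast
    qed
    have iv: "inflection ?g (C u) \<longleftrightarrow> infl g (c u) = 0" "vertex ?g (C u) \<longleftrightarrow> vert 1 (- (a * s)) (1 + a\<^sup>2) g (c u) = 0"
      if u: "u \<in> {x<..<y}" for u
    proof -
      note q = cW[OF u]
      have m: "1 = 1 * d1\<^sup>2 + 2 * 0 * d1 * 0 + 1 * 0\<^sup>2"
        "- (a * s) = 1 * d1 * - (a * d2) + 0 * (d1 * d2 + - (a * d2) * 0) + 1 * 0 * d2"
        "1 + a\<^sup>2 = 1 * (- (a * d2))\<^sup>2 + 2 * 0 * (- (a * d2)) * d2 + 1 * d2\<^sup>2"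
        by (simp_all add: sq s power_mult_distrib)
      have dt: "d1 * d2 - - (a * d2) * 0 = s" using s by simp
      have "infl g (c u) = s ^ 3 * s\<^sup>2 * infl ?g (C u)"
        using lc.infl_g[OF q] vert_cong(1)[OF U(1) CU(2)[OF u] pg] unfolding g_def C_def L_def dt by simp
      moreover have "vert 1 (- (a * s)) (1 + a\<^sup>2) g (c u) = s ^ 6 * s ^ 5 * vert 1 0 1 ?g (C u)"
        using lc.vert_g[OF m q] vert_cong(2)[OF U(1) CU(2)[OF u] pg] unfolding g_def C_def L_def dt by simp
      ultimately show "inflection ?g (C u) \<longleftrightarrow> infl g (c u) = 0" "vertex ?g (C u) \<longleftrightarrow> vert 1 (- (a * s)) (1 + a\<^sup>2) g (c u) = 0"
        using inflection_vertex_iff[OF U(1) sg' sC gC dC u CU(2)[OF u] grad[OF u]] s0 by simp_all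
    qed
    have im: "C ` {x<..<y} = {p \<in> curve e ?g. d1 * (fst p + a * snd p) + d2 * snd p > 0}"
    proof (intro equalityI subsetI)
      fix p assume "p \<in> C ` {x<..<y}"
      then obtain u where u: "p = L (c u)" "u \<in> {x<..<y}" by (auto simp: C_def)
      then show "p \<in> {p \<in> curve e ?g. d1 * (fst p + a * snd p) + d2 * snd p > 0}"
        using z[OF u(2)] ball[OF e(1), of "c u"] gh[of "c u" t] by (simp add: curve_def PL(2))
    next
      fix p assume "p \<in> {p \<in> curve e ?g. d1 * (fst p + a * snd p) + d2 * snd p > 0}"
      then have "M p \<in> {z. fst z + snd z > 0 \<and> np.qd z < e\<^sup>2 \<and> g z = t}"
        using ball[OF e(1), of "M p"] gh[of "M p" t] PL(2)[of "M p"] by (simp add: curve_def LM)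
      then have "M p \<in> c ` {x<..<y}" unfolding c(4) .
      then obtain u where "M p = c u" "u \<in> {x<..<y}" by blast
      then show "p \<in> C ` {x<..<y}" using LM(1)[of p] by (auto simp: C_def image_iff)
    qed
    have reg: "\<forall>p\<in>C ` {x<..<y}. regular_point ?g p"
      using gC grad by (auto simp: regular_point_def simp del: split_paired_All)
    have sp: "spells {x<..<y} (\<lambda>u. inflection ?g (C u)) (\<lambda>u. vertex ?g (C u)) (quadrant_word e1 e2 e3 e4 d1 d2)"
      using c(5) unfolding word by (rule iffD2[OF spells_cong, rotated 2]) (simp_all only: iv)
    show ?thesis unfolding arc_on_def im[symmetric] using c(1) sC bP PC reg sp by blast
  qed
  show ?thesis
  proof (rule exI[of _ e0], intro conjI allI impI e0)
    fix e assume e: "0 < e" "e < e0"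
    obtain \<delta> where \<delta>: "\<delta> > 0" and D: "\<And>t. 0 < t \<and> t < \<delta> \<Longrightarrow>
      (\<exists>x y c. x < y \<and> smooth_on {x<..<y} c \<and>
      (\<forall>p\<in>{x<..<y}. fst (c p) - snd (c p) = p \<and> (pdx g (c p), pdy g (c p)) \<noteq> (0, 0)) \<and>
      c ` {x<..<y} = {z. fst z + snd z > 0 \<and> np.qd z < e\<^sup>2 \<and> g z = t} \<and>
      spells {x<..<y} (\<lambda>p. infl g (c p) = 0) (\<lambda>p. vert 1 (- (a * s)) (1 + a\<^sup>2) g (c p) = 0) np.word) \<and>
      (\<forall>z. np.qd z < e\<^sup>2 \<longrightarrow> g z = t \<longrightarrow> fst z + snd z \<noteq> 0)" using arc[OF e] by blast
    show "\<exists>\<delta>>0. \<forall>t. 0 < t \<and> t < \<delta> \<longrightarrow>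
      arc_on (\<lambda>p. h p - s * t) {p \<in> curve e (\<lambda>p. h p - s * t). d1 * (fst p + a * snd p) + d2 * snd p > 0}
        (quadrant_word e1 e2 e3 e4 d1 d2) \<and>
      (\<forall>p\<in>curve e (\<lambda>p. h p - s * t). d1 * (fst p + a * snd p) + d2 * snd p \<noteq> 0)"
    proof (rule exI[of _ \<delta>], intro conjI \<delta> allI impI)
      fix t assume t: "0 < t \<and> t < \<delta>"
      show "arc_on (\<lambda>p. h p - s * t) {p \<in> curve e (\<lambda>p. h p - s * t). d1 * (fst p + a * snd p) + d2 * snd p > 0}
        (quadrant_word e1 e2 e3 e4 d1 d2)" using D[OF t] main[OF e] by blast
      show "\<forall>p\<in>curve e (\<lambda>p. h p - s * t). d1 * (fst p + a * snd p) + d2 * snd p \<noteq> 0"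
      proof
        fix p assume p: "p \<in> curve e (\<lambda>p. h p - s * t)"
        then have "np.qd (M p) < e\<^sup>2" "g (M p) = t"
          using ball[OF e(1), of "M p"] gh[of "M p" t] by (simp_all add: curve_def LM)
        then have "fst (M p) + snd (M p) \<noteq> 0" using D[OF t] by blast
        then show "d1 * (fst p + a * snd p) + d2 * snd p \<noteq> 0" using PL(2)[of "M p"] by (simp add: LM)
      qed
    qed
  qed
qed

text \<open>The level s t is met in the two opposite quadrants with d1 d2 = s. Their linear forms
  differ by a sign, so one form separates the two arcs.\<close>

lemma level_two_arcs:
  assumes s: "s = 1 \<or> s = -1" and nz: "e1 \<noteq> 0" "e2 \<noteq> 0" "e3 \<noteq> 0" "e4 \<noteq> 0"
  shows "\<exists>e0>0. \<forall>e. 0 < e \<longrightarrow> e < e0 \<longrightarrow> (\<exists>\<delta>>0. \<forall>t. 0 < t \<and> t < \<delta> \<longrightarrow>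
    two_arcs e (\<lambda>p. h p - s * t) (quadrant_word e1 e2 e3 e4 1 s) (quadrant_word e1 e2 e3 e4 (-1) (- s)))"
proof -
  obtain r1 where r1: "r1 > 0" and 1: "\<And>e. 0 < e \<Longrightarrow> e < r1 \<Longrightarrow> \<exists>\<delta>>0. \<forall>t. 0 < t \<and> t < \<delta> \<longrightarrow>
    arc_on (\<lambda>p. h p - s * t) {p \<in> curve e (\<lambda>p. h p - s * t). 1 * (fst p + a * snd p) + s * snd p > 0}
      (quadrant_word e1 e2 e3 e4 1 s) \<and>
    (\<forall>p\<in>curve e (\<lambda>p. h p - s * t). 1 * (fst p + a * snd p) + s * snd p \<noteq> 0)"
    using quadrant[of 1 s s] s nz by auto
  obtain r2 where r2: "r2 > 0" and 2: "\<And>e. 0 < e \<Longrightarrow> e < r2 \<Longrightarrow> \<exists>\<delta>>0. \<forall>t. 0 < t \<and> t < \<delta> \<longrightarrow>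
    arc_on (\<lambda>p. h p - s * t) {p \<in> curve e (\<lambda>p. h p - s * t). -1 * (fst p + a * snd p) + - s * snd p > 0}
      (quadrant_word e1 e2 e3 e4 (-1) (- s)) \<and>
    (\<forall>p\<in>curve e (\<lambda>p. h p - s * t). -1 * (fst p + a * snd p) + - s * snd p \<noteq> 0)"
    using quadrant[of "-1" "- s" s] s nz by auto
  show ?thesis
  proof (rule exI[of _ "min r1 r2"], intro conjI allI impI)
    fix e assume e: "0 < e" "e < min r1 r2"
    obtain \<delta>1 where d1: "\<delta>1 > 0" "\<And>t. 0 < t \<and> t < \<delta>1 \<Longrightarrow>
      arc_on (\<lambda>p. h p - s * t) {p \<in> curve e (\<lambda>p. h p - s * t). 1 * (fst p + a * snd p) + s * snd p > 0}
        (quadrant_word e1 e2 e3 e4 1 s) \<and>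
      (\<forall>p\<in>curve e (\<lambda>p. h p - s * t). 1 * (fst p + a * snd p) + s * snd p \<noteq> 0)" using 1[of e] e by auto
    obtain \<delta>2 where d2: "\<delta>2 > 0" "\<And>t. 0 < t \<and> t < \<delta>2 \<Longrightarrow>
      arc_on (\<lambda>p. h p - s * t) {p \<in> curve e (\<lambda>p. h p - s * t). -1 * (fst p + a * snd p) + - s * snd p > 0}
        (quadrant_word e1 e2 e3 e4 (-1) (- s))" using 2[of e] e by auto
    show "\<exists>\<delta>>0. \<forall>t. 0 < t \<and> t < \<delta> \<longrightarrow>
      two_arcs e (\<lambda>p. h p - s * t) (quadrant_word e1 e2 e3 e4 1 s) (quadrant_word e1 e2 e3 e4 (-1) (- s))"
    proof (rule exI[of _ "min \<delta>1 \<delta>2"], intro conjI allI impI)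
      fix t assume t: "0 < t \<and> t < min \<delta>1 \<delta>2"
      have b: "bounded_linear (\<lambda>p :: real \<times> real. 1 * (fst p + a * snd p) + s * snd p)"
        by (intro bounded_linear_add bounded_linear_const_mult bounded_linear_fst bounded_linear_snd)
      have "{p \<in> curve e (\<lambda>p. h p - s * t). -1 * (fst p + a * snd p) + - s * snd p > 0} =
        {p \<in> curve e (\<lambda>p. h p - s * t). 1 * (fst p + a * snd p) + s * snd p < 0}" by auto
      then have "arc_on (\<lambda>p. h p - s * t) {p \<in> curve e (\<lambda>p. h p - s * t). 1 * (fst p + a * snd p) + s * snd p < 0}
        (quadrant_word e1 e2 e3 e4 (-1) (- s))" using d2(2)[of t] t by simp
      then show "two_arcs e (\<lambda>p. h p - s * t) (quadrant_word e1 e2 e3 e4 1 s) (quadrant_word e1 e2 e3 e4 (-1) (- s))"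
        unfolding two_arcs_def using b d1(2)[of t] t by (intro exI[of _ "\<lambda>p. 1 * (fst p + a * snd p) + s * snd p"]) simp
    qed (use d1 d2 in simp)
  qed (use r1 r2 in simp)
qed

end


section \<open>Reduction of a versal deformation\<close>

text \<open>A member of a deformation and its normal form are different functions with a common zero
  set. Agreement of zeros and of regular points is enough, because arc length parametrisations see
  the function only through its zeros.\<close>

definition same_curve :: "real \<Rightarrow> (real \<times> real \<Rightarrow> real) \<Rightarrow> (real \<times> real \<Rightarrow> real) \<Rightarrow> bool" where
  "same_curve e g h \<longleftrightarrow> (\<forall>p\<in>ball 0 e. (g p = 0 \<longleftrightarrow> h p = 0) \<and> (regular_point g p \<longleftrightarrow> regular_point h p))"

lemma arclength_param_same_curve:
  assumes s: "same_curve e g h" and p: "p \<in> ball 0 e" and \<gamma>: "arclength_param g p \<gamma>" shows "arclength_param h p \<gamma>"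
proof -
  obtain r where r: "r > 0" "smooth_on {-r<..<r} \<gamma>" "\<And>s. s \<in> {-r<..<r} \<Longrightarrow> g (\<gamma> s) = 0 \<and> norm (vector_derivative \<gamma> (at s)) = 1"
    and 0: "\<gamma> 0 = p" using \<gamma> unfolding arclength_param_def by blast
  have "open ({-r<..<r} \<inter> \<gamma> -` ball 0 e)"
    by (rule continuous_open_preimage[OF smooth_on_continuous[OF r(2)]]) auto
  moreover have "0 \<in> {-r<..<r} \<inter> \<gamma> -` ball 0 e" using r(1) 0 p by simp
  ultimately obtain r' where r': "r' > 0" "ball 0 r' \<subseteq> {-r<..<r} \<inter> \<gamma> -` ball 0 e" using open_contains_ball by blast
  have b: "ball 0 r' = {-r'<..<r'}" by (auto simp: dist_real_def)
  have "smooth_on {-r'<..<r'} \<gamma>" by (rule smooth_on_mono_set[OF r(2)]) (use r'(2) b in auto)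
  moreover have "h (\<gamma> s) = 0 \<and> norm (vector_derivative \<gamma> (at s)) = 1" if "s \<in> {-r'<..<r'}" for s
  proof -
    have "s \<in> {-r<..<r}" "\<gamma> s \<in> ball 0 e" using r'(2) that unfolding b by blast+
    then show ?thesis using r(3)[of s] s unfolding same_curve_def by blast
  qed
  ultimately show ?thesis unfolding arclength_param_def using 0 r'(1) by blast
qed

lemma same_curve_sym: "same_curve e g h \<Longrightarrow> same_curve e h g"
  unfolding same_curve_def by blast

lemma same_curve_points:
  assumes s: "same_curve e g h"
  shows "curve e g = curve e h"
    "p \<in> curve e g \<Longrightarrow> regular_point g p \<longleftrightarrow> regular_point h p" "p \<in> curve e g \<Longrightarrow> singular_point g p \<longleftrightarrow> singular_point h p"
    "p \<in> curve e g \<Longrightarrow> inflection g p \<longleftrightarrow> inflection h p" "p \<in> curve e g \<Longrightarrow> vertex g p \<longleftrightarrow> vertex h p"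
proof -
  show "curve e g = curve e h" using s unfolding same_curve_def curve_def by blast
  assume p: "p \<in> curve e g"
  then have b: "p \<in> ball 0 e" by (simp add: curve_def)
  show r: "regular_point g p \<longleftrightarrow> regular_point h p" using s b unfolding same_curve_def by blast
  have "g p = 0 \<longleftrightarrow> h p = 0" using s b unfolding same_curve_def by blast
  then show "singular_point g p \<longleftrightarrow> singular_point h p" using r unfolding regular_point_def singular_point_def by blast
  have "arclength_param g p \<gamma> \<longleftrightarrow> arclength_param h p \<gamma>" for \<gamma>
    using arclength_param_same_curve[OF s b] arclength_param_same_curve[OF same_curve_sym[OF s] b] by blast
  then show "inflection g p \<longleftrightarrow> inflection h p" "vertex g p \<longleftrightarrow> vertex h p"
    unfolding inflection_def vertex_def using r by simp_all
qed

lemma same_curve_FRS_same: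
  assumes s: "same_curve e g h" shows "FRS_same e g h"
proof -
  note p = same_curve_points[OF s]
  have "homeomorphism (curve e g) (curve e h) id id" using p(1) by (simp add: homeomorphism_def)
  then have "same_relative_position e g h" unfolding same_relative_position_def
    by (intro exI[of _ id] conjI ballI) (simp_all add: p(3,4,5) p(1)[symmetric])
  moreover have "smooth_on_subset (curve e g) id"
    unfolding smooth_on_subset_def by (intro ballI exI[of _ UNIV] exI[of _ id]) (auto simp: id_def intro: smooth_intros)
  then have "diffeomorphic (curve e g) (curve e h)" unfolding diffeomorphic_def p(1)[symmetric]
    by (intro exI[of _ id]) auto
  moreover have "{p \<in> curve e g. inflection g p} = {p \<in> curve e h. inflection h p}" "{p \<in> curve e g. vertex g p} = {p \<in> curve e h. vertex h p}"
    using p(4,5) by (auto simp: p(1)[symmetric])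
  ultimately show ?thesis by (simp add: FRS_same_def)
qed

lemma same_curve_two_arcs:
  assumes s: "same_curve e g h" and t: "two_arcs e h v w" shows "two_arcs e g v w"
proof -
  note p = same_curve_points[OF same_curve_sym[OF s]]
  have arc: "arc_on g K w" if "arc_on h K w" "K \<subseteq> curve e h" for K w
  proof -
    obtain a b c L where k: "a < b" "smooth_on {a<..<b} c" "bounded_linear (L :: real \<times> real \<Rightarrow> real)"
      "\<forall>u\<in>{a<..<b}. L (c u) = u" "c ` {a<..<b} = K" "\<forall>p\<in>K. regular_point h p"
      and sp: "spells {a<..<b} (\<lambda>u. inflection h (c u)) (\<lambda>u. vertex h (c u)) w" using \<open>arc_on h K w\<close> unfolding arc_on_def by blast
    have c: "c u \<in> curve e h" if "u \<in> {a<..<b}" for u using that k(5) \<open>K \<subseteq> curve e h\<close> by blast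
    have "spells {a<..<b} (\<lambda>u. inflection g (c u)) (\<lambda>u. vertex g (c u)) w"
      by (rule iffD1[OF spells_cong sp]) (use p(4,5) c in blast)+
    moreover have "\<forall>p\<in>K. regular_point g p" using k(6) p(2) \<open>K \<subseteq> curve e h\<close> by blast
    ultimately show ?thesis unfolding arc_on_def using k by blast
  qed
  obtain el where l: "bounded_linear (el :: real \<times> real \<Rightarrow> real)" "\<forall>p\<in>curve e h. el p \<noteq> 0"
    "arc_on h {p \<in> curve e h. el p > 0} v" "arc_on h {p \<in> curve e h. el p < 0} w"
    using t unfolding two_arcs_def by blast
  have "arc_on g {p \<in> curve e h. el p > 0} v" "arc_on g {p \<in> curve e h. el p < 0} w"
    by (rule arc[OF l(3)], blast, rule arc[OF l(4)], blast)
  then show ?thesis unfolding two_arcs_def p(1)[symmetric] using l by blast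
qed

lemma same_curve_eq:
  assumes "\<And>p. p \<in> ball 0 e \<Longrightarrow> g p = h p" shows "same_curve e g h"
  unfolding same_curve_def
proof
  fix p :: "real \<times> real" assume p: "p \<in> ball 0 e"
  have "pdx g p = pdx h p" "pdy g p = pdy h p" by (rule pd_cong[OF open_ball p], rule assms, assumption)+
  then show "(g p = 0 \<longleftrightarrow> h p = 0) \<and> (regular_point g p \<longleftrightarrow> regular_point h p)"
    using assms[OF p] by (simp add: regular_point_def)
qed

lemma vord_subset: "vord k U g \<Longrightarrow> S \<subseteq> U \<Longrightarrow> vord k S g"
  by (induction k arbitrary: g) (auto intro: smooth_on_mono_set)

lemma vord_compose_unit:
  assumes u: "smooth_on UNIV (u :: real \<times> real \<Rightarrow> real)" "u 0 = 0" "smooth_on UNIV v" "v 0 = 0"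
    and U': "open U'" "0 \<in> U'" "U' \<subseteq> U" and f: "vord k ((\<lambda>p. (u p, v p)) -` U) (\<lambda>p. f (u p, v p))"
    and w: "smooth_on U' w" "\<And>p. p \<in> U' \<Longrightarrow> h p = f p * w p"
  shows "vord k ((\<lambda>p. (u p, v p)) -` U') (\<lambda>p. h (u p, v p))"
proof -
  let ?S = "(\<lambda>p. (u p, v p)) -` U'"
  have "continuous_on UNIV (\<lambda>p. (u p, v p))" by (intro continuous_on_Pair smooth_on_continuous u)
  then have S: "open ?S" "0 \<in> ?S" using open_vimage[OF U'(1)] u U'(2) by (simp_all add: zero_prod_def)
  have "vord k ?S (\<lambda>p. f (u p, v p))" by (rule vord_subset[OF f]) (use U'(3) in auto)
  moreover have "smooth_on ?S (\<lambda>p. w (u p, v p))"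
    by (rule smooth_on_compose[OF w(1) S(1) U'(1) smooth_on_Pair[OF S(1) smooth_on_mono_set[OF u(1)] smooth_on_mono_set[OF u(3)]]]) auto
  then have "vord 0 ?S (\<lambda>p. w (u p, v p))" by simp
  ultimately have "vord k ?S (\<lambda>p. f (u p, v p) * w (u p, v p))" by (rule vord_mult[OF S]) simp
  then show ?thesis by (rule vord_eqI[OF S]) (simp add: w(2))
qed

text \<open>A factor with value 1 at the origin preserves the quadratic part, and vanishing orders
  along the approximate branches survive any smooth factor.\<close>

lemma jets_unit:
  assumes j: "jets U f a e1 k1 e2 k2" and U': "open U'" "0 \<in> U'" "U' \<subseteq> U"
    and w: "smooth_on U' w" "w 0 = 1" "\<And>p. p \<in> U' \<Longrightarrow> h p = f p * w p"
  shows "jets U' h a e1 k1 e2 k2"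
proof -
  interpret j: jets U f a e1 k1 e2 k2 by (rule j)
  show ?thesis
  proof
    show "open U'" "0 \<in> U'" by fact+
    have "smooth_on U' (\<lambda>p. f p * w p)" by (intro smooth_intros U' w smooth_on_mono_set[OF j.h])
    then show "smooth_on U' h" using smooth_on_cong[OF U'(1), of h "\<lambda>p. f p * w p"] w(3) by simp
    have x: "vord 1 U' fst" "vord 1 U' snd" by (rule vord_fst[OF U'(1)] vord_snd[OF U'(1)]; simp)+
    have q: "vord 2 U' (\<lambda>p. fst p * snd p + a * snd p ^ 2)"
      by (intro vord_add[OF U'(1,2)] vord_cmult[OF U'(1,2)] vord_mult[OF U'(1,2) x] vord_power[OF U'(1,2) x(2)]) simp_all
    have 1: "vord 3 U' (\<lambda>p. (f p - (fst p * snd p + a * snd p ^ 2)) * w p)"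
      by (rule vord_mult[OF U'(1,2) vord_subset[OF j.quad U'(3)], of 0]) (use w in simp_all)
    have 2: "vord 3 U' (\<lambda>p. (fst p * snd p + a * snd p ^ 2) * (w p - 1))"
      by (rule vord_mult[OF U'(1,2) q vord_oneI[OF U'(1)]]; (intro smooth_intros U' w)?) (use w in simp_all)
    from vord_add[OF U'(1,2) 1 2] show "vord 3 U' (\<lambda>p. h p - (fst p * snd p + a * snd p ^ 2))"
      by (rule vord_eqI[OF U'(1,2)]) (simp add: w(3) algebra_simps)
  qed (rule vord_compose_unit[OF _ _ _ _ U' _ w(1,3)]; (intro smooth_intros j.first j.second)?; simp)+
qed

text \<open>The quotient is the mean of the vertical derivative over the segment from (p, 0) to (p,
  s), hence smooth, with value \<open>D 0\<close> at the origin.\<close>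

lemma Hadamard_vertical:
  fixes H D :: "(real \<times> real) \<times> real \<Rightarrow> real"
  assumes W: "W = ball 0 r \<times> {-r<..<r}" and D: "smooth_on W D"
    and H: "\<And>p s. (p, s) \<in> W \<Longrightarrow> ((\<lambda>s. H (p, s)) has_real_derivative D (p, s)) (at s)"
  shows "\<exists>K. smooth_on W K \<and> (\<forall>p s. (p, s) \<in> W \<longrightarrow> H (p, s) = H (p, 0) + s * K (p, s)) \<and> K 0 = D 0"
proof -
  define K where "K = (\<lambda>z. integral (cbox 0 1) (\<lambda>t. D (fst z, t * snd z)))"
  have oW: "open W" unfolding W by (intro open_Times) auto
  let ?O = "(\<lambda>x. (fst (fst x), snd x * snd (fst x))) -` W"
  have O: "open ?O" by (rule open_vimage[OF oW], intro continuous_intros)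
  have seg: "(p, t * s) \<in> W" if "(p, s) \<in> W" "t \<in> {0..1}" for p t s
  proof -
    have "\<bar>s\<bar> < r" using that by (auto simp: W)
    moreover have "\<bar>t * s\<bar> \<le> \<bar>s\<bar>" using that by (simp add: abs_mult mult_left_le_one_le)
    ultimately show ?thesis using that by (auto simp: W)
  qed
  have "smooth_on ?O (\<lambda>x. D (fst (fst x), snd x * snd (fst x)))"
    by (rule smooth_on_compose[OF D O oW]) (auto intro!: smooth_intros O)
  from smooth_on_integral[OF O oW _ this] have K: "smooth_on W K" unfolding K_def using seg by auto
  have "H (p, s) = H (p, 0) + s * K (p, s)" if z: "(p, s) \<in> W" for p s
  proof -
    have "((\<lambda>t. s * D (p, t * s)) has_integral (H (p, 1 * s) - H (p, 0 * s))) {0..1}"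
    proof (rule fundamental_theorem_of_calculus)
      fix t :: real assume t: "t \<in> {0..1}"
      have "((\<lambda>t. H (p, t * s)) has_real_derivative D (p, t * s) * s) (at t)"
        by (rule DERIV_chain2[where f = "\<lambda>s. H (p, s)" and g = "\<lambda>t. t * s", OF H[OF seg[OF z t]]])
          (auto intro!: derivative_eq_intros)
      then show "((\<lambda>t. H (p, t * s)) has_vector_derivative s * D (p, t * s)) (at t within {0..1})"
        by (simp add: has_real_derivative_iff_has_vector_derivative[symmetric] mult.commute has_field_derivative_at_within)
    qed simp
    from integral_unique[OF this] have "integral {0..1} (\<lambda>t. s * D (p, t * s)) = H (p, s) - H (p, 0)"
      by (simp only: mult_1_left mult_zero_left)
    then show ?thesis by (simp add: K_def)
  qed
  moreover have "K 0 = D 0" unfolding K_def by (simp add: zero_prod_def)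
  ultimately show ?thesis using K by blast
qed

text \<open>Versality is applied to the constant germ 1: as f_x and f_y vanish at the origin, c =
  dG/ds(0, 0) cannot be 0. If s = y p solves G p s = 0, then h = -c y has the same curves as G,
  since h p + c s = 0 exactly for s = y p. The factor c normalises the unit h / f to 1 at the
  origin.\<close>

lemma versal_normal_form:
  fixes G :: "real \<times> real \<Rightarrow> real \<Rightarrow> real"
  assumes j: "jets U f a e1 k1 e2 k2" and pd0: "pdx f (0, 0) = 0" "pdy f (0, 0) = 0"
    and def: "deformation f G" and ver: "Re_versal f G"
  obtains c U' h r \<delta> where "c \<noteq> 0" "jets U' h a e1 k1 e2 k2" "r > 0" "\<delta> > 0"
    "\<And>e s. 0 < e \<Longrightarrow> e < r \<Longrightarrow> \<bar>s\<bar> < \<delta> \<Longrightarrow> same_curve e (\<lambda>p. G p s) (\<lambda>p. h p + c * s)"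
proof -
  interpret j: jets U f a e1 k1 e2 k2 by (rule j)
  define H where "H = (\<lambda>(p, s). G p s)"
  have HG: "H (p, s) = G p s" for p s by (simp add: H_def)
  obtain Q where Q: "open Q" "0 \<in> Q" "smooth_on Q H" using def unfolding deformation_def smooth_germ_def H_def by blast
  have G0: "G 0 0 = 0" using def unfolding deformation_def by blast
  obtain B where B: "open B" "0 \<in> B" "\<And>p. p \<in> B \<Longrightarrow> G p 0 = f p"
    using def unfolding deformation_def eventually_nhds by blast
  define D where "D = (\<lambda>z. frechet_derivative H (at z) (0, 1))"
  have sD: "smooth_on Q D" unfolding D_def by (rule smooth_on_frechet_apply[OF Q(1,3)])
  have vd: "((\<lambda>s. H (p, s)) has_real_derivative D (p, s)) (at s)" if "(p, s) \<in> Q" for p s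
    unfolding D_def by (rule smooth_vertical_derivative[OF Q(3) that])
  define c where "c = D 0"
  have c: "c \<noteq> 0"
  proof
    assume 0: "c = 0"
    have "smooth_germ (\<lambda>p :: real \<times> real. 1)" unfolding smooth_germ_def
      by (intro exI[of _ UNIV]) (auto intro: smooth_intros)
    from ver[unfolded Re_versal_def, rule_format, OF this] obtain c' \<alpha> \<beta> where ev: "\<forall>\<^sub>F p in nhds 0. 1 = (\<Sum>b\<in>Basis. c' b * frechet_derivative (G p) (at 0) b)
                  + \<alpha> p * pdx f p + \<beta> p * pdy f p" by blast
    have "(0 :: (real \<times> real) \<times> real) = (0, 0)" by (simp add: zero_prod_def)
    then have "(G 0 has_derivative (*) c) (at 0)" using vd[of 0 0] Q(2) unfolding c_def has_field_derivative_def HG by simp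
    then have "frechet_derivative (G 0) (at 0) = (*) c" by (rule frechet_derivative_at[symmetric])
    then show False using eventually_nhds_x_imp_x[OF ev] pd0 0 by (simp add: zero_prod_def[symmetric])
  qed
  \<comment> \<open>This sign makes the vertical derivative of \<kappa> H positive, as
    \<open>implicit_function\<close> requires.\<close>
  define \<kappa> where "\<kappa> = sgn c"
  have \<kappa>: "\<kappa> \<noteq> 0" "\<kappa> * c > 0" using c by (simp_all add: \<kappa>_def sgn_if)
  have "open (Q \<inter> (\<lambda>z. \<kappa> * D z) -` {0<..})"
    by (rule continuous_open_preimage[OF _ Q(1)]) (auto intro!: continuous_intros smooth_on_continuous[OF sD])
  moreover have "(0, 0) \<in> Q \<inter> (\<lambda>z. \<kappa> * D z) -` {0<..}" using \<kappa> Q(2) by (simp add: c_def zero_prod_def)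
  ultimately obtain X Y where XY: "open X" "open Y" "(0, 0) \<in> X \<times> Y" "X \<times> Y \<subseteq> Q \<inter> (\<lambda>z. \<kappa> * D z) -` {0<..}"
    by (rule open_prod_elim) blast
  obtain r1 where r1: "r1 > 0" "ball 0 r1 \<subseteq> X" using XY open_contains_ball by (metis mem_Sigma_iff)
  obtain r2 where r2: "r2 > 0" "ball 0 r2 \<subseteq> Y" using XY open_contains_ball by (metis mem_Sigma_iff)
  define r where "r = min r1 r2"
  have r: "r > 0" using r1 r2 by (simp add: r_def)
  define W where "W = ball (0 :: real \<times> real) r \<times> {-r<..<r}"
  have oW: "open W" unfolding W_def by (intro open_Times) auto
  have WQ: "z \<in> Q \<and> \<kappa> * D z > 0" if "z \<in> W" for z
  proof -
    obtain p s where z: "z = (p, s)" by (cases z)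
    have "p \<in> ball 0 r1" "s \<in> ball 0 r2" using that by (auto simp: z W_def r_def dist_real_def)
    then show ?thesis using XY(4) r1 r2 z by blast
  qed
  have sHW: "smooth_on W H" "smooth_on W D" by (rule smooth_on_mono_set[OF Q(3)] smooth_on_mono_set[OF sD]; use WQ in blast)+
  have sW: "smooth_on W (\<lambda>z. \<kappa> * H z)" by (intro smooth_intros oW sHW)
  have vdW: "((\<lambda>s. H (p, s)) has_real_derivative D (p, s)) (at s)" if "(p, s) \<in> W" for p s using vd WQ that by blast
  have fd: "frechet_derivative (\<lambda>z. \<kappa> * H z) (at z) (0, 1) > 0" if "z \<in> W" for z
  proof -
    have "((\<lambda>z. \<kappa> * H z) has_derivative (\<lambda>v. \<kappa> * frechet_derivative H (at z) v)) (at z)"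
      by (intro has_derivative_mult_right smooth_on_frechet[OF sHW(1) that])
    from frechet_derivative_at[OF this] have "frechet_derivative (\<lambda>z. \<kappa> * H z) (at z) (0, 1) = \<kappa> * D z"
      unfolding D_def by metis
    then show ?thesis using WQ[OF that] by simp
  qed
  have conv: "(x, y) \<in> W" if "(x, y1) \<in> W" "(x, y2) \<in> W" "y1 \<le> y" "y \<le> y2" for x y1 y2 y
    using that by (auto simp: W_def)
  \<comment> \<open>Over the origin \<kappa> H is negative at height -q and positive at q.
    \<open>A\<close> consists of the base points where these signs persist, so that every fibre over
    \<open>A\<close> contains a zero.\<close>
  define q where "q = r / 2"
  have q: "0 < q" "q < r" using r by (simp_all add: q_def)
  have inc: "\<kappa> * H (0, x) < \<kappa> * H (0, y)" if "x < y" "- r < x" "y < r" for x y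
  proof (rule DERIV_pos_imp_increasing[OF that(1)])
    fix t assume t: "x \<le> t" "t \<le> y"
    then have z: "(0, t) \<in> W" using that r by (auto simp: W_def)
    have "((\<lambda>s. \<kappa> * H (0, s)) has_real_derivative \<kappa> * D (0, t)) (at t)" by (rule DERIV_cmult[OF vdW[OF z]])
    then show "\<exists>d. ((\<lambda>s. \<kappa> * H (0, s)) has_real_derivative d) (at t) \<and> 0 < d" using WQ[OF z] by blast
  qed
  define A where "A = (ball 0 r \<inter> (\<lambda>p. \<kappa> * H (p, - q)) -` {..<0}) \<inter> (ball 0 r \<inter> (\<lambda>p. \<kappa> * H (p, q)) -` {0<..})"
  have cH: "continuous_on (ball 0 r) (\<lambda>p. \<kappa> * H (p, y))" if "\<bar>y\<bar> < r" for y
    by (intro continuous_intros continuous_on_compose2[OF smooth_on_continuous[OF sHW(1)]]) (use that in \<open>auto simp: W_def\<close>)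
  have A: "open A" unfolding A_def
    by (intro open_Int continuous_open_preimage[OF cH]) (use q in auto)
  have A0: "0 \<in> A" using inc[of "- q" 0] inc[of 0 q] q r G0 by (simp add: A_def HG)
  have ex: "\<exists>y. (p, y) \<in> W \<and> \<kappa> * H (p, y) = 0" if p: "p \<in> A" for p
  proof -
    have "continuous_on {-q..q} (\<lambda>s. \<kappa> * H (p, s))"
      by (intro continuous_intros continuous_on_compose2[OF smooth_on_continuous[OF sHW(1)]]) (use p q in \<open>auto simp: A_def W_def\<close>)
    then obtain y where y: "- q \<le> y" "y \<le> q" "\<kappa> * H (p, y) = 0"
      using IVT'[of "\<lambda>s. \<kappa> * H (p, s)" "- q" 0 q] p q by (auto simp: A_def)
    then have "(p, y) \<in> W" using p q by (auto simp: A_def W_def)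
    then show ?thesis using y(3) by blast
  qed
  obtain y where y: "smooth_on A y" "\<And>p. p \<in> A \<Longrightarrow> (p, y p) \<in> W" "\<And>p. p \<in> A \<Longrightarrow> \<kappa> * H (p, y p) = 0"
    "\<And>p s. p \<in> A \<Longrightarrow> (p, s) \<in> W \<Longrightarrow> \<kappa> * H (p, s) = 0 \<Longrightarrow> s = y p"
  proof (rule implicit_function[OF oW sW fd _ A ex])
    show "(x, y) \<in> W" if "(x, y1) \<in> W" "(x, y2) \<in> W" "y1 \<le> y" "y \<le> y2" for x y1 y2 y by (rule conv[OF that])
  next
    fix y assume y: "smooth_on A y" "\<And>p. p \<in> A \<Longrightarrow> (p, y p) \<in> W" "\<And>p. p \<in> A \<Longrightarrow> \<kappa> * H (p, y p) = 0"
      "\<And>p s. p \<in> A \<Longrightarrow> (p, s) \<in> W \<Longrightarrow> \<kappa> * H (p, s) = 0 \<Longrightarrow> s = y p"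
    show thesis by (rule that[OF y])
  qed
  have Hy: "H (p, y p) = 0" if "p \<in> A" for p using y(3)[OF that] \<kappa> by simp
  have y0: "y 0 = 0" using y(4)[OF A0, of 0] r G0 by (simp add: W_def HG)
  obtain K where K: "smooth_on W K" "\<And>p s. (p, s) \<in> W \<Longrightarrow> H (p, s) = H (p, 0) + s * K (p, s)" "K 0 = D 0"
    using Hadamard_vertical[OF W_def sHW(2) vdW] by blast
  have sK: "smooth_on A (\<lambda>p. K (p, y p))"
    by (rule smooth_on_compose[OF K(1) A oW]) (use y in \<open>auto intro!: smooth_intros A\<close>)
  define U' where "U' = (A \<inter> (\<lambda>p. K (p, y p)) -` (- {0})) \<inter> (U \<inter> B)"
  have U': "open U'" unfolding U'_def
    by (intro open_Int j.U(1) B(1) continuous_open_preimage[OF smooth_on_continuous[OF sK] A]) auto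
  have K0: "K (0, y 0) = c" unfolding c_def y0 K(3)[symmetric] by (simp add: zero_prod_def)
  have U'0: "0 \<in> U'" using A0 j.U(2) B(2) K0 c by (simp add: U'_def)
  define h where "h = (\<lambda>p. - c * y p)"
  have jh: "jets U' h a e1 k1 e2 k2"
  proof (rule jets_unit[OF j U' U'0])
    show "U' \<subseteq> U" by (auto simp: U'_def)
    have "smooth_on U' (\<lambda>p. K (p, y p))" by (rule smooth_on_mono_set[OF sK]) (auto simp: U'_def)
    then show "smooth_on U' (\<lambda>p. c / K (p, y p))" by (intro smooth_intros U') (auto simp: U'_def)
    show "c / K (0, y 0) = 1" using K0 c by simp
    fix p assume p: "p \<in> U'"
    have k: "K (p, y p) \<noteq> 0" "p \<in> A" "G p 0 = f p" using p B(3) by (auto simp: U'_def)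
    \<comment> \<open>Hadamard's identity evaluated at the solution s = y p, where the left-hand
      side vanishes.\<close>
    have "f p + y p * K (p, y p) = 0" using K(2)[OF y(2)[OF k(2)]] Hy[OF k(2)] k(3) by (simp add: HG)
    then have "f p = - (y p * K (p, y p))" by linarith
    then show "h p = f p * (c / K (p, y p))" using k(1) by (simp add: h_def)
  qed
  obtain r3 where r3: "r3 > 0" "ball 0 r3 \<subseteq> U'" using U' U'0 open_contains_ball by blast
  have same: "same_curve e (\<lambda>p. G p s) (\<lambda>p. h p + c * s)" if e: "0 < e" "e < r3" and s: "\<bar>s\<bar> < r" for e s
    unfolding same_curve_def
  proof
    fix p :: "real \<times> real" assume "p \<in> ball 0 e"
    then have "p \<in> U'" using r3(2) e by auto
    then have p: "p \<in> A" by (simp add: U'_def)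
    then have pW: "(p, s) \<in> W" using s by (auto simp: A_def W_def)
    have z: "G p s = 0 \<longleftrightarrow> s = y p" using y(4)[OF p pW] Hy[OF p] by (auto simp: HG)
    have z': "h p + c * s = 0 \<longleftrightarrow> s = y p" using c by (auto simp: h_def)
    \<comment> \<open>Differentiating H(q, y q) = 0 shows that the gradient of G with s fixed is -D
      times that of y, with D nonzero; the gradient of h is -c times that of y. Hence both vanish or
      neither does.\<close>
    have "(pdx (\<lambda>p. G p s) p, pdy (\<lambda>p. G p s) p) \<noteq> (0, 0) \<longleftrightarrow> (pdx (\<lambda>p. h p + c * s) p, pdy (\<lambda>p. h p + c * s) p) \<noteq> (0, 0)"
      if sy: "s = y p"
    proof -
      define E where "E = frechet_derivative H (at (p, s))"
      have E: "(H has_derivative E) (at (p, s))" unfolding E_def by (rule smooth_on_frechet[OF sHW(1) pW])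
      interpret E: bounded_linear E by (rule has_derivative_bounded_linear[OF E])
      define F where "F = frechet_derivative y (at p)"
      have F: "(y has_derivative F) (at p)" unfolding F_def by (rule smooth_on_frechet[OF y(1) p])
      have "((\<lambda>q. (q, s)) has_derivative (\<lambda>v. (v, 0))) (at p)" by (auto intro!: derivative_eq_intros)
      from has_derivative_compose[OF this E] have 1: "((\<lambda>q. G q s) has_derivative (\<lambda>v. E (v, 0))) (at p)" by (simp add: HG)
      have "((\<lambda>q. (q, y q)) has_derivative (\<lambda>v. (v, F v))) (at p)" by (intro has_derivative_Pair has_derivative_ident F)
      from has_derivative_compose[OF this E[unfolded sy]] have "((\<lambda>q. H (q, y q)) has_derivative (\<lambda>v. E (v, F v))) (at p)" .
      moreover have "((\<lambda>q. H (q, y q)) has_derivative (\<lambda>v. 0)) (at p)"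
        by (rule has_derivative_transform_within_open[OF has_derivative_const[of 0] A p]) (simp add: Hy)
      ultimately have "(\<lambda>v. E (v, F v)) = (\<lambda>v. 0)" by (rule has_derivative_unique)
      then have EF: "E (v, F v) = 0" for v by (rule fun_cong)
      have "E (v, F v) = E (v, 0) + F v * E (0, 1)" for v
        using E.add[of "(v, 0)" "(0, F v)"] E.scaleR[of "F v" "(0, 1)"] by simp
      then have EE: "E (v, 0) = - (F v * D (p, s))" for v using EF[of v] by (simp add: D_def E_def)
      have "((\<lambda>q. h q + c * s) has_derivative (\<lambda>v. - c * F v)) (at p)" unfolding h_def
        by (auto intro!: derivative_eq_intros F)
      note d = pdx_eqI[OF this] pdy_eqI[OF this] pdx_eqI[OF 1] pdy_eqI[OF 1]
      have "D (p, s) \<noteq> 0" using WQ[OF pW] by auto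
      then show ?thesis unfolding d EE using c by simp
    qed
    then show "(G p s = 0 \<longleftrightarrow> h p + c * s = 0) \<and> (regular_point (\<lambda>p. G p s) p \<longleftrightarrow> regular_point (\<lambda>p. h p + c * s) p)"
      unfolding regular_point_def z z' by blast
  qed
  show thesis by (rule that[OF c jh r3(1) r same])
qed


section \<open>Configurations and FRS-equivalence\<close>

text \<open>\<open>has_strings\<close> prescribes neither the orientation of an arc nor which
  component comes first from the geometric point of view, so words are compared up to reversal and
  exchange.\<close>

definition same_words :: "letter list \<times> letter list \<Rightarrow> letter list \<times> letter list \<Rightarrow> bool" where
  "same_words u w \<longleftrightarrow> (fst w \<in> {fst u, rev (fst u)} \<and> snd w \<in> {snd u, rev (snd u)}) \<or>
     (fst w \<in> {snd u, rev (snd u)} \<and> snd w \<in> {fst u, rev (fst u)})"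

lemma two_arcs_same_words:
  assumes t: "two_arcs e g u v" and w: "same_words (u, v) w" shows "has_strings e g w"
proof -
  have *: "has_strings e g (x, y)" if "two_arcs e g u v" "x \<in> {u, rev u}" "y \<in> {v, rev v}" for x y u v
    using that(2,3) two_arcs_rev[OF that(1)] that(1) by (auto intro: two_arcs_has_strings)
  show ?thesis using w *[OF t] *[OF two_arcs_swap[OF t]] unfolding same_words_def
    by (cases w) (simp only: fst_conv snd_conv, blast)
qed

definition words :: "real \<Rightarrow> real \<Rightarrow> real \<Rightarrow> real \<Rightarrow> real \<Rightarrow> letter list \<times> letter list" where
  "words e1 e2 e3 e4 s = (quadrant_word e1 e2 e3 e4 1 s, quadrant_word e1 e2 e3 e4 (-1) (- s))"

text \<open>The words depend on the signs of the four numbers only, so sixteen cases exhaust the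
  claim. Which sign \<sigma> realises the left-hand configuration varies with the case. The argument
  is - \<sigma> on that side because a parameter of sign \<sigma> selects a level of
  \<open>f\<close> of the opposite sign.\<close>

lemma words_cases:
  assumes "e1 \<noteq> 0" "e2 \<noteq> 0" "e3 \<noteq> 0" "e4 \<noteq> 0"
  shows "e3 * e4 < 0 \<Longrightarrow> \<exists>\<sigma>\<in>{1, -1}. same_words (words e1 e2 e3 e4 (- \<sigma>)) ([V,I,V,I], [V,V]) \<and>
      same_words (words e1 e2 e3 e4 \<sigma>) ([V,I,V], [V,V,I])"
    "e3 * e4 > 0 \<and> e1 * e2 * e3 > 0 \<Longrightarrow> \<exists>\<sigma>\<in>{1, -1}. same_words (words e1 e2 e3 e4 (- \<sigma>)) ([V,I], [V,I]) \<and>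
      same_words (words e1 e2 e3 e4 \<sigma>) ([V,I,V,I,V], [V,V,V])"
    "e3 * e4 > 0 \<and> e1 * e2 * e3 < 0 \<Longrightarrow> \<exists>\<sigma>\<in>{1, -1}. same_words (words e1 e2 e3 e4 (- \<sigma>)) ([I,V,I], [V]) \<and>
      same_words (words e1 e2 e3 e4 \<sigma>) ([V,V,I,V], [V,V,I,V])"
proof -
  consider "e1 > 0" "e2 > 0" "e3 > 0" "e4 > 0" | "e1 > 0" "e2 > 0" "e3 > 0" "e4 < 0"
    | "e1 > 0" "e2 > 0" "e3 < 0" "e4 > 0" | "e1 > 0" "e2 > 0" "e3 < 0" "e4 < 0"
    | "e1 > 0" "e2 < 0" "e3 > 0" "e4 > 0" | "e1 > 0" "e2 < 0" "e3 > 0" "e4 < 0"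
    | "e1 > 0" "e2 < 0" "e3 < 0" "e4 > 0" | "e1 > 0" "e2 < 0" "e3 < 0" "e4 < 0"
    | "e1 < 0" "e2 > 0" "e3 > 0" "e4 > 0" | "e1 < 0" "e2 > 0" "e3 > 0" "e4 < 0"
    | "e1 < 0" "e2 > 0" "e3 < 0" "e4 > 0" | "e1 < 0" "e2 > 0" "e3 < 0" "e4 < 0"
    | "e1 < 0" "e2 < 0" "e3 > 0" "e4 > 0" | "e1 < 0" "e2 < 0" "e3 > 0" "e4 < 0"
    | "e1 < 0" "e2 < 0" "e3 < 0" "e4 > 0" | "e1 < 0" "e2 < 0" "e3 < 0" "e4 < 0"
    using assms by (meson neq_iff)
  then have "(e3 * e4 < 0 \<longrightarrow> (\<exists>\<sigma>\<in>{1, -1}. same_words (words e1 e2 e3 e4 (- \<sigma>)) ([V,I,V,I], [V,V]) \<and>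
      same_words (words e1 e2 e3 e4 \<sigma>) ([V,I,V], [V,V,I]))) \<and>
    (e3 * e4 > 0 \<and> e1 * e2 * e3 > 0 \<longrightarrow> (\<exists>\<sigma>\<in>{1, -1}. same_words (words e1 e2 e3 e4 (- \<sigma>)) ([V,I], [V,I]) \<and>
      same_words (words e1 e2 e3 e4 \<sigma>) ([V,I,V,I,V], [V,V,V]))) \<and>
    (e3 * e4 > 0 \<and> e1 * e2 * e3 < 0 \<longrightarrow> (\<exists>\<sigma>\<in>{1, -1}. same_words (words e1 e2 e3 e4 (- \<sigma>)) ([I,V,I], [V]) \<and>
      same_words (words e1 e2 e3 e4 \<sigma>) ([V,V,I,V], [V,V,I,V])))"
    by cases (simp_all add: same_words_def words_def quadrant_word_def zero_less_mult_iff mult_less_0_iff not_less[symmetric] less_not_sym)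
  then show "e3 * e4 < 0 \<Longrightarrow> \<exists>\<sigma>\<in>{1, -1}. same_words (words e1 e2 e3 e4 (- \<sigma>)) ([V,I,V,I], [V,V]) \<and>
      same_words (words e1 e2 e3 e4 \<sigma>) ([V,I,V], [V,V,I])"
    "e3 * e4 > 0 \<and> e1 * e2 * e3 > 0 \<Longrightarrow> \<exists>\<sigma>\<in>{1, -1}. same_words (words e1 e2 e3 e4 (- \<sigma>)) ([V,I], [V,I]) \<and>
      same_words (words e1 e2 e3 e4 \<sigma>) ([V,I,V,I,V], [V,V,V])"
    "e3 * e4 > 0 \<and> e1 * e2 * e3 < 0 \<Longrightarrow> \<exists>\<sigma>\<in>{1, -1}. same_words (words e1 e2 e3 e4 (- \<sigma>)) ([I,V,I], [V]) \<and>
      same_words (words e1 e2 e3 e4 \<sigma>) ([V,V,I,V], [V,V,I,V])" by blast+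
qed

text \<open>The curve h + t = 0 is the level -t, whence the argument \<open>- sgn t\<close>.\<close>

lemma (in jets) level_words:
  assumes nz: "e1 \<noteq> 0" "e2 \<noteq> 0" "e3 \<noteq> 0" "e4 \<noteq> 0"
  obtains e0 where "e0 > 0" "\<And>e. 0 < e \<Longrightarrow> e < e0 \<Longrightarrow> \<exists>\<delta>>0. \<forall>t. t \<noteq> 0 \<longrightarrow> \<bar>t\<bar> < \<delta> \<longrightarrow>
    two_arcs e (\<lambda>p. h p + t) (fst (words e1 e2 e3 e4 (- sgn t))) (snd (words e1 e2 e3 e4 (- sgn t)))"
proof -
  have "\<exists>r>0. \<forall>e. 0 < e \<longrightarrow> e < r \<longrightarrow> (\<exists>\<delta>>0. \<forall>t. 0 < t \<and> t < \<delta> \<longrightarrow>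
      two_arcs e (\<lambda>p. h p - s * t) (fst (words e1 e2 e3 e4 s)) (snd (words e1 e2 e3 e4 s)))"
    if "s = 1 \<or> s = -1" for s
    using level_two_arcs[OF that nz] by (simp add: words_def)
  from this[of 1] this[of "-1"] obtain r1 r2 where r: "r1 > 0" "r2 > 0"
    and 1: "\<And>e. 0 < e \<Longrightarrow> e < r1 \<Longrightarrow> \<exists>\<delta>>0. \<forall>t. 0 < t \<and> t < \<delta> \<longrightarrow>
      two_arcs e (\<lambda>p. h p - 1 * t) (fst (words e1 e2 e3 e4 1)) (snd (words e1 e2 e3 e4 1))"
    and 2: "\<And>e. 0 < e \<Longrightarrow> e < r2 \<Longrightarrow> \<exists>\<delta>>0. \<forall>t. 0 < t \<and> t < \<delta> \<longrightarrow>
      two_arcs e (\<lambda>p. h p - (-1) * t) (fst (words e1 e2 e3 e4 (-1))) (snd (words e1 e2 e3 e4 (-1)))" by blast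
  show thesis
  proof (rule that[of "min r1 r2"])
    show "min r1 r2 > 0" using r by simp
    fix e assume e: "0 < e" "e < min r1 r2"
    obtain \<delta>1 where d1: "\<delta>1 > 0" "\<And>t. 0 < t \<and> t < \<delta>1 \<Longrightarrow>
      two_arcs e (\<lambda>p. h p - 1 * t) (fst (words e1 e2 e3 e4 1)) (snd (words e1 e2 e3 e4 1))" using 1[of e] e by auto
    obtain \<delta>2 where d2: "\<delta>2 > 0" "\<And>t. 0 < t \<and> t < \<delta>2 \<Longrightarrow>
      two_arcs e (\<lambda>p. h p - (-1) * t) (fst (words e1 e2 e3 e4 (-1))) (snd (words e1 e2 e3 e4 (-1)))" using 2[of e] e by auto
    show "\<exists>\<delta>>0. \<forall>t. t \<noteq> 0 \<longrightarrow> \<bar>t\<bar> < \<delta> \<longrightarrow>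
      two_arcs e (\<lambda>p. h p + t) (fst (words e1 e2 e3 e4 (- sgn t))) (snd (words e1 e2 e3 e4 (- sgn t)))"
    proof (rule exI[of _ "min \<delta>1 \<delta>2"], intro conjI allI impI)
      fix t :: real assume t: "t \<noteq> 0" "\<bar>t\<bar> < min \<delta>1 \<delta>2"
      show "two_arcs e (\<lambda>p. h p + t) (fst (words e1 e2 e3 e4 (- sgn t))) (snd (words e1 e2 e3 e4 (- sgn t)))"
        using d1(2)[of "- t"] d2(2)[of t] t by (cases "t > 0") auto
    qed (use d1 d2 in simp)
  qed
qed

section \<open>Strata of the parameter line, and the equivalence\<close>

lemma submanifold_relatively_open:
  assumes "subspace L" "dim L = d" "openin (top_of_set L) X" shows "submanifold X d"
proof -
  have "smooth_on_subset X id" unfolding smooth_on_subset_def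
    by (intro ballI exI[of _ UNIV] exI[of _ id]) (auto simp: id_def intro: smooth_intros)
  then have "diffeomorphic X X" unfolding diffeomorphic_def by (intro exI[of _ id]) auto
  then show ?thesis unfolding submanifold_def using assms by (intro ballI exI[of _ X] exI[of _ L]) auto
qed

lemma stratification_signs: "stratification {-1<..<1::real} {{-1<..<0}, {0}, {0<..<1}}" (is "stratification _ ?S")
  unfolding stratification_def
proof (intro conjI ballI impI)
  show "finite ?S" "\<Union> ?S = {-1<..<1}" "disjoint ?S" by (auto simp: disjoint_def)
  fix X assume X: "X \<in> ?S"
  then show "X \<noteq> {}" "connected X" by auto
  have "open X \<or> X = {0}" using X by auto
  moreover have "submanifold X 1" if "open X"
    by (rule submanifold_relatively_open[of UNIV]) (use that in auto)
  moreover have "submanifold {0 :: real} 0" by (rule submanifold_relatively_open[of "{0}"]) auto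
  ultimately show "\<exists>d. submanifold X d" by blast
  fix Y assume "Y \<in> ?S" "Y \<inter> closure X \<noteq> {}"
  then show "Y \<subseteq> {-1<..<1} \<inter> closure X" using X by (auto simp: closure_greaterThanLessThan)
qed

text \<open>The parameter map multiplies by the sign of c. Then h + c s and f + \<kappa> s are
  levels of equal sign, and the words depend on this sign and on the jets, which h and f
  share.\<close>

lemma FRS_equivalent_translation:
  fixes G F :: "real \<times> real \<Rightarrow> real \<Rightarrow> real"
  assumes j: "jets U f a e1 k1 e2 k2"
    and nz: "e1 \<noteq> 0" "e2 \<noteq> 0" "k1 - 2 * a * e1\<^sup>2 \<noteq> 0" "(1 + a\<^sup>2) * k2 - 2 * a * e2\<^sup>2 \<noteq> 0"
    and pd0: "pdx f (0, 0) = 0" "pdy f (0, 0) = 0"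
    and G: "deformation f G" "Re_versal f G" and F: "\<And>p t. F p t = f p + t"
  shows "FRS_equivalent G F"
proof -
  obtain c U' h r d where c: "c \<noteq> 0" and jh: "jets U' h a e1 k1 e2 k2" and r: "r > 0" "d > 0"
    and nf: "\<And>e s. 0 < e \<Longrightarrow> e < r \<Longrightarrow> \<bar>s\<bar> < d \<Longrightarrow> same_curve e (\<lambda>p. G p s) (\<lambda>p. h p + c * s)"
    using versal_normal_form[OF j pd0 G] by metis
  let ?w = "words e1 e2 (k1 - 2 * a * e1\<^sup>2) ((1 + a\<^sup>2) * k2 - 2 * a * e2\<^sup>2)"
  obtain rf where rf: "rf > 0" "\<And>e. 0 < e \<Longrightarrow> e < rf \<Longrightarrow> \<exists>\<delta>>0. \<forall>t. t \<noteq> 0 \<longrightarrow> \<bar>t\<bar> < \<delta> \<longrightarrow>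
    two_arcs e (\<lambda>p. f p + t) (fst (?w (- sgn t))) (snd (?w (- sgn t)))"
    using jets.level_words[OF j nz] by metis
  obtain rh where rh: "rh > 0" "\<And>e. 0 < e \<Longrightarrow> e < rh \<Longrightarrow> \<exists>\<delta>>0. \<forall>t. t \<noteq> 0 \<longrightarrow> \<bar>t\<bar> < \<delta> \<longrightarrow>
    two_arcs e (\<lambda>p. h p + t) (fst (?w (- sgn t))) (snd (?w (- sgn t)))"
    using jets.level_words[OF jh nz] by metis
  obtain B where B: "open B" "0 \<in> B" "\<And>p. p \<in> B \<Longrightarrow> G p 0 = f p"
    using G(1) unfolding deformation_def eventually_nhds by blast
  obtain rb where rb: "rb > 0" "ball 0 rb \<subseteq> B" using B open_contains_ball by blast
  define \<kappa> where "\<kappa> = sgn c"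
  have \<kappa>: "\<kappa> = 1 \<or> \<kappa> = -1" using c by (auto simp: \<kappa>_def sgn_if)
  define e0 where "e0 = min (min r rf) (min rh rb)"
  let ?S = "{{-1<..<0}, {0}, {0<..<1::real}}"
  have main: "\<exists>\<delta>>0.
           (\<forall>X\<in>?S. \<forall>s\<in>X \<inter> ball 0 \<delta>. \<forall>s'\<in>X \<inter> ball 0 \<delta>. FRS_same e (\<lambda>p. G p s) (\<lambda>p. G p s')) \<and>
           (\<forall>X\<in>?S. \<forall>u\<in>X \<inter> ball 0 \<delta>. \<forall>u'\<in>X \<inter> ball 0 \<delta>. FRS_same e (\<lambda>p. F p u) (\<lambda>p. F p u')) \<and>
           (\<forall>s\<in>{-1<..<1} \<inter> ball 0 \<delta>. FRS_same e (\<lambda>p. G p s) (\<lambda>p. F p (\<kappa> * s)))"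
    if e: "0 < e" "e < e0" for e
  proof -
    have e': "e < r" "e < rf" "e < rh" "e < rb" using e by (simp_all add: e0_def)
    obtain d1 where d1: "d1 > 0" "\<And>t. t \<noteq> 0 \<Longrightarrow> \<bar>t\<bar> < d1 \<Longrightarrow>
      two_arcs e (\<lambda>p. f p + t) (fst (?w (- sgn t))) (snd (?w (- sgn t)))" using rf(2)[OF e(1) e'(2)] by blast
    obtain d2 where d2: "d2 > 0" "\<And>t. t \<noteq> 0 \<Longrightarrow> \<bar>t\<bar> < d2 \<Longrightarrow>
      two_arcs e (\<lambda>p. h p + t) (fst (?w (- sgn t))) (snd (?w (- sgn t)))" using rh(2)[OF e(1) e'(3)] by blast
    define \<delta> where "\<delta> = min d (min d1 (d2 / \<bar>c\<bar>))"
    have \<delta>: "\<delta> > 0" using r d1 d2 c by (simp add: \<delta>_def)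
    have TF: "two_arcs e (\<lambda>p. F p u) (fst (?w (- sgn u))) (snd (?w (- sgn u)))" if "u \<noteq> 0" "\<bar>u\<bar> < \<delta>" for u
      using d1(2)[of u] that by (simp add: F \<delta>_def)
    have TG: "two_arcs e (\<lambda>p. G p s) (fst (?w (- sgn (\<kappa> * s)))) (snd (?w (- sgn (\<kappa> * s))))" if "s \<noteq> 0" "\<bar>s\<bar> < \<delta>" for s
    proof -
      have "\<bar>s\<bar> < d2 / \<bar>c\<bar>" "\<bar>s\<bar> < d" using that by (simp_all add: \<delta>_def)
      then have "\<bar>c * s\<bar> < d2" using c by (simp add: field_simps abs_mult)
      then have "two_arcs e (\<lambda>p. h p + c * s) (fst (?w (- sgn (c * s)))) (snd (?w (- sgn (c * s))))"
        using d2(2)[of "c * s"] that(1) c by simp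
      moreover have "sgn (\<kappa> * s) = sgn (c * s)" by (simp add: \<kappa>_def sgn_mult)
      ultimately show ?thesis using same_curve_two_arcs[OF nf[OF e(1) e'(1) \<open>\<bar>s\<bar> < d\<close>]] by simp
    qed
    have refl: "FRS_same e g g" for g by (rule same_curve_FRS_same) (simp add: same_curve_def)
    have st: "s = 0 \<and> s' = 0 \<or> s \<noteq> 0 \<and> s' \<noteq> 0 \<and> sgn s = sgn s'" if "X \<in> ?S" "s \<in> X" "s' \<in> X" for X s s'
      using that by auto
    show ?thesis
    proof (rule exI[of _ \<delta>], intro conjI \<delta> ballI)
      fix X s s' assume X: "X \<in> ?S" "s \<in> X \<inter> ball 0 \<delta>" "s' \<in> X \<inter> ball 0 \<delta>"
      then have b: "\<bar>s\<bar> < \<delta>" "\<bar>s'\<bar> < \<delta>" by (simp_all add: dist_real_def)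
      from st[of X s s'] X consider "s = s'" | "s \<noteq> 0" "s' \<noteq> 0" "sgn s = sgn s'" by auto
      note cases = this
      show "FRS_same e (\<lambda>p. G p s) (\<lambda>p. G p s')"
        using cases
      proof cases
        case 2
        then have "sgn (\<kappa> * s) = sgn (\<kappa> * s')" by (simp add: sgn_mult)
        then show ?thesis using two_arcs_FRS_same[OF TG[OF 2(1) b(1)]] TG[OF 2(2) b(2)] by simp
      qed (simp add: refl)
      show "FRS_same e (\<lambda>p. F p s) (\<lambda>p. F p s')"
        using cases
      proof cases
        case 2
        then show ?thesis using two_arcs_FRS_same[OF TF[OF 2(1) b(1)]] TF[OF 2(2) b(2)] by simp
      qed (simp add: refl)
    next
      fix s :: real assume "s \<in> {-1<..<1} \<inter> ball 0 \<delta>"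
      then have b: "\<bar>s\<bar> < \<delta>" "\<bar>\<kappa> * s\<bar> < \<delta>" using \<kappa> by (auto simp: dist_real_def)
      show "FRS_same e (\<lambda>p. G p s) (\<lambda>p. F p (\<kappa> * s))"
      proof (cases "s = 0")
        case True
        \<comment> \<open>At parameter 0 both curves are f = 0 near the origin, so the singular
          stratum is compared by equality instead of words.\<close>
        have "same_curve e (\<lambda>p. G p 0) (\<lambda>p. F p 0)"
        proof (rule same_curve_eq)
          fix p :: "real \<times> real" assume "p \<in> ball 0 e"
          then have "p \<in> B" using subset_ball[OF less_imp_le[OF e'(4)], of 0] rb(2) by blast
          then show "G p 0 = F p 0" by (simp add: F B(3))
        qed
        then show ?thesis using same_curve_FRS_same True by simp
      next
        case False
        then have "\<kappa> * s \<noteq> 0" using \<kappa> by auto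
        then show ?thesis using two_arcs_FRS_same[OF TG[OF False b(1)] TF[OF _ b(2)]] by blast
      qed
    qed
  qed
  have e0: "e0 > 0" using r rf rh rb by (simp add: e0_def)
  have hom: "homeomorphism {-1<..<1} {-1<..<1} (\<lambda>s. \<kappa> * s) (\<lambda>s. \<kappa> * s)"
    using \<kappa> by (intro homeomorphismI continuous_intros) auto
  have im: "(\<lambda>X. (\<lambda>s. \<kappa> * s) ` X) ` ?S = ?S"
    using \<kappa> by (auto simp: insert_commute)
  show ?thesis unfolding FRS_equivalent_def
    by (rule exI[of _ "{-1<..<1}"], rule exI[of _ ?S], rule exI[of _ "{-1<..<1}"], rule exI[of _ ?S],
        rule exI[of _ "\<lambda>s. \<kappa> * s"], rule exI[of _ "\<lambda>s. \<kappa> * s"],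
        intro conjI stratification_signs hom im exI[of _ e0] allI impI e0 main)
      auto
qed

lemma has_configuration_words:
  fixes F :: "real \<times> real \<Rightarrow> real \<Rightarrow> real"
  assumes j: "jets U f a e1 k1 e2 k2"
    and nz: "e1 \<noteq> 0" "e2 \<noteq> 0" "k1 - 2 * a * e1\<^sup>2 \<noteq> 0" "(1 + a\<^sup>2) * k2 - 2 * a * e2\<^sup>2 \<noteq> 0"
    and F: "\<And>p t. F p t = f p + t"
    and w: "\<exists>\<sigma>\<in>{1, -1}. same_words (words e1 e2 (k1 - 2 * a * e1\<^sup>2) ((1 + a\<^sup>2) * k2 - 2 * a * e2\<^sup>2) (- \<sigma>)) l \<and>
      same_words (words e1 e2 (k1 - 2 * a * e1\<^sup>2) ((1 + a\<^sup>2) * k2 - 2 * a * e2\<^sup>2) \<sigma>) m"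
  shows "has_configuration F l m"
proof -
  let ?w = "words e1 e2 (k1 - 2 * a * e1\<^sup>2) ((1 + a\<^sup>2) * k2 - 2 * a * e2\<^sup>2)"
  obtain \<sigma> where \<sigma>: "\<sigma> \<in> {1, -1}" and wl: "same_words (?w (- \<sigma>)) l" "same_words (?w \<sigma>) m" using w by blast
  obtain rf where rf: "rf > 0" "\<And>e. 0 < e \<Longrightarrow> e < rf \<Longrightarrow> \<exists>\<delta>>0. \<forall>t. t \<noteq> 0 \<longrightarrow> \<bar>t\<bar> < \<delta> \<longrightarrow>
    two_arcs e (\<lambda>p. f p + t) (fst (?w (- sgn t))) (snd (?w (- sgn t)))"
    using jets.level_words[OF j nz] by metis
  show ?thesis unfolding has_configuration_def
  proof (rule bexI[OF _ \<sigma>], rule exI[of _ rf], intro conjI allI impI rf(1))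
    fix e assume e: "0 < e \<and> e < rf"
    obtain \<delta> where \<delta>: "\<delta> > 0" "\<And>t. t \<noteq> 0 \<Longrightarrow> \<bar>t\<bar> < \<delta> \<Longrightarrow>
      two_arcs e (\<lambda>p. f p + t) (fst (?w (- sgn t))) (snd (?w (- sgn t)))" using rf(2)[of e] e by blast
    have *: "has_strings e (\<lambda>p. F p (\<tau> * t)) x" if "\<tau> \<in> {1, -1}" "same_words (?w (- \<tau>)) x" "0 < t" "t < \<delta>" for \<tau> t x
    proof -
      have "\<tau> * t \<noteq> 0" "\<bar>\<tau> * t\<bar> < \<delta>" "sgn (\<tau> * t) = \<tau>" using that by auto
      then have "two_arcs e (\<lambda>p. F p (\<tau> * t)) (fst (?w (- \<tau>))) (snd (?w (- \<tau>)))"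
        using \<delta>(2)[of "\<tau> * t"] by (simp add: F)
      then show ?thesis by (rule two_arcs_same_words) (use that(2) in simp)
    qed
    show "\<exists>\<delta>>0. \<forall>t. 0 < t \<and> t < \<delta> \<longrightarrow> has_strings e (\<lambda>p. F p (\<sigma> * t)) l \<and> has_strings e (\<lambda>p. F p (- \<sigma> * t)) m"
      by (rule exI[of _ \<delta>]) (use \<delta>(1) *[OF \<sigma> wl(1)] *[of "- \<sigma>" m] \<sigma> wl(2) in auto)
  qed
qed

theorem theorem4p5:
  fixes f :: "real \<times> real \<Rightarrow> real" and F :: "real \<times> real \<Rightarrow> real \<Rightarrow> real"
  assumes smooth: "smooth_germ f" and zero: "f (0, 0) = 0"
    and sing: "A1_minus f"
    and normalised: "taylor_coeff f 2 0 = 0" "taylor_coeff f 2 1 = 1"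
    and generic: "eta1 f \<noteq> 0" "eta2 f \<noteq> 0" "eta3 f \<noteq> 0" "eta4 f \<noteq> 0"
    and F: "\<And>x y t. F (x, y) t = f (x, y) + t"
  shows "(\<forall>G :: real \<times> real \<Rightarrow> real \<Rightarrow> real.
            deformation f G \<and> Re_versal f G \<longrightarrow> FRS_equivalent G F) \<and>
         (eta3 f * eta4 f < 0 \<longrightarrow>
            has_configuration F ([V,I,V,I], [V,V]) ([V,I,V], [V,V,I])) \<and>
         (eta3 f * eta4 f > 0 \<and> eta1 f * eta2 f * eta3 f > 0 \<longrightarrow>
            has_configuration F ([V,I], [V,I]) ([V,I,V,I,V], [V,V,V])) \<and>
         (eta3 f * eta4 f > 0 \<and> eta1 f * eta2 f * eta3 f < 0 \<longrightarrow>
            has_configuration F ([I,V,I], [V]) ([V,V,I,V], [V,V,I,V]))"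
proof -
  obtain U where U: "open U" "0 \<in> U" "smooth_on U f" using smooth unfolding smooth_germ_def by blast
  note j = jets_taylor[OF U zero sing normalised]
  \<comment> \<open>The generic quantities \<open>e3\<close> and \<open>e4\<close> of the jets turn
    back into \<open>eta3\<close> and \<open>eta4\<close>.\<close>
  have e: "eta3 f + 2 * taylor_coeff f 2 2 * (eta1 f)\<^sup>2 - 2 * taylor_coeff f 2 2 * (eta1 f)\<^sup>2 = eta3 f"
    "(1 + (taylor_coeff f 2 2)\<^sup>2) * eta4_bar f - 2 * taylor_coeff f 2 2 * (eta2 f)\<^sup>2 = eta4 f"
    by (simp_all add: eta4_def Let_def)
  have F': "F p t = f p + t" for p t by (cases p) (simp add: F)
  have pd0: "pdx f (0, 0) = 0" "pdy f (0, 0) = 0" using sing by (simp_all add: A1_minus_def)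
  note conf = has_configuration_words[OF j, unfolded e, OF generic F'] and c = words_cases[OF generic]
  have "FRS_equivalent G F" if "deformation f G \<and> Re_versal f G" for G :: "real \<times> real \<Rightarrow> real \<Rightarrow> real"
    by (rule FRS_equivalent_translation[OF j, unfolded e, OF generic pd0 _ _ F']) (use that in auto)
  then show ?thesis using conf[OF c(1)] conf[OF c(2)] conf[OF c(3)] by blast
qed

end
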